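(* Let $\mu$ be an admissible weight, $M>0$, and let $\mathbf{X}_0,\mathbf{Y}_0:\mathbb{T}\to\mathbb{R}^2$ satisfy $\mathbf{X}_0',\mathbf{Y}_0'\in\dot B^{1/2,\mu}_{2,1}(\mathbb{T};\mathbb{R}^2)$ with norms at most $M$, and $|\mathbf{X}_0|_*>0$, $|\mathbf{Y}_0|_*>0$. Let the tension map $\mathbf{T}(z)=\mathcal{T}(|z|)\hat z$ satisfy $D\mathbf{T}\in W^{1,\infty}(\mathbb{R}^2;\mathbb{R}^{2\times2})$ and $D\mathbf{T}(z)\ge\lambda\mathcal{I}$ for all $z$, for some $\lambda>0$. Consider the corresponding solutions $\mathbf{X},\mathbf{Y}:[0,T]\times\mathbb{T}\to\mathbb{R}^2$, i.e. strong solutions of the Peskin problem with tension map $\mathbf{T}$ and initial data $\mathbf{X}_0$, $\mathbf{Y}_0$ respectively, each satisfying the energy bound (E) of the context. Choose any admissible weight $\omega$ such that there exists $r_*\ge1$ for which $\omega(r)/\mu(r)$ is decreasing for $r\ge r_*$ and $\lim_{r\to\infty}\omega(r)/\mu(r)=0$. For any $\varepsilon>0$ there exists $\delta_*>0$ such that for any $0<\delta\le\delta_*$, $\|\mathbf{X}_0'-\mathbf{Y}_0'\|_{L^2_\theta}<\delta$ implies $$\int_{\mathbb{T}}\frac{d\beta}{|\beta|^{3/2}}\,\omega(|\beta|^{-1})\,\|\delta_\beta(\mathbf{X}'-\mathbf{Y}')\|_{L^\infty_TL^2_\theta}<\varepsilon.$$ In particular, if $\|\mathbf{X}_0'-\mathbf{Y}_0'\|_{L^2_\theta}=0$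 then the solution is unique in $\mathcal{B}^\omega_T$.
   Context: $\mathbb{T}=\mathbb{R}/2\pi\mathbb{Z}=[-\pi,\pi]$. For a function $f$ on $\mathbb{T}$: $\delta_\alpha f(\theta)=f(\theta+\alpha)-f(\theta)$, and $D_\alpha f(\theta)=\delta_\alpha f(\theta)/\alpha$ for $\alpha\in[-\pi,\pi]\setminus\{0\}$. A prime on $\mathbf{X}$ denotes $\partial_\theta$. The arc-chord number is $|\mathbf{X}|_*=\inf_{\theta,\alpha\in\mathbb{T},\alpha\neq0}|D_\alpha\mathbf{X}(\theta)|$. For $z\in\mathbb{R}^2\setminus\{0\}$, $\hat z=z/|z|$, $\hat z^\perp$ is the unit vector perpendicular to $\hat z$, $\mathcal{I}$ is the $2\times2$ identity, $\mathcal{R}(z)=\hat z\otimes\hat z^\perp+\hat z^\perp\otimes\hat z$, $\mathcal{P}(z)=\hat z\otimes\hat z-\hat z^\perp\otimes\hat z^\perp$. The scalar tension is a function $\mathcal{T}:[0,\infty)\to[0,\infty)$ and the tension map is $\mathbf{T}(z)=\mathcal{T}(|z|)\hat z$. Peskin problem (equation for $\mathbf{X}'$): $$\partial_t\mathbf{X}'(\theta)=\int_{\mathbb{T}}\frac{d\alpha}{\alpha^2}\,\mathcal{K}[\mathbf{X}](\theta,\alpha)\,\delta_\alpha\mathbf{T}(\mathbf{X}'(\theta)),$$ where $$4\pi\mathcal{K}[\mathbf{X}](\theta,\alpha)=\frac{\mathbf{X}'(\theta+\alpha)\cdot\mathcal{P}(D_\alpha\mathbf{X}(\theta))\mathbf{X}'(\theta)}{|D_\alpha\mathbf{X}(\theta)|^2}\mathcal{I}-\frac{\mathbf{X}'(\theta+\alpha)\cdot\mathcal{R}(D_\alpha\mathbf{X}(\theta))\mathbf{X}'(\theta)}{|D_\alpha\mathbf{X}(\theta)|^2}\mathcal{R}(D_\alpha\mathbf{X}(\theta))+\frac{\mathbf{X}'(\theta+\alpha)\cdot(\mathcal{P}(D_\alpha\mathbf{X}(\theta))-\mathcal{I})\mathbf{X}'(\theta)}{|D_\alpha\mathbf{X}(\theta)|^2}\mathcal{P}(D_\alpha\mathbf{X}(\theta)).$$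 Admissible weight: $\mu:[0,\infty)\to[1,\infty)$ such that (i) $\mu$ is increasing and $\lim_{r\to\infty}\mu(r)=\infty$; (ii) there is $c_0>0$ with $\mu(2r)\le c_0\mu(r)$ for all $r\ge0$; (iii) $r\mapsto\mu(r)/\log(4+r)$ is decreasing on $[0,\infty)$. $\|f\|_{\dot B^{1/2,\mu}_{2,1}}=\int_{\mathbb{T}}\frac{d\beta}{|\beta|^{3/2}}\mu(|\beta|^{-1})\|\delta_\beta f\|_{L^2(\mathbb{T})}$, and $\|f\|_{\mathcal{B}^\omega_T}=\int_{\mathbb{T}}\frac{d\beta}{|\beta|^{3/2}}\omega(|\beta|^{-1})\|\delta_\beta f\|_{L^\infty_TL^2_\theta}$, with $L^q_TL^p_\theta$ the mixed norm over $[0,T]\times\mathbb{T}$. Strong solution with initial data $\mathbf{X}_0$: $\mathbf{X}\in C^2((0,T]\times\mathbb{T};\mathbb{R}^2)$ solves the Peskin equation for $\mathbf{X}'$ pointwise, $\inf_{0\le t\le T}|\mathbf{X}(t)|_*>0$, and $\lim_{t\to0}\|\mathbf{X}'(t)-\mathbf{X}_0'\|_{L^\infty}=0$. Energy bound (E), with $c>0$ a universal constant: $\int_{\mathbb{T}}\frac{d\beta}{|\beta|^{3/2}}\mu(|\beta|^{-1})\big(\|\delta_\beta\mathbf{X}'\|_{L^\infty_TL^2_\theta}+c\sqrt\lambda\|\delta_\beta(-\Delta)^{1/4}\mathbf{X}'\|_{L^2_TL^2_\theta}\big)\le4\|\mathbf{X}_0'\|_{\dot B^{1/2,\mu}_{2,1}}$.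 (It is known that if $\mu$ is an admissible weight, $\mathbf{X}_0:\mathbb{T}\to\mathbb{R}^2$ satisfies $\|\mathbf{X}_0'\|_{\dot B^{1/2,\mu}_{2,1}}\le M$ and $|\mathbf{X}_0|_*>0$, and the tension map satisfies $D\mathbf{T}\in W^{1,\infty}(\mathbb{R}^2;\mathbb{R}^{2\times2})$ and $D\mathbf{T}(z)\ge\lambda\mathcal{I}$ for all $z$ with $\lambda>0$, then there is a time $T>0$, depending only on $M$, $\mu$, $|\mathbf{X}_0|_*$, $\lambda$ and $\|D\mathbf{T}\|_{W^{1,\infty}}$, and a strong solution on $[0,T]$ with initial data $\mathbf{X}_0$ satisfying (E); these are the "corresponding solutions".) *)

theory Defs
  imports "HOL-Analysis.Analysis" "HOL-Probability.Essential_Supremum"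
begin

text \<open>
  Functions on the torus are \<open>2 * pi\<close>-periodic functions on the reals, and integrals over the
  torus are integrals over \<open>{-pi..pi}\<close> with respect to (unnormalised) Lebesgue measure.
  A function of time and angle is curried: \<open>X t \<theta>\<close>. All norms take values in \<open>ennreal\<close>, so that
  an infinite norm is really infinite.
\<close>

definition periodic :: "(real \<Rightarrow> 'a) \<Rightarrow> bool" where
  "periodic f \<longleftrightarrow> (\<forall>\<theta>. f (\<theta> + 2 * pi) = f \<theta>)"

definition delta :: "real \<Rightarrow> (real \<Rightarrow> real^2) \<Rightarrow> real \<Rightarrow> real^2" where
  "delta \<alpha> f \<theta> = f (\<theta> + \<alpha>) - f \<theta>"

definition Dquot :: "real \<Rightarrow> (real \<Rightarrow> real^2) \<Rightarrow> real \<Rightarrow> real^2" where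
  "Dquot \<alpha> f \<theta> = delta \<alpha> f \<theta> /\<^sub>R \<alpha>"

definition dtheta :: "(real \<Rightarrow> real^2) \<Rightarrow> real \<Rightarrow> real^2" where
  "dtheta f \<theta> = vector_derivative f (at \<theta>)"

definition arc_chord :: "(real \<Rightarrow> real^2) \<Rightarrow> real" where
  "arc_chord X = (INF (\<theta>, \<alpha>) \<in> {-pi..pi} \<times> ({-pi..pi} - {0}). norm (Dquot \<alpha> X \<theta>))"

subsection \<open>Regularity classes\<close>

text \<open>
  \<open>k\<close> times continuously differentiable on \<open>S\<close>, differentiation being relative to \<open>S\<close>
  (one-sided at boundary points); \<open>g b\<close> is the partial derivative in the direction \<open>b\<close>.
\<close>

primrec Ck_on :: "nat \<Rightarrow> 'a::euclidean_space set \<Rightarrow> ('a \<Rightarrow> 'b::real_normed_vector) \<Rightarrow> bool" where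
  "Ck_on 0 S f \<longleftrightarrow> continuous_on S f"
| "Ck_on (Suc k) S f \<longleftrightarrow>
     (\<exists>g. (\<forall>z\<in>S. (f has_derivative (\<lambda>h. \<Sum>b\<in>Basis. (h \<bullet> b) *\<^sub>R g b z)) (at z within S)) \<and>
          (\<forall>b\<in>Basis. Ck_on k S (g b)))"

definition Linf_class :: "('a::euclidean_space \<Rightarrow> 'b::euclidean_space) \<Rightarrow> bool" where
  "Linf_class f \<longleftrightarrow> f \<in> borel_measurable lebesgue \<and> (\<exists>C. AE z in lebesgue. norm (f z) \<le> C)"

definition weak_partial ::
    "'a::euclidean_space \<Rightarrow> ('a \<Rightarrow> 'b::euclidean_space) \<Rightarrow> ('a \<Rightarrow> 'b) \<Rightarrow> bool" where
  "weak_partial b f g \<longleftrightarrow>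
     (\<forall>\<phi>::'a \<Rightarrow> real. Ck_on 1 UNIV \<phi> \<and> bounded {z. \<phi> z \<noteq> 0} \<longrightarrow>
        (LINT z|lebesgue. frechet_derivative \<phi> (at z) b *\<^sub>R f z) =
        - (LINT z|lebesgue. \<phi> z *\<^sub>R g z))"

definition W1inf :: "('a::euclidean_space \<Rightarrow> 'b::euclidean_space) \<Rightarrow> bool" where
  "W1inf f \<longleftrightarrow> Linf_class f \<and> (\<forall>b\<in>Basis. \<exists>g. Linf_class g \<and> weak_partial b f g)"

text \<open>
  The Sobolev class \<open>W^{1,1}\<close> of the torus, through its absolutely continuous representatives:
  \<open>dtheta X\<close> is then the (weak and almost everywhere) derivative of \<open>X\<close>. At the exceptional
  points \<open>dtheta X\<close> has an arbitrary value, which no norm below sees.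
\<close>

definition W11_torus :: "(real \<Rightarrow> real^2) \<Rightarrow> bool" where
  "W11_torus X \<longleftrightarrow> periodic X \<and>
     (\<forall>a b. a \<le> b \<longrightarrow> set_integrable lebesgue {a..b} (dtheta X) \<and>
        X b - X a = (LINT \<theta>:{a..b}|lebesgue. dtheta X \<theta>))"

subsection \<open>Norms\<close>

definition sqrt_ennreal :: "ennreal \<Rightarrow> ennreal" where
  "sqrt_ennreal x = (if x = top then top else ennreal (sqrt (enn2real x)))"

definition L2_norm :: "(real \<Rightarrow> real^2) \<Rightarrow> ennreal" where
  "L2_norm f = sqrt_ennreal (\<integral>\<^sup>+\<theta>\<in>{-pi..pi}. ennreal ((norm (f \<theta>))\<^sup>2) \<partial>lebesgue)"

definition Linf_norm :: "(real \<Rightarrow> real^2) \<Rightarrow> ennreal" where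
  "Linf_norm f = esssup (restrict_space lebesgue {-pi..pi}) (\<lambda>\<theta>. ennreal (norm (f \<theta>)))"

definition LinfL2_norm :: "real \<Rightarrow> (real \<Rightarrow> real \<Rightarrow> real^2) \<Rightarrow> ennreal" where
  "LinfL2_norm T f = esssup (restrict_space lebesgue {0..T}) (\<lambda>t. L2_norm (f t))"

definition L2L2_norm :: "real \<Rightarrow> (real \<Rightarrow> real \<Rightarrow> real^2) \<Rightarrow> ennreal" where
  "L2L2_norm T f = sqrt_ennreal (\<integral>\<^sup>+t\<in>{0..T}. (L2_norm (f t))\<^sup>2 \<partial>lebesgue)"

definition admissible_weight :: "(real \<Rightarrow> real) \<Rightarrow> bool" where
  "admissible_weight \<mu> \<longleftrightarrow>
     (\<forall>r\<ge>0. 1 \<le> \<mu> r) \<and>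
     mono_on {0..} \<mu> \<and> filterlim \<mu> at_top at_top \<and>
     (\<exists>c0>0. \<forall>r\<ge>0. \<mu> (2 * r) \<le> c0 * \<mu> r) \<and>
     antimono_on {0..} (\<lambda>r. \<mu> r / ln (4 + r))"

definition besov_norm :: "(real \<Rightarrow> real) \<Rightarrow> (real \<Rightarrow> real^2) \<Rightarrow> ennreal" where
  "besov_norm \<mu> f =
     (\<integral>\<^sup>+\<beta>\<in>{-pi..pi}. ennreal (\<mu> (1 / \<bar>\<beta>\<bar>) / \<bar>\<beta>\<bar> powr (3/2)) * L2_norm (delta \<beta> f) \<partial>lebesgue)"

definition B_norm :: "(real \<Rightarrow> real) \<Rightarrow> real \<Rightarrow> (real \<Rightarrow> real \<Rightarrow> real^2) \<Rightarrow> ennreal" where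
  "B_norm \<omega> T f =
     (\<integral>\<^sup>+\<beta>\<in>{-pi..pi}. ennreal (\<omega> (1 / \<bar>\<beta>\<bar>) / \<bar>\<beta>\<bar> powr (3/2)) *
        LinfL2_norm T (\<lambda>t. delta \<beta> (f t)) \<partial>lebesgue)"

subsection \<open>Fractional Laplacian\<close>

definition fourier_coeff :: "(real \<Rightarrow> real^2) \<Rightarrow> int \<Rightarrow> complex^2" where
  "fourier_coeff f k =
     (\<chi> j. (LINT \<theta>:{-pi..pi}|lebesgue. complex_of_real (f \<theta> $ j) * cis (- of_int k * \<theta>)) / (2 * pi))"

text \<open>
  \<open>frac_laplacian s f\<close> is \<open>(-\<Delta>)^s f\<close>, the Fourier multiplier \<open>(k\<^sup>2)^s\<close> (which is \<open>0\<close> at \<open>k = 0\<close>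
  by the convention for \<open>powr\<close>). It is an element of \<open>L\<^sup>2\<close>, hence determined up to a null set,
  whenever the multiplied coefficients are square summable.
\<close>

definition is_frac_laplacian :: "real \<Rightarrow> (real \<Rightarrow> real^2) \<Rightarrow> (real \<Rightarrow> real^2) \<Rightarrow> bool" where
  "is_frac_laplacian s f g \<longleftrightarrow>
     periodic g \<and> g \<in> borel_measurable lebesgue \<and> L2_norm g < top \<and>
     (\<forall>k. fourier_coeff g k = (of_int (k\<^sup>2) powr s) *\<^sub>R fourier_coeff f k)"

definition frac_laplacian :: "real \<Rightarrow> (real \<Rightarrow> real^2) \<Rightarrow> real \<Rightarrow> real^2" where
  "frac_laplacian s f = (SOME g. is_frac_laplacian s f g)"

subsection \<open>The Peskin problem\<close>

definition perp :: "real^2 \<Rightarrow> real^2" where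
  "perp z = vector [- (z $ 2), z $ 1]"

definition tensor :: "real^2 \<Rightarrow> real^2 \<Rightarrow> real^2^2" where
  "tensor v w = (\<chi> i j. v $ i * w $ j)"

text \<open>
  The unit vector \<open>z / norm z\<close> is \<open>sgn z\<close>. Replacing \<open>perp\<close> by the opposite rotation changes the
  sign of \<open>R_mat\<close>, and leaves \<open>peskin_kernel\<close> unchanged.
\<close>

definition R_mat :: "real^2 \<Rightarrow> real^2^2" where
  "R_mat z = tensor (sgn z) (perp (sgn z)) + tensor (perp (sgn z)) (sgn z)"

definition P_mat :: "real^2 \<Rightarrow> real^2^2" where
  "P_mat z = tensor (sgn z) (sgn z) - tensor (perp (sgn z)) (perp (sgn z))"

text \<open>
  Since \<open>sgn 0 = 0\<close>, the tension map vanishes at the origin, the only value compatible with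
  continuity there.
\<close>

definition tension_map :: "(real \<Rightarrow> real) \<Rightarrow> real^2 \<Rightarrow> real^2" where
  "tension_map \<T> z = \<T> (norm z) *\<^sub>R sgn z"

definition admissible_tension :: "(real \<Rightarrow> real) \<Rightarrow> real \<Rightarrow> bool" where
  "admissible_tension \<T> \<Lambda> \<longleftrightarrow>
     (\<forall>r\<ge>0. 0 \<le> \<T> r) \<and>
     (\<forall>z. tension_map \<T> differentiable (at z)) \<and>
     W1inf (\<lambda>z. jacobian (tension_map \<T>) (at z)) \<and>
     (\<forall>z h. \<Lambda> * (h \<bullet> h) \<le> h \<bullet> (jacobian (tension_map \<T>) (at z) *v h))"

definition peskin_kernel :: "(real \<Rightarrow> real^2) \<Rightarrow> real \<Rightarrow> real \<Rightarrow> real^2^2" where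
  "peskin_kernel X \<theta> \<alpha> =
     (let U = dtheta X (\<theta> + \<alpha>); V = dtheta X \<theta>; D = Dquot \<alpha> X \<theta>
      in (1 / (4 * pi)) *\<^sub>R
           (((U \<bullet> (P_mat D *v V)) / (norm D)\<^sup>2) *\<^sub>R mat 1
            - ((U \<bullet> (R_mat D *v V)) / (norm D)\<^sup>2) *\<^sub>R R_mat D
            + ((U \<bullet> ((P_mat D - mat 1) *v V)) / (norm D)\<^sup>2) *\<^sub>R P_mat D))"

text \<open>
  The integrand behaves like \<open>1 / \<alpha>\<close> at \<open>\<alpha> = 0\<close>, so the integral over the torus is a
  principal value.
\<close>

definition peskin_rhs :: "(real \<Rightarrow> real) \<Rightarrow> (real \<Rightarrow> real^2) \<Rightarrow> real \<Rightarrow> real^2 \<Rightarrow> bool" where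
  "peskin_rhs \<T> X \<theta> v \<longleftrightarrow>
     ((\<lambda>\<eta>. LINT \<alpha>:{\<alpha>. \<eta> \<le> \<bar>\<alpha>\<bar> \<and> \<bar>\<alpha>\<bar> \<le> pi}|lebesgue.
          (1 / \<alpha>\<^sup>2) *\<^sub>R (peskin_kernel X \<theta> \<alpha> *v
             delta \<alpha> (\<lambda>\<theta>'. tension_map \<T> (dtheta X \<theta>')) \<theta>))
      \<longlongrightarrow> v) (at_right 0)"

definition strong_solution ::
    "(real \<Rightarrow> real) \<Rightarrow> real \<Rightarrow> (real \<Rightarrow> real^2) \<Rightarrow> (real \<Rightarrow> real \<Rightarrow> real^2) \<Rightarrow> bool" where
  "strong_solution \<T> T X0 X \<longleftrightarrow>
     (\<forall>t\<in>{0..T}. periodic (X t)) \<and>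
     Ck_on 2 ({0<..T} \<times> UNIV) (\<lambda>(t, \<theta>). X t \<theta>) \<and>
     (\<forall>t\<in>{0<..T}. \<forall>\<theta>. \<exists>v. peskin_rhs \<T> (X t) \<theta> v \<and>
        ((\<lambda>s. dtheta (X s) \<theta>) has_vector_derivative v) (at t within {0<..T})) \<and>
     0 < (INF t\<in>{0..T}. arc_chord (X t)) \<and>
     ((\<lambda>t. Linf_norm (\<lambda>\<theta>. dtheta (X t) \<theta> - dtheta X0 \<theta>)) \<longlongrightarrow> 0) (at_right 0)"

definition energy_bound ::
    "(real \<Rightarrow> real) \<Rightarrow> real \<Rightarrow> real \<Rightarrow> real \<Rightarrow> (real \<Rightarrow> real^2) \<Rightarrow> (real \<Rightarrow> real \<Rightarrow> real^2) \<Rightarrow> bool" where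
  "energy_bound \<mu> \<Lambda> c T X0 X \<longleftrightarrow>
     (\<integral>\<^sup>+\<beta>\<in>{-pi..pi}. ennreal (\<mu> (1 / \<bar>\<beta>\<bar>) / \<bar>\<beta>\<bar> powr (3/2)) *
        (LinfL2_norm T (\<lambda>t. delta \<beta> (dtheta (X t))) +
         ennreal (c * sqrt \<Lambda>) *
           L2L2_norm T (\<lambda>t. delta \<beta> (frac_laplacian (1/4) (dtheta (X t))))) \<partial>lebesgue)
     \<le> 4 * besov_norm \<mu> (dtheta X0)"

definition admissible_datum :: "(real \<Rightarrow> real) \<Rightarrow> real \<Rightarrow> (real \<Rightarrow> real^2) \<Rightarrow> bool" where
  "admissible_datum \<mu> M X0 \<longleftrightarrow>
     W11_torus X0 \<and> besov_norm \<mu> (dtheta X0) \<le> ennreal M \<and> 0 < arc_chord X0"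

definition corresponding_solution ::
    "(real \<Rightarrow> real) \<Rightarrow> (real \<Rightarrow> real) \<Rightarrow> real \<Rightarrow> real \<Rightarrow> real \<Rightarrow> (real \<Rightarrow> real^2) \<Rightarrow>
     (real \<Rightarrow> real \<Rightarrow> real^2) \<Rightarrow> bool" where
  "corresponding_solution \<mu> \<T> \<Lambda> c T X0 X \<longleftrightarrow>
     strong_solution \<T> T X0 X \<and> energy_bound \<mu> \<Lambda> c T X0 X"

end

theory Submission
  imports Defs
begin

text \<open>
  The difference \<open>Z = X' - Y'\<close> of two solutions is controlled linearly by the data in \<open>L\<^sup>2\<close>. Testing the
  equation with \<open>Z\<close> and symmetrising the principal value leaves, for each increment \<open>\<alpha>\<close>, an energy
  density whose leading part \<open>\<Lambda> \<bar>\<delta> Z\<bar>\<^sup>2\<close> has a good sign. By Young's inequality the rest is at most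
  \<open>(\<bar>Z\<bar>\<^sup>2 + average of \<bar>Z\<bar>\<^sup>2) \<cdot> sup \<bar>\<delta> X'\<bar>\<^sup>2\<close>, and similarly for \<open>Y\<close>. The embedding of \<open>B^{1/2}_{2,1}\<close> into
  the bounded functions turns the supremum into a Besov norm of the increment, which after division
  by \<open>\<alpha>\<^sup>2\<close> is integrable in \<open>\<alpha>\<close> and \<open>t\<close> by Minkowski's inequality and the dissipation in the energy
  bound. Gronwall's inequality then gives \<open>\<parallel>Z t\<parallel>\<^sup>2 \<le> 3 exp K \<parallel>Z 0\<parallel>\<^sup>2\<close>, with \<open>K\<close> depending only on the
  parameters and the lower bound \<open>m\<close> of the arc-chord numbers.

  In the weighted norm, increments with small \<open>\<bar>\<beta>\<bar>\<close> are absorbed by the energy bound because \<open>\<omega> / \<mu>\<close>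
  tends to \<open>0\<close>, and the remaining ones are controlled by the stability in \<open>L\<^sup>2\<close>.
\<close>

subsection \<open>Fourier coefficients\<close>

text \<open>The equation is known only as a pointwise principal value, so testing it with Z needs a
  limit under the angular integral. For this the truncations have to be bounded in L^2 uniformly in
  the cut-off; the bound may depend on the time slice, since it serves the passage to the limit and
  not the estimate. Increments of Z appear because the integrand is antisymmetric under exchanging
  the two ends of a chord.

  No derivative is lost: the good term is quadratic in the increment of Z, while each error is a
  product of that increment, the size of Z and an increment of a solution. Young's inequality leaves
  the squared increments of the solutions, which their dissipation pays for.

  Fourier series serve three purposes: \<open>frac_laplacian\<close> is a mere choice, so a function
  with its coefficients must be shown to exist; its L^2 norm must be turned into an integral of
  squared increments; the truncations must be bounded.

  Two further obstacles are the pointwise regularity of the tension, given only weak and essential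
  information, and norms that need not be measurable in \<beta>, whose integrals are handled by
  monotonicity.\<close>

lemma lebesgue_on_eq_integral:
  fixes f :: "real \<Rightarrow> 'b::euclidean_space"
  assumes "continuous_on {a..b} f"
  shows "integrable (lebesgue_on {a..b}) f" "integral\<^sup>L (lebesgue_on {a..b}) f = integral {a..b} f"
proof -
  show *: "integrable (lebesgue_on {a..b}) f"
    using assms by (intro continuous_imp_integrable_real)
  show "integral\<^sup>L (lebesgue_on {a..b}) f = integral {a..b} f"
    by (rule lebesgue_integral_eq_integral[OF *]) auto
qed

lemma continuous_cis_comp [continuous_intros]:
  "continuous_on S f \<Longrightarrow> continuous_on S (\<lambda>x. cis (f x))"
  by (simp add: continuous_on_cis)

definition fc :: "(real \<Rightarrow> real) \<Rightarrow> int \<Rightarrow> complex" where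
  "fc f k = (LINT \<theta>:{-pi..pi}|lebesgue. complex_of_real (f \<theta>) * cis (- of_int k * \<theta>)) / (2 * pi)"

lemma fourier_coeff_nth: "fourier_coeff f k $ j = fc (\<lambda>\<theta>. f \<theta> $ j) k"
  by (simp add: fourier_coeff_def fc_def)

lemma fc_alt: "fc f k = (LINT \<theta>|lebesgue_on {-pi..pi}. complex_of_real (f \<theta>) * cis (- of_int k * \<theta>)) / (2 * pi)"
  unfolding fc_def by (subst integral_restrict_space) (auto simp: set_lebesgue_integral_def)

lemma integral_cis:
  "integral {-pi..pi} (\<lambda>\<theta>. cis (of_int n * \<theta>)) = (if n = 0 then 2 * pi else 0)"
proof (cases "n = 0")
  case False
  let ?F = "\<lambda>\<theta>. cis (of_int n * \<theta>) / (\<i> * of_int n)"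
  have "((\<lambda>\<theta>. cis (of_int n * \<theta>)) has_integral (?F pi - ?F (-pi))) {-pi..pi}"
  proof (rule fundamental_theorem_of_calculus)
    fix x :: real
    have "((\<lambda>z. exp (\<i> * of_int n * z)) has_field_derivative (\<i> * of_int n) * exp (\<i> * of_int n * of_real x)) (at (of_real x))"
      by (auto intro!: derivative_eq_intros)
    from has_vector_derivative_real_field[OF this]
    have "((\<lambda>\<theta>. cis (of_int n * \<theta>)) has_vector_derivative (\<i> * of_int n) * cis (of_int n * x)) (at x)"
      by (simp add: cis_conv_exp mult_ac)
    from has_vector_derivative_divide[OF this, of "\<i> * of_int n"] False
    show "(?F has_vector_derivative cis (of_int n * x)) (at x within {-pi..pi})"
      by (auto intro: has_vector_derivative_at_within)
  qed auto
  moreover have "?F pi = ?F (-pi)"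
  proof -
    have "cis (of_int n * pi) = cis (of_int n * (- pi))"
      by (auto simp: complex_eq_iff sin_zero_iff_int2)
    then show ?thesis by simp
  qed
  ultimately show ?thesis using False by (simp add: integral_unique)
qed (simp add: scaleR_conv_of_real)

lemma integral_Re_combination:
  fixes a :: "'x \<Rightarrow> real" and b c :: "'x \<Rightarrow> complex"
  assumes "integrable M a" "integrable M b" "integrable M c"
  shows "integrable M (\<lambda>x. a x - 2 * Re (b x) + Re (c x))"
    "(LINT x|M. a x - 2 * Re (b x) + Re (c x)) = (LINT x|M. a x) - 2 * Re (LINT x|M. b x) + Re (LINT x|M. c x)"
  using assms integral_Re[OF assms(2)] integral_Re[OF assms(3)] by simp_all

text \<open>Orthogonality of the characters, with the square completed in each coefficient. The
  choice \<open>c = fc f\<close> gives Bessel's inequality; an arbitrary \<open>c\<close>, taken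
  from an approximating polynomial, gives the converse in \<open>parseval_le\<close>.\<close>

lemma trig_distance:
  fixes c :: "int \<Rightarrow> complex"
  assumes F: "finite F" and f: "integrable (lebesgue_on {-pi..pi}) f"
    and f2: "integrable (lebesgue_on {-pi..pi}) (\<lambda>\<theta>. (f \<theta>)\<^sup>2)"
  shows "integrable (lebesgue_on {-pi..pi}) (\<lambda>\<theta>. (cmod (complex_of_real (f \<theta>) - (\<Sum>k\<in>F. c k * cis (of_int k * \<theta>))))\<^sup>2)"
    and "(LINT \<theta>|lebesgue_on {-pi..pi}. (cmod (complex_of_real (f \<theta>) - (\<Sum>k\<in>F. c k * cis (of_int k * \<theta>))))\<^sup>2)
     = (LINT \<theta>|lebesgue_on {-pi..pi}. (f \<theta>)\<^sup>2) - 2 * pi * (\<Sum>k\<in>F. (cmod (fc f k))\<^sup>2)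
        + 2 * pi * (\<Sum>k\<in>F. (cmod (fc f k - c k))\<^sup>2)"
proof -
  let ?M = "lebesgue_on {-pi..pi}"
  let ?p = "\<lambda>\<theta>. \<Sum>k\<in>F. c k * cis (of_int k * \<theta>)"
  have cf: "integrable ?M (\<lambda>\<theta>. complex_of_real (f \<theta>) * cis (- of_int k * \<theta>))" for k :: int
  proof (rule Bochner_Integration.integrable_bound[OF f])
    have "(\<lambda>\<theta>. cis (- of_int k * \<theta>)) \<in> borel_measurable ?M"
      by (intro continuous_imp_measurable_on_sets_lebesgue continuous_intros) auto
    then show "(\<lambda>\<theta>. complex_of_real (f \<theta>) * cis (- of_int k * \<theta>)) \<in> borel_measurable ?M"
      using f by measurable
  qed (auto simp: norm_mult)
  have fck: "(LINT \<theta>|?M. complex_of_real (f \<theta>) * cis (- of_int k * \<theta>)) = 2 * pi * fc f k" for k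
    by (simp add: fc_alt)
  have e: "(cmod (complex_of_real (f \<theta>) - ?p \<theta>))\<^sup>2 = (f \<theta>)\<^sup>2
      - 2 * Re (\<Sum>k\<in>F. cnj (c k) * (complex_of_real (f \<theta>) * cis (- of_int k * \<theta>))) 
      + Re (\<Sum>k\<in>F. \<Sum>j\<in>F. c k * cnj (c j) * cis (of_int (k - j) * \<theta>))" for \<theta>
  proof -
    have "(cmod (complex_of_real (f \<theta>) - ?p \<theta>))\<^sup>2 = Re ((complex_of_real (f \<theta>) - ?p \<theta>) * cnj (complex_of_real (f \<theta>) - ?p \<theta>))"
      by (simp only: complex_norm_square[symmetric]) simp
    also have "\<dots> = (f \<theta>)\<^sup>2 - 2 * Re (complex_of_real (f \<theta>) * cnj (?p \<theta>)) + Re (?p \<theta> * cnj (?p \<theta>))"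
      by (simp add: algebra_simps power2_eq_square)
    also have "complex_of_real (f \<theta>) * cnj (?p \<theta>) = (\<Sum>k\<in>F. cnj (c k) * (complex_of_real (f \<theta>) * cis (- of_int k * \<theta>)))"
      by (simp add: sum_distrib_left cis_cnj mult_ac)
    also have "?p \<theta> * cnj (?p \<theta>) = (\<Sum>k\<in>F. \<Sum>j\<in>F. c k * cnj (c j) * cis (of_int (k - j) * \<theta>))"
    proof -
      have "(c k * cis (of_int k * \<theta>)) * (cnj (c j) * cnj (cis (of_int j * \<theta>))) = c k * cnj (c j) * cis (of_int (k - j) * \<theta>)" for k j
        by (simp add: cis_cnj cis_mult algebra_simps)
      then show ?thesis unfolding cnj_sum complex_cnj_mult sum_product by (intro sum.cong refl)
    qed
    finally show ?thesis .
  qed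
  have i2: "integrable ?M (\<lambda>\<theta>. \<Sum>k\<in>F. cnj (c k) * (complex_of_real (f \<theta>) * cis (- of_int k * \<theta>)))"
    using cf by (intro Bochner_Integration.integrable_sum integrable_mult_right) auto
  have ic: "integrable ?M (\<lambda>\<theta>. cis (of_int n * \<theta>))" 
      "(LINT \<theta>|?M. cis (of_int n * \<theta>)) = (if n = 0 then 2 * pi else 0)" for n :: int
    using lebesgue_on_eq_integral[of "-pi" pi "\<lambda>\<theta>. cis (of_int n * \<theta>)"] integral_cis[of n]
      continuous_cis_comp[of "{-pi..pi}" "\<lambda>\<theta>. of_int n * \<theta>"]
    by (simp_all add: continuous_on_mult_left continuous_on_id)
  have i3: "integrable ?M (\<lambda>\<theta>. \<Sum>k\<in>F. \<Sum>j\<in>F. c k * cnj (c j) * cis (of_int (k - j) * \<theta>))"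
    by (intro ic(1) Bochner_Integration.integrable_sum integrable_mult_right)
  show "integrable ?M (\<lambda>\<theta>. (cmod (complex_of_real (f \<theta>) - ?p \<theta>))\<^sup>2)"
    unfolding e by (rule integral_Re_combination(1)[OF f2 i2 i3])
  have "(LINT \<theta>|?M. (cmod (complex_of_real (f \<theta>) - ?p \<theta>))\<^sup>2) = (LINT \<theta>|?M. (f \<theta>)\<^sup>2)
      - 2 * Re (LINT \<theta>|?M. (\<Sum>k\<in>F. cnj (c k) * (complex_of_real (f \<theta>) * cis (- of_int k * \<theta>)))) 
      + Re (LINT \<theta>|?M. (\<Sum>k\<in>F. \<Sum>j\<in>F. c k * cnj (c j) * cis (of_int (k - j) * \<theta>)))"
    unfolding e by (rule integral_Re_combination(2)[OF f2 i2 i3])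
  also have "(LINT \<theta>|?M. (\<Sum>k\<in>F. cnj (c k) * (complex_of_real (f \<theta>) * cis (- of_int k * \<theta>))))
      = (\<Sum>k\<in>F. cnj (c k) * (2 * pi * fc f k))"
    using cf fck by (subst Bochner_Integration.integral_sum) auto
  also have "(LINT \<theta>|?M. (\<Sum>k\<in>F. \<Sum>j\<in>F. c k * cnj (c j) * cis (of_int (k - j) * \<theta>)))
     = (\<Sum>k\<in>F. \<Sum>j\<in>F. c k * cnj (c j) * (if k - j = 0 then 2 * pi else 0))"
    by (simp add: ic Bochner_Integration.integral_sum del: of_int_diff)
  also have "\<dots> = (\<Sum>k\<in>F. c k * cnj (c k) * (2 * pi))"
    using F by (simp add: if_distrib sum.delta' cong: if_cong)
  also have "(LINT \<theta>|?M. (f \<theta>)\<^sup>2) - 2 * Re (\<Sum>k\<in>F. cnj (c k) * (2 * pi * fc f k)) + Re (\<Sum>k\<in>F. c k * cnj (c k) * (2 * pi))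
    = (LINT \<theta>|?M. (f \<theta>)\<^sup>2) + (\<Sum>k\<in>F. 2 * pi * (Re (c k * cnj (c k)) - 2 * Re (cnj (c k) * fc f k)))"
    by (simp add: sum_distrib_left sum_subtractf sum.distrib algebra_simps)
  also have "\<dots> = (LINT \<theta>|?M. (f \<theta>)\<^sup>2) + (\<Sum>k\<in>F. 2 * pi * ((cmod (fc f k - c k))\<^sup>2 - (cmod (fc f k))\<^sup>2))"
  proof -
    have "Re (c k * cnj (c k)) - 2 * Re (cnj (c k) * fc f k) = (cmod (fc f k - c k))\<^sup>2 - (cmod (fc f k))\<^sup>2" for k
      unfolding cmod_power2 by (simp add: power2_eq_square algebra_simps)
    then show ?thesis by simp
  qed
  finally show "(LINT \<theta>|lebesgue_on {-pi..pi}. (cmod (complex_of_real (f \<theta>) - ?p \<theta>))\<^sup>2)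
     = (LINT \<theta>|lebesgue_on {-pi..pi}. (f \<theta>)\<^sup>2) - 2 * pi * (\<Sum>k\<in>F. (cmod (fc f k))\<^sup>2)
        + 2 * pi * (\<Sum>k\<in>F. (cmod (fc f k - c k))\<^sup>2)"
    by (simp add: sum_distrib_left sum_subtractf algebra_simps)
qed

lemma bessel:
  assumes F: "finite F" and f: "integrable (lebesgue_on {-pi..pi}) f"
    and f2: "integrable (lebesgue_on {-pi..pi}) (\<lambda>\<theta>. (f \<theta>)\<^sup>2)"
  shows "2 * pi * (\<Sum>k\<in>F. (cmod (fc f k))\<^sup>2) \<le> (LINT \<theta>|lebesgue_on {-pi..pi}. (f \<theta>)\<^sup>2)"
proof -
  have "0 \<le> (LINT \<theta>|lebesgue_on {-pi..pi}. (cmod (complex_of_real (f \<theta>) - (\<Sum>k\<in>F. fc f k * cis (of_int k * \<theta>))))\<^sup>2)"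
    by (intro Bochner_Integration.integral_nonneg) auto
  then show ?thesis unfolding trig_distance(2)[OF assms] by simp
qed

section \<open>Trigonometric polynomials and Parseval's inequality\<close>

definition trig_poly :: "(real \<Rightarrow> real) \<Rightarrow> bool" where
  "trig_poly p \<longleftrightarrow> (\<exists>F c. finite F \<and> (\<forall>\<theta>. complex_of_real (p \<theta>) = (\<Sum>k\<in>F. c k * cis (of_int k * \<theta>))))"

lemma trig_polyI: "finite F \<Longrightarrow> (\<And>\<theta>. complex_of_real (p \<theta>) = (\<Sum>k\<in>F. c k * cis (of_int k * \<theta>))) \<Longrightarrow> trig_poly p"
  unfolding trig_poly_def by blast

text \<open>The frequencies \<open>e i\<close> may repeat, so equal ones are merged by summing their
  coefficients. Sums and products of trigonometric polynomials both arrive in this redundant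
  form.\<close>

lemma trig_poly_gather:
  fixes e :: "'i \<Rightarrow> int" and d :: "'i \<Rightarrow> complex"
  assumes I: "finite I" and p: "\<And>\<theta>. complex_of_real (p \<theta>) = (\<Sum>i\<in>I. d i * cis (of_int (e i) * \<theta>))"
  shows "trig_poly p"
proof (rule trig_polyI[of "e ` I"])
  show "complex_of_real (p \<theta>) = (\<Sum>k\<in>e ` I. (\<Sum>i\<in>{i\<in>I. e i = k}. d i) * cis (of_int k * \<theta>))" for \<theta>
    unfolding p using sum.image_gen[OF I, of "\<lambda>i. d i * cis (of_int (e i) * \<theta>)" e]
    by (auto simp: sum_distrib_right intro!: sum.cong)
qed (use I in auto)

lemma trig_poly_add: assumes "trig_poly p" "trig_poly q" shows "trig_poly (\<lambda>\<theta>. p \<theta> + q \<theta>)"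
proof -
  obtain F c G d where F: "finite F" "\<And>\<theta>. complex_of_real (p \<theta>) = (\<Sum>k\<in>F. c k * cis (of_int k * \<theta>))"
    and G: "finite G" "\<And>\<theta>. complex_of_real (q \<theta>) = (\<Sum>k\<in>G. d k * cis (of_int k * \<theta>))"
    using assms unfolding trig_poly_def by metis
  show ?thesis
    by (rule trig_poly_gather[of "F <+> G" _ "case_sum c d" "case_sum id id"])
      (use F G in \<open>auto simp: sum.Plus o_def\<close>)
qed

lemma trig_poly_mult: assumes "trig_poly p" "trig_poly q" shows "trig_poly (\<lambda>\<theta>. p \<theta> * q \<theta>)"
proof -
  obtain F c G d where F: "finite F" "\<And>\<theta>. complex_of_real (p \<theta>) = (\<Sum>k\<in>F. c k * cis (of_int k * \<theta>))"
    and G: "finite G" "\<And>\<theta>. complex_of_real (q \<theta>) = (\<Sum>k\<in>G. d k * cis (of_int k * \<theta>))"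
    using assms unfolding trig_poly_def by metis
  have "(c x * cis (of_int x * \<theta>)) * (d y * cis (of_int y * \<theta>)) = c x * d y * cis (of_int (x + y) * \<theta>)" for x y \<theta>
    by (simp add: cis_mult[symmetric] algebra_simps)
  then show ?thesis
    by (intro trig_poly_gather[of "F \<times> G" _ "\<lambda>(i,j). c i * d j" "\<lambda>(i,j). i + j"])
      (use F G in \<open>auto simp: sum_product sum.cartesian_product intro!: sum.cong\<close>)
qed

text \<open>The bridge from Stone-Weierstrass on the circle: a real polynomial is built from linear
  functionals, constants, sums and products, and a linear functional of \<open>cis \<theta>\<close>
  is a combination of cosine and sine.\<close>

lemma trig_poly_real_polynomial:
  assumes "real_polynomial_function g" shows "trig_poly (\<lambda>\<theta>. g (cis \<theta>))"
  using assms
proof induction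
  case (linear h)
  have "h (cis \<theta>) = cos \<theta> * h 1 + sin \<theta> * h \<i>" for \<theta>
  proof -
    have "cis \<theta> = cos \<theta> *\<^sub>R 1 + sin \<theta> *\<^sub>R \<i>" by (simp add: complex_eq_iff)
    then show ?thesis using linear by (simp add: linear_simps)
  qed
  \<comment> \<open>Euler's formulas: a cos \<theta> + b sin \<theta> has the coefficient (a - i
    b)/2 at frequency 1 and its conjugate at -1.\<close>
  then show ?case
    by (intro trig_polyI[of "{1,-1}" _ "\<lambda>k. (h 1 - of_int k * \<i> * h \<i>) / 2"])
      (auto simp: complex_eq_iff field_simps)
next
  case (const c)
  show ?case by (rule trig_polyI[of "{0}" _ "\<lambda>_. c"]) auto
qed (auto intro: trig_poly_add trig_poly_mult)

lemma periodic_int: assumes "periodic f" shows "f (x + 2 * pi * of_int n) = f x"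
proof -
  have nat: "f (x + 2 * pi * of_nat n) = f x" for n :: nat and x
  proof (induction n)
    case (Suc n)
    have "f (x + 2 * pi * of_nat (Suc n)) = f ((x + 2 * pi * of_nat n) + 2 * pi)" by (simp add: algebra_simps)
    with Suc assms show ?case unfolding periodic_def by simp
  qed simp
  show ?thesis
  proof (cases "n \<ge> 0")
    case True then show ?thesis using nat[of x "nat n"] by simp
  next
    case False then show ?thesis using nat[of "x + 2 * pi * of_int n" "nat (-n)"] by simp
  qed
qed

text \<open>Stone-Weierstrass on the unit circle for \<open>f\<close> composed with the argument.
  The composition is continuous although \<open>Arg\<close> is not, because a jump by 2 pi is
  invisible to a periodic \<open>f\<close>.\<close>

lemma trig_poly_approx:
  fixes f :: "real \<Rightarrow> real"
  assumes per: "periodic f" and cont: "continuous_on UNIV f" and e: "0 < e"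
  obtains p where "trig_poly p" "\<And>\<theta>. \<bar>f \<theta> - p \<theta>\<bar> < e"
proof -
  have f2: "f x = f y" if "cis x = cis y" for x y
  proof -
    have "sin x = sin y \<and> cos x = cos y" using that by (auto simp: complex_eq_iff)
    then obtain n :: int where "x = y + 2 * pi * n" by (auto simp: sin_cos_eq_iff)
    then show ?thesis using periodic_int[OF per] by simp
  qed
  let ?F = "\<lambda>z. f (Arg z)"
  have icont: "isCont f x" for x using cont by (simp add: continuous_on_eq_continuous_at)
  have "isCont ?F z" if "z \<in> sphere 0 1" for z
  proof (cases "z \<in> \<real>\<^sub>\<le>\<^sub>0")
    case False
    show ?thesis by (rule isCont_o2[OF continuous_at_Arg[OF False] icont])
  next
    \<comment> \<open>On the branch cut \<open>Arg\<close> is replaced by \<open>Arg2pi\<close>,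
      which is continuous there; both give the same value of \<open>f\<close> near \<open>z\<close>,
      since they agree modulo a period.\<close>
    case True
    have nz: "z \<noteq> 0" using that by auto
    then have "z \<notin> \<real>\<^sub>\<ge>\<^sub>0" using True by (auto simp: complex_nonneg_Reals_iff complex_nonpos_Reals_iff complex_eq_iff)
    then have "isCont (\<lambda>z. f (Arg2pi z)) z" by (intro isCont_o2[OF continuous_at_Arg2pi icont])
    moreover have "eventually (\<lambda>w. f (Arg2pi w) = f (Arg w)) (nhds z)"
    proof (rule eventually_mono[OF eventually_nhds_in_open[of "-{0}"]])
      fix w :: complex assume "w \<in> -{0}"
      then have "w \<noteq> 0" by simp
      then have "cis (Arg w) = cis (Arg2pi w)"
        using Arg_eq[of w] Arg2pi_eq[of w] by (simp add: cis_conv_exp) (metis mult_cancel_left norm_eq_zero of_real_eq_0_iff)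
      then show "f (Arg2pi w) = f (Arg w)" using f2 by metis
    qed (use nz in auto)
    ultimately show ?thesis by (simp add: isCont_cong)
  qed
  then have "continuous_on (sphere 0 1) ?F" by (auto intro: continuous_at_imp_continuous_on)
  then obtain g where g: "real_polynomial_function g" "\<And>z. z \<in> sphere 0 1 \<Longrightarrow> \<bar>?F z - g z\<bar> < e"
    using Stone_Weierstrass_real_polynomial_function[OF _ _ e, of "sphere 0 1" ?F] by auto
  show thesis
  proof (rule that[of "\<lambda>\<theta>. g (cis \<theta>)"])
    show "trig_poly (\<lambda>\<theta>. g (cis \<theta>))" using g(1) by (rule trig_poly_real_polynomial)
    fix \<theta>
    have "cis (Arg (cis \<theta>)) = cis \<theta>" using Arg_eq[of "cis \<theta>"] by (simp add: cis_conv_exp)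
    then have "f (Arg (cis \<theta>)) = f \<theta>" using f2 by blast
    then show "\<bar>f \<theta> - g (cis \<theta>)\<bar> < e" using g(2)[of "cis \<theta>"] by simp
  qed
qed

text \<open>This half of Parseval's identity is what later arguments use: a bound for all finite
  sums of squared coefficients bounds the L^2 norm. A trigonometric polynomial uniformly close to
  \<open>f\<close> makes the left side of \<open>trig_distance\<close> small.\<close>

lemma parseval_le:
  fixes f :: "real \<Rightarrow> real"
  assumes per: "periodic f" and cont: "continuous_on UNIV f"
    and B: "\<And>F. finite F \<Longrightarrow> (\<Sum>k\<in>F. (cmod (fc f k))\<^sup>2) \<le> B"
  shows "integral {-pi..pi} (\<lambda>\<theta>. (f \<theta>)\<^sup>2) \<le> 2 * pi * B"
proof -
  let ?M = "lebesgue_on {-pi..pi}"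
  have cont': "continuous_on {-pi..pi} f" using cont by (rule continuous_on_subset) auto
  note f = lebesgue_on_eq_integral(1)[OF cont']
  have f2: "integrable ?M (\<lambda>\<theta>. (f \<theta>)\<^sup>2)" "integral\<^sup>L ?M (\<lambda>\<theta>. (f \<theta>)\<^sup>2) = integral {-pi..pi} (\<lambda>\<theta>. (f \<theta>)\<^sup>2)"
    using cont' by (auto intro!: lebesgue_on_eq_integral continuous_intros)
  have "integral {-pi..pi} (\<lambda>\<theta>. (f \<theta>)\<^sup>2) \<le> 2 * pi * B + e" if "0 < e" for e
  proof -
    \<comment> \<open>The squared distance to the polynomial integrates to at most 2 pi d^2, which
      is to be \<open>e\<close>.\<close>
    define d where "d = sqrt (e / (2 * pi))"
    have d: "0 < d" "2 * pi * d\<^sup>2 = e" using that by (auto simp: d_def)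
    obtain p where p: "trig_poly p" "\<And>\<theta>. \<bar>f \<theta> - p \<theta>\<bar> < d"
      using trig_poly_approx[OF per cont d(1)] by blast
    then obtain F c where F: "finite F" and c: "\<And>\<theta>. complex_of_real (p \<theta>) = (\<Sum>k\<in>F. c k * cis (of_int k * \<theta>))"
      unfolding trig_poly_def by metis
    have "(LINT \<theta>|?M. (cmod (complex_of_real (f \<theta>) - (\<Sum>k\<in>F. c k * cis (of_int k * \<theta>))))\<^sup>2) \<le> (LINT \<theta>|?M. d\<^sup>2)"
    proof (rule integral_mono[OF trig_distance(1)[OF F f f2(1)]])
      show "integrable ?M (\<lambda>_. d\<^sup>2)" using lebesgue_on_eq_integral(1)[of "-pi" pi "\<lambda>_. d\<^sup>2"] by simp
      show "(cmod (complex_of_real (f \<theta>) - (\<Sum>k\<in>F. c k * cis (of_int k * \<theta>))))\<^sup>2 \<le> d\<^sup>2" for \<theta>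
        unfolding c[symmetric] of_real_diff[symmetric] norm_of_real
        using p(2)[of \<theta>] by (intro power_mono) auto
    qed
    also have "\<dots> = e" using lebesgue_on_eq_integral(2)[of "-pi" pi "\<lambda>_. d\<^sup>2"] d by simp
    finally have "integral {-pi..pi} (\<lambda>\<theta>. (f \<theta>)\<^sup>2) - 2 * pi * (\<Sum>k\<in>F. (cmod (fc f k))\<^sup>2)
        + 2 * pi * (\<Sum>k\<in>F. (cmod (fc f k - c k))\<^sup>2) \<le> e"
      unfolding trig_distance(2)[OF F f f2(1)] f2(2) .
    moreover have "0 \<le> 2 * pi * (\<Sum>k\<in>F. (cmod (fc f k - c k))\<^sup>2)" by (simp add: sum_nonneg)
    moreover have "2 * pi * (\<Sum>k\<in>F. (cmod (fc f k))\<^sup>2) \<le> 2 * pi * B" using B[OF F] by simp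
    ultimately show ?thesis by linarith
  qed
  then show ?thesis by (rule field_le_epsilon)
qed

section \<open>Translation and differentiation of periodic functions\<close>

lemma periodic_shift: "periodic f \<Longrightarrow> periodic (\<lambda>\<theta>. f (\<theta> + \<beta>))"
proof -
  assume "periodic f"
  moreover have "\<theta> + 2 * pi + \<beta> = (\<theta> + \<beta>) + 2 * pi" for \<theta> by simp
  ultimately show ?thesis unfolding periodic_def by (simp only:) simp
qed

text \<open>Modulo whole periods the shift is some \<open>r\<close> between 0 and 2 pi; the initial
  piece of length \<open>r\<close> is then moved to the other end by one period.\<close>

lemma periodic_has_integral_shift:
  fixes f :: "real \<Rightarrow> 'b::euclidean_space"
  assumes per: "periodic f" and I: "(f has_integral I) {-pi..pi}"
  shows "((\<lambda>x. f (x + \<beta>)) has_integral I) {-pi..pi}"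
proof -
  define n where "n = \<lfloor>\<beta> / (2 * pi)\<rfloor>"
  define r where "r = \<beta> - 2 * pi * of_int n"
  have "of_int n \<le> \<beta> / (2 * pi)" "\<beta> / (2 * pi) < of_int n + 1" unfolding n_def by linarith+
  then have r: "0 \<le> r" "r \<le> 2 * pi" unfolding r_def by (simp_all add: field_simps)
  have fr: "f (x + \<beta>) = f (x + r)" for x
    using periodic_int[OF per, of "x + r" n] by (simp add: r_def algebra_simps)
  have int: "f integrable_on {-pi..pi}" using I by blast
  let ?I1 = "integral {-pi..-pi+r} f" and ?I2 = "integral {-pi+r..pi} f"
  have 1: "(f has_integral ?I1) {-pi..-pi+r}" and 2: "(f has_integral ?I2) {-pi+r..pi}"
    using integrable_on_subinterval[OF int, of "-pi" "-pi+r"] integrable_on_subinterval[OF int, of "-pi+r" pi] r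
    by (auto intro!: integrable_integral)
  have "(f has_integral (?I1 + ?I2)) {-pi..pi}"
    by (rule has_integral_combine[OF _ _ 1 2]) (use r in auto)
  then have I_eq: "I = ?I2 + ?I1" using I has_integral_unique by (metis add.commute)
  have "((\<lambda>x. f (x - 2 * pi)) has_integral ?I1) {pi..pi+r}"
    using has_integral_shift_real_ivl[OF 1, of "- 2 * pi"] by simp
  moreover have "f (x - 2 * pi) = f x" for x using periodic_int[OF per, of x "-1"] by simp
  ultimately have "(f has_integral ?I1) {pi..pi+r}" by simp
  from has_integral_combine[OF _ _ 2 this] have "(f has_integral I) {-pi+r..pi+r}" using r I_eq by simp
  from has_integral_shift_real_ivl[OF this, of r] show ?thesis by (simp add: fr)
qed

lemma periodic_integral_shift:
  fixes f :: "real \<Rightarrow> 'b::euclidean_space"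
  assumes "periodic f" "f integrable_on {-pi..pi}"
  shows "integral {-pi..pi} (\<lambda>x. f (x + \<beta>)) = integral {-pi..pi} f"
  using periodic_has_integral_shift[OF assms(1) integrable_integral[OF assms(2)]] by (rule integral_unique)

lemma set_integrable_lebesgue_on_iff:
  fixes f :: "real \<Rightarrow> 'b::euclidean_space"
  shows "integrable (lebesgue_on {a..b}) f \<longleftrightarrow> f absolutely_integrable_on {a..b}"
  by (simp add: integrable_restrict_space set_integrable_def)

lemma periodic_integrable_shift:
  fixes f :: "real \<Rightarrow> 'b::euclidean_space"
  assumes per: "periodic f" and I: "integrable (lebesgue_on {-pi..pi}) f"
  shows "integrable (lebesgue_on {-pi..pi}) (\<lambda>x. f (x + \<beta>))"
    "(LINT x|lebesgue_on {-pi..pi}. f (x + \<beta>)) = (LINT x|lebesgue_on {-pi..pi}. f x)"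
proof -
  have f: "f absolutely_integrable_on {-pi..pi}" using I by (simp add: set_integrable_lebesgue_on_iff)
  have fi: "f integrable_on {-pi..pi}" and ni: "(\<lambda>x. norm (f x)) integrable_on {-pi..pi}"
    using f by (auto simp: absolutely_integrable_on_def)
  have pern: "periodic (\<lambda>x. norm (f x))" using per by (simp add: periodic_def)
  show *: "integrable (lebesgue_on {-pi..pi}) (\<lambda>x. f (x + \<beta>))"
    unfolding set_integrable_lebesgue_on_iff absolutely_integrable_on_def
    using periodic_has_integral_shift[OF per integrable_integral[OF fi]]
      periodic_has_integral_shift[OF pern integrable_integral[OF ni]] by blast
  show "(LINT x|lebesgue_on {-pi..pi}. f (x + \<beta>)) = (LINT x|lebesgue_on {-pi..pi}. f x)"
    using lebesgue_integral_eq_integral[OF *] lebesgue_integral_eq_integral[OF I] periodic_integral_shift[OF per fi]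
    by simp
qed

lemma integrable_mult_cis:
  assumes "integrable (lebesgue_on {-pi..pi}) f"
  shows "integrable (lebesgue_on {-pi..pi}) (\<lambda>\<theta>. complex_of_real (f \<theta>) * cis (c * \<theta>))"
proof (rule Bochner_Integration.integrable_bound[OF assms])
  have "continuous_on {-pi..pi} (\<lambda>\<theta>. cis (c * \<theta>))" by (intro continuous_intros)
  then have "(\<lambda>\<theta>. cis (c * \<theta>)) \<in> borel_measurable (lebesgue_on {-pi..pi})"
    by (intro continuous_imp_measurable_on_sets_lebesgue) auto
  then show "(\<lambda>\<theta>. complex_of_real (f \<theta>) * cis (c * \<theta>)) \<in> borel_measurable (lebesgue_on {-pi..pi})"
    using assms by measurable
qed (auto simp: norm_mult)

lemma fc_shift:
  assumes per: "periodic f" and I: "integrable (lebesgue_on {-pi..pi}) f"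
  shows "fc (\<lambda>x. f (x + \<beta>)) k = cis (of_int k * \<beta>) * fc f k"
proof -
  let ?h = "\<lambda>\<theta>. complex_of_real (f \<theta>) * cis (- of_int k * \<theta>)"
  have "cis (- of_int k * (\<theta> + 2 * pi)) = cis (- of_int k * \<theta>)" for \<theta>
  proof -
    have "cis (- of_int k * (\<theta> + 2 * pi)) = cis (- of_int k * \<theta>) * cis (2 * pi * of_int (-k))"
      by (simp add: cis_mult algebra_simps)
    moreover have "cis (2 * pi * of_int (-k)) = 1" by (rule cis_multiple_2pi) auto
    ultimately show ?thesis by simp
  qed
  then have perh: "periodic ?h" using per by (simp add: periodic_def)
  have "(LINT x|lebesgue_on {-pi..pi}. ?h x) = (LINT x|lebesgue_on {-pi..pi}. ?h (x + \<beta>))"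
    using periodic_integrable_shift(2)[OF perh integrable_mult_cis[OF I], of \<beta>] by simp
  also have "\<dots> = (LINT x|lebesgue_on {-pi..pi}. cis (- of_int k * \<beta>) * (complex_of_real (f (x + \<beta>)) * cis (- of_int k * x)))"
  proof (intro Bochner_Integration.integral_cong refl)
    fix x
    have "cis (- of_int k * (x + \<beta>)) = cis (- of_int k * \<beta>) * cis (- of_int k * x)"
      unfolding cis_mult by (simp add: algebra_simps)
    then show "?h (x + \<beta>) = cis (- of_int k * \<beta>) * (complex_of_real (f (x + \<beta>)) * cis (- of_int k * x))"
      by (simp only: mult_ac)
  qed
  also have "\<dots> = cis (- of_int k * \<beta>) * (LINT x|lebesgue_on {-pi..pi}. complex_of_real (f (x + \<beta>)) * cis (- of_int k * x))"
    by (rule integral_mult_right_zero)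
  finally have "fc f k = cis (- of_int k * \<beta>) * fc (\<lambda>x. f (x + \<beta>)) k"
    by (simp add: fc_alt)
  then have "cis (of_int k * \<beta>) * fc f k = (cis (of_int k * \<beta>) * cis (- of_int k * \<beta>)) * fc (\<lambda>x. f (x + \<beta>)) k" by simp
  then show ?thesis by (simp only: cis_mult) simp
qed

lemma fc_diff:
  assumes "integrable (lebesgue_on {-pi..pi}) f" "integrable (lebesgue_on {-pi..pi}) g"
  shows "fc (\<lambda>x. f x - g x) k = fc f k - fc g k"
  using Bochner_Integration.integral_diff[OF integrable_mult_cis[OF assms(1)] integrable_mult_cis[OF assms(2)], of "- of_int k" "- of_int k"]
  by (simp add: fc_alt left_diff_distrib diff_divide_distrib)

lemma fc_add:
  assumes "integrable (lebesgue_on {-pi..pi}) f" "integrable (lebesgue_on {-pi..pi}) g"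
  shows "fc (\<lambda>x. f x + g x) k = fc f k + fc g k"
  using Bochner_Integration.integral_add[OF integrable_mult_cis[OF assms(1)] integrable_mult_cis[OF assms(2)], of "- of_int k" "- of_int k"]
  by (simp add: fc_alt ring_distribs add_divide_distrib)

lemma fc_cmult: "fc (\<lambda>x. c * f x) k = of_real c * fc f k"
  by (simp add: fc_alt mult.assoc)

lemma fc_delta:
  assumes per: "periodic f" and I: "integrable (lebesgue_on {-pi..pi}) f"
  shows "fc (\<lambda>x. f (x + \<beta>) - f x) k = (cis (of_int k * \<beta>) - 1) * fc f k"
  using fc_diff[OF periodic_integrable_shift(1)[OF assms] I] fc_shift[OF assms]
  by (simp add: left_diff_distrib)

lemma fc_integral:
  assumes "continuous_on {-pi..pi} f"
  shows "fc f k = integral {-pi..pi} (\<lambda>\<theta>. complex_of_real (f \<theta>) * cis (- of_int k * \<theta>)) / (2 * pi)"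
  unfolding fc_alt using assms by (subst lebesgue_on_eq_integral(2)) (auto intro!: continuous_intros)

text \<open>Integration by parts against the character; the boundary terms cancel because both
  factors take equal values at the two ends of the period.\<close>

lemma fc_deriv:
  assumes per: "periodic f" and d: "\<And>x. (f has_real_derivative f' x) (at x)" and c: "continuous_on UNIV f'"
  shows "fc f' k = \<i> * of_int k * fc f k"
proof -
  let ?e = "\<lambda>\<theta>. cis (- of_int k * \<theta>)"
  have cf: "continuous_on S f" for S using DERIV_isCont[OF d] by (simp add: continuous_at_imp_continuous_on)
  have cf': "continuous_on S f'" for S using c by (rule continuous_on_subset) auto
  have de: "(?e has_vector_derivative (- \<i> * of_int k) * ?e x) (at x)" for x
  proof -
    have "((\<lambda>z. exp (- \<i> * of_int k * z)) has_field_derivative (- \<i> * of_int k) * exp (- \<i> * of_int k * of_real x)) (at (of_real x))"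
      by (auto intro!: derivative_eq_intros)
    from has_vector_derivative_real_field[OF this]
    show ?thesis by (simp add: cis_conv_exp mult_ac)
  qed
  have df: "((\<lambda>x. complex_of_real (f x)) has_vector_derivative complex_of_real (f' x)) (at x)" for x
    using d[of x] by (auto simp: has_real_derivative_iff_has_vector_derivative intro: has_vector_derivative_of_real)
  have "((\<lambda>\<theta>. complex_of_real (f \<theta>) * ((- \<i> * of_int k) * ?e \<theta>) + complex_of_real (f' \<theta>) * ?e \<theta>) has_integral 
     (complex_of_real (f pi) * ?e pi - complex_of_real (f (-pi)) * ?e (-pi))) {-pi..pi}"
    by (rule fundamental_theorem_of_calculus) (simp, rule has_vector_derivative_at_within[OF has_vector_derivative_mult[OF df de]])
  moreover have "f pi = f (-pi)" using periodic_int[OF per, of "-pi" 1] by simp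
  moreover have "?e pi = ?e (-pi)" by (auto simp: complex_eq_iff sin_zero_iff_int2)
  ultimately have "0 = integral {-pi..pi} (\<lambda>\<theta>. complex_of_real (f \<theta>) * ((- \<i> * of_int k) * ?e \<theta>) + complex_of_real (f' \<theta>) * ?e \<theta>)"
    by (simp add: integral_unique)
  also have "\<dots> = (- \<i> * of_int k) * integral {-pi..pi} (\<lambda>\<theta>. complex_of_real (f \<theta>) * ?e \<theta>) + integral {-pi..pi} (\<lambda>\<theta>. complex_of_real (f' \<theta>) * ?e \<theta>)"
  proof -
    have i: "(\<lambda>\<theta>. complex_of_real (f \<theta>) * ?e \<theta>) integrable_on {-pi..pi}" "(\<lambda>\<theta>. complex_of_real (f' \<theta>) * ?e \<theta>) integrable_on {-pi..pi}"
      using cf cf' by (auto intro!: integrable_continuous_interval continuous_intros)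
    have eq: "complex_of_real (f \<theta>) * ((- \<i> * of_int k) * ?e \<theta>) = (- \<i> * of_int k) * (complex_of_real (f \<theta>) * ?e \<theta>)" for \<theta>
      by (simp only: mult_ac)
    show ?thesis
      unfolding eq using integral_add[OF integrable_on_mult_right[OF i(1), of "- \<i> * of_int k"] i(2)]
      by (simp only: integral_mult_right)
  qed
  finally have "integral {-pi..pi} (\<lambda>\<theta>. complex_of_real (f' \<theta>) * ?e \<theta>) = \<i> * of_int k * integral {-pi..pi} (\<lambda>\<theta>. complex_of_real (f \<theta>) * ?e \<theta>)"
    by (simp add: algebra_simps)
  then show ?thesis by (simp only: fc_integral[OF cf] fc_integral[OF cf'] times_divide_eq_right)
qed

subsection \<open>Fourier multipliers\<close>

lemma norm_cis_minus_one: "(cmod (cis x - 1))\<^sup>2 = 2 - 2 * cos x"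
proof -
  have "(cmod (cis x - 1))\<^sup>2 = (cos x)\<^sup>2 + (sin x)\<^sup>2 + 1 - 2 * cos x"
    unfolding cmod_power2 by (simp add: power2_eq_square algebra_simps)
  then show ?thesis by simp
qed

lemma two_minus_two_cos_le: "2 - 2 * cos x \<le> x\<^sup>2" "2 - 2 * cos x \<le> 4" "0 \<le> 2 - 2 * cos (x::real)"
proof -
  have "1 - cos x = 2 * (sin (x/2))\<^sup>2" using cos_double_sin[of "x/2"] by simp
  moreover have "(sin (x/2))\<^sup>2 \<le> (x/2)\<^sup>2" using abs_sin_x_le_abs_x[of "x/2"] by (rule abs_le_square_iff[THEN iffD1])
  ultimately show "2 - 2 * cos x \<le> x\<^sup>2" by (simp add: power_divide)
  show "2 - 2 * cos x \<le> 4" "0 \<le> 2 - 2 * cos (x::real)" using cos_ge_minus_one[of x] cos_le_one[of x] by linarith+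
qed

text \<open>Splitting at 1/|k|: below it the integrand is at most k^2, above it at most
  4/\<alpha>^2, which contribute |k| and 4|k|. The result is the symbol of an operator of first
  order.\<close>

lemma nn_integral_multiplier:
  "(\<integral>\<^sup>+\<alpha>. ennreal ((2 - 2 * cos (of_int k * \<alpha>)) / \<alpha>\<^sup>2) * indicator {0<..} \<alpha> \<partial>lborel) \<le> ennreal (5 * \<bar>of_int k\<bar>)"
proof (cases "k = 0")
  case False
  define a where "a = \<bar>real_of_int k\<bar>"
  have a: "0 < a" using False by (simp add: a_def)
  have "(\<integral>\<^sup>+\<alpha>. ennreal ((2 - 2 * cos (of_int k * \<alpha>)) / \<alpha>\<^sup>2) * indicator {0<..} \<alpha> \<partial>lborel)
    \<le> (\<integral>\<^sup>+\<alpha>. ennreal (a\<^sup>2) * indicator {0..1/a} \<alpha> + ennreal (4 * (1 / \<alpha>\<^sup>2)) * indicator {1/a..} \<alpha> \<partial>lborel)"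
  proof (rule nn_integral_mono)
    fix \<alpha> :: real
    have "(2 - 2 * cos (of_int k * \<alpha>)) / \<alpha>\<^sup>2 \<le> a\<^sup>2" if "0 < \<alpha>"
      using two_minus_two_cos_le(1)[of "of_int k * \<alpha>"] that by (simp add: a_def field_simps power_mult_distrib)
    moreover have "(2 - 2 * cos (of_int k * \<alpha>)) / \<alpha>\<^sup>2 \<le> 4 * (1 / \<alpha>\<^sup>2)" if "0 < \<alpha>"
      using divide_right_mono[OF two_minus_two_cos_le(2)[of "of_int k * \<alpha>"], of "\<alpha>\<^sup>2"] by simp
    ultimately show "ennreal ((2 - 2 * cos (of_int k * \<alpha>)) / \<alpha>\<^sup>2) * indicator {0<..} \<alpha>
      \<le> ennreal (a\<^sup>2) * indicator {0..1/a} \<alpha> + ennreal (4 * (1 / \<alpha>\<^sup>2)) * indicator {1/a..} \<alpha>"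
      by (cases "\<alpha> \<le> 1/a"; cases "0 < \<alpha>") (auto simp: indicator_def intro!: ennreal_leI add_increasing2)
  qed
  also have "\<dots> = ennreal (a\<^sup>2) * ennreal (1/a) + (\<integral>\<^sup>+\<alpha>. ennreal (4 * (1 / \<alpha>\<^sup>2)) * indicator {1/a..} \<alpha> \<partial>lborel)"
    using a by (subst nn_integral_add) (auto simp: nn_integral_cmult_indicator)
  also have "(\<integral>\<^sup>+\<alpha>. ennreal (4 * (1 / \<alpha>\<^sup>2)) * indicator {1/a..} \<alpha> \<partial>lborel) = ennreal (0 - (- 4 / (1/a)))"
  proof (rule nn_integral_FTC_atLeast[where F="\<lambda>x. - 4 / x" and T=0])
    fix x assume "1/a \<le> x" then have "x > 0" using a by (simp add: order_less_le_trans[of 0 "1/a"])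
    then show "((\<lambda>x. - 4 / x) has_real_derivative 4 * (1 / x\<^sup>2)) (at x)"
      by (auto intro!: derivative_eq_intros simp: power2_eq_square)
  next
    show "((\<lambda>x. - 4 / x) \<longlongrightarrow> 0) (at_top::real filter)"
      by (intro tendsto_divide_0[OF tendsto_const] filterlim_at_top_imp_at_infinity filterlim_ident)
  qed auto
  also have "ennreal (a\<^sup>2) * ennreal (1/a) + ennreal (0 - (- 4 / (1/a))) = ennreal (5 * a)"
    using a by (simp add: ennreal_mult[symmetric] ennreal_plus[symmetric] power2_eq_square del: ennreal_plus)
  finally show ?thesis by (simp add: a_def)
qed simp

lemma integral_multiplier:
  assumes "0 < \<eta>" "\<eta> \<le> pi"
  shows "0 \<le> integral {\<eta>..pi} (\<lambda>\<alpha>. (2 - 2 * cos (of_int k * \<alpha>)) / \<alpha>\<^sup>2)"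
    "integral {\<eta>..pi} (\<lambda>\<alpha>. (2 - 2 * cos (of_int k * \<alpha>)) / \<alpha>\<^sup>2) \<le> 5 * \<bar>of_int k\<bar>"
proof -
  let ?m = "\<lambda>\<alpha>. (2 - 2 * cos (of_int k * \<alpha>)) / \<alpha>\<^sup>2"
  have c: "?m integrable_on {\<eta>..pi}"
    using assms by (intro integrable_continuous_interval continuous_intros) auto
  have nn: "0 \<le> ?m \<alpha>" for \<alpha> :: real using two_minus_two_cos_le(3)[of "of_int k * \<alpha>"] by simp
  show "0 \<le> integral {\<eta>..pi} ?m" by (intro integral_nonneg c nn)
  have "ennreal (integral {\<eta>..pi} ?m) = (\<integral>\<^sup>+\<alpha>. ennreal (?m \<alpha>) * indicator {\<eta>..pi} \<alpha> \<partial>lborel)"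
    using nn_integral_has_integral_lebesgue'[OF nn integrable_integral[OF c]] by simp
  also have "\<dots> \<le> (\<integral>\<^sup>+\<alpha>. ennreal (?m \<alpha>) * indicator {0<..} \<alpha> \<partial>lborel)"
    using assms by (intro nn_integral_mono) (auto simp: indicator_def)
  also note nn_integral_multiplier
  finally show "integral {\<eta>..pi} ?m \<le> 5 * \<bar>of_int k\<bar>" by (subst (asm) ennreal_le_iff) auto
qed

lemma powr_quarter_sq: "0 \<le> a \<Longrightarrow> (a powr (1/4))\<^sup>2 = sqrt a"
  by (cases "a = 0") (simp_all add: powr_half_sqrt[symmetric] power2_eq_square powr_add[symmetric])

text \<open>By Parseval the squared increment of \<open>h\<close> is bounded by a series with
  weights 2 - 2 cos(k \<alpha>). Integrated against \<alpha>^-2 these weights become at most 5|k|,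
  and |k| times the squared coefficient of \<open>h\<close> is the squared coefficient of
  \<open>g\<close>, so Bessel's inequality for \<open>g\<close> concludes.\<close>

lemma half_derivative_energy:
  fixes h g :: "real \<Rightarrow> real"
  assumes per: "periodic h" and h: "continuous_on UNIV h"
    and g: "integrable (lebesgue_on {-pi..pi}) g" "integrable (lebesgue_on {-pi..pi}) (\<lambda>\<theta>. (g \<theta>)\<^sup>2)"
    and gh: "\<And>k. fc g k = of_real (of_int (k\<^sup>2) powr (1/4)) * fc h k"
  shows "(\<integral>\<^sup>+\<alpha>. ennreal (integral {-pi..pi} (\<lambda>\<theta>. (h (\<theta> + \<alpha>) - h \<theta>)\<^sup>2) / \<alpha>\<^sup>2) * indicator {0<..} \<alpha> \<partial>lborel)
    \<le> ennreal (5 * (LINT \<theta>|lebesgue_on {-pi..pi}. (g \<theta>)\<^sup>2))"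
proof -
  have ch: "continuous_on S h" for S using h by (rule continuous_on_subset) auto
  note hi = lebesgue_on_eq_integral(1)[OF ch]
  \<comment> \<open>The integers are enumerated by \<open>int_decode\<close> so that the sum over
    frequencies becomes a series, for which sum and integral can be exchanged.\<close>
  let ?w = "\<lambda>n \<alpha>. (2 - 2 * cos (of_int (int_decode n) * \<alpha>)) * (cmod (fc h (int_decode n)))\<^sup>2"
  have wnn: "0 \<le> ?w n \<alpha>" for n \<alpha> by (intro mult_nonneg_nonneg two_minus_two_cos_le) auto
  have fin_sum: "ennreal (\<Sum>k\<in>F. u k) \<le> (\<Sum>n. ennreal (u (int_decode n)))" if "finite F" "\<And>k. 0 \<le> u k" for F and u :: "int \<Rightarrow> real"
  proof -
    have "(\<Sum>k\<in>F. u k) = (\<Sum>n\<in>int_encode ` F. u (int_decode n))"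
      by (subst sum.reindex) (auto intro: inj_on_subset[OF inj_int_encode])
    then have "ennreal (\<Sum>k\<in>F. u k) = (\<Sum>n\<in>int_encode ` F. ennreal (u (int_decode n)))"
      using that(2) by (simp add: sum_ennreal)
    also have "\<dots> \<le> (\<Sum>n. ennreal (u (int_decode n)))"
      using that(1) by (intro sum_le_suminf) auto
    finally show ?thesis .
  qed
  \<comment> \<open>If the series diverges there is nothing to show; otherwise its value is the
    bound required by \<open>parseval_le\<close>.\<close>
  have pw: "ennreal (integral {-pi..pi} (\<lambda>\<theta>. (h (\<theta> + \<alpha>) - h \<theta>)\<^sup>2)) \<le> ennreal (2 * pi) * (\<Sum>n. ennreal (?w n \<alpha>))" for \<alpha>
  proof (cases "(\<Sum>n. ennreal (?w n \<alpha>)) = top")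
    case True
    then show ?thesis by (simp add: ennreal_mult_top)
  next
    case False
    define B where "B = enn2real (\<Sum>n. ennreal (?w n \<alpha>))"
    have B: "ennreal B = (\<Sum>n. ennreal (?w n \<alpha>))" "0 \<le> B" using False by (auto simp: B_def less_top)
    have "integral {-pi..pi} (\<lambda>\<theta>. (h (\<theta> + \<alpha>) - h \<theta>)\<^sup>2) \<le> 2 * pi * B"
    proof (rule parseval_le)
      show "periodic (\<lambda>\<theta>. h (\<theta> + \<alpha>) - h \<theta>)"
        using per periodic_shift[OF per, of \<alpha>] by (simp add: periodic_def)
      show "continuous_on UNIV (\<lambda>\<theta>. h (\<theta> + \<alpha>) - h \<theta>)"
        by (intro continuous_intros continuous_on_compose2[OF h]) auto
      fix F :: "int set" assume F: "finite F"
      have "ennreal (\<Sum>k\<in>F. (cmod (fc (\<lambda>\<theta>. h (\<theta> + \<alpha>) - h \<theta>) k))\<^sup>2)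
         = ennreal (\<Sum>k\<in>F. (2 - 2 * cos (of_int k * \<alpha>)) * (cmod (fc h k))\<^sup>2)"
        by (simp add: fc_delta[OF per hi] norm_mult power_mult_distrib norm_cis_minus_one)
      also have "\<dots> \<le> ennreal B"
        unfolding B by (rule fin_sum[OF F]) (intro mult_nonneg_nonneg two_minus_two_cos_le, auto)
      finally show "(\<Sum>k\<in>F. (cmod (fc (\<lambda>\<theta>. h (\<theta> + \<alpha>) - h \<theta>) k))\<^sup>2) \<le> B"
        using B(2) by simp
    qed
    then have "ennreal (integral {-pi..pi} (\<lambda>\<theta>. (h (\<theta> + \<alpha>) - h \<theta>)\<^sup>2)) \<le> ennreal (2 * pi * B)" by (rule ennreal_leI)
    then show ?thesis using B by (simp add: ennreal_mult)
  qed
  have "(\<integral>\<^sup>+\<alpha>. ennreal (integral {-pi..pi} (\<lambda>\<theta>. (h (\<theta> + \<alpha>) - h \<theta>)\<^sup>2) / \<alpha>\<^sup>2) * indicator {0<..} \<alpha> \<partial>lborel)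
    \<le> (\<integral>\<^sup>+\<alpha>. (\<Sum>n. ennreal (2 * pi) * (ennreal ((cmod (fc h (int_decode n)))\<^sup>2) * (ennreal ((2 - 2 * cos (of_int (int_decode n) * \<alpha>)) / \<alpha>\<^sup>2) * indicator {0<..} \<alpha>))) \<partial>lborel)"
  proof (rule nn_integral_mono)
    fix \<alpha> :: real
    have "ennreal (integral {-pi..pi} (\<lambda>\<theta>. (h (\<theta> + \<alpha>) - h \<theta>)\<^sup>2) / \<alpha>\<^sup>2)
       \<le> (ennreal (2 * pi) * (\<Sum>n. ennreal (?w n \<alpha>))) * ennreal (1 / \<alpha>\<^sup>2)"
    proof -
      have "ennreal (integral {-pi..pi} (\<lambda>\<theta>. (h (\<theta> + \<alpha>) - h \<theta>)\<^sup>2) / \<alpha>\<^sup>2)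
        = ennreal (integral {-pi..pi} (\<lambda>\<theta>. (h (\<theta> + \<alpha>) - h \<theta>)\<^sup>2)) * ennreal (1 / \<alpha>\<^sup>2)"
        by (subst ennreal_mult''[symmetric]) auto
      then show ?thesis by (simp only:) (rule mult_right_mono[OF pw], simp)
    qed
    also have "\<dots> = (\<Sum>n. ennreal (2 * pi) * (ennreal (?w n \<alpha>) * ennreal (1 / \<alpha>\<^sup>2)))"
      by (simp only: mult.assoc ennreal_suminf_multc ennreal_suminf_cmult)
    also have "\<dots> = (\<Sum>n. ennreal (2 * pi) * (ennreal ((cmod (fc h (int_decode n)))\<^sup>2) * ennreal ((2 - 2 * cos (of_int (int_decode n) * \<alpha>)) / \<alpha>\<^sup>2)))"
    proof (rule suminf_cong)
      fix n
      let ?m = "2 - 2 * cos (of_int (int_decode n) * \<alpha>)"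
      have "ennreal (?w n \<alpha>) = ennreal ?m * ennreal ((cmod (fc h (int_decode n)))\<^sup>2)"
        by (rule ennreal_mult) (auto intro: two_minus_two_cos_le)
      moreover have "ennreal (?m / \<alpha>\<^sup>2) = ennreal ?m * ennreal (1 / \<alpha>\<^sup>2)"
        using ennreal_mult[OF two_minus_two_cos_le(3), of "1 / \<alpha>\<^sup>2" "of_int (int_decode n) * \<alpha>"] by simp
      ultimately show "ennreal (2 * pi) * (ennreal (?w n \<alpha>) * ennreal (1 / \<alpha>\<^sup>2)) = ennreal (2 * pi) * (ennreal ((cmod (fc h (int_decode n)))\<^sup>2) * ennreal (?m / \<alpha>\<^sup>2))"
        by (simp only: mult_ac)
    qed
    finally show "ennreal (integral {-pi..pi} (\<lambda>\<theta>. (h (\<theta> + \<alpha>) - h \<theta>)\<^sup>2) / \<alpha>\<^sup>2) * indicator {0<..} \<alpha>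
      \<le> (\<Sum>n. ennreal (2 * pi) * (ennreal ((cmod (fc h (int_decode n)))\<^sup>2) * (ennreal ((2 - 2 * cos (of_int (int_decode n) * \<alpha>)) / \<alpha>\<^sup>2) * indicator {0<..} \<alpha>)))"
      by (simp add: indicator_def)
  qed
  also have "\<dots> = (\<Sum>n. ennreal (2 * pi) * (ennreal ((cmod (fc h (int_decode n)))\<^sup>2) * 
      (\<integral>\<^sup>+\<alpha>. ennreal ((2 - 2 * cos (of_int (int_decode n) * \<alpha>)) / \<alpha>\<^sup>2) * indicator {0<..} \<alpha> \<partial>lborel)))"
    by (subst nn_integral_suminf) (auto simp: nn_integral_cmult)
  also have "\<dots> \<le> (\<Sum>n. ennreal (2 * pi) * (ennreal ((cmod (fc h (int_decode n)))\<^sup>2) * ennreal (5 * \<bar>of_int (int_decode n)\<bar>)))"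
    by (intro suminf_le mult_left_mono nn_integral_multiplier) auto
  also have "\<dots> = (\<Sum>n. ennreal (5 * (2 * pi) * (cmod (fc g (int_decode n)))\<^sup>2))"
  proof (intro suminf_cong)
    fix n
    let ?k = "int_decode n"
    have "(real_of_int (?k\<^sup>2) powr (1/4))\<^sup>2 = \<bar>of_int ?k\<bar>"
      using powr_quarter_sq[of "real_of_int (?k\<^sup>2)"] by simp
    then have "(cmod (fc g ?k))\<^sup>2 = \<bar>of_int ?k\<bar> * (cmod (fc h ?k))\<^sup>2"
      unfolding gh by (simp add: norm_mult power_mult_distrib)
    then show "ennreal (2 * pi) * (ennreal ((cmod (fc h ?k))\<^sup>2) * ennreal (5 * \<bar>of_int ?k\<bar>)) = ennreal (5 * (2 * pi) * (cmod (fc g ?k))\<^sup>2)"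
      by (simp add: ennreal_mult[symmetric] mult_ac)
  qed
  also have "\<dots> \<le> ennreal (5 * (LINT \<theta>|lebesgue_on {-pi..pi}. (g \<theta>)\<^sup>2))"
  proof (rule suminf_le_const)
    fix N
    have "(\<Sum>n<N. ennreal (5 * (2 * pi) * (cmod (fc g (int_decode n)))\<^sup>2)) = ennreal (5 * (2 * pi * (\<Sum>n<N. (cmod (fc g (int_decode n)))\<^sup>2)))"
      by (simp add: sum_ennreal sum_distrib_left mult.assoc)
    also have "(\<Sum>n<N. (cmod (fc g (int_decode n)))\<^sup>2) = (\<Sum>k\<in>int_decode ` {..<N}. (cmod (fc g k))\<^sup>2)"
      by (subst sum.reindex) (auto intro: inj_on_subset[OF inj_int_decode])
    also have "ennreal (5 * (2 * pi * (\<Sum>k\<in>int_decode ` {..<N}. (cmod (fc g k))\<^sup>2))) \<le> ennreal (5 * (LINT \<theta>|lebesgue_on {-pi..pi}. (g \<theta>)\<^sup>2))"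
      using bessel[OF _ g, of "int_decode ` {..<N}"] by (intro ennreal_leI mult_left_mono) auto
    finally show "(\<Sum>n<N. ennreal (5 * (2 * pi) * (cmod (fc g (int_decode n)))\<^sup>2)) \<le> ennreal (5 * (LINT \<theta>|lebesgue_on {-pi..pi}. (g \<theta>)\<^sup>2))" .
  qed simp
  finally show ?thesis .
qed

lemma fc_second_difference:
  assumes per: "periodic g" and cg: "continuous_on UNIV g"
  shows "fc (\<lambda>\<theta>. (g (\<theta> + \<alpha>) + g (\<theta> - \<alpha>)) - 2 * g \<theta>) k = - of_real (2 - 2 * cos (of_int k * \<alpha>)) * fc g k"
proof -
  have c: "continuous_on {-pi..pi} (\<lambda>\<theta>. g (\<theta> + \<alpha>))" "continuous_on {-pi..pi} (\<lambda>\<theta>. g (\<theta> - \<alpha>))"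
     "continuous_on {-pi..pi} (\<lambda>\<theta>. g (\<theta> + \<alpha>) + g (\<theta> - \<alpha>))" "continuous_on {-pi..pi} (\<lambda>\<theta>. 2 * g \<theta>)" "continuous_on {-pi..pi} g"
    by (auto intro!: continuous_intros continuous_on_compose2[OF cg])
  note gi = lebesgue_on_eq_integral(1)[OF c(5)]
  have "fc (\<lambda>\<theta>. g (\<theta> - \<alpha>)) k = cis (- of_int k * \<alpha>) * fc g k"
    using fc_shift[OF per gi, of "-\<alpha>" k] by simp
  then have "fc (\<lambda>\<theta>. (g (\<theta> + \<alpha>) + g (\<theta> - \<alpha>)) - 2 * g \<theta>) k = cis (of_int k * \<alpha>) * fc g k + cis (- of_int k * \<alpha>) * fc g k - 2 * fc g k"
    using fc_diff[OF lebesgue_on_eq_integral(1)[OF c(3)] lebesgue_on_eq_integral(1)[OF c(4)], of k]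
      fc_add[OF lebesgue_on_eq_integral(1)[OF c(1)] lebesgue_on_eq_integral(1)[OF c(2)], of k]
    by (simp add: fc_cmult fc_shift[OF per gi])
  then show ?thesis by (simp add: complex_eq_iff algebra_simps)
qed

text \<open>For fixed \<eta> this is a Fourier multiplier whose symbol lies between -5|k| and 0,
  uniformly in \<eta>. As |k| is the modulus of the symbol of differentiation, the L^2 norm of the
  derivative bounds it, with the squared constant 25. The truncated principal values inherit their
  uniform bound from here.\<close>

lemma truncated_second_difference_L2:
  fixes g g' :: "real \<Rightarrow> real"
  assumes per: "periodic g" and d: "\<And>x. (g has_real_derivative g' x) (at x)" and c: "continuous_on UNIV g'"
    and \<eta>: "0 < \<eta>" "\<eta> \<le> pi"
  defines "A \<equiv> \<lambda>\<theta>. integral {\<eta>..pi} (\<lambda>\<alpha>. (g (\<theta> + \<alpha>) + g (\<theta> - \<alpha>) - 2 * g \<theta>) / \<alpha>\<^sup>2)"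
  shows "continuous_on UNIV A" "integral {-pi..pi} (\<lambda>\<theta>. (A \<theta>)\<^sup>2) \<le> 25 * integral {-pi..pi} (\<lambda>\<theta>. (g' \<theta>)\<^sup>2)"
proof -
  have cg: "continuous_on UNIV g" using DERIV_isCont[OF d] by (simp add: continuous_at_imp_continuous_on)
  have cgS: "continuous_on S g" for S using cg by (rule continuous_on_subset) auto
  have cg': "continuous_on S g'" for S using c by (rule continuous_on_subset) auto
  note gi = lebesgue_on_eq_integral(1)[OF cgS]
  have cA: "continuous_on (cbox a b) A" for a b
    unfolding A_def interval_cbox
    by (intro integral_continuous_on_param) (use \<eta> in \<open>auto intro!: continuous_intros continuous_on_compose2[OF cg] simp: split_beta\<close>)
  then have cA': "continuous_on {a..b} A" for a b by (metis interval_cbox)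
  show cAU: "continuous_on UNIV A"
  proof (rule continuous_at_imp_continuous_on, rule ballI)
    fix x :: real
    show "isCont A x" using cA'[of "x-1" "x+1"] by (rule continuous_on_interior) simp
  qed
  have perA: "periodic A"
  proof -
    have "g (\<theta> + 2 * pi + \<alpha>) = g (\<theta> + \<alpha>)" for \<theta> \<alpha>
      using periodic_shift[OF per, of \<alpha>] by (simp add: periodic_def)
    from this[of _ "- _"] this[of _ 0] this show ?thesis by (simp add: periodic_def A_def)
  qed
  \<comment> \<open>Exchanging the two integrals lets the Fourier coefficient act on the second
    difference for each \<alpha> separately.\<close>
  have fcA: "fc A k = - of_real (integral {\<eta>..pi} (\<lambda>\<alpha>. (2 - 2 * cos (of_int k * \<alpha>)) / \<alpha>\<^sup>2)) * fc g k" for k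
  proof -
    let ?q = "\<lambda>\<theta> \<alpha>. complex_of_real ((g (\<theta> + \<alpha>) + g (\<theta> - \<alpha>) - 2 * g \<theta>) / \<alpha>\<^sup>2) * cis (- of_int k * \<theta>)"
    have "2 * pi * fc A k = integral {-pi..pi} (\<lambda>\<theta>. complex_of_real (A \<theta>) * cis (- of_int k * \<theta>))"
      unfolding fc_integral[OF cA'] by simp
    also have "\<dots> = integral {-pi..pi} (\<lambda>\<theta>. integral {\<eta>..pi} (?q \<theta>))"
    proof (intro integral_cong)
      fix \<theta> :: real
      have i: "(\<lambda>\<alpha>. (g (\<theta> + \<alpha>) + g (\<theta> - \<alpha>) - 2 * g \<theta>) / \<alpha>\<^sup>2) integrable_on {\<eta>..pi}"
        using \<eta> by (intro integrable_continuous_interval) (auto intro!: continuous_intros continuous_on_compose2[OF cg])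
      then have "((\<lambda>\<alpha>. complex_of_real ((g (\<theta> + \<alpha>) + g (\<theta> - \<alpha>) - 2 * g \<theta>) / \<alpha>\<^sup>2)) has_integral complex_of_real (A \<theta>)) {\<eta>..pi}"
        unfolding A_def by (intro has_integral_of_real integrable_integral)
      from has_integral_mult_left[OF this, of "cis (- of_int k * \<theta>)"]
      show "complex_of_real (A \<theta>) * cis (- of_int k * \<theta>) = integral {\<eta>..pi} (?q \<theta>)"
        by (rule integral_unique[symmetric])
    qed
    also have "\<dots> = integral {\<eta>..pi} (\<lambda>\<alpha>. integral {-pi..pi} (\<lambda>\<theta>. ?q \<theta> \<alpha>))"
      unfolding interval_cbox
      by (rule integral_swap_continuous) (use \<eta> in \<open>auto intro!: continuous_intros continuous_on_compose2[OF cg] simp: split_beta simp flip: interval_cbox\<close>)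
    also have "\<dots> = integral {\<eta>..pi} (\<lambda>\<alpha>. - (2 * pi * fc g k) * complex_of_real ((2 - 2 * cos (of_int k * \<alpha>)) / \<alpha>\<^sup>2))"
    proof (intro integral_cong)
      fix \<alpha> assume "\<alpha> \<in> {\<eta>..pi}"
      have cq: "continuous_on {-pi..pi} (\<lambda>\<theta>. (g (\<theta> + \<alpha>) + g (\<theta> - \<alpha>)) - 2 * g \<theta>)"
        by (auto intro!: continuous_intros continuous_on_compose2[OF cg])
      have "fc (\<lambda>\<theta>. (g (\<theta> + \<alpha>) + g (\<theta> - \<alpha>)) - 2 * g \<theta>) k = - of_real (2 - 2 * cos (of_int k * \<alpha>)) * fc g k"
        by (rule fc_second_difference[OF per cg])
      then have "integral {-pi..pi} (\<lambda>\<theta>. complex_of_real ((g (\<theta> + \<alpha>) + g (\<theta> - \<alpha>)) - 2 * g \<theta>) * cis (- of_int k * \<theta>)) = - (2 * pi * fc g k) * of_real (2 - 2 * cos (of_int k * \<alpha>))"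
        unfolding fc_integral[OF cq] by (simp add: field_simps)
      moreover have "integral {-pi..pi} (\<lambda>\<theta>. ?q \<theta> \<alpha>) = integral {-pi..pi} (\<lambda>\<theta>. complex_of_real ((g (\<theta> + \<alpha>) + g (\<theta> - \<alpha>)) - 2 * g \<theta>) * cis (- of_int k * \<theta>)) / of_real (\<alpha>\<^sup>2)"
        by (subst integral_divide[symmetric]) (simp add: divide_simps)
      ultimately show "integral {-pi..pi} (\<lambda>\<theta>. ?q \<theta> \<alpha>) = - (2 * pi * fc g k) * complex_of_real ((2 - 2 * cos (of_int k * \<alpha>)) / \<alpha>\<^sup>2)"
        by simp
    qed
    also have "\<dots> = - (2 * pi * fc g k) * of_real (integral {\<eta>..pi} (\<lambda>\<alpha>. (2 - 2 * cos (of_int k * \<alpha>)) / \<alpha>\<^sup>2))"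
    proof -
      have "(\<lambda>\<alpha>. (2 - 2 * cos (of_int k * \<alpha>)) / \<alpha>\<^sup>2) integrable_on {\<eta>..pi}"
        using \<eta> by (intro integrable_continuous_interval continuous_intros) auto
      then show ?thesis
        by (intro integral_unique has_integral_mult_right has_integral_of_real integrable_integral)
    qed
    finally have "2 * pi * fc A k = 2 * pi * (- of_real (integral {\<eta>..pi} (\<lambda>\<alpha>. (2 - 2 * cos (of_int k * \<alpha>)) / \<alpha>\<^sup>2)) * fc g k)"
      by (simp only: mult_ac mult_minus_left mult_minus_right)
    then show ?thesis by (subst (asm) mult_cancel_left) simp
  qed
  have "integral {-pi..pi} (\<lambda>\<theta>. (A \<theta>)\<^sup>2) \<le> 2 * pi * (25 * integral {-pi..pi} (\<lambda>\<theta>. (g' \<theta>)\<^sup>2) / (2 * pi))"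
  proof (rule parseval_le[OF perA cAU])
    fix F :: "int set" assume F: "finite F"
    have "(\<Sum>k\<in>F. (cmod (fc A k))\<^sup>2) \<le> (\<Sum>k\<in>F. 25 * (cmod (fc g' k))\<^sup>2)"
    proof (rule sum_mono)
      fix k
      have "cmod (fc A k) \<le> 5 * \<bar>of_int k\<bar> * cmod (fc g k)"
        unfolding fcA using integral_multiplier[OF \<eta>, of k] by (auto simp: norm_mult intro!: mult_right_mono)
      also have "\<dots> = 5 * cmod (fc g' k)" unfolding fc_deriv[OF per d c] by (simp add: norm_mult)
      finally have "(cmod (fc A k))\<^sup>2 \<le> (5 * cmod (fc g' k))\<^sup>2" by (rule power_mono) simp
      then show "(cmod (fc A k))\<^sup>2 \<le> 25 * (cmod (fc g' k))\<^sup>2" by (simp add: power_mult_distrib)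
    qed
    also have "\<dots> = 25 * (\<Sum>k\<in>F. (cmod (fc g' k))\<^sup>2)" by (simp add: sum_distrib_left)
    also have "\<dots> \<le> 25 * (integral {-pi..pi} (\<lambda>\<theta>. (g' \<theta>)\<^sup>2) / (2 * pi))"
    proof -
      have 1: "continuous_on {-pi..pi} (\<lambda>\<theta>. (g' \<theta>)\<^sup>2)" using cg' by (intro continuous_intros)
      have "2 * pi * (\<Sum>k\<in>F. (cmod (fc g' k))\<^sup>2) \<le> integral {-pi..pi} (\<lambda>\<theta>. (g' \<theta>)\<^sup>2)"
        using bessel[OF F lebesgue_on_eq_integral(1)[OF cg'] lebesgue_on_eq_integral(1)[OF 1]]
        unfolding lebesgue_on_eq_integral(2)[OF 1] .
      then show ?thesis by (simp add: field_simps)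
    qed
    finally show "(\<Sum>k\<in>F. (cmod (fc A k))\<^sup>2) \<le> 25 * integral {-pi..pi} (\<lambda>\<theta>. (g' \<theta>)\<^sup>2) / (2 * pi)" by simp
  qed
  then show "integral {-pi..pi} (\<lambda>\<theta>. (A \<theta>)\<^sup>2) \<le> 25 * integral {-pi..pi} (\<lambda>\<theta>. (g' \<theta>)\<^sup>2)" by simp
qed

lemma periodic_bounded:
  fixes f :: "real \<Rightarrow> 'a::real_normed_vector"
  assumes per: "periodic f" and c: "continuous_on UNIV f"
  obtains B where "\<And>x. norm (f x) \<le> B"
proof -
  have "compact (f ` {0..2*pi})"
    by (intro compact_continuous_image continuous_on_subset[OF c]) auto
  then obtain B where B: "\<And>x. x \<in> {0..2*pi} \<Longrightarrow> norm (f x) \<le> B"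
    using compact_imp_bounded bounded_iff by (metis imageI)
  show thesis
  proof (rule that)
    fix x
    define n where "n = \<lfloor>x / (2 * pi)\<rfloor>"
    have "of_int n \<le> x / (2 * pi)" "x / (2 * pi) < of_int n + 1" unfolding n_def by linarith+
    then have "x - 2 * pi * of_int n \<in> {0..2*pi}" by (simp add: field_simps)
    from B[OF this] show "norm (f x) \<le> B"
      using periodic_int[OF per, of "x - 2 * pi * of_int n" n] by simp
  qed
qed

section \<open>The half Laplacian as an integral of second differences\<close>

lemma fc_borel:
  assumes [measurable]: "f \<in> borel_measurable borel"
  shows "fc f k = (LINT \<theta>|lborel. indicator {-pi..pi} \<theta> *\<^sub>R (complex_of_real (f \<theta>) * cis (- of_int k * \<theta>))) / (2 * pi)"
proof -
  have [measurable]: "(\<lambda>\<theta>. cis (- of_int k * \<theta>)) \<in> borel_measurable borel"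
    by (intro borel_measurable_continuous_onI continuous_intros)
  have "(\<lambda>\<theta>. indicator {-pi..pi} \<theta> *\<^sub>R (complex_of_real (f \<theta>) * cis (- of_int k * \<theta>))) \<in> borel_measurable lborel"
    by measurable
  then show ?thesis unfolding fc_def set_lebesgue_integral_def by (simp only: integral_completion)
qed

text \<open>
  The half Laplacian of a smooth function is, up to \<open>frac_const\<close>, the absolutely convergent integral
  of its second differences against \<open>\<alpha> powr (-3/2)\<close>.
\<close>

definition frac_weight :: "real \<Rightarrow> real" where
  "frac_weight \<alpha> = indicator {0<..} \<alpha> * (min 1 \<alpha> * \<alpha> powr (-3/2))"

lemma frac_weight_integrable: "integrable lborel frac_weight"
proof -
  have [measurable]: "frac_weight \<in> borel_measurable borel" unfolding frac_weight_def by measurable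
  have 1: "integrable lborel (\<lambda>x::real. indicator {0..1} x *\<^sub>R (x powr (-1/2)))"
  proof -
    have "((\<lambda>x::real. x powr (-1/2)) has_integral (1 powr (-1/2 + 1) / (-1/2 + 1))) {0..1}"
      by (rule has_integral_powr_from_0) auto
    then have "(\<lambda>x::real. x powr (-1/2)) absolutely_integrable_on {0..1}"
      by (intro nonnegative_absolutely_integrable_1) auto
    then show ?thesis by (simp add: set_integrable_def integrable_completion)
  qed
  have 2: "integrable lborel (\<lambda>x::real. indicator {1..} x *\<^sub>R (x powr (-3/2)))"
  proof -
    have "((\<lambda>x::real. x powr (-3/2)) has_integral (- (1 powr (-3/2 + 1)) / (-3/2 + 1))) {1..}"
      by (rule has_integral_powr_to_inf) auto
    then have "(\<lambda>x::real. x powr (-3/2)) absolutely_integrable_on {1..}"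
      by (intro nonnegative_absolutely_integrable_1) auto
    then show ?thesis by (simp add: set_integrable_def integrable_completion)
  qed
  show ?thesis
  proof (rule Bochner_Integration.integrable_bound[OF Bochner_Integration.integrable_add[OF 1 2]])
    show "AE x in lborel. norm (frac_weight x) \<le> norm (indicator {0..1} x *\<^sub>R x powr (- 1 / 2) + indicator {1..} x *\<^sub>R x powr (- 3 / 2))"
    proof (rule AE_I2)
      fix x :: real
      have "x * x powr (-3/2) = x powr (-1/2)" if "0 < x" using powr_add[of x 1 "-3/2"] that by simp
      then show "norm (frac_weight x) \<le> norm (indicator {0..1} x *\<^sub>R x powr (- 1 / 2) + indicator {1..} x *\<^sub>R x powr (- 3 / 2))"
        by (cases "x \<le> 1"; cases "0 < x") (auto simp: frac_weight_def indicator_def min_def abs_mult)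
    qed
  qed simp
qed

definition frac_const :: real where
  "frac_const = (LINT x|lborel. indicator {0<..} x * ((2 - 2 * cos x) * x powr (-3/2)))"

lemma frac_kernel_integrable:
  "integrable lborel (\<lambda>x::real. indicator {0<..} x * ((2 - 2 * cos x) * x powr (-3/2)))"
proof (rule Bochner_Integration.integrable_bound[OF integrable_mult_right[OF frac_weight_integrable, of 4]])
  show "AE x in lborel. norm (indicator {0<..} x * ((2 - 2 * cos x) * x powr (- 3 / 2))) \<le> norm (4 * frac_weight x)"
  proof (rule AE_I2)
    fix x :: real
    have "\<bar>2 - 2 * cos x\<bar> \<le> 4 * min 1 x" if "0 < x"
    proof -
      have "x\<^sup>2 \<le> x" if "x \<le> 1" using that \<open>0 < x\<close> by (simp add: power2_eq_square mult_le_one)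
      then show ?thesis using two_minus_two_cos_le[of x] that by (auto simp: min_def)
    qed
    then show "norm (indicator {0<..} x * ((2 - 2 * cos x) * x powr (- 3 / 2))) \<le> norm (4 * frac_weight x)"
      by (cases "0 < x") (auto simp: frac_weight_def abs_mult mult.assoc[symmetric] intro!: mult_right_mono)
  qed
qed simp

lemma frac_const_pos: "0 < frac_const"
proof -
  \<comment> \<open>On [1,2] the factor 2 - 2 cos x is smallest at 1 and the power is smallest at
    2.\<close>
  let ?c = "(2 - 2 * cos 1) * 2 powr (-3/2) :: real"
  have c: "0 < ?c" using cos_monotone_0_pi[of 0 1] pi_gt3 by simp
  have "(LINT x|lborel. indicator {1..2::real} x *\<^sub>R ?c) \<le> frac_const"
    unfolding frac_const_def
  proof (rule integral_mono)
    show "integrable lborel (\<lambda>x. indicator {1..2::real} x *\<^sub>R ?c)" by simp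
    fix x :: real
    show "indicator {1..2} x *\<^sub>R ?c \<le> indicator {0<..} x * ((2 - 2 * cos x) * x powr (- 3 / 2))"
    proof (cases "x \<in> {1..2}")
      case True
      then have "cos x \<le> cos 1" using pi_gt3 by (intro cos_monotone_0_pi_le) auto
      moreover have "2 powr (-3/2) \<le> x powr (-3/2)" using True by (intro powr_mono2') auto
      ultimately have "?c \<le> (2 - 2 * cos x) * x powr (- 3 / 2)" 
        using two_minus_two_cos_le(3)[of x] by (intro mult_mono) auto
      then show ?thesis using True by simp
    qed (use two_minus_two_cos_le(3)[of x] in \<open>auto simp: indicator_def\<close>)
  qed (rule frac_kernel_integrable)
  moreover have "(LINT x|lborel. indicator {1..2::real} x *\<^sub>R ?c) = ?c" by simp
  ultimately show ?thesis using c by linarith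
qed

text \<open>Rescaling the variable by |k| in the integral defining \<open>frac_const\<close>: the
  power contributes |k|^(3/2) and the Jacobian 1/|k|, which leaves |k|^(1/2), that is
  (k^2)^(1/4).\<close>

lemma frac_kernel_scaling:
  "(LINT x|lborel. indicator {0<..} x * ((2 - 2 * cos (of_int k * x)) * x powr (-3/2))) = (of_int (k\<^sup>2)) powr (1/4) * frac_const"
proof (cases "k = 0")
  case False
  define a where "a = \<bar>real_of_int k\<bar>"
  have a: "0 < a" using False by (simp add: a_def)
  have "cos (of_int k * x) = cos (a * x)" for x
    unfolding a_def by (cases "0 \<le> k") (simp_all)
  then have "(LINT x|lborel. indicator {0<..} x * ((2 - 2 * cos (of_int k * x)) * x powr (-3/2)))
     = (LINT x|lborel. a powr (3/2) * (indicator {0<..} (a * x) * ((2 - 2 * cos (a * x)) * (a * x) powr (-3/2))))"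
  proof (intro Bochner_Integration.integral_cong refl)
    fix x
    have "x powr (-3/2) = a powr (3/2) * (a * x) powr (-3/2)" if "0 < x"
      using a that powr_add[of a "3/2" "-3/2"] by (simp add: powr_mult mult.assoc[symmetric])
    moreover have "(0 < a * x) = (0 < x)" using a by (simp add: zero_less_mult_iff)
    ultimately show "indicator {0<..} x * ((2 - 2 * cos (of_int k * x)) * x powr (-3/2)) = a powr (3/2) * (indicator {0<..} (a * x) * ((2 - 2 * cos (a * x)) * (a * x) powr (-3/2)))"
      using \<open>\<And>x. cos (of_int k * x) = cos (a * x)\<close> by (cases "0 < x") (simp_all add: indicator_def)
  qed
  also have "\<dots> = a powr (3/2) * (LINT x|lborel. indicator {0<..} (a * x) * ((2 - 2 * cos (a * x)) * (a * x) powr (-3/2)))"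
    by simp
  also have "(LINT x|lborel. indicator {0<..} (a * x) * ((2 - 2 * cos (a * x)) * (a * x) powr (-3/2))) = frac_const / a"
    using lborel_integral_real_affine[of a "\<lambda>x. indicator {0<..} x * ((2 - 2 * cos x) * x powr (-3/2))" 0] a
    by (simp add: frac_const_def field_simps)
  also have "a powr (3/2) * (frac_const / a) = a powr (1/2) * frac_const"
    using powr_diff[of a "3/2" 1] a by simp
  also have "a powr (1/2) = (of_int (k\<^sup>2)) powr (1/4)"
  proof -
    have "real_of_int (k\<^sup>2) = a powr 2" using a by (simp add: a_def powr_numeral)
    then show ?thesis by (simp add: powr_powr)
  qed
  finally show ?thesis .
qed simp

text \<open>Produces the witness for \<open>frac_laplacian\<close> with exponent 1/4, whose symbol
  is |k|^(1/2). The integral converges absolutely because second differences are bounded for large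
  \<alpha> and of order \<alpha> near 0; Fubini's theorem then computes its Fourier
  coefficients.\<close>

lemma half_laplacian_exists:
  fixes f f' :: "real \<Rightarrow> real"
  assumes per: "periodic f" and d: "\<And>x. (f has_real_derivative f' x) (at x)" and c: "continuous_on UNIV f'"
  obtains g B where "periodic g" "g \<in> borel_measurable borel" "\<And>x. \<bar>g x\<bar> \<le> B"
    "\<And>k. fc g k = of_real (of_int (k\<^sup>2) powr (1/4)) * fc f k"
proof -
  have cf: "continuous_on UNIV f" using DERIV_isCont[OF d] by (simp add: continuous_at_imp_continuous_on)
  then have [measurable]: "f \<in> borel_measurable borel" by (rule borel_measurable_continuous_onI)
  have per': "periodic f'"
    unfolding periodic_def
  proof
    fix \<theta>
    have "((\<lambda>x. f (x + 2 * pi)) has_real_derivative f' (\<theta> + 2 * pi)) (at \<theta>)"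
      using d[of "\<theta> + 2 * pi"] by (simp add: DERIV_shift)
    moreover have "(\<lambda>x. f (x + 2 * pi)) = f" using per by (simp add: periodic_def)
    ultimately show "f' (\<theta> + 2 * pi) = f' \<theta>" using d[of \<theta>] DERIV_unique by metis
  qed
  obtain B0 where B0: "\<And>x. \<bar>f x\<bar> \<le> B0" using periodic_bounded[OF per cf] by auto
  obtain L where L: "\<And>x. \<bar>f' x\<bar> \<le> L" using periodic_bounded[OF per' c] by auto
  have lip: "\<bar>f x - f y\<bar> \<le> L * \<bar>x - y\<bar>" for x y
    using field_differentiable_bound[of UNIV f f' L x y] d L by auto
  \<comment> \<open>Four values bounded by \<open>B0\<close> dominate a second difference for
    \<alpha> \<ge> 1, two increments of slope at most \<open>L\<close> for \<alpha> \<le> 1;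
    \<open>K\<close> serves both.\<close>
  define K where "K = 4 * B0 + 2 * L"
  have BL: "0 \<le> B0" "0 \<le> L" using B0[of 0] L[of 0] by auto
  have K: "\<bar>2 * f \<theta> - f (\<theta> + \<alpha>) - f (\<theta> - \<alpha>)\<bar> \<le> K * min 1 \<alpha>" if "0 < \<alpha>" for \<theta> \<alpha>
  proof (cases "\<alpha> \<le> 1")
    case True
    have "\<bar>2 * f \<theta> - f (\<theta> + \<alpha>) - f (\<theta> - \<alpha>)\<bar> \<le> 2 * L * \<alpha>"
      using lip[of \<theta> "\<theta> + \<alpha>"] lip[of \<theta> "\<theta> - \<alpha>"] that by (auto simp: abs_if split: if_splits)
    also have "\<dots> \<le> K * \<alpha>" using BL that unfolding K_def by (intro mult_right_mono) auto
    finally show ?thesis using True by simp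
  next
    case False
    then show ?thesis using B0[of \<theta>] B0[of "\<theta> + \<alpha>"] B0[of "\<theta> - \<alpha>"] BL by (simp add: K_def)
  qed
  define H where "H = (\<lambda>\<theta> \<alpha>. indicator {0<..} \<alpha> * ((2 * f \<theta> - f (\<theta> + \<alpha>) - f (\<theta> - \<alpha>)) * \<alpha> powr (-3/2)))"
  have Hm [measurable]: "(\<lambda>(\<theta>, \<alpha>). H \<theta> \<alpha>) \<in> borel_measurable (borel \<Otimes>\<^sub>M borel)"
    unfolding H_def by measurable
  have Hb: "\<bar>H \<theta> \<alpha>\<bar> \<le> K * frac_weight \<alpha>" for \<theta> \<alpha>
  proof (cases "0 < \<alpha>")
    case True
    then show ?thesis using mult_right_mono[OF K[OF True, of \<theta>], of "\<alpha> powr (-3/2)"]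
      by (simp add: H_def frac_weight_def abs_mult mult.assoc)
  qed (simp add: H_def frac_weight_def)
  have Hi: "integrable lborel (H \<theta>)" for \<theta>
  proof (rule Bochner_Integration.integrable_bound[OF integrable_mult_right[OF frac_weight_integrable, of K]])
    show "AE \<alpha> in lborel. norm (H \<theta> \<alpha>) \<le> norm (K * frac_weight \<alpha>)"
    proof (rule AE_I2)
      show "norm (H \<theta> \<alpha>) \<le> norm (K * frac_weight \<alpha>)" for \<alpha>
        using Hb[of \<theta> \<alpha>] abs_ge_self[of "K * frac_weight \<alpha>"] unfolding real_norm_def by linarith
    qed
  qed (simp add: H_def)
  define g where "g = (\<lambda>\<theta>. (LINT \<alpha>|lborel. H \<theta> \<alpha>) / frac_const)"
  have gm [measurable]: "g \<in> borel_measurable borel"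
    unfolding g_def by measurable
  show thesis
  proof (rule that)
    show "periodic g"
    proof -
      have "f (\<theta> + 2 * pi + \<alpha>) = f (\<theta> + \<alpha>)" for \<theta> \<alpha>
        using periodic_shift[OF per, of \<alpha>] by (simp add: periodic_def)
      from this[of _ "- _"] this[of _ 0] this show ?thesis by (simp add: periodic_def g_def H_def)
    qed
    show "\<bar>g x\<bar> \<le> (LINT \<alpha>|lborel. K * frac_weight \<alpha>) / frac_const" for x
    proof -
      have "\<bar>LINT \<alpha>|lborel. H x \<alpha>\<bar> \<le> (LINT \<alpha>|lborel. \<bar>H x \<alpha>\<bar>)" by (rule integral_abs_bound)
      also have "\<dots> \<le> (LINT \<alpha>|lborel. K * frac_weight \<alpha>)"
        by (intro integral_mono integrable_abs Hi integrable_mult_right frac_weight_integrable Hb)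
      finally show ?thesis using frac_const_pos by (simp add: g_def abs_divide divide_right_mono)
    qed
    fix k :: int
    let ?e = "\<lambda>\<theta>. cis (- of_int k * \<theta>)"
    have [measurable]: "?e \<in> borel_measurable borel" by (intro borel_measurable_continuous_onI continuous_intros)
    let ?Q = "\<lambda>\<theta> \<alpha>. indicator {-pi..pi} \<theta> *\<^sub>R (complex_of_real (H \<theta> \<alpha>) * ?e \<theta>)"
    have Qi: "integrable (lborel \<Otimes>\<^sub>M lborel) (\<lambda>(\<theta>, \<alpha>). ?Q \<theta> \<alpha>)"
    proof (rule Bochner_Integration.integrable_bound)
      show "integrable (lborel \<Otimes>\<^sub>M lborel) (\<lambda>(\<theta>, \<alpha>). indicator {-pi..pi} \<theta> * (K * frac_weight \<alpha>))"
      proof (rule lborel_pair.Fubini_integrable)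
        show "(\<lambda>(\<theta>, \<alpha>). indicator {-pi..pi} \<theta> * (K * frac_weight \<alpha>)) \<in> borel_measurable (lborel \<Otimes>\<^sub>M lborel)"
          unfolding frac_weight_def by measurable
        show "integrable lborel (\<lambda>\<theta>. LINT \<alpha>|lborel. norm (case (\<theta>, \<alpha>) of (\<theta>, \<alpha>) \<Rightarrow> indicator {-pi..pi} \<theta> * (K * frac_weight \<alpha>)))"
          by (simp add: abs_mult)
        show "AE \<theta> in lborel. integrable lborel (\<lambda>\<alpha>. case (\<theta>, \<alpha>) of (\<theta>, \<alpha>) \<Rightarrow> indicator {-pi..pi} \<theta> * (K * frac_weight \<alpha>))"
          using frac_weight_integrable by simp
      qed
      show "AE x in lborel \<Otimes>\<^sub>M lborel. norm (case x of (\<theta>, \<alpha>) \<Rightarrow> ?Q \<theta> \<alpha>) \<le> norm (case x of (\<theta>, \<alpha>) \<Rightarrow> indicator {-pi..pi} \<theta> * (K * frac_weight \<alpha>))"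
        using Hb by (intro AE_I2) (auto simp: norm_mult indicator_def intro: order_trans[OF _ abs_ge_self])
    qed measurable
    have "2 * pi * fc g k = (LINT \<theta>|lborel. indicator {-pi..pi} \<theta> *\<^sub>R (complex_of_real (g \<theta>) * ?e \<theta>))"
      by (simp add: fc_borel)
    also have "\<dots> = (LINT \<theta>|lborel. (LINT \<alpha>|lborel. ?Q \<theta> \<alpha>) / frac_const)"
      using Hi by (intro Bochner_Integration.integral_cong refl) (simp add: g_def scaleR_conv_of_real)
    also have "\<dots> = (LINT \<theta>|lborel. (LINT \<alpha>|lborel. ?Q \<theta> \<alpha>)) / frac_const" by simp
    also have "(LINT \<theta>|lborel. (LINT \<alpha>|lborel. ?Q \<theta> \<alpha>)) = (LINT \<alpha>|lborel. (LINT \<theta>|lborel. ?Q \<theta> \<alpha>))"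
      using lborel_pair.Fubini_integral[OF Qi] by simp
    also have "\<dots> = (LINT \<alpha>|lborel. complex_of_real (indicator {0<..} \<alpha> * ((2 - 2 * cos (of_int k * \<alpha>)) * \<alpha> powr (-3/2))) * (2 * pi * fc f k))"
    proof (intro Bochner_Integration.integral_cong refl)
      fix \<alpha> :: real
      let ?D = "\<lambda>\<theta>. (f (\<theta> + \<alpha>) + f (\<theta> - \<alpha>)) - 2 * f \<theta>"
      have "?Q \<theta> \<alpha> = complex_of_real (- indicator {0<..} \<alpha> * \<alpha> powr (-3/2)) * (indicator {-pi..pi} \<theta> *\<^sub>R (complex_of_real (?D \<theta>) * ?e \<theta>))" for \<theta>
        by (simp add: H_def scaleR_conv_of_real algebra_simps)
      then have "(LINT \<theta>|lborel. ?Q \<theta> \<alpha>) = complex_of_real (- indicator {0<..} \<alpha> * \<alpha> powr (-3/2)) * (LINT \<theta>|lborel. indicator {-pi..pi} \<theta> *\<^sub>R (complex_of_real (?D \<theta>) * ?e \<theta>))"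
        by (simp only: integral_mult_right_zero)
      also have "(LINT \<theta>|lborel. indicator {-pi..pi} \<theta> *\<^sub>R (complex_of_real (?D \<theta>) * ?e \<theta>)) = 2 * pi * fc ?D k"
      proof -
        have "?D \<in> borel_measurable borel" by measurable
        from fc_borel[OF this, of k] show ?thesis by simp
      qed
      also have "fc ?D k = - of_real (2 - 2 * cos (of_int k * \<alpha>)) * fc f k" by (rule fc_second_difference[OF per cf])
      finally show "(LINT \<theta>|lborel. ?Q \<theta> \<alpha>) = complex_of_real (indicator {0<..} \<alpha> * ((2 - 2 * cos (of_int k * \<alpha>)) * \<alpha> powr (-3/2))) * (2 * pi * fc f k)"
        by (simp add: algebra_simps)
    qed
    also have "\<dots> = complex_of_real (of_int (k\<^sup>2) powr (1/4) * frac_const) * (2 * pi * fc f k)"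
      by (simp only: integral_mult_left_zero integral_complex_of_real frac_kernel_scaling)
    finally have "2 * pi * fc g k = 2 * pi * (of_real (of_int (k\<^sup>2) powr (1/4)) * fc f k)"
      using frac_const_pos by simp
    then show "fc g k = of_real (of_int (k\<^sup>2) powr (1/4)) * fc f k" by (subst (asm) mult_cancel_left) simp
  qed (rule gm)
qed

subsection \<open>Besov differences\<close>

text \<open>The square of \<open>L2_norm (delta \<beta> g)\<close> as a real number, with which it
  agrees for continuous \<open>g\<close>. As an integral of a continuous integrand over a compact
  interval it depends continuously on its parameters.\<close>

definition qdiff :: "(real \<Rightarrow> real^2) \<Rightarrow> real \<Rightarrow> real" where
  "qdiff g \<beta> = integral {-pi..pi} (\<lambda>\<theta>. (norm (g (\<theta> + \<beta>) - g \<theta>))\<^sup>2)"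

text \<open>The Cauchy-Schwarz inequality against the constant 1, read off from the nonnegative
  integral of the squared deviation of \<open>u\<close> from its mean \<open>M\<close>.\<close>

lemma integral_square_le:
  fixes u :: "real \<Rightarrow> real"
  assumes ab: "a \<le> b" and u: "continuous_on {a..b} u"
  shows "(integral {a..b} u)\<^sup>2 \<le> (b - a) * integral {a..b} (\<lambda>x. (u x)\<^sup>2)"
proof (cases "a = b")
  case False
  then have l: "0 < b - a" using ab by simp
  define I1 I2 M where "I1 = integral {a..b} u" and "I2 = integral {a..b} (\<lambda>x. (u x)\<^sup>2)" and "M = I1 / (b - a)"
  have i: "(u has_integral I1) {a..b}" "((\<lambda>x. (u x)\<^sup>2) has_integral I2) {a..b}"
    using u unfolding I1_def I2_def by (auto intro!: integrable_integral integrable_continuous_interval continuous_intros)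
  have hi: "((\<lambda>x. (u x)\<^sup>2 - (2 * M) * u x + M\<^sup>2) has_integral (I2 - (2 * M) * I1 + (b - a) *\<^sub>R M\<^sup>2)) {a..b}"
    using has_integral_add[OF has_integral_diff[OF i(2) has_integral_mult_right[OF i(1), of "2 * M"]] has_integral_const_real[of "M\<^sup>2" a b]] ab
    by simp
  have eq: "(u x)\<^sup>2 - (2 * M) * u x + M\<^sup>2 = (u x - M)\<^sup>2" for x
    by (simp add: power2_diff)
  have "0 \<le> I2 - (2 * M) * I1 + (b - a) *\<^sub>R M\<^sup>2"
    using hi unfolding eq by (rule has_integral_nonneg) simp
  also have "\<dots> = I2 - I1\<^sup>2 / (b - a)"
  proof -
    have "I1\<^sup>2 / (b - a) = M * I1" by (simp add: M_def power2_eq_square)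
    moreover have "(b - a) *\<^sub>R M\<^sup>2 = M * I1" using l by (simp add: M_def power2_eq_square)
    ultimately show ?thesis by simp
  qed
  finally have "0 \<le> I2 - I1\<^sup>2 / (b - a)" .
  then have "I1\<^sup>2 / (b - a) \<le> I2" by simp
  then show ?thesis using l by (simp add: I1_def I2_def pos_divide_le_eq mult.commute)
qed simp

lemma qdiff_nonneg: "0 \<le> qdiff g \<beta>"
proof (cases "(\<lambda>\<theta>. (norm (g (\<theta> + \<beta>) - g \<theta>))\<^sup>2) integrable_on {-pi..pi}")
  case True then show ?thesis unfolding qdiff_def by (rule integral_nonneg) auto
next
  case False then show ?thesis by (simp add: qdiff_def not_integrable_integral)
qed

lemma qdiff_continuous:
  assumes c: "continuous_on UNIV g" shows "continuous_on S (qdiff g)"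
proof -
  have *: "continuous_on (cbox a b) (qdiff g)" for a b
    unfolding qdiff_def interval_cbox
    by (intro integral_continuous_on_param) (auto intro!: continuous_intros continuous_on_compose2[OF c] simp: split_beta)
  have "isCont (qdiff g) x" for x
    using *[of "x-1" "x+1"] by (intro continuous_on_interior[of "cbox (x-1) (x+1)"]) (auto simp: interval_cbox[symmetric])
  then show ?thesis by (simp add: continuous_at_imp_continuous_on)
qed

lemma qdiff_split:
  assumes per: "periodic g" and c: "continuous_on UNIV g"
  shows "qdiff g (\<beta> + \<gamma>) \<le> 2 * qdiff g \<beta> + 2 * qdiff g \<gamma>"
proof -
  have cg: "continuous_on S (\<lambda>\<theta>. g (\<theta> + a))" for a S
    by (intro continuous_on_compose2[OF c] continuous_intros) auto
  have cg0: "continuous_on S g" for S using c by (rule continuous_on_subset) auto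
  have sq: "(norm (a + b))\<^sup>2 \<le> 2 * (norm a)\<^sup>2 + 2 * (norm b)\<^sup>2" for a b :: "real^2"
  proof -
    have "(norm (a + b))\<^sup>2 \<le> (norm a + norm b)\<^sup>2" by (intro power_mono norm_triangle_ineq) auto
    also have "\<dots> \<le> 2 * (norm a)\<^sup>2 + 2 * (norm b)\<^sup>2"
      using zero_le_square[of "norm a - norm b"] by (simp add: power2_eq_square algebra_simps)
    finally show ?thesis .
  qed
  have i: "(\<lambda>\<theta>. (norm (g (\<theta> + \<gamma> + \<beta>) - g (\<theta> + \<gamma>)))\<^sup>2) integrable_on {-pi..pi}" 
     "(\<lambda>\<theta>. (norm (g (\<theta> + \<gamma>) - g \<theta>))\<^sup>2) integrable_on {-pi..pi}"
     "(\<lambda>\<theta>. (norm (g (\<theta> + (\<beta> + \<gamma>)) - g \<theta>))\<^sup>2) integrable_on {-pi..pi}"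
     "(\<lambda>\<theta>. (norm (g (\<theta> + \<beta>) - g \<theta>))\<^sup>2) integrable_on {-pi..pi}"
    using cg[of _ \<gamma>] cg[of _ "\<gamma> + \<beta>"] cg[of _ "\<beta> + \<gamma>"] cg[of _ \<beta>] cg0
    by (auto intro!: integrable_continuous_interval continuous_intros simp: add.assoc)
  have "qdiff g (\<beta> + \<gamma>) \<le> integral {-pi..pi} (\<lambda>\<theta>. 2 * (norm (g (\<theta> + \<gamma> + \<beta>) - g (\<theta> + \<gamma>)))\<^sup>2 + 2 * (norm (g (\<theta> + \<gamma>) - g \<theta>))\<^sup>2)"
    unfolding qdiff_def
  proof (intro integral_le i integrable_add integrable_on_mult_right)
    fix \<theta>
    show "(norm (g (\<theta> + (\<beta> + \<gamma>)) - g \<theta>))\<^sup>2 \<le> 2 * (norm (g (\<theta> + \<gamma> + \<beta>) - g (\<theta> + \<gamma>)))\<^sup>2 + 2 * (norm (g (\<theta> + \<gamma>) - g \<theta>))\<^sup>2"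
      using sq[of "g (\<theta> + \<gamma> + \<beta>) - g (\<theta> + \<gamma>)" "g (\<theta> + \<gamma>) - g \<theta>"] by (simp add: add_ac)
  qed
  also have "\<dots> = 2 * integral {-pi..pi} (\<lambda>\<theta>. (norm (g (\<theta> + \<gamma> + \<beta>) - g (\<theta> + \<gamma>)))\<^sup>2) + 2 * qdiff g \<gamma>"
    using i by (simp add: integral_add integrable_on_mult_right qdiff_def)
  also have "integral {-pi..pi} (\<lambda>\<theta>. (norm (g (\<theta> + \<gamma> + \<beta>) - g (\<theta> + \<gamma>)))\<^sup>2) = qdiff g \<beta>"
  proof -
    have "periodic (\<lambda>\<theta>. (norm (g (\<theta> + \<beta>) - g \<theta>))\<^sup>2)"
      using per periodic_shift[OF per, of \<beta>] by (simp add: periodic_def)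
    from periodic_integral_shift[OF this i(4), of \<gamma>] show ?thesis by (simp add: qdiff_def)
  qed
  finally show ?thesis .
qed

text \<open>For every \<beta> in [0,h] the increment by \<open>h\<close> splits into increments by
  \<beta> and h - \<beta>; averaging over \<beta> counts the same integral twice. Replacing the
  value at one increment by an integral is what later turns a dyadic sum into the Besov integral.
  The constant 4 is 2 times sqrt 2, the latter rounded up to 2.\<close>

lemma qdiff_average:
  assumes per: "periodic g" and c: "continuous_on UNIV g" and h: "0 < h"
  shows "sqrt (qdiff g h) \<le> (4 / h) * integral {0..h} (\<lambda>\<beta>. sqrt (qdiff g \<beta>))"
proof -
  let ?N = "\<lambda>\<beta>. sqrt (qdiff g \<beta>)"
  have cN: "continuous_on S ?N" for S by (intro continuous_intros qdiff_continuous[OF c])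
  have cN': "continuous_on S (\<lambda>\<beta>. ?N (h - \<beta>))" for S
    by (intro continuous_on_compose2[OF cN[of UNIV]] continuous_intros) auto
  have i: "?N integrable_on {0..h}" "(\<lambda>\<beta>. ?N (h - \<beta>)) integrable_on {0..h}"
    by (auto intro!: integrable_continuous_interval cN cN')
  have tri: "?N h \<le> 2 * (?N \<beta> + ?N (h - \<beta>))" for \<beta>
  proof -
    have "?N h \<le> sqrt (2 * qdiff g \<beta> + 2 * qdiff g (h - \<beta>))"
      using qdiff_split[OF per c, of \<beta> "h - \<beta>"] by simp
    also have "\<dots> \<le> sqrt (2 * qdiff g \<beta>) + sqrt (2 * qdiff g (h - \<beta>))"
      by (intro sqrt_add_le_add_sqrt mult_nonneg_nonneg qdiff_nonneg) auto
    also have "\<dots> = sqrt 2 * (?N \<beta> + ?N (h - \<beta>))" by (simp add: real_sqrt_mult algebra_simps)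
    also have "\<dots> \<le> 2 * (?N \<beta> + ?N (h - \<beta>))"
      by (intro mult_right_mono add_nonneg_nonneg) (auto simp: qdiff_nonneg real_le_lsqrt sqrt2_less_2 less_imp_le)
    finally show ?thesis .
  qed
  have "h * ?N h = integral {0..h} (\<lambda>_. ?N h)" using h by simp
  also have "\<dots> \<le> integral {0..h} (\<lambda>\<beta>. 2 * (?N \<beta> + ?N (h - \<beta>)))"
    by (intro integral_le integrable_const_ivl integrable_on_mult_right integrable_add i tri)
  also have "\<dots> = 2 * (integral {0..h} ?N + integral {0..h} (\<lambda>\<beta>. ?N (h - \<beta>)))"
    using i by (simp add: integral_add)
  also have "integral {0..h} (\<lambda>\<beta>. ?N (h - \<beta>)) = integral {0..h} ?N"
  proof -
    have "((\<lambda>x. ?N (x + h)) has_integral integral {0..h} ?N) {0-h..h-h}"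
      by (rule has_integral_shift_real_ivl) (rule integrable_integral[OF i(1)])
    from has_integral_reflect_lemma_real[OF this] show ?thesis by (simp add: integral_unique)
  qed
  finally show ?thesis using h by (simp add: field_simps)
qed

text \<open>Halving \<open>h\<close> multiplies the weight by 2^(3/2), which exceeds 2, so each sum
  is dominated by twice its last term. In the second part the last scale counted still satisfies
  \<beta> \<le> h j.\<close>

lemma geometric_weight_sum:
  fixes h :: "nat \<Rightarrow> real"
  defines "h \<equiv> \<lambda>j. pi / 2 ^ j"
  shows "(\<Sum>j\<le>n. h j powr (-3/2)) \<le> 2 * h n powr (-3/2)"
    and "0 < \<beta> \<Longrightarrow> (\<Sum>j\<le>n. if \<beta> \<le> h j then h j powr (-3/2) else 0) \<le> 2 * \<beta> powr (-3/2)"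
proof -
  have hp: "0 < h j" for j by (simp add: h_def)
  have step: "h j powr (-3/2) \<le> h (Suc j) powr (-3/2) / 2" for j
  proof -
    have e: "h j = 2 * h (Suc j)" by (simp add: h_def)
    have "h j powr (-3/2) = 2 powr (-3/2) * h (Suc j) powr (-3/2)"
      unfolding e using hp[of "Suc j"] by (simp add: powr_mult)
    moreover have "2 powr (-3/2) \<le> (2::real) powr (-1)" by (rule powr_mono) auto
    ultimately show ?thesis using mult_right_mono[of "2 powr (-3/2)" "2 powr (-1)::real" "h (Suc j) powr (-3/2)"]
      by (simp add: powr_minus_divide)
  qed
  have geo: "(\<Sum>j\<le>n. h j powr (-3/2)) \<le> 2 * h n powr (-3/2)" for n
  proof (induction n)
    case (Suc n)
    then show ?case using step[of n] by simp
  qed simp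
  then show "(\<Sum>j\<le>n. h j powr (-3/2)) \<le> 2 * h n powr (-3/2)" .
  assume \<beta>: "0 < \<beta>"
  show "(\<Sum>j\<le>n. if \<beta> \<le> h j then h j powr (-3/2) else 0) \<le> 2 * \<beta> powr (-3/2)"
  proof (induction n)
    case 0
    have e: "{..0::nat} = {0}" by auto
    have "\<beta> powr (-3/2) \<le> 2 * \<beta> powr (-3/2)" by simp
    then show ?case unfolding e using \<beta> powr_mono2'[of "-3/2" \<beta> "h 0"] by (cases "\<beta> \<le> h 0") (auto intro: order_trans)
  next
    case (Suc n)
    show ?case
    proof (cases "\<beta> \<le> h (Suc n)")
      case True
      have "(\<Sum>j\<le>Suc n. if \<beta> \<le> h j then h j powr (-3/2) else 0) \<le> (\<Sum>j\<le>Suc n. h j powr (-3/2))"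
        by (intro sum_mono) auto
      also have "\<dots> \<le> 2 * h (Suc n) powr (-3/2)" by (rule geo)
      also have "\<dots> \<le> 2 * \<beta> powr (-3/2)" using \<beta> True by (intro mult_left_mono powr_mono2') auto
      finally show ?thesis .
    next
      case False
      then show ?thesis using Suc by simp
    qed
  qed
qed

text \<open>By telescoping averages over dyadic intervals.\<close>

lemma besov_embedding:
  fixes g :: "real \<Rightarrow> real^2"
  assumes per: "periodic g" and c: "continuous_on UNIV g" and mean: "integral {-pi..pi} g = 0"
  shows "ennreal (norm (g \<theta>)) \<le> 4 * (\<integral>\<^sup>+\<beta>. ennreal (\<beta> powr (-3/2) * sqrt (qdiff g \<beta>)) * indicator {0<..pi} \<beta> \<partial>lborel)"
proof -
  define h :: "nat \<Rightarrow> real" where "h = (\<lambda>j. pi / 2 ^ j)"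
  have hp: "0 < h j" and hpi: "h j \<le> pi" for j
  proof -
    show "0 < h j" by (simp add: h_def)
    have "(1::real) \<le> 2 ^ j" by simp
    then show "h j \<le> pi" unfolding h_def by (simp add: divide_le_eq mult_le_cancel_left1)
  qed
  have cg: "continuous_on S (\<lambda>s. g (\<theta> + s))" for S \<theta>
    by (intro continuous_on_compose2[OF c] continuous_intros) auto
  have cS: "continuous_on S g" for S using c by (rule continuous_on_subset) auto
  \<comment> \<open>The mean of \<open>g\<close> over the arc of length \<open>l\<close> starting at
    \<theta>. It tends to the value of \<open>g\<close> as \<open>l\<close> tends to 0 and vanishes
    at the full period.\<close>
  define A where "A = (\<lambda>l. (1 / l) *\<^sub>R integral {0..l} (\<lambda>s. g (\<theta> + s)))"
  let ?N = "\<lambda>\<beta>. sqrt (qdiff g \<beta>)"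
  have cN: "continuous_on S ?N" for S by (intro continuous_intros qdiff_continuous[OF c])
  let ?I = "\<lambda>l. integral {0..l} ?N"
  have I0: "0 \<le> ?I l" for l
    by (intro integral_nonneg integrable_continuous_interval cN) (simp add: qdiff_nonneg)
  \<comment> \<open>The difference of the means is half a mean of increments by \<open>l\<close>.
    Cauchy-Schwarz on the arc, enlarged to a whole period, bounds it by the L^2 increment, which
    \<open>qdiff_average\<close> turns into an integral over smaller increments.\<close>
  have diff: "norm (A l - A (2 * l)) \<le> 2 * l powr (-3/2) * ?I l" if l: "0 < l" "l \<le> pi" for l
  proof -
    have i: "(\<lambda>s. g (\<theta> + s)) integrable_on {a..b}" for a b by (intro integrable_continuous_interval cg)
    have i': "(\<lambda>s. g (\<theta> + s + l)) integrable_on {a..b}" for a b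
      using cg[of _ "\<theta> + l"] by (intro integrable_continuous_interval) (simp add: add_ac)
    have "integral {0..2*l} (\<lambda>s. g (\<theta> + s)) = integral {0..l} (\<lambda>s. g (\<theta> + s)) + integral {l..2*l} (\<lambda>s. g (\<theta> + s))"
      by (rule Henstock_Kurzweil_Integration.integral_combine[symmetric]) (use l i in auto)
    also have "integral {l..2*l} (\<lambda>s. g (\<theta> + s)) = integral {0..l} (\<lambda>s. g (\<theta> + s + l))"
      using integral_shift_real_ivl[of l l "2*l" "\<lambda>s. g (\<theta> + s)"] by (simp add: add.assoc)
    finally have "A l - A (2 * l) = - (1 / (2 * l)) *\<^sub>R (integral {0..l} (\<lambda>s. g (\<theta> + s + l)) - integral {0..l} (\<lambda>s. g (\<theta> + s)))"
      using l by (simp add: A_def algebra_simps vec_eq_iff)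
    also have "integral {0..l} (\<lambda>s. g (\<theta> + s + l)) - integral {0..l} (\<lambda>s. g (\<theta> + s)) = integral {0..l} (\<lambda>s. g (\<theta> + s + l) - g (\<theta> + s))"
      by (rule integral_diff[symmetric, OF i' i])
    finally have e: "norm (A l - A (2 * l)) = (1 / (2 * l)) * norm (integral {0..l} (\<lambda>s. g (\<theta> + s + l) - g (\<theta> + s)))"
      using l by simp
    have cd: "continuous_on S (\<lambda>s. g (\<theta> + s + l) - g (\<theta> + s))" for S
      using cg[of S "\<theta> + l"] cg[of S \<theta>] by (intro continuous_intros) (simp_all add: add_ac)
    let ?u = "\<lambda>s. norm (g (\<theta> + s + l) - g (\<theta> + s))"
    have "norm (integral {0..l} (\<lambda>s. g (\<theta> + s + l) - g (\<theta> + s))) \<le> integral {0..l} ?u"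
      by (intro integral_norm_bound_integral integrable_continuous_interval cd continuous_on_norm) auto
    also have "\<dots> \<le> sqrt (l * integral {0..l} (\<lambda>s. (?u s)\<^sup>2))"
      using integral_square_le[of 0 l ?u, OF _ continuous_on_norm[OF cd]] l by (intro real_le_rsqrt) simp
    also have "integral {0..l} (\<lambda>s. (?u s)\<^sup>2) \<le> qdiff g l"
    proof -
      have "integral {0..l} (\<lambda>s. (?u s)\<^sup>2) \<le> integral {-pi..pi} (\<lambda>s. (?u s)\<^sup>2)"
        using l by (intro integral_subset_le integrable_continuous_interval continuous_intros cd) auto
      also have "\<dots> = integral {-pi..pi} (\<lambda>s. (norm (g (s + \<theta> + l) - g (s + \<theta>)))\<^sup>2)" by (simp add: add.commute)
      also have "\<dots> = qdiff g l"
      proof -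
        have p: "periodic (\<lambda>\<theta>. (norm (g (\<theta> + l) - g \<theta>))\<^sup>2)"
          using per periodic_shift[OF per, of l] by (simp add: periodic_def)
        have "continuous_on {-pi..pi} (\<lambda>\<theta>. (norm (g (\<theta> + l) - g \<theta>))\<^sup>2)"
          using cg[of _ l] cS by (intro continuous_intros) (simp_all add: add.commute)
        from periodic_integral_shift[OF p integrable_continuous_interval[OF this], of \<theta>]
        show ?thesis by (simp add: qdiff_def)
      qed
      finally show ?thesis .
    qed
    finally have "norm (integral {0..l} (\<lambda>s. g (\<theta> + s + l) - g (\<theta> + s))) \<le> sqrt (l * qdiff g l)"
      using l by (simp add: mult_left_mono)
    also have "\<dots> = sqrt l * ?N l" by (simp add: real_sqrt_mult)
    also have "\<dots> \<le> sqrt l * ((4 / l) * ?I l)"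
      using l by (intro mult_left_mono qdiff_average[OF per c]) auto
    finally have "norm (A l - A (2 * l)) \<le> (1 / (2 * l)) * (sqrt l * ((4 / l) * ?I l))"
      unfolding e using l by (intro mult_left_mono) auto
    also have "\<dots> = 2 * l powr (-3/2) * ?I l"
    proof -
      have "l powr (-3/2) = l powr (1/2) * l powr (-2)" by (simp add: powr_add[symmetric])
      then have "l powr (-3/2) = sqrt l / l\<^sup>2" using l by (simp add: powr_half_sqrt powr_minus_divide powr_numeral)
      then show ?thesis using l by (simp add: power2_eq_square field_simps)
    qed
    finally show ?thesis .
  qed
  have A0: "A (2 * pi) = 0"
  proof -
    have "integral {0..2*pi} (\<lambda>s. g (\<theta> + s)) = integral {-pi..pi} (\<lambda>s. g (s + (\<theta> + pi)))"
      using integral_shift_real_ivl[of 0 pi "2*pi" "\<lambda>s. g (\<theta> + s)"] integral_shift_real_ivl[of pi 0 "2*pi" "\<lambda>s. g (\<theta> + s)"]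
      by (simp add: add_ac)
    also have "\<dots> = 0"
      using periodic_integral_shift[OF per integrable_continuous_interval[OF cS], of "\<theta> + pi"] mean by simp
    finally show ?thesis by (simp add: A_def)
  qed
  have An: "norm (A (h n)) \<le> (\<Sum>j\<le>n. 2 * h j powr (-3/2) * ?I (h j))" for n
  proof (induction n)
    case 0
    show ?case using diff[OF hp hpi, of 0] A0 by (simp add: h_def)
  next
    case (Suc n)
    have "2 * h (Suc n) = h n" by (simp add: h_def)
    then show ?case using diff[OF hp hpi, of "Suc n"] Suc norm_triangle_ineq[of "A (h (Suc n)) - A (h n)" "A (h n)"] by simp
  qed
  have bound: "ennreal (norm (A (h n))) \<le> 4 * (\<integral>\<^sup>+\<beta>. ennreal (\<beta> powr (-3/2) * ?N \<beta>) * indicator {0<..pi} \<beta> \<partial>lborel)" for n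
  proof -
    have [measurable]: "?N \<in> borel_measurable borel" by (rule borel_measurable_continuous_onI[OF cN])
    have I_nn: "ennreal (?I l) = (\<integral>\<^sup>+\<beta>. ennreal (?N \<beta>) * indicator {0..l} \<beta> \<partial>lborel)" for l
      using nn_integral_has_integral_lebesgue'[of "{0..l}" ?N, OF _ integrable_integral[OF integrable_continuous_interval[OF cN]]]
      by (simp add: qdiff_nonneg)
    have "ennreal (norm (A (h n))) \<le> ennreal (\<Sum>j\<le>n. 2 * h j powr (-3/2) * ?I (h j))" by (rule ennreal_leI[OF An])
    also have "\<dots> = (\<Sum>j\<le>n. ennreal (2 * h j powr (-3/2)) * (\<integral>\<^sup>+\<beta>. ennreal (?N \<beta>) * indicator {0..h j} \<beta> \<partial>lborel))"
      by (subst sum_ennreal[symmetric]) (auto simp: I0 ennreal_mult I_nn[symmetric] intro!: mult_nonneg_nonneg)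
    \<comment> \<open>Sum and integral are exchanged: at a given \<beta> only the scales
      \<open>h j\<close> \<ge> \<beta> contribute, and their weights sum up to at most 2
      \<beta>^(-3/2).\<close>
    also have "\<dots> = (\<integral>\<^sup>+\<beta>. (\<Sum>j\<le>n. ennreal (2 * h j powr (-3/2)) * (ennreal (?N \<beta>) * indicator {0..h j} \<beta>)) \<partial>lborel)"
      by (subst nn_integral_sum) (auto simp: nn_integral_cmult)
    also have "\<dots> \<le> (\<integral>\<^sup>+\<beta>. 4 * (ennreal (\<beta> powr (-3/2) * ?N \<beta>) * indicator {0<..pi} \<beta>) \<partial>lborel)"
    proof (rule nn_integral_mono_AE)
      have "AE \<beta> in lborel. \<beta> \<noteq> (0::real)" by (rule AE_lborel_singleton)
      then show "AE \<beta> in lborel. (\<Sum>j\<le>n. ennreal (2 * h j powr (-3/2)) * (ennreal (?N \<beta>) * indicator {0..h j} \<beta>)) \<le> 4 * (ennreal (\<beta> powr (-3/2) * ?N \<beta>) * indicator {0<..pi} \<beta>)"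
      proof eventually_elim
        case (elim \<beta>)
        show ?case
        proof (cases "0 < \<beta> \<and> \<beta> \<le> pi")
          case True
          have "(\<Sum>j\<le>n. ennreal (2 * h j powr (-3/2)) * (ennreal (?N \<beta>) * indicator {0..h j} \<beta>))
            = (\<Sum>j\<le>n. ennreal (2 * ?N \<beta> * (if \<beta> \<le> h j then h j powr (-3/2) else 0)))"
            using True by (intro sum.cong refl) (auto simp: indicator_def ennreal_mult[symmetric] qdiff_nonneg mult_ac)
          also have "\<dots> = ennreal (2 * ?N \<beta> * (\<Sum>j\<le>n. if \<beta> \<le> h j then h j powr (-3/2) else 0))"
            by (subst sum_ennreal) (auto simp: sum_distrib_left qdiff_nonneg intro!: mult_nonneg_nonneg)
          also have "\<dots> \<le> ennreal (2 * ?N \<beta> * (2 * \<beta> powr (-3/2)))"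
            using geometric_weight_sum(2)[of \<beta> n] True unfolding h_def by (intro ennreal_leI mult_left_mono) (auto simp: qdiff_nonneg)
          also have "\<dots> = 4 * (ennreal (\<beta> powr (-3/2) * ?N \<beta>))"
            by (subst ennreal_numeral[symmetric], subst ennreal_mult[symmetric]) (auto simp: qdiff_nonneg mult_ac intro!: mult_nonneg_nonneg)
          finally show ?thesis using True by simp
        next
          case False
          then have "indicator {0..h j} \<beta> = (0::ennreal)" for j
            using elim hpi[of j] by (auto simp: indicator_def)
          then show ?thesis by simp
        qed
      qed
    qed
    also have "\<dots> = 4 * (\<integral>\<^sup>+\<beta>. ennreal (\<beta> powr (-3/2) * ?N \<beta>) * indicator {0<..pi} \<beta> \<partial>lborel)"
      by (subst nn_integral_cmult) auto
    finally show ?thesis .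
  qed
  have lim: "(\<lambda>n. A (h n)) \<longlonglongrightarrow> g \<theta>"
  proof -
    have "((\<lambda>l. integral {0..l} (\<lambda>s. g (\<theta> + s))) has_vector_derivative g (\<theta> + 0)) (at 0 within {0..1})"
      by (rule integral_has_vector_derivative[OF cg]) auto
    then have "((\<lambda>l. (1 / norm l) *\<^sub>R (integral {0..l} (\<lambda>s. g (\<theta> + s)) - l *\<^sub>R g \<theta>)) \<longlongrightarrow> 0) (at 0 within {0..1})"
      by (auto simp: has_vector_derivative_def has_derivative_within divide_inverse)
    moreover have "filterlim h (at 0 within {0..1}) sequentially"
      unfolding filterlim_at
    proof
      have "h \<longlonglongrightarrow> 0" unfolding h_def using LIMSEQ_divide_realpow_zero[of 2 pi] by simp
      then show "h \<longlonglongrightarrow> 0" .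
      then have "\<forall>\<^sub>F n in sequentially. h n < 1" by (rule order_tendstoD) simp
      then show "\<forall>\<^sub>F n in sequentially. h n \<in> {0..1} \<and> h n \<noteq> 0"
      proof eventually_elim
        case (elim n)
        then show ?case using hp[of n] by simp
      qed
    qed
    ultimately have "(\<lambda>n. (1 / norm (h n)) *\<^sub>R (integral {0..h n} (\<lambda>s. g (\<theta> + s)) - h n *\<^sub>R g \<theta>)) \<longlonglongrightarrow> 0"
      by (rule filterlim_compose)
    moreover have "(1 / norm (h n)) *\<^sub>R (integral {0..h n} (\<lambda>s. g (\<theta> + s)) - h n *\<^sub>R g \<theta>) = A (h n) - g \<theta>" for n
      using hp[of n] by (simp add: A_def scaleR_diff_right)
    ultimately have "(\<lambda>n. A (h n) - g \<theta>) \<longlonglongrightarrow> 0" by simp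
    then show ?thesis by (rule Lim_null[THEN iffD2])
  qed
  then have "(\<lambda>n. ennreal (norm (A (h n)))) \<longlonglongrightarrow> ennreal (norm (g \<theta>))"
    by (intro tendsto_ennrealI tendsto_norm)
  then show ?thesis by (rule LIMSEQ_le_const2) (use bound in blast)
qed

text \<open>For the exponent 2, Minkowski's inequality follows by expanding the square.\<close>

lemma minkowski_nn_integral:
  fixes F :: "'a \<Rightarrow> 'b \<Rightarrow> ennreal"
  assumes M: "sigma_finite_measure M" and N: "sigma_finite_measure N"
    and F [measurable]: "(\<lambda>(x, y). F x y) \<in> borel_measurable (M \<Otimes>\<^sub>M N)"
    and G [measurable]: "G \<in> borel_measurable N" and FG: "\<And>y. y \<in> space N \<Longrightarrow> (\<integral>\<^sup>+x. (F x y)\<^sup>2 \<partial>M) \<le> (G y)\<^sup>2"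
  shows "(\<integral>\<^sup>+x. (\<integral>\<^sup>+y. F x y \<partial>N)\<^sup>2 \<partial>M) \<le> (\<integral>\<^sup>+y. G y \<partial>N)\<^sup>2"
proof -
  interpret M: sigma_finite_measure M by fact
  interpret N: sigma_finite_measure N by fact
  interpret MN: pair_sigma_finite M N ..
  have le: "a \<le> b" if "a\<^sup>2 \<le> b\<^sup>2" for a b :: ennreal
  proof (rule ccontr)
    assume "\<not> a \<le> b" then have "b < a" by simp
    then have "b\<^sup>2 < a\<^sup>2"
      by (cases a; cases b) (auto simp: ennreal_power[symmetric] power2_eq_square ennreal_mult[symmetric] ennreal_less_iff top_unique ennreal_top_mult mult_strict_mono' less_top)
    with that show False by simp
  qed
  have cs: "(\<integral>\<^sup>+x. F x y * F x z \<partial>M) \<le> G y * G z" if y: "y \<in> space N" and z: "z \<in> space N" for y z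
  proof (rule le)
    have [measurable]: "(\<lambda>x. F x y) \<in> borel_measurable M" "(\<lambda>x. F x z) \<in> borel_measurable M"
      using measurable_Pair1[OF F y] measurable_Pair1[OF F z] by (simp_all)
    have "(\<integral>\<^sup>+x. F x y * F x z \<partial>M)\<^sup>2 \<le> (\<integral>\<^sup>+x. (F x y)\<^sup>2 \<partial>M) * (\<integral>\<^sup>+x. (F x z)\<^sup>2 \<partial>M)"
      by (rule Cauchy_Schwarz_nn_integral) auto
    also have "\<dots> \<le> (G y)\<^sup>2 * (G z)\<^sup>2" by (intro mult_mono FG y z) auto
    finally show "(\<integral>\<^sup>+x. F x y * F x z \<partial>M)\<^sup>2 \<le> (G y * G z)\<^sup>2" by (simp add: power_mult_distrib)
  qed
  have "(\<integral>\<^sup>+x. (\<integral>\<^sup>+y. F x y \<partial>N)\<^sup>2 \<partial>M) = (\<integral>\<^sup>+x. (\<integral>\<^sup>+y. (\<integral>\<^sup>+z. F x y * F x z \<partial>N) \<partial>N) \<partial>M)"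
  proof (rule nn_integral_cong)
    fix x assume x: "x \<in> space M"
    have [measurable]: "(\<lambda>y. F x y) \<in> borel_measurable N"
      using measurable_Pair2[OF F x] by simp
    show "(\<integral>\<^sup>+y. F x y \<partial>N)\<^sup>2 = (\<integral>\<^sup>+y. (\<integral>\<^sup>+z. F x y * F x z \<partial>N) \<partial>N)"
      by (simp add: power2_eq_square nn_integral_cmult nn_integral_multc)
  qed
  also have "\<dots> = (\<integral>\<^sup>+y. (\<integral>\<^sup>+x. (\<integral>\<^sup>+z. F x y * F x z \<partial>N) \<partial>M) \<partial>N)"
    by (rule MN.Fubini'[symmetric]) measurable
  also have "\<dots> = (\<integral>\<^sup>+y. (\<integral>\<^sup>+z. (\<integral>\<^sup>+x. F x y * F x z \<partial>M) \<partial>N) \<partial>N)"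
  proof (rule nn_integral_cong)
    fix y assume y: "y \<in> space N"
    have [measurable]: "(\<lambda>x. F x y) \<in> borel_measurable M"
      using measurable_Pair1[OF F y] by simp
    show "(\<integral>\<^sup>+x. (\<integral>\<^sup>+z. F x y * F x z \<partial>N) \<partial>M) = (\<integral>\<^sup>+z. (\<integral>\<^sup>+x. F x y * F x z \<partial>M) \<partial>N)"
      by (rule MN.Fubini'[symmetric]) measurable
  qed
  also have "\<dots> \<le> (\<integral>\<^sup>+y. (\<integral>\<^sup>+z. G y * G z \<partial>N) \<partial>N)"
    by (intro nn_integral_mono cs)
  also have "\<dots> = (\<integral>\<^sup>+y. G y \<partial>N)\<^sup>2"
    by (simp add: power2_eq_square nn_integral_cmult nn_integral_multc)
  finally show ?thesis .
qed

subsection \<open>Regularity of the tension map\<close>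

lemma lebesgue_translate: "distr lebesgue lebesgue (\<lambda>x. t + x) = (lebesgue :: 'a::euclidean_space measure)"
  using lebesgue_affine_euclidean[of "\<lambda>_. 1" t] by (simp add: euclidean_representation density_1)

lemma measurable_lebesgue_translate: "(\<lambda>x. t + x) \<in> lebesgue \<rightarrow>\<^sub>M (lebesgue :: 'a::euclidean_space measure)"
  using lebesgue_affine_measurable[of "\<lambda>_. 1" t] by (simp add: euclidean_representation)

lemma lebesgue_integral_translate:
  fixes f :: "'a::euclidean_space \<Rightarrow> real"
  assumes "f \<in> borel_measurable lebesgue"
  shows "(LINT x|lebesgue. f (t + x)) = (LINT x|lebesgue. f x)"
  using integral_distr[OF measurable_lebesgue_translate assms, of t] by (simp add: lebesgue_translate)

text \<open>Dominated convergence along sequences tending to 0, with a domination that holds only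
  for |s| \<le> 1.\<close>

lemma has_real_derivative_LINT:
  fixes F :: "real \<Rightarrow> 'a \<Rightarrow> real"
  assumes int: "\<And>s. integrable M (F s)" and F': "F' \<in> borel_measurable M"
    and d: "\<And>z. z \<in> space M \<Longrightarrow> ((\<lambda>s. F s z) has_real_derivative F' z) (at 0)"
    and w: "integrable M w" and bd: "\<And>s z. \<bar>s\<bar> \<le> 1 \<Longrightarrow> z \<in> space M \<Longrightarrow> \<bar>F s z - F 0 z\<bar> \<le> \<bar>s\<bar> * w z"
  shows "((\<lambda>s. LINT z|M. F s z) has_real_derivative (LINT z|M. F' z)) (at 0)"
proof -
  have "((\<lambda>s. ((LINT z|M. F s z) - (LINT z|M. F 0 z)) / s) \<longlongrightarrow> (LINT z|M. F' z)) (at 0)"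
    unfolding tendsto_at_iff_sequentially comp_def
  proof (intro allI impI)
    fix X :: "nat \<Rightarrow> real" assume X: "\<forall>i. X i \<in> UNIV - {0}" "X \<longlonglongrightarrow> 0"
    have X0: "X i \<noteq> 0" for i using X(1) by auto
    \<comment> \<open>The indicator discards the finitely many indices with |X i| > 1, so that the
      dominating function works for all indices while the limit is unaffected.\<close>
    have "(\<lambda>i. LINT z|M. (F (X i) z - F 0 z) / X i * indicator {j. \<bar>X j\<bar> \<le> 1} i) \<longlonglongrightarrow> (LINT z|M. F' z)"
    proof (rule integral_dominated_convergence[where w=w])
      show "AE z in M. norm ((F (X i) z - F 0 z) / X i * indicator {j. \<bar>X j\<bar> \<le> 1} i) \<le> w z" for i
      proof (rule AE_I2)
        fix z assume z: "z \<in> space M"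
        have "0 \<le> w z" using bd[of 1 z] z by simp
        then show "norm ((F (X i) z - F 0 z) / X i * indicator {j. \<bar>X j\<bar> \<le> 1} i) \<le> w z"
          using bd[of "X i" z] z X0[of i] by (auto simp: indicator_def field_simps)
      qed
      have ev: "\<forall>\<^sub>F i in sequentially. \<bar>X i\<bar> \<le> 1"
        using X(2) by (auto simp: tendsto_iff dist_real_def dest!: spec[of _ 1] elim!: eventually_mono)
      show "AE z in M. (\<lambda>i. (F (X i) z - F 0 z) / X i * indicator {j. \<bar>X j\<bar> \<le> 1} i) \<longlonglongrightarrow> F' z"
      proof (rule AE_I2)
        fix z assume "z \<in> space M"
        then have "((\<lambda>s. (F s z - F 0 z) / s) \<longlongrightarrow> F' z) (at 0)"
          using d[of z] by (simp add: has_field_derivative_iff)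
        then have "(\<lambda>i. (F (X i) z - F 0 z) / X i) \<longlonglongrightarrow> F' z"
          using X unfolding tendsto_at_iff_sequentially comp_def by blast
        then show "(\<lambda>i. (F (X i) z - F 0 z) / X i * indicator {j. \<bar>X j\<bar> \<le> 1} i) \<longlonglongrightarrow> F' z"
          by (rule Lim_transform_eventually) (use ev in \<open>auto elim!: eventually_mono simp: indicator_def\<close>)
      qed
    qed (use int w F' in measurable)
    moreover have "\<forall>\<^sub>F i in sequentially. (LINT z|M. (F (X i) z - F 0 z) / X i * indicator {j. \<bar>X j\<bar> \<le> 1} i) = ((LINT z|M. F (X i) z) - (LINT z|M. F 0 z)) / X i"
      using X(2) by (auto simp: tendsto_iff dist_real_def int dest!: spec[of _ 1] elim!: eventually_mono)
    ultimately show "(\<lambda>i. ((LINT z|M. F (X i) z) - (LINT z|M. F 0 z)) / X i) \<longlonglongrightarrow> (LINT z|M. F' z)"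
      by (rule Lim_transform_eventually)
  qed
  then show ?thesis by (simp add: has_field_derivative_iff)
qed

lemma DERIV_at_zero_shift: "((\<lambda>s. F (x + s)) has_real_derivative d) (at 0) \<Longrightarrow> (F has_real_derivative d) (at x)"
  using DERIV_shift[of F d 0 x] by (simp add: add.commute)

text \<open>The complement is open and null, hence empty. This upgrades almost everywhere bounds of
  continuous quantities to every point.\<close>

lemma AE_closed_imp_everywhere:
  fixes S :: "'a::euclidean_space set"
  assumes "AE z in lborel. z \<in> S" "closed S"
  shows "z \<in> S"
proof (rule ccontr)
  assume "z \<notin> S"
  then have "\<not> negligible (- S)" using assms(2) by (intro open_not_negligible) auto
  moreover have "- S \<in> null_sets lborel" using assms by (simp add: AE_iff_null_sets borel_comp borel_closed)
  ultimately show False by (simp add: negligible_iff_null_sets null_sets_completionI)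
qed

text \<open>Fubini's theorem: the exceptional set is covered by a Borel null set \<open>N\<close>,
  every translate of which is null; exchanging the two quantifiers shows that almost every line
  meets \<open>N\<close> in a null set.\<close>

lemma AE_line:
  fixes e :: "'a::euclidean_space"
  assumes "AE z in lebesgue. P z"
  shows "AE z in lborel. negligible {s::real. \<not> P (z + s *\<^sub>R e)}"
proof -
  have "AE z in lborel. P z" using assms by (simp add: AE_completion_iff)
  then obtain N where "{z \<in> space lborel. \<not> P z} \<subseteq> N" "emeasure lborel N = 0" "N \<in> sets lborel"
    by (rule AE_E)
  then have N: "{z. \<not> P z} \<subseteq> N" "N \<in> null_sets lborel" by auto
  have [measurable]: "N \<in> sets borel" using N(2) by auto
  have "AE z in lborel. z + s *\<^sub>R e \<notin> N" for s
  proof -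
    have "negligible N" using N(2) by (simp add: negligible_iff_null_sets null_sets_completionI)
    then have "negligible ((+) (- (s *\<^sub>R e)) ` N)" by (rule negligible_translation)
    moreover have "(+) (- (s *\<^sub>R e)) ` N = {z. z + s *\<^sub>R e \<in> N}"
      by (auto simp: image_iff intro!: bexI[where x="_ + s *\<^sub>R e"])
    moreover have "{z. z + s *\<^sub>R e \<in> N} \<in> sets borel" by measurable
    ultimately have "{z. z + s *\<^sub>R e \<in> N} \<in> null_sets lborel"
      by (simp add: negligible_iff_null_sets null_sets_def)
    then show ?thesis using AE_not_in by force
  qed
  then have "AE s in lborel. AE z in lborel. z + s *\<^sub>R e \<notin> N" by simp
  then have "AE z in lborel. AE s in lborel. z + s *\<^sub>R e \<notin> N"
  proof (subst (asm) lborel_pair.AE_commute)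
    have "(\<lambda>x. snd x + fst x *\<^sub>R e) \<in> borel_measurable (lborel \<Otimes>\<^sub>M lborel)" by measurable
    from measurable_sets[OF this, of "- N"]
    show "{x \<in> space (lborel \<Otimes>\<^sub>M lborel). snd x + fst x *\<^sub>R e \<notin> N} \<in> sets (lborel \<Otimes>\<^sub>M lborel)"
      by (simp add: vimage_def Int_def conj_commute)
  qed
  then show ?thesis
  proof (rule AE_mp, intro AE_I2 impI)
    fix z assume "AE s in lborel. z + s *\<^sub>R e \<notin> N"
    then have "{s. z + s *\<^sub>R e \<in> N} \<in> null_sets lborel"
      by (subst AE_iff_null_sets) (auto, measurable)
    then have "negligible {s. z + s *\<^sub>R e \<in> N}"
      by (simp add: negligible_iff_null_sets null_sets_completionI)
    then show "negligible {s::real. \<not> P (z + s *\<^sub>R e)}"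
      by (rule negligible_subset) (use N(1) in auto)
  qed
qed

text \<open>The fundamental theorem of calculus for the Henstock--Kurzweil integral needs no integrability
  of the derivative, so an almost everywhere bound on it suffices.\<close>

lemma lipschitz_if_AE_bounded_derivative:
  fixes u f :: "'a::euclidean_space \<Rightarrow> real"
  assumes der: "\<And>z. ((\<lambda>s. u (z + s *\<^sub>R e)) has_real_derivative f z) (at 0)"
    and cont: "continuous_on UNIV u" and bd: "AE z in lebesgue. \<bar>f z\<bar> \<le> C"
  shows "\<bar>u (z + k *\<^sub>R e) - u z\<bar> \<le> C * \<bar>k\<bar>"
proof -
  have pos: "\<bar>u (z + k *\<^sub>R e) - u z\<bar> \<le> C * k" if k: "0 \<le> k" for z k
  proof -
    let ?S = "{z. \<bar>u (z + k *\<^sub>R e) - u z\<bar> \<le> C * k}"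
    have "AE z in lborel. z \<in> ?S"
      using AE_line[OF bd, of e]
    proof (rule AE_mp, intro AE_I2 impI)
      fix z assume neg: "negligible {s::real. \<not> \<bar>f (z + s *\<^sub>R e)\<bar> \<le> C}"
      have "((\<lambda>s. f (z + s *\<^sub>R e)) has_integral (u (z + k *\<^sub>R e) - u (z + 0 *\<^sub>R e))) {0..k}"
      proof (rule fundamental_theorem_of_calculus[OF k])
        fix x assume "x \<in> {0..k}"
        have "((\<lambda>s. u (z + s *\<^sub>R e)) has_real_derivative f (z + x *\<^sub>R e)) (at x)"
          using DERIV_at_zero_shift[of "\<lambda>s. u (z + s *\<^sub>R e)" x] der[of "z + x *\<^sub>R e"] by (simp add: scaleR_add_left add.assoc)
        then show "((\<lambda>s. u (z + s *\<^sub>R e)) has_vector_derivative f (z + x *\<^sub>R e)) (at x within {0..k})"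
          by (auto simp: has_real_derivative_iff_has_vector_derivative algebra_simps intro: has_vector_derivative_at_within)
      qed
      then have "((\<lambda>s. if \<bar>f (z + s *\<^sub>R e)\<bar> \<le> C then f (z + s *\<^sub>R e) else 0) has_integral (u (z + k *\<^sub>R e) - u z)) {0..k}"
        using has_integral_spike[OF neg, of "{0..k}" "\<lambda>s. if \<bar>f (z + s *\<^sub>R e)\<bar> \<le> C then f (z + s *\<^sub>R e) else 0" "\<lambda>s. f (z + s *\<^sub>R e)"]
        by auto
      \<comment> \<open>A negative \<open>C\<close> would make the exceptional set the whole line,
        which is not negligible.\<close>
      moreover have "0 \<le> C"
      proof (rule ccontr)
        assume "\<not> 0 \<le> C"
        then have "{s::real. \<not> \<bar>f (z + s *\<^sub>R e)\<bar> \<le> C} = UNIV" by auto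
        with neg show False by simp
      qed
      ultimately have "norm (u (z + k *\<^sub>R e) - u z) \<le> C * measure lborel {0..k}"
        by (intro has_integral_bound_real[where f="\<lambda>s. if \<bar>f (z + s *\<^sub>R e)\<bar> \<le> C then f (z + s *\<^sub>R e) else 0"]) auto
      then show "z \<in> ?S" using k by simp
    qed
    moreover have "closed ?S"
      by (intro closed_Collect_le continuous_intros continuous_on_compose2[OF cont]) auto
    ultimately show ?thesis using AE_closed_imp_everywhere[of ?S z] by simp
  qed
  show ?thesis
  proof (cases "0 \<le> k")
    case False
    then show ?thesis using pos[of "-k" "z + k *\<^sub>R e"] by (simp add: abs_minus_commute)
  qed (use pos in simp)
qed

text \<open>The positive part is squared to be continuously differentiable, the regularity that
  \<open>weak_partial\<close> asks of test functions. The bump vanishes outside the ball of radius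
  \<epsilon> around \<open>c\<close>, and the explicit form makes the dependence on \<open>c\<close>
  computable.\<close>

definition bump :: "real \<Rightarrow> 'a::euclidean_space \<Rightarrow> 'a \<Rightarrow> real" where
  "bump \<epsilon> c z = (max 0 (1 - ((z - c) \<bullet> (z - c)) / \<epsilon>\<^sup>2))\<^sup>2"

definition bump_partial :: "real \<Rightarrow> 'a::euclidean_space \<Rightarrow> 'a \<Rightarrow> 'a \<Rightarrow> real" where
  "bump_partial \<epsilon> c b z = 2 * max 0 (1 - ((z - c) \<bullet> (z - c)) / \<epsilon>\<^sup>2) * (- 2 * ((z - c) \<bullet> b) / \<epsilon>\<^sup>2)"

lemma has_real_derivative_pos_part_sq: "((\<lambda>x. (max 0 x)\<^sup>2) has_real_derivative 2 * max 0 x) (at x)"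
proof -
  consider "x > 0" | "x < 0" | "x = 0" by linarith
  then show ?thesis
  proof cases
    case 1
    have "((\<lambda>x. x\<^sup>2) has_real_derivative 2 * max 0 x) (at x)" using 1 by (auto intro!: derivative_eq_intros)
    then show ?thesis
      by (rule DERIV_cong_ev[THEN iffD1, rotated -1, OF _ refl _ refl])
         (use 1 eventually_nhds_in_open[of "{0<..}" x] in \<open>auto elim!: eventually_mono\<close>)
  next
    case 2
    have "((\<lambda>x. 0) has_real_derivative 2 * max 0 x) (at x)" using 2 by (auto intro!: derivative_eq_intros)
    then show ?thesis
      by (rule DERIV_cong_ev[THEN iffD1, rotated -1, OF _ refl _ refl])
         (use 2 eventually_nhds_in_open[of "{..<0}" x] in \<open>auto elim!: eventually_mono\<close>)
  next
    case 3
    have "((\<lambda>h::real. (max 0 h)\<^sup>2 / h) \<longlongrightarrow> 0) (at 0)"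
    proof (rule tendsto_rabs_zero_cancel, rule tendsto_sandwich[where f="\<lambda>_. 0" and h="\<lambda>h. \<bar>h\<bar>"])
      show "\<forall>\<^sub>F h::real in at 0. \<bar>(max 0 h)\<^sup>2 / h\<bar> \<le> \<bar>h\<bar>"
        by (intro always_eventually allI) (auto simp: max_def power2_eq_square)
      show "((\<lambda>h::real. \<bar>h\<bar>) \<longlongrightarrow> 0) (at 0)" by (rule tendsto_rabs_zero) (rule tendsto_ident_at)
    qed auto
    then show ?thesis using 3 by (simp add: has_field_derivative_iff)
  qed
qed

lemma bump_has_derivative:
  assumes "\<epsilon> \<noteq> 0"
  shows "(bump \<epsilon> c has_derivative (\<lambda>h. bump_partial \<epsilon> c h z)) (at z)"
proof -
  have "((\<lambda>z. 1 - ((z - c) \<bullet> (z - c)) * inverse (\<epsilon>\<^sup>2)) has_derivative (\<lambda>h. - (2 * ((z - c) \<bullet> h)) * inverse (\<epsilon>\<^sup>2))) (at z)"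
    by (auto intro!: derivative_eq_intros simp: inner_commute)
  from has_derivative_compose[OF this has_real_derivative_pos_part_sq[THEN has_field_derivative_imp_has_derivative]]
  show ?thesis unfolding bump_def bump_partial_def divide_inverse by (simp add: mult_ac)
qed

lemma bump_C1: assumes "\<epsilon> \<noteq> 0" shows "Ck_on 1 UNIV (bump \<epsilon> (c::'a::euclidean_space))"
proof -
  have eq: "bump_partial \<epsilon> c h z = (\<Sum>b\<in>Basis. (h \<bullet> b) *\<^sub>R bump_partial \<epsilon> c b z)" for h z :: 'a
    by (simp add: bump_partial_def euclidean_inner[of "z - c" h] sum_distrib_left sum_divide_distrib mult_ac flip: sum_negf)
  have "(bump \<epsilon> c has_derivative (\<lambda>h. \<Sum>b\<in>Basis. (h \<bullet> b) *\<^sub>R bump_partial \<epsilon> c b z)) (at z)" for z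
    by (rule has_derivative_eq_rhs[OF bump_has_derivative[OF assms]]) (rule ext, rule eq)
  moreover have "continuous_on UNIV (bump_partial \<epsilon> c b)" for b
    unfolding bump_partial_def[abs_def] using assms by (intro continuous_intros) auto
  ultimately show ?thesis unfolding One_nat_def Ck_on.simps by auto
qed

lemma bump_support: "\<epsilon> > 0 \<Longrightarrow> bump \<epsilon> c z \<noteq> 0 \<Longrightarrow> norm (z - c) < \<epsilon>"
proof -
  assume "\<epsilon> > 0" "bump \<epsilon> c z \<noteq> 0"
  then have "(norm (z - c))\<^sup>2 < \<epsilon>\<^sup>2"
    by (auto simp: bump_def max_def dot_square_norm field_simps split: if_splits intro!: power_strict_mono)
  then show ?thesis using \<open>\<epsilon> > 0\<close> by (simp add: power_less_imp_less_base)
qed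

lemma bump_nonneg: "0 \<le> bump \<epsilon> c z" by (simp add: bump_def)

lemma bump_le_1: "bump \<epsilon> c z \<le> 1"
  unfolding bump_def by (intro power_le_one) auto

lemma bump_measurable_lebesgue [measurable]: "bump \<epsilon> c \<in> borel_measurable lebesgue"
proof -
  have "bump \<epsilon> c \<in> borel_measurable borel" unfolding bump_def[abs_def] by measurable
  then show ?thesis by (simp add: measurable_completion)
qed

text \<open>A difference of squares of numbers in [0,1], whose own difference is controlled because
  |z - c|^2 - |z - c'|^2 is the inner product of c' - c with the sum of z - c and z - c'. It
  dominates the difference quotients when the centre is moved.\<close>

lemma bump_center_lipschitz:
  assumes \<epsilon>: "\<epsilon> > 0" and z: "norm (z - c) \<le> R" "norm (z - c') \<le> R"
  shows "\<bar>bump \<epsilon> c z - bump \<epsilon> c' z\<bar> \<le> 4 * R / \<epsilon>\<^sup>2 * norm (c - c')"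
proof -
  let ?p = "\<lambda>c. max 0 (1 - ((z - c) \<bullet> (z - c)) / \<epsilon>\<^sup>2)"
  have p: "0 \<le> ?p c" "?p c \<le> 1" for c by auto
  have "\<bar>bump \<epsilon> c z - bump \<epsilon> c' z\<bar> = \<bar>?p c + ?p c'\<bar> * \<bar>?p c - ?p c'\<bar>"
    unfolding bump_def by (simp add: power2_eq_square square_diff_square_factored abs_mult)
  also have "\<dots> \<le> 2 * \<bar>?p c - ?p c'\<bar>"
  proof (rule mult_right_mono)
    show "\<bar>?p c + ?p c'\<bar> \<le> 2" using p[of c] p[of c'] by linarith
  qed simp
  also have "\<bar>?p c - ?p c'\<bar> \<le> \<bar>((z - c) \<bullet> (z - c)) / \<epsilon>\<^sup>2 - ((z - c') \<bullet> (z - c')) / \<epsilon>\<^sup>2\<bar>" by linarith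
  also have "\<dots> = \<bar>(c' - c) \<bullet> ((z - c) + (z - c'))\<bar> / \<epsilon>\<^sup>2"
    by (simp add: diff_divide_distrib[symmetric] inner_diff_left inner_diff_right inner_add_right inner_commute algebra_simps)
  also have "\<dots> \<le> (norm (c' - c) * (R + R)) / \<epsilon>\<^sup>2"
    using z by (intro divide_right_mono order_trans[OF Cauchy_Schwarz_ineq2] mult_left_mono order_trans[OF norm_triangle_ineq]) auto
  finally show ?thesis by (simp add: norm_minus_commute mult_ac)
qed

lemma integrable_bump:
  fixes f :: "'a::euclidean_space \<Rightarrow> real"
  assumes \<epsilon>: "\<epsilon> > 0" and f: "f \<in> borel_measurable lebesgue" and bd: "AE z in lebesgue. z \<in> cball c \<epsilon> \<longrightarrow> \<bar>f z\<bar> \<le> C"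
  shows "integrable lebesgue (\<lambda>z. bump \<epsilon> c z * f z)"
proof (rule Bochner_Integration.integrable_bound)
  show "integrable lebesgue (\<lambda>z. indicator (cball c \<epsilon>) z *\<^sub>R C)"
    using emeasure_lborel_cball_finite[of c \<epsilon>] by (intro integrable_real_indicator[THEN integrable_scaleR_left]) auto
  show "(\<lambda>z. bump \<epsilon> c z * f z) \<in> borel_measurable lebesgue" using f by measurable
  show "AE z in lebesgue. norm (bump \<epsilon> c z * f z) \<le> norm (indicator (cball c \<epsilon>) z *\<^sub>R C)"
    using bd
  proof (rule AE_mp, intro AE_I2 impI)
    fix z assume a: "z \<in> cball c \<epsilon> \<longrightarrow> \<bar>f z\<bar> \<le> C"
    show "norm (bump \<epsilon> c z * f z) \<le> norm (indicator (cball c \<epsilon>) z *\<^sub>R C)"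
    proof (cases "bump \<epsilon> c z = 0")
      case False
      then have z: "z \<in> cball c \<epsilon>" using bump_support[OF \<epsilon> False] by (simp add: dist_norm norm_minus_commute)
      have "norm (bump \<epsilon> c z * f z) \<le> 1 * C"
        unfolding real_norm_def abs_mult using a z bump_nonneg[of \<epsilon> c z] bump_le_1[of \<epsilon> c z] by (intro mult_mono) auto
      then show ?thesis using z by simp
    qed simp
  qed
qed

text \<open>
  A weak derivative bounded by \<open>Cg\<close> controls the mixed second differences of the primitive \<open>u\<close>: if the
  bound failed somewhere, it would fail on a ball, and testing with bumps there gives a contradiction.
\<close>

lemma second_difference_bound:
  fixes u f g :: "'a::euclidean_space \<Rightarrow> real"
  assumes der: "\<And>z. ((\<lambda>s. u (z + s *\<^sub>R e)) has_real_derivative f z) (at 0)"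
    and cont: "continuous_on UNIV u" and f: "f \<in> borel_measurable lebesgue" and fbd: "AE z in lebesgue. \<bar>f z\<bar> \<le> Cf"
    and g: "g \<in> borel_measurable lebesgue" and gbd: "AE z in lebesgue. \<bar>g z\<bar> \<le> Cg"
    and weak: "\<And>\<epsilon> c. \<epsilon> > 0 \<Longrightarrow> (LINT z|lebesgue. bump_partial \<epsilon> c b z * f z) = - (LINT z|lebesgue. bump \<epsilon> c z * g z)" and b: "b \<in> Basis"
  shows "\<bar>f (z + h *\<^sub>R b) - f z\<bar> \<le> Cg * \<bar>h\<bar>"
proof -
  have um [measurable]: "u \<in> borel_measurable lebesgue"
    using borel_measurable_continuous_onI[OF cont] by (simp add: measurable_completion)
  note f [measurable] g [measurable]
  have tr: "bump \<epsilon> (c + v) (v + z) = bump \<epsilon> c z" for \<epsilon> and c v z :: 'a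
    by (simp add: bump_def)
  have tr2: "bump \<epsilon> (c + v) (z + v) = bump \<epsilon> c z" for \<epsilon> and c v z :: 'a
    by (simp add: bump_def)
  have sd: "\<bar>u (x + h *\<^sub>R b + k *\<^sub>R e) - u (x + k *\<^sub>R e) - (u (x + h *\<^sub>R b) - u x)\<bar> \<le> Cg * \<bar>h\<bar> * \<bar>k\<bar>" for x k h
  proof (rule ccontr)
    assume neg: "\<not> ?thesis"
    let ?W = "\<lambda>z. u (z + h *\<^sub>R b + k *\<^sub>R e) - u (z + k *\<^sub>R e) - (u (z + h *\<^sub>R b) - u z)"
    have Wc: "continuous_on UNIV ?W"
      by (intro continuous_intros continuous_on_compose2[OF cont]) auto
    \<comment> \<open>The sign \<sigma> of \<open>?W x\<close> removes the absolute value, and by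
      continuity the strict inequality persists on a ball.\<close>
    obtain \<epsilon> \<sigma> where \<epsilon>: "\<epsilon> > 0" and \<sigma>: "\<bar>\<sigma>\<bar> = 1" "\<And>z. norm (z - x) < \<epsilon> \<Longrightarrow> \<sigma> * ?W z > Cg * \<bar>h\<bar> * \<bar>k\<bar>"
    proof -
      define \<sigma> where "\<sigma> = (if ?W x \<ge> 0 then 1 else -1 :: real)"
      have "continuous_on UNIV (\<lambda>z. \<sigma> * ?W z)" by (rule continuous_on_mult_left[OF Wc])
      then have "isCont (\<lambda>z. \<sigma> * ?W z) x" by (simp only: continuous_on_eq_continuous_at[OF open_UNIV]) simp
      moreover have "\<sigma> * ?W x > Cg * \<bar>h\<bar> * \<bar>k\<bar>" using neg by (auto simp: \<sigma>_def not_le)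
      ultimately have "\<forall>\<^sub>F z in nhds x. \<sigma> * ?W z > Cg * \<bar>h\<bar> * \<bar>k\<bar>"
        using order_tendstoD(1)[OF tendsto_at_iff_tendsto_nhds[of "\<lambda>z. \<sigma> * ?W z" x, THEN iffD1]]
        by (simp add: isCont_def)
      then obtain d where "d > 0" "\<And>z. dist z x < d \<Longrightarrow> \<sigma> * ?W z > Cg * \<bar>h\<bar> * \<bar>k\<bar>"
        by (auto simp: eventually_nhds_metric)
      then show thesis by (intro that[of d \<sigma>]) (auto simp: dist_norm \<sigma>_def)
    qed
    define I where "I = (LINT z|lebesgue. bump \<epsilon> (0::'a) z)"
    have I: "(LINT z|lebesgue. bump \<epsilon> c z) = I" for c :: 'a
      using lebesgue_integral_translate[OF bump_measurable_lebesgue, of \<epsilon> "c" c] tr[of \<epsilon> 0 c] by (simp add: I_def)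
    have int1: "integrable lebesgue (bump \<epsilon> c)" for c :: 'a
      using integrable_bump[OF \<epsilon>, of "\<lambda>_. 1" c 1] by simp
    have intf: "integrable lebesgue (\<lambda>z. bump \<epsilon> c z * f z)" "integrable lebesgue (\<lambda>z. bump \<epsilon> c z * g z)" for c
      by (rule integrable_bump[OF \<epsilon> f, where C=Cf], use fbd in eventually_elim, simp)
        (rule integrable_bump[OF \<epsilon> g, where C=Cg], use gbd in eventually_elim, simp)
    have intu: "integrable lebesgue (\<lambda>z. bump \<epsilon> c z * u (z + v))" for c v
    proof -
      have "compact ((\<lambda>z. u (z + v)) ` cball c \<epsilon>)"
        by (intro compact_continuous_image continuous_on_compose2[OF cont] continuous_intros) auto
      then obtain C where "\<And>z. z \<in> cball c \<epsilon> \<Longrightarrow> \<bar>u (z + v)\<bar> \<le> C"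
        using compact_imp_bounded bounded_iff by (metis imageI real_norm_def)
      moreover have "(\<lambda>z. u (z + v)) \<in> borel_measurable lebesgue"
        using measurable_compose[OF measurable_lebesgue_translate um, of v] by (simp add: add.commute)
      ultimately show ?thesis by (intro integrable_bump[OF \<epsilon>, where C=C]) auto
    qed
    let ?A = "\<lambda>c. LINT z|lebesgue. bump \<epsilon> c z * f z"
    let ?B = "\<lambda>c. LINT z|lebesgue. bump \<epsilon> c z * u z"
    \<comment> \<open>Moving the centre differentiates the bump, with the opposite sign of its
      derivative in \<open>z\<close>; the weak derivative then passes from the bump to
      \<open>f\<close>.\<close>
    have A_deriv: "((\<lambda>s. ?A (c + s *\<^sub>R b)) has_real_derivative (LINT z|lebesgue. bump \<epsilon> c z * g z)) (at 0)" for c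
    proof -
      have "((\<lambda>s. ?A (c + s *\<^sub>R b)) has_real_derivative (LINT z|lebesgue. (- bump_partial \<epsilon> c b z) * f z)) (at 0)"
      proof (rule has_real_derivative_LINT[where w="\<lambda>z. 4 * (\<epsilon> + 1) / \<epsilon>\<^sup>2 * (indicator (cball c (\<epsilon> + 1)) z * \<bar>f z\<bar>)"])
        show "(\<lambda>z. - bump_partial \<epsilon> c b z * f z) \<in> borel_measurable lebesgue"
        proof -
          have "bump_partial \<epsilon> c b \<in> borel_measurable borel" unfolding bump_partial_def by measurable
          then have [measurable]: "bump_partial \<epsilon> c b \<in> borel_measurable lebesgue" by (simp add: measurable_completion)
          show ?thesis by measurable
        qed
        fix z
        have "((\<lambda>s. bump \<epsilon> (c + s *\<^sub>R b) z) has_real_derivative - bump_partial \<epsilon> c b z) (at 0)"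
        proof -
          have "((\<lambda>s::real. z - s *\<^sub>R b) has_derivative (\<lambda>s. - (s *\<^sub>R b))) (at 0)"
            by (auto intro!: derivative_eq_intros)
          from has_derivative_compose[OF this, of "bump \<epsilon> c"] bump_has_derivative[of \<epsilon> c z] \<epsilon>
          have "((\<lambda>s. bump \<epsilon> c (z - s *\<^sub>R b)) has_derivative (\<lambda>s. bump_partial \<epsilon> c (- (s *\<^sub>R b)) z)) (at 0)" by simp
          moreover have "bump \<epsilon> c (z - s *\<^sub>R b) = bump \<epsilon> (c + s *\<^sub>R b) z" for s by (simp add: bump_def algebra_simps)
          moreover have "(\<lambda>s. bump_partial \<epsilon> c (- (s *\<^sub>R b)) z) = (*) (- bump_partial \<epsilon> c b z)"
            by (auto simp: bump_partial_def)
          ultimately show ?thesis by (simp add: has_field_derivative_def)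
        qed
        then show "((\<lambda>s. bump \<epsilon> (c + s *\<^sub>R b) z * f z) has_real_derivative - bump_partial \<epsilon> c b z * f z) (at 0)"
          by (rule DERIV_cmult_right)
        fix s :: real assume s: "\<bar>s\<bar> \<le> 1"
        show "\<bar>bump \<epsilon> (c + s *\<^sub>R b) z * f z - bump \<epsilon> (c + 0 *\<^sub>R b) z * f z\<bar>
           \<le> \<bar>s\<bar> * (4 * (\<epsilon> + 1) / \<epsilon>\<^sup>2 * (indicator (cball c (\<epsilon> + 1)) z * \<bar>f z\<bar>))"
        proof (cases "bump \<epsilon> (c + s *\<^sub>R b) z = 0 \<and> bump \<epsilon> c z = 0")
          case False
          have nsb: "norm (s *\<^sub>R b) \<le> 1" using s b by simp
          have "norm (z - c) < \<epsilon> \<or> norm (z - (c + s *\<^sub>R b)) < \<epsilon>" using False bump_support[OF \<epsilon>] by blast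
          then have n: "norm (z - c) \<le> \<epsilon> + 1" "norm (z - (c + s *\<^sub>R b)) \<le> \<epsilon> + 1"
            using nsb norm_triangle_ineq[of "z - (c + s *\<^sub>R b)" "s *\<^sub>R b"] norm_triangle_ineq4[of "z - c" "s *\<^sub>R b"]
            by (auto simp: algebra_simps)
          have "\<bar>bump \<epsilon> (c + s *\<^sub>R b) z - bump \<epsilon> c z\<bar> \<le> 4 * (\<epsilon> + 1) / \<epsilon>\<^sup>2 * \<bar>s\<bar>"
            using bump_center_lipschitz[OF \<epsilon> n(2,1)] b by simp
          note 1 = mult_right_mono[OF this, of "\<bar>f z\<bar>"]
          have e: "bump \<epsilon> (c + s *\<^sub>R b) z * f z - bump \<epsilon> (c + 0 *\<^sub>R b) z * f z = (bump \<epsilon> (c + s *\<^sub>R b) z - bump \<epsilon> c z) * f z"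
            by (simp add: left_diff_distrib)
          have "z \<in> cball c (\<epsilon> + 1)" using n(1) by (simp add: dist_norm norm_minus_commute)
          then show ?thesis unfolding e abs_mult using 1 by (simp add: mult_ac)
        qed (use \<epsilon> in auto)
      next
        show "integrable lebesgue (\<lambda>z. bump \<epsilon> (c + s *\<^sub>R b) z * f z)" for s by (rule intf)
        have "integrable lebesgue (\<lambda>z. indicator (cball c (\<epsilon> + 1)) z * \<bar>f z\<bar>)"
        proof (rule Bochner_Integration.integrable_bound)
          show "integrable lebesgue (\<lambda>z. indicator (cball c (\<epsilon> + 1)) z *\<^sub>R Cf)"
            using emeasure_lborel_cball_finite[of c "\<epsilon> + 1"] by (intro integrable_real_indicator[THEN integrable_scaleR_left]) auto
          show "AE z in lebesgue. norm (indicator (cball c (\<epsilon> + 1)) z * \<bar>f z\<bar>) \<le> norm (indicator (cball c (\<epsilon> + 1)) z *\<^sub>R Cf)"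
            using fbd by (rule AE_mp) (auto simp: indicator_def)
        qed (use f in \<open>auto intro!: borel_measurable_times borel_measurable_indicator\<close>)
        then show "integrable lebesgue (\<lambda>z. 4 * (\<epsilon> + 1) / \<epsilon>\<^sup>2 * (indicator (cball c (\<epsilon> + 1)) z * \<bar>f z\<bar>))"
          by (rule integrable_mult_right)
      qed
      moreover have "(LINT z|lebesgue. (- bump_partial \<epsilon> c b z) * f z) = (LINT z|lebesgue. bump \<epsilon> c z * g z)"
        using weak[OF \<epsilon>, of c] by simp
      ultimately show ?thesis by simp
    qed
    have A_lip: "\<bar>?A (c + h *\<^sub>R b) - ?A c\<bar> \<le> Cg * I * \<bar>h\<bar>" for c
    proof -
      have gI: "\<bar>LINT z|lebesgue. bump \<epsilon> c z * g z\<bar> \<le> Cg * I" for c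
      proof -
        have "\<bar>LINT z|lebesgue. bump \<epsilon> c z * g z\<bar> \<le> (LINT z|lebesgue. \<bar>bump \<epsilon> c z * g z\<bar>)" by (rule integral_abs_bound)
        also have "\<dots> \<le> (LINT z|lebesgue. Cg * bump \<epsilon> c z)"
        proof (rule integral_mono_AE)
          show "AE z in lebesgue. \<bar>bump \<epsilon> c z * g z\<bar> \<le> Cg * bump \<epsilon> c z"
            using gbd by (rule AE_mp) (auto intro!: AE_I2 mult_right_mono simp: abs_mult bump_nonneg mult.commute[of "bump \<epsilon> c _"])
        qed (use intf int1 in auto)
        also have "\<dots> = Cg * I" by (simp add: I)
        finally show ?thesis .
      qed
      have "norm (?A (c + h *\<^sub>R b) - ?A (c + 0 *\<^sub>R b)) \<le> Cg * I * norm (h - 0)"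
      proof (rule field_differentiable_bound[of UNIV "\<lambda>h. ?A (c + h *\<^sub>R b)" "\<lambda>s. LINT z|lebesgue. bump \<epsilon> (c + s *\<^sub>R b) z * g z"])
        fix s
        show "((\<lambda>h. ?A (c + h *\<^sub>R b)) has_real_derivative (LINT z|lebesgue. bump \<epsilon> (c + s *\<^sub>R b) z * g z)) (at s within UNIV)"
          using DERIV_at_zero_shift[of "\<lambda>h. ?A (c + h *\<^sub>R b)" s] A_deriv[of "c + s *\<^sub>R b"] by (simp add: scaleR_add_left add.assoc)
      qed (use gI in auto)
      then show ?thesis by simp
    qed
    \<comment> \<open>Here the bump is held fixed and \<open>u\<close> is translated instead, so
      that the derivative falls on \<open>u\<close>; the Lipschitz bound of \<open>u\<close> along
      \<open>e\<close> provides the domination.\<close>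
    have B_deriv: "((\<lambda>s. ?B (c + s *\<^sub>R e)) has_real_derivative ?A c) (at 0)" for c
    proof -
      have "?B (c + v) = (LINT z|lebesgue. bump \<epsilon> c z * u (z + v))" for v
        using lebesgue_integral_translate[of "\<lambda>z. bump \<epsilon> (c + v) z * u z" v] by (simp add: tr tr2 add.commute[of v])
      moreover have "((\<lambda>s. LINT z|lebesgue. bump \<epsilon> c z * u (z + s *\<^sub>R e)) has_real_derivative ?A c) (at 0)"
      proof (rule has_real_derivative_LINT[where w="\<lambda>z. Cf * bump \<epsilon> c z"])
        show "((\<lambda>s. bump \<epsilon> c z * u (z + s *\<^sub>R e)) has_real_derivative bump \<epsilon> c z * f z) (at 0)" for z
          using der[of z] by (rule DERIV_cmult)
        show "\<bar>bump \<epsilon> c z * u (z + s *\<^sub>R e) - bump \<epsilon> c z * u (z + 0 *\<^sub>R e)\<bar> \<le> \<bar>s\<bar> * (Cf * bump \<epsilon> c z)" for s z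
        proof -
          have e: "bump \<epsilon> c z * u (z + s *\<^sub>R e) - bump \<epsilon> c z * u (z + 0 *\<^sub>R e) = bump \<epsilon> c z * (u (z + s *\<^sub>R e) - u z)"
            by (simp add: right_diff_distrib)
          show ?thesis
            unfolding e abs_mult using mult_left_mono[OF lipschitz_if_AE_bounded_derivative[OF der cont fbd, of z s] bump_nonneg[of \<epsilon> c z]]
            by (simp add: bump_nonneg mult_ac)
        qed
      qed (use intu int1 in auto)
      ultimately show ?thesis by simp
    qed
    \<comment> \<open>The mean value inequality in \<open>k\<close>: the derivative of the
      difference of the two averages is an increment of \<open>?A\<close> along \<open>b\<close>,
      which \<open>A_lip\<close> bounds.\<close>
    have "norm ((?B (x + h *\<^sub>R b + k *\<^sub>R e) - ?B (x + k *\<^sub>R e)) - (?B (x + h *\<^sub>R b + 0 *\<^sub>R e) - ?B (x + 0 *\<^sub>R e))) \<le> (Cg * I * \<bar>h\<bar>) * norm (k - 0)"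
    proof (rule field_differentiable_bound[of UNIV "\<lambda>k. ?B (x + h *\<^sub>R b + k *\<^sub>R e) - ?B (x + k *\<^sub>R e)"
          "\<lambda>k. ?A (x + h *\<^sub>R b + k *\<^sub>R e) - ?A (x + k *\<^sub>R e)"])
      fix s
      have *: "((\<lambda>h. ?B (c + h *\<^sub>R e)) has_real_derivative ?A (c + s *\<^sub>R e)) (at s)" for c
        using DERIV_at_zero_shift[of "\<lambda>h. ?B (c + h *\<^sub>R e)" s] B_deriv[of "c + s *\<^sub>R e"] by (simp add: scaleR_add_left add.assoc)
      show "((\<lambda>k. ?B (x + h *\<^sub>R b + k *\<^sub>R e) - ?B (x + k *\<^sub>R e)) has_real_derivative ?A (x + h *\<^sub>R b + s *\<^sub>R e) - ?A (x + s *\<^sub>R e)) (at s within UNIV)"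
        by (intro DERIV_diff *)
      show "norm (?A (x + h *\<^sub>R b + s *\<^sub>R e) - ?A (x + s *\<^sub>R e)) \<le> Cg * I * \<bar>h\<bar>"
        using A_lip[of "x + s *\<^sub>R e"] by (simp add: add.assoc add.commute[of "h *\<^sub>R b"])
    qed auto
    then have upper: "\<bar>?B (x + h *\<^sub>R b + k *\<^sub>R e) - ?B (x + k *\<^sub>R e) - (?B (x + h *\<^sub>R b) - ?B x)\<bar> \<le> Cg * \<bar>h\<bar> * \<bar>k\<bar> * I"
      by (simp add: mult_ac)
    have Bv: "?B (x + v) = (LINT z|lebesgue. bump \<epsilon> x z * u (z + v))" for v
      using lebesgue_integral_translate[of "\<lambda>z. bump \<epsilon> (x + v) z * u z" v] by (simp add: tr tr2 add.commute[of v])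
    have Weq: "?B (x + h *\<^sub>R b + k *\<^sub>R e) - ?B (x + k *\<^sub>R e) - (?B (x + h *\<^sub>R b) - ?B x) = (LINT z|lebesgue. bump \<epsilon> x z * ?W z)"
      using Bv[of "h *\<^sub>R b + k *\<^sub>R e"] Bv[of "k *\<^sub>R e"] Bv[of "h *\<^sub>R b"] Bv[of 0]
        intu[of x "h *\<^sub>R b + k *\<^sub>R e"] intu[of x "k *\<^sub>R e"] intu[of x "h *\<^sub>R b"] intu[of x 0]
      by (simp add: add.assoc right_diff_distrib)
    \<comment> \<open>The average of \<open>?W\<close> against the bump exceeds the bound strictly,
      as the bump is positive on the ball where the pointwise inequality is strict; this contradicts
      \<open>upper\<close>.\<close>
    have "Cg * \<bar>h\<bar> * \<bar>k\<bar> * I < \<sigma> * (LINT z|lebesgue. bump \<epsilon> x z * ?W z)"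
    proof -
      have Wi: "integrable lebesgue (\<lambda>z. bump \<epsilon> x z * ?W z)"
        using intu[of x "h *\<^sub>R b + k *\<^sub>R e"] intu[of x "k *\<^sub>R e"] intu[of x "h *\<^sub>R b"] intu[of x 0]
        by (simp add: add.assoc right_diff_distrib)
      have "(LINT z|lebesgue. Cg * \<bar>h\<bar> * \<bar>k\<bar> * bump \<epsilon> x z) < (LINT z|lebesgue. \<sigma> * (bump \<epsilon> x z * ?W z))"
      proof (rule ccontr)
        let ?d = "\<lambda>z. \<sigma> * (bump \<epsilon> x z * ?W z) - Cg * \<bar>h\<bar> * \<bar>k\<bar> * bump \<epsilon> x z"
        assume "\<not> ?thesis"
        then have "(LINT z|lebesgue. ?d z) \<le> 0"
          using int1 Wi by (subst Bochner_Integration.integral_diff) auto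
        moreover have dpos: "0 < ?d z" if "z \<in> ball x \<epsilon>" for z
        proof -
          have "((z - x) \<bullet> (z - x)) < \<epsilon>\<^sup>2"
            using that \<epsilon> by (simp add: dot_square_norm dist_norm norm_minus_commute power_strict_mono)
          then have "0 < bump \<epsilon> x z" using \<epsilon> by (simp add: bump_def field_simps)
          then have "Cg * \<bar>h\<bar> * \<bar>k\<bar> * bump \<epsilon> x z < (\<sigma> * ?W z) * bump \<epsilon> x z"
            using \<sigma>(2)[of z] that by (intro mult_strict_right_mono) (auto simp: dist_norm norm_minus_commute)
          then show ?thesis by (simp add: mult_ac)
        qed
        moreover have dnn: "0 \<le> ?d z" for z
        proof (cases "bump \<epsilon> x z = 0")
          case False
          then have "z \<in> ball x \<epsilon>" using bump_support[OF \<epsilon> False] by (simp add: dist_norm norm_minus_commute)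
          then show ?thesis using dpos less_imp_le by blast
        qed simp
        moreover have di: "integrable lebesgue ?d" using int1 Wi by auto
        ultimately have "(LINT z|lebesgue. ?d z) = 0"
          by (intro antisym) (auto intro: Bochner_Integration.integral_nonneg)
        then have "AE z in lebesgue. ?d z = 0"
          using integral_nonneg_eq_0_iff_AE[OF di] dnn by simp
        then have "AE z in lebesgue. z \<notin> ball x \<epsilon>"
        proof eventually_elim
          case (elim z)
          show ?case using dpos[of z] unfolding elim by blast
        qed
        then have "ball x \<epsilon> \<in> null_sets lebesgue" by (subst AE_iff_null_sets) auto
        then show False using open_not_negligible[of "ball x \<epsilon>"] \<epsilon> by (simp add: negligible_iff_null_sets)
      qed
      then show ?thesis by (simp add: I)
    qed
    moreover have "\<sigma> * (LINT z|lebesgue. bump \<epsilon> x z * ?W z) \<le> \<bar>LINT z|lebesgue. bump \<epsilon> x z * ?W z\<bar>"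
    proof -
      have "\<sigma> = 1 \<or> \<sigma> = -1" using \<sigma>(1) by linarith
      then show ?thesis by auto
    qed
    ultimately show False using upper unfolding Weq by linarith
  qed
  \<comment> \<open>Divided by \<open>k\<close>, the mixed second difference of \<open>u\<close>
    becomes the increment of \<open>f\<close> as \<open>k\<close> tends to 0.\<close>
  have "((\<lambda>k. \<bar>(u (z + h *\<^sub>R b + k *\<^sub>R e) - u (z + h *\<^sub>R b)) / k - (u (z + k *\<^sub>R e) - u z) / k\<bar>) \<longlongrightarrow> \<bar>f (z + h *\<^sub>R b) - f z\<bar>) (at 0)"
    using der[of "z + h *\<^sub>R b"] der[of z] by (intro tendsto_intros) (auto simp: has_field_derivative_iff)
  then show ?thesis
  proof (rule tendsto_upperbound)
    show "\<forall>\<^sub>F k in at 0. \<bar>(u (z + h *\<^sub>R b + k *\<^sub>R e) - u (z + h *\<^sub>R b)) / k - (u (z + k *\<^sub>R e) - u z) / k\<bar> \<le> Cg * \<bar>h\<bar>"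
      unfolding eventually_at
    proof (intro exI[of _ 1] conjI ballI impI)
      fix k :: real assume k: "k \<noteq> 0 \<and> dist k 0 < 1"
      have "\<bar>(u (z + h *\<^sub>R b + k *\<^sub>R e) - u (z + h *\<^sub>R b)) / k - (u (z + k *\<^sub>R e) - u z) / k\<bar> 
         = \<bar>u (z + h *\<^sub>R b + k *\<^sub>R e) - u (z + k *\<^sub>R e) - (u (z + h *\<^sub>R b) - u z)\<bar> / \<bar>k\<bar>"
        by (simp add: diff_divide_distrib[symmetric] abs_divide algebra_simps)
      also have "\<dots> \<le> Cg * \<bar>h\<bar> * \<bar>k\<bar> / \<bar>k\<bar>" by (intro divide_right_mono sd) auto
      finally show "\<bar>(u (z + h *\<^sub>R b + k *\<^sub>R e) - u (z + h *\<^sub>R b)) / k - (u (z + k *\<^sub>R e) - u z) / k\<bar> \<le> Cg * \<bar>h\<bar>"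
        using k by simp
    qed simp
  qed simp
qed

lemma integrable_weighted:
  fixes f :: "'a::euclidean_space \<Rightarrow> 'b::euclidean_space"
  assumes f: "f \<in> borel_measurable lebesgue" and bd: "AE z in lebesgue. norm (f z) \<le> C"
    and q: "q \<in> borel_measurable lebesgue" "\<And>z. \<bar>q z\<bar> \<le> K" "\<And>z. z \<notin> cball c r \<Longrightarrow> q z = 0"
  shows "integrable lebesgue (\<lambda>z. q z *\<^sub>R f z)"
proof (rule Bochner_Integration.integrable_bound)
  show "integrable lebesgue (\<lambda>z. indicator (cball c r) z *\<^sub>R (K * C))"
    using emeasure_lborel_cball_finite[of c r] by (intro integrable_real_indicator[THEN integrable_scaleR_left]) auto
  show "(\<lambda>z. q z *\<^sub>R f z) \<in> borel_measurable lebesgue" using f q(1) by measurable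
  show "AE z in lebesgue. norm (q z *\<^sub>R f z) \<le> norm (indicator (cball c r) z *\<^sub>R (K * C))"
    using bd
  proof eventually_elim
    case (elim z)
    have "norm (q z *\<^sub>R f z) \<le> K * C" using q(2)[of z] elim by (simp add: mult_mono)
    then show ?case using q(3)[of z] by (cases "z \<in> cball c r") auto
  qed
qed

text \<open>The weak derivative is a statement about matrix valued integrals; taking an entry is
  bounded linear and commutes with the integral once the integrands are known to be
  integrable.\<close>

lemma bump_weak_partial_component:
  fixes f g :: "'a::euclidean_space \<Rightarrow> real^'n^'m"
  assumes f: "Linf_class f" and g: "Linf_class g" and weak: "weak_partial b f g" and b: "b \<in> Basis" and \<epsilon>: "\<epsilon> > 0"
  shows "(LINT z|lebesgue. bump_partial \<epsilon> c b z * (f z $ r $ j)) = - (LINT z|lebesgue. bump \<epsilon> c z * (g z $ r $ j))"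
proof -
  have bl: "bounded_linear (\<lambda>M::real^'n^'m. M $ r $ j)"
    by (rule bounded_linear_compose[OF bounded_linear_vec_nth bounded_linear_vec_nth])
  obtain Cf Cg where C: "AE z in lebesgue. norm (f z) \<le> Cf" "AE z in lebesgue. norm (g z) \<le> Cg"
    using f g by (auto simp: Linf_class_def)
  have out: "bump_partial \<epsilon> c b z = 0" "bump \<epsilon> c z = 0" if "z \<notin> cball c \<epsilon>" for z
  proof -
    have "\<epsilon>\<^sup>2 \<le> (z - c) \<bullet> (z - c)"
      using that \<epsilon> by (simp add: dot_square_norm dist_norm norm_minus_commute power_mono)
    then have "1 - (z - c) \<bullet> (z - c) / \<epsilon>\<^sup>2 \<le> 0" using \<epsilon> by (simp add: field_simps)
    then show "bump_partial \<epsilon> c b z = 0" "bump \<epsilon> c z = 0" by (simp_all add: bump_partial_def bump_def max_def)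
  qed
  have bp: "\<bar>bump_partial \<epsilon> c b z\<bar> \<le> 4 / \<epsilon>" for z
  proof (cases "z \<in> cball c \<epsilon>")
    case True
    have "\<bar>(z - c) \<bullet> b\<bar> \<le> \<epsilon>"
      using True norm_nth_le[of "z - c" b] Basis_le_norm[OF b, of "z - c"] by (simp add: dist_norm norm_minus_commute)
    then have "\<bar>bump_partial \<epsilon> c b z\<bar> \<le> (2 * 1) * (2 * \<epsilon> / \<epsilon>\<^sup>2)"
      unfolding bump_partial_def abs_mult
      by (intro mult_mono) (auto simp: abs_mult abs_divide divide_simps)
    then show ?thesis using \<epsilon> by (simp add: power2_eq_square)
  qed (use out \<epsilon> in simp)
  have i1: "integrable lebesgue (\<lambda>z. bump_partial \<epsilon> c b z *\<^sub>R f z)"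
  proof (rule integrable_weighted[OF _ C(1) _ bp])
    have "bump_partial \<epsilon> c b \<in> borel_measurable borel" unfolding bump_partial_def by measurable
    then show "bump_partial \<epsilon> c b \<in> borel_measurable lebesgue" by (simp add: measurable_completion)
  qed (use f out in \<open>auto simp: Linf_class_def\<close>)
  have i2: "integrable lebesgue (\<lambda>z. bump \<epsilon> c z *\<^sub>R g z)"
    by (rule integrable_weighted[OF _ C(2) bump_measurable_lebesgue, where K=1])
      (use g out bump_nonneg[of \<epsilon> c] bump_le_1[of \<epsilon> c] in \<open>auto simp: Linf_class_def\<close>)
  have "frechet_derivative (bump \<epsilon> c) (at z) = (\<lambda>h. bump_partial \<epsilon> c h z)" for z
    using bump_has_derivative[of \<epsilon> c z] \<epsilon> by (intro frechet_derivative_at[symmetric]) auto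
  moreover have "bounded {z. bump \<epsilon> c z \<noteq> 0}"
    by (rule bounded_subset[OF bounded_cball[of c \<epsilon>]]) (use out in blast)
  ultimately have "(LINT z|lebesgue. bump_partial \<epsilon> c b z *\<^sub>R f z) = - (LINT z|lebesgue. bump \<epsilon> c z *\<^sub>R g z)"
    using weak bump_C1[of \<epsilon> c] \<epsilon> unfolding weak_partial_def by (auto dest!: spec[of _ "bump \<epsilon> c"])
  then have "(LINT z|lebesgue. bump_partial \<epsilon> c b z *\<^sub>R f z) $ r $ j = (- (LINT z|lebesgue. bump \<epsilon> c z *\<^sub>R g z)) $ r $ j" by simp
  then show ?thesis
    using integral_bounded_linear[OF bl i1] integral_bounded_linear[OF bl i2] by simp
qed

text \<open>The Jacobian is defined everywhere, so its essential bounds are upgraded to pointwise ones.\<close>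

lemma tension_regularity:
  assumes adm: "admissible_tension \<T> \<Lambda>"
  obtains J :: "real^2 \<Rightarrow> real^2^2" and L B where
    "\<And>z. (tension_map \<T> has_derivative (\<lambda>h. J z *v h)) (at z)"
    "\<And>z w h. norm (J z *v h - J w *v h) \<le> L * norm (z - w) * norm h"
    "\<And>x y. norm (tension_map \<T> x - tension_map \<T> y) \<le> B * norm (x - y)"
    "\<And>z h. \<Lambda> * (h \<bullet> h) \<le> h \<bullet> (J z *v h)" "0 \<le> B" "0 \<le> L"
proof -
  define T where "T = tension_map \<T>"
  define J where "J = (\<lambda>z. jacobian T (at z))"
  have dT: "(T has_derivative (\<lambda>h. J z *v h)) (at z)" for z
    using adm by (auto simp: admissible_tension_def J_def T_def jacobian_works)
  have W: "W1inf J" using adm by (simp add: admissible_tension_def J_def T_def)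
  then obtain C where C: "AE z in lebesgue. norm (J z) \<le> C" and Jm: "J \<in> borel_measurable lebesgue" and JL: "Linf_class J"
    by (auto simp: W1inf_def Linf_class_def)
  obtain g where g: "\<And>b. b \<in> Basis \<Longrightarrow> Linf_class (g b) \<and> weak_partial b J (g b)"
    using W unfolding W1inf_def by metis
  then obtain Cg where Cg: "\<And>b. b \<in> Basis \<Longrightarrow> AE z in lebesgue. norm (g b z) \<le> Cg b"
    unfolding Linf_class_def by metis
  define M where "M = (\<Sum>b\<in>(Basis :: (real^2) set). \<bar>Cg b\<bar>)"
  have M: "Cg b \<le> M" if "b \<in> Basis" for b
    unfolding M_def using that member_le_sum[of b Basis "\<lambda>b. \<bar>Cg b\<bar>"] by auto
  have M0: "0 \<le> M" by (simp add: M_def sum_nonneg)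
  have comp_le: "\<bar>X $ r $ j\<bar> \<le> norm X" for X :: "real^2^2" and r j
    using component_le_norm_cart[of "X $ r" j] Finite_Cartesian_Product.norm_nth_le[of X r] by linarith
  have comp_m: "(\<lambda>z. F z $ r $ j) \<in> borel_measurable lebesgue" if "F \<in> borel_measurable lebesgue" for F :: "real^2 \<Rightarrow> real^2^2" and r j
    using that by (intro borel_measurable_continuous_on[of "\<lambda>M. M $ r $ j"] continuous_intros)
  have cT: "continuous_on UNIV T" using dT has_derivative_continuous by (metis continuous_at_imp_continuous_on)
  have der: "((\<lambda>s. T (z + s *\<^sub>R axis j 1) $ r) has_real_derivative J z $ r $ j) (at 0)" for z r j
  proof -
    have "((\<lambda>s::real. z + s *\<^sub>R axis j 1) has_derivative (\<lambda>s. s *\<^sub>R axis j 1)) (at 0)"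
      by (auto intro!: derivative_eq_intros)
    from has_derivative_compose[OF this, of T "\<lambda>h. J z *v h"] dT[of z]
    have "((\<lambda>s. T (z + s *\<^sub>R axis j 1)) has_derivative (\<lambda>s. J z *v (s *\<^sub>R axis j 1))) (at 0)" by simp
    from bounded_linear.has_derivative[OF bounded_linear_vec_nth this, of r]
    have "((\<lambda>s. T (z + s *\<^sub>R axis j 1) $ r) has_derivative (\<lambda>s. (J z *v (s *\<^sub>R axis j 1)) $ r)) (at 0)" .
    moreover have "(\<lambda>s. (J z *v (s *\<^sub>R axis j 1)) $ r) = (*) (J z $ r $ j)"
      by (auto simp: matrix_vector_mult_scaleR matrix_vector_mul_component inner_axis)
    ultimately show ?thesis by (simp add: has_field_derivative_def)
  qed
  have cTr: "continuous_on UNIV (\<lambda>z. T z $ r)" for r using cT by (intro continuous_intros)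
  have bdJ: "AE z in lebesgue. \<bar>J z $ r $ j\<bar> \<le> C" for r j
    using C by eventually_elim (use comp_le order_trans in blast)
  have lipJ1: "\<bar>J (z + h *\<^sub>R b) $ r $ j - J z $ r $ j\<bar> \<le> M * \<bar>h\<bar>" if b: "b \<in> Basis" for z h b r j
  proof -
    have gM: "AE z in lebesgue. \<bar>g b z $ r $ j\<bar> \<le> M"
      using Cg[OF b]
    proof eventually_elim
      case (elim z) then show ?case using comp_le[of "g b z" r j] M[OF b] by linarith
    qed
    show ?thesis
      by (rule second_difference_bound[OF der cTr comp_m[OF Jm] bdJ comp_m gM bump_weak_partial_component[OF JL _ _ b] b])
        (use g[OF b] in \<open>auto simp: Linf_class_def\<close>)
  qed
  \<comment> \<open>The path from \<open>w\<close> to \<open>z\<close> changes one coordinate at a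
    time, because the bounds hold along coordinate directions.\<close>
  have dec: "z = w + (z - w) $ 1 *\<^sub>R axis 1 1 + (z - w) $ 2 *\<^sub>R axis 2 1" for z w :: "real^2"
    by (simp add: vec_eq_iff forall_2 axis_def)
  have ab: "axis i 1 \<in> (Basis :: (real^2) set)" for i by (simp add: axis_in_Basis_iff)
  have nth_le: "\<bar>(z - w) $ i\<bar> \<le> norm (z - w)" for z w :: "real^2" and i by (rule component_le_norm_cart)
  have lipJ: "\<bar>J z $ r $ j - J w $ r $ j\<bar> \<le> 2 * M * norm (z - w)" for z w r j
  proof -
    let ?v = "w + (z - w) $ 1 *\<^sub>R axis 1 1"
    have "\<bar>J z $ r $ j - J ?v $ r $ j\<bar> \<le> M * \<bar>(z - w) $ 2\<bar>"
      using lipJ1[OF ab, of ?v "(z - w) $ 2" 2 r j] by (subst (1) dec[of z w])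
    moreover have "\<bar>J ?v $ r $ j - J w $ r $ j\<bar> \<le> M * \<bar>(z - w) $ 1\<bar>" by (rule lipJ1[OF ab])
    moreover have "M * \<bar>(z - w) $ i\<bar> \<le> M * norm (z - w)" for i using nth_le M0 by (rule mult_left_mono)
    from this[of 1] this[of 2] calculation show ?thesis by linarith
  qed
  have C0: "0 \<le> C"
  proof (rule ccontr)
    assume "\<not> 0 \<le> C"
    then have "AE z in lebesgue. (z::real^2) \<in> {}" using C by (auto elim!: eventually_mono) (smt (verit) norm_ge_zero)
    then have "AE z in lborel. (z::real^2) \<in> {}" by (subst (asm) AE_completion_iff)
    from AE_closed_imp_everywhere[OF this] show False by simp
  qed
  have lipT1: "\<bar>T z $ r - T w $ r\<bar> \<le> 2 * C * norm (z - w)" for z w r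
  proof -
    let ?v = "w + (z - w) $ 1 *\<^sub>R axis 1 1"
    have "\<bar>T z $ r - T ?v $ r\<bar> \<le> C * \<bar>(z - w) $ 2\<bar>"
      using lipschitz_if_AE_bounded_derivative[OF der[of _ 2 r] cTr bdJ, of ?v "(z - w) $ 2"] by (subst (1) dec[of z w])
    moreover have "\<bar>T ?v $ r - T w $ r\<bar> \<le> C * \<bar>(z - w) $ 1\<bar>"
      by (rule lipschitz_if_AE_bounded_derivative[OF der[of _ 1 r] cTr bdJ])
    moreover have "C * \<bar>(z - w) $ i\<bar> \<le> C * norm (z - w)" for i using nth_le C0 by (rule mult_left_mono)
    from this[of 1] this[of 2] calculation show ?thesis by linarith
  qed
  have n2: "norm x \<le> 2 * K" if "\<And>i. \<bar>x $ i\<bar> \<le> K" for x :: "real^2" and K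
    using norm_le_l1_cart[of x] that[of 1] that[of 2] by (simp add: sum_2)
  \<comment> \<open>An entry of \<open>J\<close> has Lipschitz constant 2M; a component of the
    product sums two entries and the norm two components, which gives 8M. A component of the map has
    constant 2C, so its norm has 4C.\<close>
  show thesis
  proof (rule that[of J "8 * M" "4 * C"])
    show "(tension_map \<T> has_derivative (\<lambda>h. J z *v h)) (at z)" for z using dT by (simp add: T_def)
    show "norm (tension_map \<T> x - tension_map \<T> y) \<le> 4 * C * norm (x - y)" for x y
      using n2[of "T x - T y" "2 * C * norm (x - y)"] lipT1[of x _ y] by (simp add: T_def)
    show "\<Lambda> * (h \<bullet> h) \<le> h \<bullet> (J z *v h)" for z h using adm by (simp add: admissible_tension_def J_def T_def)
    show "norm (J z *v h - J w *v h) \<le> 8 * M * norm (z - w) * norm h" for z w h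
    proof -
      have "\<bar>(J z *v h - J w *v h) $ r\<bar> \<le> 4 * M * norm (z - w) * norm h" for r
      proof -
        have e: "(J z *v h - J w *v h) $ r = (J z $ r $ 1 - J w $ r $ 1) * h $ 1 + (J z $ r $ 2 - J w $ r $ 2) * h $ 2"
          by (simp add: matrix_vector_mult_def sum_2 algebra_simps)
        have "\<bar>(J z $ r $ i - J w $ r $ i) * h $ i\<bar> \<le> (2 * M * norm (z - w)) * norm h" for i
          unfolding abs_mult using lipJ[of z r i w] component_le_norm_cart[of h i] M0 by (intro mult_mono) auto
        from this[of 1] this[of 2] show ?thesis unfolding e by linarith
      qed
      from n2[OF this] show ?thesis by simp
    qed
  qed (use M0 C0 in auto)
qed

subsection \<open>The kernel and the energy density\<close>

text \<open>Boundedness travels with the Lipschitz property because products need both; the class is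
  then an algebra, closed under inverses of functions that are bounded below by a positive
  number.\<close>

definition bdlip :: "'a::metric_space set \<Rightarrow> ('a \<Rightarrow> real) \<Rightarrow> bool" where
  "bdlip S f \<longleftrightarrow> (\<exists>B L. (\<forall>x\<in>S. \<bar>f x\<bar> \<le> B) \<and> (\<forall>x\<in>S. \<forall>y\<in>S. \<bar>f x - f y\<bar> \<le> L * dist x y))"

lemma bdlipI: "(\<And>x. x \<in> S \<Longrightarrow> \<bar>f x\<bar> \<le> B) \<Longrightarrow> (\<And>x y. x \<in> S \<Longrightarrow> y \<in> S \<Longrightarrow> \<bar>f x - f y\<bar> \<le> L * dist x y) \<Longrightarrow> bdlip S f"
  unfolding bdlip_def by blast

lemma bdlipE:
  assumes "bdlip S f"
  obtains B L where "0 \<le> B" "0 \<le> L" "\<And>x. x \<in> S \<Longrightarrow> \<bar>f x\<bar> \<le> B" "\<And>x y. x \<in> S \<Longrightarrow> y \<in> S \<Longrightarrow> \<bar>f x - f y\<bar> \<le> L * dist x y"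
proof -
  obtain B L where b: "\<And>x. x \<in> S \<Longrightarrow> \<bar>f x\<bar> \<le> B" and l: "\<And>x y. x \<in> S \<Longrightarrow> y \<in> S \<Longrightarrow> \<bar>f x - f y\<bar> \<le> L * dist x y"
    using assms unfolding bdlip_def by blast
  show thesis
  proof (rule that[of "\<bar>B\<bar>" "\<bar>L\<bar>"])
    show "\<bar>f x\<bar> \<le> \<bar>B\<bar>" if "x \<in> S" for x using b[OF that] by linarith
    show "\<bar>f x - f y\<bar> \<le> \<bar>L\<bar> * dist x y" if "x \<in> S" "y \<in> S" for x y
      using l[OF that] mult_right_mono[OF abs_ge_self[of L], of "dist x y"] by simp
  qed auto
qed

lemma bdlip_const: "bdlip S (\<lambda>_. c)"
  by (rule bdlipI[of _ _ "\<bar>c\<bar>" 0]) auto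

lemma bdlip_add: assumes "bdlip S f" "bdlip S g" shows "bdlip S (\<lambda>x. f x + g x)"
proof -
  obtain B L where f: "\<And>x. x \<in> S \<Longrightarrow> \<bar>f x\<bar> \<le> B" "\<And>x y. x \<in> S \<Longrightarrow> y \<in> S \<Longrightarrow> \<bar>f x - f y\<bar> \<le> L * dist x y"
    using assms(1) by (rule bdlipE) blast
  obtain B' L' where g: "\<And>x. x \<in> S \<Longrightarrow> \<bar>g x\<bar> \<le> B'" "\<And>x y. x \<in> S \<Longrightarrow> y \<in> S \<Longrightarrow> \<bar>g x - g y\<bar> \<le> L' * dist x y"
    using assms(2) by (rule bdlipE) blast
  show ?thesis
  proof (rule bdlipI[of _ _ "B + B'" "L + L'"])
    show "\<bar>f x + g x\<bar> \<le> B + B'" if "x \<in> S" for x using f(1)[OF that] g(1)[OF that] by linarith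
    show "\<bar>f x + g x - (f y + g y)\<bar> \<le> (L + L') * dist x y" if "x \<in> S" "y \<in> S" for x y
      using f(2)[OF that] g(2)[OF that] by (simp add: distrib_right)
  qed
qed

lemma bdlip_mult: assumes "bdlip S f" "bdlip S g" shows "bdlip S (\<lambda>x. f x * g x)"
proof -
  obtain B L where f: "0 \<le> B" "\<And>x. x \<in> S \<Longrightarrow> \<bar>f x\<bar> \<le> B" "\<And>x y. x \<in> S \<Longrightarrow> y \<in> S \<Longrightarrow> \<bar>f x - f y\<bar> \<le> L * dist x y"
    using assms(1) by (rule bdlipE) blast
  obtain B' L' where g: "0 \<le> B'" "\<And>x. x \<in> S \<Longrightarrow> \<bar>g x\<bar> \<le> B'" "\<And>x y. x \<in> S \<Longrightarrow> y \<in> S \<Longrightarrow> \<bar>g x - g y\<bar> \<le> L' * dist x y"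
    using assms(2) by (rule bdlipE) blast
  show ?thesis
  proof (rule bdlipI[of _ _ "B * B'" "L * B' + B * L'"])
    show "\<bar>f x * g x\<bar> \<le> B * B'" if "x \<in> S" for x
      unfolding abs_mult using f(1) f(2)[OF that] g(2)[OF that] by (intro mult_mono) auto
    show "\<bar>f x * g x - f y * g y\<bar> \<le> (L * B' + B * L') * dist x y" if "x \<in> S" "y \<in> S" for x y
    proof -
      have "\<bar>f x * g x - f y * g y\<bar> = \<bar>(f x - f y) * g x + f y * (g x - g y)\<bar>" by (simp add: algebra_simps)
      also have "\<dots> \<le> \<bar>f x - f y\<bar> * \<bar>g x\<bar> + \<bar>f y\<bar> * \<bar>g x - g y\<bar>" by (metis abs_mult abs_triangle_ineq)
      also have "\<dots> \<le> (L * dist x y) * B' + B * (L' * dist x y)"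
        using f(1) g(1) f(2)[OF that(2)] g(2)[OF that(1)] f(3)[OF that] g(3)[OF that]
        by (intro add_mono mult_mono) (auto intro: order_trans[OF abs_ge_zero])
      finally show ?thesis by (simp add: algebra_simps)
    qed
  qed
qed

lemma bdlip_minus: "bdlip S f \<Longrightarrow> bdlip S (\<lambda>x. - f x)"
  using bdlip_mult[OF bdlip_const[of S "-1"], of f] by simp

lemma bdlip_diff: "bdlip S f \<Longrightarrow> bdlip S g \<Longrightarrow> bdlip S (\<lambda>x. f x - g x)"
  using bdlip_add[of S f "\<lambda>x. - g x"] bdlip_minus[of S g] by simp

lemma bdlip_inverse:
  assumes "bdlip S f" and m: "0 < m" "\<And>x. x \<in> S \<Longrightarrow> m \<le> f x"
  shows "bdlip S (\<lambda>x. inverse (f x))"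
proof -
  obtain B L where f: "0 \<le> L" "\<And>x y. x \<in> S \<Longrightarrow> y \<in> S \<Longrightarrow> \<bar>f x - f y\<bar> \<le> L * dist x y"
    using assms(1) by (rule bdlipE) blast
  have p: "0 < f x" "inverse (f x) \<le> inverse m" if "x \<in> S" for x
    using m(2)[OF that] m(1) by (auto intro: le_imp_inverse_le)
  show ?thesis
  proof (rule bdlipI[of _ _ "inverse m" "inverse m * L * inverse m"])
    show "\<bar>inverse (f x)\<bar> \<le> inverse m" if "x \<in> S" for x using p[OF that] by simp
    show "\<bar>inverse (f x) - inverse (f y)\<bar> \<le> inverse m * L * inverse m * dist x y" if "x \<in> S" "y \<in> S" for x y
    proof -
      have "inverse (f x) - inverse (f y) = inverse (f x) * (f y - f x) * inverse (f y)"
        using p(1)[OF that(1)] p(1)[OF that(2)] by (simp add: field_simps)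
      then have "\<bar>inverse (f x) - inverse (f y)\<bar> = inverse (f x) * \<bar>f x - f y\<bar> * inverse (f y)"
        using p(1)[OF that(1)] p(1)[OF that(2)] by (simp add: abs_mult abs_minus_commute)
      also have "\<dots> \<le> inverse m * (L * dist x y) * inverse m"
        using p[OF that(1)] p[OF that(2)] f m(1) that by (intro mult_mono) auto
      finally show ?thesis by (simp add: mult_ac)
    qed
  qed
qed

text \<open>The Peskin kernel with its three arguments made independent, so that it can be compared
  at different points, in particular at three equal arguments.\<close>

definition kern :: "real^2 \<Rightarrow> real^2 \<Rightarrow> real^2 \<Rightarrow> real^2^2" where
  "kern U V D = (1 / (4 * pi)) *\<^sub>R
           (((U \<bullet> (P_mat D *v V)) / (norm D)\<^sup>2) *\<^sub>R mat 1
            - ((U \<bullet> (R_mat D *v V)) / (norm D)\<^sup>2) *\<^sub>R R_mat D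
            + ((U \<bullet> ((P_mat D - mat 1) *v V)) / (norm D)\<^sup>2) *\<^sub>R P_mat D)"

lemma peskin_kernel_kern: "peskin_kernel X \<theta> \<alpha> = kern (dtheta X (\<theta> + \<alpha>)) (dtheta X \<theta>) (Dquot \<alpha> X \<theta>)"
  by (simp add: peskin_kernel_def kern_def Let_def)

lemma sgn_nth: "sgn (D::real^2) $ i = D $ i * inverse (norm D)"
  by (simp add: sgn_div_norm)

lemma P_mat_entries:
  "P_mat D $ 1 $ 1 = (sgn D $ 1)\<^sup>2 - (sgn D $ 2)\<^sup>2" "P_mat D $ 1 $ 2 = 2 * sgn D $ 1 * sgn D $ 2"
  "P_mat D $ 2 $ 1 = 2 * sgn D $ 1 * sgn D $ 2" "P_mat D $ 2 $ 2 = (sgn D $ 2)\<^sup>2 - (sgn D $ 1)\<^sup>2"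
  by (simp_all add: P_mat_def tensor_def perp_def power2_eq_square)

lemma R_mat_entries:
  "R_mat D $ 1 $ 1 = - 2 * sgn D $ 1 * sgn D $ 2" "R_mat D $ 1 $ 2 = (sgn D $ 1)\<^sup>2 - (sgn D $ 2)\<^sup>2"
  "R_mat D $ 2 $ 1 = (sgn D $ 1)\<^sup>2 - (sgn D $ 2)\<^sup>2" "R_mat D $ 2 $ 2 = 2 * sgn D $ 1 * sgn D $ 2"
  by (simp_all add: R_mat_def tensor_def perp_def power2_eq_square)

lemma inner_matrix_2: "(U::real^2) \<bullet> ((A::real^2^2) *v V) = U $ 1 * (A $ 1 $ 1 * V $ 1 + A $ 1 $ 2 * V $ 2) + U $ 2 * (A $ 2 $ 1 * V $ 1 + A $ 2 $ 2 * V $ 2)"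
  by (simp add: inner_vec_def matrix_vector_mult_def sum_2)

text \<open>The matrices in the three bilinear forms are symmetric, so exchanging the two end points
  leaves the scalars unchanged.\<close>

lemma kern_commute: "kern U V D = kern V U D"
  unfolding kern_def by (simp add: inner_matrix_2 P_mat_entries R_mat_entries mat_def algebra_simps)

text \<open>\<open>P_mat D\<close> fixes \<open>D\<close>, \<open>R_mat D\<close> maps it to a
  perpendicular vector, and the difference of \<open>P_mat D\<close> and the identity annihilates
  it, so a single term survives. This is the leading part of the kernel near \<alpha> = 0.\<close>

lemma kern_diagonal: assumes "D \<noteq> 0" shows "kern D D D = (1 / (4 * pi)) *\<^sub>R mat 1"
proof -
  define r a b where "r = norm D" and "a = sgn D $ 1" and "b = sgn D $ 2"
  have r: "r \<noteq> 0" using assms by (simp add: r_def)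
  have D: "D $ 1 = r * a" "D $ 2 = r * b" using r by (simp_all add: a_def b_def r_def sgn_nth)
  have "norm (sgn D) = 1" using assms by (simp add: norm_sgn)
  then have ab: "a\<^sup>2 + b\<^sup>2 = 1" by (simp add: norm_vec_def L2_set_def sum_2 a_def b_def)
  have "(a\<^sup>2 - b\<^sup>2)\<^sup>2 + 4 * a\<^sup>2 * b\<^sup>2 = (a\<^sup>2 + b\<^sup>2)\<^sup>2" by (simp add: power2_eq_square algebra_simps)
  then have ab2: "(a\<^sup>2 - b\<^sup>2)\<^sup>2 + 4 * a\<^sup>2 * b\<^sup>2 = 1" using ab by simp
  have 1: "D \<bullet> (P_mat D *v D) = r\<^sup>2"
  proof -
    have "D \<bullet> (P_mat D *v D) = r\<^sup>2 * ((a\<^sup>2 - b\<^sup>2)\<^sup>2 + 4 * a\<^sup>2 * b\<^sup>2)"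
      unfolding inner_matrix_2 P_mat_entries D a_def[symmetric] b_def[symmetric]
      by (simp add: power2_eq_square algebra_simps)
    then show ?thesis using ab2 by simp
  qed
  have 2: "D \<bullet> (R_mat D *v D) = 0"
    unfolding inner_matrix_2 R_mat_entries D a_def[symmetric] b_def[symmetric]
    by (simp add: power2_eq_square algebra_simps)
  have 3: "D \<bullet> ((P_mat D - mat 1) *v D) = 0"
    using 1 by (simp add: matrix_vector_mult_diff_rdistrib inner_diff_right r_def dot_square_norm)
  show ?thesis unfolding kern_def 1 2 3 using r by (simp add: r_def)
qed

text \<open>\<open>R\<close> is to bound the derivative of the curve from above and \<open>m\<close>
  its arc-chord number from below; a positive \<open>m\<close> keeps away from the singularity of
  the kernel at D = 0.\<close>

definition kern_domain :: "real \<Rightarrow> real \<Rightarrow> ((real^2) \<times> (real^2) \<times> (real^2)) set" where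
  "kern_domain R m = {(U, V, D). norm U \<le> R \<and> norm V \<le> R \<and> norm D \<le> R \<and> m \<le> norm D}"

text \<open>Each entry is a polynomial in the coordinates of the three vectors and in 1/|D|, all of
  which are bounded and Lipschitz on the domain.\<close>

lemma kern_bdlip:
  assumes m: "0 < m"
  shows "bdlip (kern_domain R m) (\<lambda>(U, V, D). kern U V D $ i $ j)"
proof -
  let ?S = "kern_domain R m"
  have d1: "norm (fst p - fst q) \<le> dist p q" for p q :: "(real^2) \<times> (real^2) \<times> (real^2)"
    using dist_fst_le[of p q] by (simp add: dist_norm)
  have d2: "norm (fst (snd p) - fst (snd q)) \<le> dist p q" for p q :: "(real^2) \<times> (real^2) \<times> (real^2)"
    using order_trans[OF dist_fst_le[of "snd p" "snd q"] dist_snd_le[of p q]] by (simp add: dist_norm)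
  have d3: "norm (snd (snd p) - snd (snd q)) \<le> dist p q" for p q :: "(real^2) \<times> (real^2) \<times> (real^2)"
    using order_trans[OF dist_snd_le[of "snd p" "snd q"] dist_snd_le[of p q]] by (simp add: dist_norm)
  have nth: "\<bar>x $ i - y $ i\<bar> \<le> norm (x - y)" for x y :: "real^2" and i
    using component_le_norm_cart[of "x - y" i] by simp
  have U: "bdlip ?S (\<lambda>p. fst p $ i)" for i
  proof (rule bdlipI[of _ _ R 1])
    show "\<bar>fst p $ i\<bar> \<le> R" if "p \<in> ?S" for p
      using that component_le_norm_cart[of "fst p" i] by (auto simp: kern_domain_def)
    show "\<bar>fst p $ i - fst q $ i\<bar> \<le> 1 * dist p q" for p q :: "(real^2) \<times> (real^2) \<times> (real^2)"
      using order_trans[OF nth d1] by simp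
  qed
  have V: "bdlip ?S (\<lambda>p. fst (snd p) $ i)" for i
  proof (rule bdlipI[of _ _ R 1])
    show "\<bar>fst (snd p) $ i\<bar> \<le> R" if "p \<in> ?S" for p
      using that component_le_norm_cart[of "fst (snd p)" i] by (auto simp: kern_domain_def)
    show "\<bar>fst (snd p) $ i - fst (snd q) $ i\<bar> \<le> 1 * dist p q" for p q :: "(real^2) \<times> (real^2) \<times> (real^2)"
      using order_trans[OF nth d2] by simp
  qed
  have D: "bdlip ?S (\<lambda>p. snd (snd p) $ i)" for i
  proof (rule bdlipI[of _ _ R 1])
    show "\<bar>snd (snd p) $ i\<bar> \<le> R" if "p \<in> ?S" for p
      using that component_le_norm_cart[of "snd (snd p)" i] by (auto simp: kern_domain_def)
    show "\<bar>snd (snd p) $ i - snd (snd q) $ i\<bar> \<le> 1 * dist p q" for p q :: "(real^2) \<times> (real^2) \<times> (real^2)"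
      using order_trans[OF nth d3] by simp
  qed
  have N: "bdlip ?S (\<lambda>p. norm (snd (snd p)))"
  proof (rule bdlipI[of _ _ R 1])
    show "\<bar>norm (snd (snd p))\<bar> \<le> R" if "p \<in> ?S" for p
      using that by (auto simp: kern_domain_def)
    show "\<bar>norm (snd (snd p)) - norm (snd (snd q))\<bar> \<le> 1 * dist p q" for p q :: "(real^2) \<times> (real^2) \<times> (real^2)"
      using order_trans[OF norm_triangle_ineq3 d3] by simp
  qed
  have I: "bdlip ?S (\<lambda>p. inverse (norm (snd (snd p))))"
    by (rule bdlip_inverse[OF N m]) (auto simp: kern_domain_def)
  have s: "bdlip ?S (\<lambda>p. sgn (snd (snd p)) $ i)" for i
    unfolding sgn_nth by (intro bdlip_mult D I)
  have mat1: "(mat 1 :: real^2^2) $ i $ j = (if i = j then 1 else 0)" for i j by (simp add: mat_def)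
  note bl = bdlip_add bdlip_diff bdlip_mult bdlip_minus bdlip_const U V I s
  have P: "bdlip ?S (\<lambda>p. P_mat (snd (snd p)) $ i $ j)" for i j
    using exhaust_2[of i] exhaust_2[of j] by (auto simp: P_mat_entries power2_eq_square intro!: bl)
  have R: "bdlip ?S (\<lambda>p. R_mat (snd (snd p)) $ i $ j)" for i j
    using exhaust_2[of i] exhaust_2[of j] by (auto simp: R_mat_entries power2_eq_square intro!: bl)
  have bil: "bdlip ?S (\<lambda>p. fst p \<bullet> (A p *v fst (snd p)))" if A: "\<And>i j. bdlip ?S (\<lambda>p. A p $ i $ j)" for A :: "_ \<Rightarrow> real^2^2"
    unfolding inner_matrix_2
    by (rule bdlip_add[OF bdlip_mult[OF U bdlip_add[OF bdlip_mult[OF A V] bdlip_mult[OF A V]]]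
      bdlip_mult[OF U bdlip_add[OF bdlip_mult[OF A V] bdlip_mult[OF A V]]]])
  have PI: "bdlip ?S (\<lambda>p. (P_mat (snd (snd p)) - mat 1) $ i $ j)" for i j
    using bdlip_diff[OF P bdlip_const[of ?S "mat 1 $ i $ j"]] by simp
  note II = bdlip_mult[OF I I]
  note bdlip_mult[OF bdlip_const[of ?S "1 / (4 * pi)"] bdlip_add[OF bdlip_diff[
      OF bdlip_mult[OF bdlip_mult[OF bil[OF P] II] bdlip_const[of ?S "mat 1 $ i $ j"]] bdlip_mult[OF bdlip_mult[OF bil[OF R] II] R[of i j]]]
      bdlip_mult[OF bdlip_mult[OF bil[OF PI] II] P[of i j]]]]
  then show ?thesis
    by (simp only: kern_def split_def power2_eq_square divide_inverse inverse_mult_distrib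
        vector_scaleR_component vector_add_component vector_minus_component real_scaleR_def)
qed

lemma kern_lipschitz:
  assumes m: "0 < m"
  obtains L where "0 \<le> L" "\<And>U V D U' V' D' h. (U, V, D) \<in> kern_domain R m \<Longrightarrow> (U', V', D') \<in> kern_domain R m \<Longrightarrow>
     norm (kern U V D *v h - kern U' V' D' *v h) \<le> L * (norm (U - U') + norm (V - V') + norm (D - D')) * norm h"
proof -
  define Q where "Q = (\<lambda>i j L. 0 \<le> L \<and> (\<forall>p\<in>kern_domain R m. \<forall>q\<in>kern_domain R m.
      \<bar>(case p of (U, V, D) \<Rightarrow> kern U V D $ i $ j) - (case q of (U, V, D) \<Rightarrow> kern U V D $ i $ j)\<bar> \<le> L * dist p q))"
  have "\<exists>L. Q i j L" for i j
    using kern_bdlip[OF m, of R i j] unfolding Q_def by (rule bdlipE) blast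
  then have Q: "Q i j (SOME L. Q i j L)" for i j by (rule someI_ex)
  define L where "L = (\<lambda>i j. SOME L. Q i j L)"
  have L0: "0 \<le> L i j" for i j using Q[of i j] by (simp add: L_def Q_def)
  have L: "\<bar>(case p of (U, V, D) \<Rightarrow> kern U V D $ i $ j) - (case q of (U, V, D) \<Rightarrow> kern U V D $ i $ j)\<bar> \<le> L i j * dist p q"
    if "p \<in> kern_domain R m" "q \<in> kern_domain R m" for i j p q
    using Q[of i j] that unfolding L_def Q_def by blast
  let ?L = "L 1 1 + L 1 2 + L 2 1 + L 2 2"
  show thesis
  proof (rule that[of ?L])
    show "0 \<le> ?L" using L0 by (simp add: add_nonneg_nonneg)
    fix U V D U' V' D' :: "real^2" and h :: "real^2"
    assume A: "(U, V, D) \<in> kern_domain R m" "(U', V', D') \<in> kern_domain R m"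
    let ?n = "norm (U - U') + norm (V - V') + norm (D - D')"
    have pair: "dist (a, b) (a', b') \<le> dist a a' + dist b b'" for a a' :: "real^2" and b b' :: "'z::metric_space"
      by (simp add: dist_Pair_Pair sqrt_sum_squares_le_sum)
    have "dist (U, V, D) (U', V', D') \<le> dist U U' + dist (V, D) (V', D')" by (rule pair)
    also have "\<dots> \<le> dist U U' + (dist V V' + dist D D')" by (intro add_left_mono pair)
    also have "\<dots> = ?n" by (simp add: dist_norm)
    finally have dn: "dist (U, V, D) (U', V', D') \<le> ?n" .
    let ?E = "\<lambda>i j. kern U V D $ i $ j - kern U' V' D' $ i $ j"
    have E: "\<bar>?E i j * h $ j\<bar> \<le> L i j * ?n * norm h" for i j
      unfolding abs_mult using L[OF A, of i j] mult_left_mono[OF dn L0[of i j]] component_le_norm_cart[of h j]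
      by (intro mult_mono) (auto intro: mult_nonneg_nonneg L0)
    let ?w = "kern U V D *v h - kern U' V' D' *v h"
    have w: "?w $ i = ?E i 1 * h $ 1 + ?E i 2 * h $ 2" for i
      by (simp add: matrix_vector_mult_def sum_2 algebra_simps)
    have "norm ?w \<le> \<bar>?w $ 1\<bar> + \<bar>?w $ 2\<bar>" using norm_le_l1_cart[of ?w] by (simp only: sum_2)
    also have "\<dots> \<le> L 1 1 * ?n * norm h + L 1 2 * ?n * norm h + (L 2 1 * ?n * norm h + L 2 2 * ?n * norm h)"
      unfolding w using E[of 1 1] E[of 1 2] E[of 2 1] E[of 2 2] by linarith
    finally show "norm ?w \<le> ?L * ?n * norm h" by (simp add: algebra_simps)
  qed
qed

lemma continuous_on_kern:
  assumes m: "0 < m" and c: "continuous_on S U" "continuous_on S V" "continuous_on S D" "continuous_on S h"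
    and d: "\<And>x. x \<in> S \<Longrightarrow> (U x, V x, D x) \<in> kern_domain R m"
  shows "continuous_on S (\<lambda>x. kern (U x) (V x) (D x) *v h x)"
proof -
  have k: "continuous_on S (\<lambda>x. kern (U x) (V x) (D x) $ i $ j)" for i j
  proof -
    obtain B L where L: "0 \<le> L" "\<And>p q. p \<in> kern_domain R m \<Longrightarrow> q \<in> kern_domain R m \<Longrightarrow> 
      \<bar>(case p of (U, V, D) \<Rightarrow> kern U V D $ i $ j) - (case q of (U, V, D) \<Rightarrow> kern U V D $ i $ j)\<bar> \<le> L * dist p q"
      using kern_bdlip[OF m, of R i j] by (rule bdlipE) blast
    have "L-lipschitz_on (kern_domain R m) (\<lambda>(U, V, D). kern U V D $ i $ j)"
      by (intro lipschitz_onI) (use L in \<open>auto simp: dist_real_def\<close>)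
    then have "continuous_on (kern_domain R m) (\<lambda>(U, V, D). kern U V D $ i $ j)" by (rule lipschitz_on_continuous_on)
    moreover have "continuous_on S (\<lambda>x. (U x, V x, D x))" by (intro continuous_on_Pair c)
    ultimately have "continuous_on S (\<lambda>x. (\<lambda>(U, V, D). kern U V D $ i $ j) (U x, V x, D x))"
      by (rule continuous_on_compose2) (use d in auto)
    then show ?thesis by simp
  qed
  have "continuous_on S (\<lambda>x. \<chi> i. kern (U x) (V x) (D x) $ i $ 1 * h x $ 1 + kern (U x) (V x) (D x) $ i $ 2 * h x $ 2)"
    using c by (intro continuous_on_vec_lambda continuous_intros k)
  then show ?thesis by (simp add: matrix_vector_mult_def sum_2)
qed

text \<open>The leading part of the kernel is coercive; every other contribution carries one factor of
  the increment of \<open>Z = X' - Y'\<close> and is absorbed by Young's inequality.\<close>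

lemma energy_density_bound:
  assumes m: "0 < m" and adm: "admissible_tension \<T> \<Lambda>" and \<Lambda>: "0 < \<Lambda>"
  obtains C where "0 \<le> C" "\<And>x0 x1 dx y0 y1 dy. (x1, x0, dx) \<in> kern_domain R m \<Longrightarrow> (y1, y0, dy) \<in> kern_domain R m \<Longrightarrow>
     - (((x1 - y1) - (x0 - y0)) \<bullet> (kern x1 x0 dx *v (tension_map \<T> x1 - tension_map \<T> x0) - kern y1 y0 dy *v (tension_map \<T> y1 - tension_map \<T> y0)))
     \<le> C * ((norm (x0 - y0))\<^sup>2 + (norm (x1 - y1))\<^sup>2 + (norm (dx - dy))\<^sup>2) * ((norm (x1 - x0))\<^sup>2 + (norm (y1 - y0))\<^sup>2 + (norm (x1 - dx))\<^sup>2 + (norm (x0 - dx))\<^sup>2)"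
proof -
  define T where "T = tension_map \<T>"
  obtain J LT B where dT: "\<And>z. (T has_derivative (\<lambda>h. J z *v h)) (at z)"
    and LT: "\<And>z w h. norm (J z *v h - J w *v h) \<le> LT * norm (z - w) * norm h"
    and B: "\<And>x y. norm (T x - T y) \<le> B * norm (x - y)"
    and coer: "\<And>z h. \<Lambda> * (h \<bullet> h) \<le> h \<bullet> (J z *v h)" and B0: "0 \<le> B" and LT0: "0 \<le> LT"
    using tension_regularity[OF adm] unfolding T_def by metis
  obtain L where L0: "0 \<le> L" and L: "\<And>U V D U' V' D' h. (U, V, D) \<in> kern_domain R m \<Longrightarrow> (U', V', D') \<in> kern_domain R m \<Longrightarrow>
     norm (kern U V D *v h - kern U' V' D' *v h) \<le> L * (norm (U - U') + norm (V - V') + norm (D - D')) * norm h"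
    using kern_lipschitz[OF m, of R] by metis
  define A where "A = LT / (4 * pi) + 2 * L * B"
  have A0: "0 \<le> A" using LT0 L0 B0 by (simp add: A_def)
  show thesis
  proof (rule that[of "12 * (A\<^sup>2 * (pi / \<Lambda>))"])
    show "0 \<le> 12 * (A\<^sup>2 * (pi / \<Lambda>))" using \<Lambda> by simp
    fix x0 x1 dx y0 y1 dy :: "real^2"
    assume X: "(x1, x0, dx) \<in> kern_domain R m" and Y: "(y1, y0, dy) \<in> kern_domain R m"
    define Z0 Z1 W where "Z0 = x0 - y0" and "Z1 = x1 - y1" and "W = (T x1 - T y1) - (T x0 - T y0)"
    define N S G where "N = norm (Z1 - Z0)" and "S = norm Z0 + norm Z1 + norm (dx - dy)"
      and "G = norm (x1 - x0) + norm (y1 - y0) + norm (x1 - dx) + norm (x0 - dx)"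
    have pos: "0 \<le> N" "0 \<le> S" "0 \<le> G" by (simp_all add: N_def S_def G_def)
    \<comment> \<open>The mean value theorem on the segment from (y1, y0) to (x1, x0) produces a
      single \<open>s\<close>, hence intermediate points \<open>?q1\<close> and \<open>?q0\<close>
      whose difference is a convex combination of the increments of y and x. The Jacobian at
      \<open>?q0\<close> is coercive on Z1 - Z0; its variation from \<open>?q0\<close> to
      \<open>?q1\<close> is an error.\<close>
    have leading: "(Z1 - Z0) \<bullet> W \<ge> \<Lambda> * N\<^sup>2 - LT * (N * (S * G))"
    proof -
      let ?\<phi> = "\<lambda>s. (Z1 - Z0) \<bullet> (T (y1 + s *\<^sub>R Z1) - T (y0 + s *\<^sub>R Z0))"
      let ?\<phi>' = "\<lambda>s. (Z1 - Z0) \<bullet> (J (y1 + s *\<^sub>R Z1) *v Z1 - J (y0 + s *\<^sub>R Z0) *v Z0)"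
      have comp: "((\<lambda>s. T (y + s *\<^sub>R z)) has_derivative (\<lambda>h. h *\<^sub>R (J (y + s *\<^sub>R z) *v z))) (at s)" for y z s
      proof -
        have "((\<lambda>s::real. y + s *\<^sub>R z) has_derivative (\<lambda>h. h *\<^sub>R z)) (at s)" by (auto intro!: derivative_eq_intros)
        from has_derivative_compose[OF this dT] show ?thesis by (simp add: matrix_vector_mult_scaleR)
      qed
      have d\<phi>: "(?\<phi> has_real_derivative ?\<phi>' s) (at s)" for s
        unfolding has_field_derivative_def
        by (rule has_derivative_eq_rhs[OF has_derivative_inner_right[OF has_derivative_diff[OF comp comp]]])
          (auto simp: inner_diff_right algebra_simps)
      obtain s where s: "0 < s" "s < 1" "?\<phi> 1 - ?\<phi> 0 = ?\<phi>' s"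
        using MVT2[of 0 1 ?\<phi> ?\<phi>'] d\<phi> by auto
      let ?q1 = "y1 + s *\<^sub>R Z1" and ?q0 = "y0 + s *\<^sub>R Z0"
      have q: "norm (?q1 - ?q0) \<le> G"
      proof -
        have "?q1 - ?q0 = (1 - s) *\<^sub>R (y1 - y0) + s *\<^sub>R (x1 - x0)"
          by (simp add: Z0_def Z1_def algebra_simps)
        then have "norm (?q1 - ?q0) \<le> \<bar>1 - s\<bar> * norm (y1 - y0) + \<bar>s\<bar> * norm (x1 - x0)"
          by (metis norm_scaleR norm_triangle_ineq)
        also have "\<dots> \<le> 1 * norm (y1 - y0) + 1 * norm (x1 - x0)"
          using s by (intro add_mono mult_right_mono) auto
        also have "\<dots> \<le> G" by (simp add: G_def)
        finally show ?thesis .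
      qed
      have "(Z1 - Z0) \<bullet> W = ?\<phi>' s"
        using s(3) by (simp add: W_def Z0_def Z1_def inner_diff_right algebra_simps)
      also have "\<dots> = (Z1 - Z0) \<bullet> (J ?q0 *v (Z1 - Z0)) + (Z1 - Z0) \<bullet> (J ?q1 *v Z1 - J ?q0 *v Z1)"
        by (simp add: inner_diff_right matrix_vector_mult_diff_distrib algebra_simps)
      also have "\<dots> \<ge> \<Lambda> * N\<^sup>2 - N * (LT * G * S)"
      proof -
        have "\<Lambda> * N\<^sup>2 \<le> (Z1 - Z0) \<bullet> (J ?q0 *v (Z1 - Z0))"
          using coer[of "Z1 - Z0" ?q0] by (simp add: N_def dot_square_norm)
        moreover have "\<bar>(Z1 - Z0) \<bullet> (J ?q1 *v Z1 - J ?q0 *v Z1)\<bar> \<le> N * (LT * G * S)"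
        proof -
          have "\<bar>(Z1 - Z0) \<bullet> (J ?q1 *v Z1 - J ?q0 *v Z1)\<bar> \<le> N * norm (J ?q1 *v Z1 - J ?q0 *v Z1)"
            unfolding N_def by (rule Cauchy_Schwarz_ineq2)
          also have "norm (J ?q1 *v Z1 - J ?q0 *v Z1) \<le> LT * norm (?q1 - ?q0) * norm Z1" by (rule LT)
          also have "\<dots> \<le> LT * G * S"
            using q LT0 by (intro mult_mono) (auto simp: S_def G_def)
          finally show ?thesis using pos by (simp add: mult_left_mono)
        qed
        ultimately show ?thesis by linarith
      qed
      finally show ?thesis by (simp add: mult_ac)
    qed
    have Dm: "(dx, dx, dx) \<in> kern_domain R m" using X by (simp add: kern_domain_def)
    then have dx0: "dx \<noteq> 0" using m by (auto simp: kern_domain_def)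
    have Wb: "norm W \<le> B * S"
    proof -
      have "norm W \<le> norm (T x1 - T y1) + norm (T x0 - T y0)" unfolding W_def by (rule norm_triangle_ineq4)
      also have "\<dots> \<le> B * norm Z1 + B * norm Z0" using B[of x1 y1] B[of x0 y0] by (simp add: Z0_def Z1_def)
      also have "\<dots> \<le> B * S" using B0 by (simp add: S_def algebra_simps)
      finally show ?thesis .
    qed
    let ?KX = "kern x1 x0 dx" and ?KY = "kern y1 y0 dy"
    \<comment> \<open>The kernel is frozen at the chord slope, where it is the identity over 4 pi.
      What remains is the freezing error acting on \<open>W\<close> and the difference of the two
      kernels acting on the tension increment of y.\<close>
    have split: "?KX *v (T x1 - T x0) - ?KY *v (T y1 - T y0)
       = (1 / (4 * pi)) *\<^sub>R W + (?KX *v W - kern dx dx dx *v W) + (?KX *v (T y1 - T y0) - ?KY *v (T y1 - T y0))"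
    proof -
      have "T x1 - T x0 = W + (T y1 - T y0)" by (simp add: W_def)
      then show ?thesis
        by (simp add: kern_diagonal[OF dx0] matrix_vector_right_distrib scaleR_matrix_vector_assoc[symmetric])
    qed
    have t2: "norm (?KX *v W - kern dx dx dx *v W) \<le> L * B * (S * G)"
    proof -
      have "norm (?KX *v W - kern dx dx dx *v W) \<le> L * (norm (x1 - dx) + norm (x0 - dx) + norm (dx - dx)) * norm W"
        by (rule L[OF X Dm])
      also have "\<dots> \<le> L * G * (B * S)"
        using Wb L0 pos by (intro mult_mono) (auto simp: G_def)
      finally show ?thesis by (simp add: mult_ac)
    qed
    have t3: "norm (?KX *v (T y1 - T y0) - ?KY *v (T y1 - T y0)) \<le> L * B * (S * G)"
    proof -
      have "norm (?KX *v (T y1 - T y0) - ?KY *v (T y1 - T y0)) \<le> L * (norm (x1 - y1) + norm (x0 - y0) + norm (dx - dy)) * norm (T y1 - T y0)"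
        by (rule L[OF X Y])
      also have "\<dots> = L * S * norm (T y1 - T y0)" by (simp add: S_def Z0_def Z1_def)
      also have "\<dots> \<le> L * S * (B * G)"
      proof (rule mult_left_mono)
        have "norm (T y1 - T y0) \<le> B * norm (y1 - y0)" by (rule B)
        also have "\<dots> \<le> B * G" using B0 by (intro mult_left_mono) (auto simp: G_def)
        finally show "norm (T y1 - T y0) \<le> B * G" .
        show "0 \<le> L * S" using L0 pos by simp
      qed
      finally show ?thesis by (simp add: mult_ac)
    qed
    have cs: "\<bar>(Z1 - Z0) \<bullet> v\<bar> \<le> N * (L * B * (S * G))" if "norm v \<le> L * B * (S * G)" for v
      using Cauchy_Schwarz_ineq2[of "Z1 - Z0" v] mult_left_mono[OF that, of N] pos by (simp add: N_def)
    have "- ((Z1 - Z0) \<bullet> (?KX *v (T x1 - T x0) - ?KY *v (T y1 - T y0)))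
       \<le> - ((1 / (4 * pi)) * (\<Lambda> * N\<^sup>2 - LT * (N * (S * G)))) + 2 * (N * (L * B * (S * G)))"
      unfolding split inner_add_right inner_scaleR_right
      using cs[OF t2] cs[OF t3] mult_left_mono[OF leading, of "1 / (4 * pi)"] by (simp add: right_diff_distrib)
    also have "\<dots> = N * (A * (S * G)) - (\<Lambda> / (4 * pi)) * N\<^sup>2"
      by (simp add: A_def field_simps)
    \<comment> \<open>Young's inequality as a completed square; the coercive term absorbs
      \<open>N\<close> entirely.\<close>
    also have "\<dots> \<le> (A * (S * G))\<^sup>2 * (pi / \<Lambda>)"
    proof -
      let ?b = "A * (S * G)"
      have "0 \<le> (\<Lambda> / (4 * pi)) * (N - ?b * (2 * pi / \<Lambda>))\<^sup>2" using \<Lambda> by simp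
      also have "\<dots> = (\<Lambda> / (4 * pi)) * N\<^sup>2 - N * ?b + ?b\<^sup>2 * (pi / \<Lambda>)"
        using \<Lambda> by (simp add: power2_eq_square field_simps)
      finally show ?thesis by linarith
    qed
    also have "\<dots> = A\<^sup>2 * (pi / \<Lambda>) * (S\<^sup>2 * G\<^sup>2)" by (simp add: power_mult_distrib mult_ac)
    \<comment> \<open>Squares of sums of three and of four terms cost the factors 3 and 4, whence
      12.\<close>
    also have "\<dots> \<le> A\<^sup>2 * (pi / \<Lambda>) * ((3 * ((norm Z0)\<^sup>2 + (norm Z1)\<^sup>2 + (norm (dx - dy))\<^sup>2)) * (4 * ((norm (x1 - x0))\<^sup>2 + (norm (y1 - y0))\<^sup>2 + (norm (x1 - dx))\<^sup>2 + (norm (x0 - dx))\<^sup>2)))"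
    proof (intro mult_left_mono mult_mono)
      have sq3: "(a + b + c)\<^sup>2 \<le> 3 * (a\<^sup>2 + b\<^sup>2 + c\<^sup>2)" for a b c :: real
        using sum_squares_ge_zero[of "a - b" "b - c"] zero_le_square[of "a - c"] by (simp add: power2_eq_square algebra_simps)
      have sq4: "(a + b + c + d)\<^sup>2 \<le> 4 * (a\<^sup>2 + b\<^sup>2 + c\<^sup>2 + d\<^sup>2)" for a b c d :: real
        using sum_squares_ge_zero[of "a - b" "b - c"] sum_squares_ge_zero[of "a - c" "a - d"] sum_squares_ge_zero[of "b - d" "c - d"]
        by (simp add: power2_eq_square algebra_simps)
      show "S\<^sup>2 \<le> 3 * ((norm Z0)\<^sup>2 + (norm Z1)\<^sup>2 + (norm (dx - dy))\<^sup>2)" unfolding S_def by (rule sq3)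
      show "G\<^sup>2 \<le> 4 * ((norm (x1 - x0))\<^sup>2 + (norm (y1 - y0))\<^sup>2 + (norm (x1 - dx))\<^sup>2 + (norm (x0 - dx))\<^sup>2)" unfolding G_def by (rule sq4)
    qed (use \<Lambda> in auto)
    also have "\<dots> = 12 * (A\<^sup>2 * (pi / \<Lambda>)) * ((norm Z0)\<^sup>2 + (norm Z1)\<^sup>2 + (norm (dx - dy))\<^sup>2) * ((norm (x1 - x0))\<^sup>2 + (norm (y1 - y0))\<^sup>2 + (norm (x1 - dx))\<^sup>2 + (norm (x0 - dx))\<^sup>2)"
    proof -
      have "x * ((3 * s) * (4 * g)) = 12 * x * s * g" for x s g :: real by simp
      then show ?thesis .
    qed
    finally show "- (((x1 - y1) - (x0 - y0)) \<bullet> (?KX *v (tension_map \<T> x1 - tension_map \<T> x0) - ?KY *v (tension_map \<T> y1 - tension_map \<T> y0)))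
     \<le> 12 * (A\<^sup>2 * (pi / \<Lambda>)) * ((norm (x0 - y0))\<^sup>2 + (norm (x1 - y1))\<^sup>2 + (norm (dx - dy))\<^sup>2) * ((norm (x1 - x0))\<^sup>2 + (norm (y1 - y0))\<^sup>2 + (norm (x1 - dx))\<^sup>2 + (norm (x0 - dx))\<^sup>2)"
      unfolding T_def Z0_def Z1_def .
  qed
qed

subsection \<open>Square integral norms of continuous functions\<close>

lemma sqrt_ennreal_ennreal: "0 \<le> x \<Longrightarrow> sqrt_ennreal (ennreal x) = ennreal (sqrt x)"
  by (simp add: sqrt_ennreal_def)

lemma sqrt_ennreal_power2: "(sqrt_ennreal x)\<^sup>2 = x"
  by (cases x) (auto simp: sqrt_ennreal_def power2_eq_square ennreal_top_mult ennreal_mult[symmetric])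

lemma ennreal_power2_le: fixes a b :: ennreal assumes "a\<^sup>2 \<le> b\<^sup>2" shows "a \<le> b"
proof (rule ccontr)
  assume "\<not> a \<le> b" then have ba: "b < a" by simp
  have "b * b < a * a"
  proof (cases a)
    case (real r)
    then obtain s where s: "b = ennreal s" "0 \<le> s" using ba by (cases b) auto
    then have "s < r" using ba real by (simp add: ennreal_less_iff)
    then have "s * s < r * r" using s by (intro mult_strict_mono') auto
    then show ?thesis using real s by (simp add: ennreal_mult[symmetric] ennreal_less_iff)
  next
    case top
    then show ?thesis using ba by (cases b) (auto simp: ennreal_mult[symmetric] ennreal_mult_top)
  qed
  then show False using assms by (simp add: power2_eq_square)
qed

lemma sqrt_ennreal_le_iff: "sqrt_ennreal x \<le> y \<longleftrightarrow> x \<le> y\<^sup>2"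
proof
  assume "sqrt_ennreal x \<le> y"
  then have "(sqrt_ennreal x)\<^sup>2 \<le> y\<^sup>2" by (intro power_mono) auto
  then show "x \<le> y\<^sup>2" by (simp add: sqrt_ennreal_power2)
next
  assume "x \<le> y\<^sup>2"
  then have "(sqrt_ennreal x)\<^sup>2 \<le> y\<^sup>2" by (simp add: sqrt_ennreal_power2)
  then show "sqrt_ennreal x \<le> y" by (rule ennreal_power2_le)
qed

lemma sqrt_ennreal_measurable [measurable]: "sqrt_ennreal \<in> borel_measurable borel"
  unfolding sqrt_ennreal_def[abs_def] by measurable

lemma L2_norm_continuous:
  assumes "continuous_on {-pi..pi} f"
  shows "L2_norm f = ennreal (sqrt (integral {-pi..pi} (\<lambda>\<theta>. (norm (f \<theta>))\<^sup>2)))"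
proof -
  have i: "(\<lambda>\<theta>. (norm (f \<theta>))\<^sup>2) integrable_on {-pi..pi}"
    using assms by (intro integrable_continuous_interval continuous_intros)
  have "(\<integral>\<^sup>+\<theta>\<in>{-pi..pi}. ennreal ((norm (f \<theta>))\<^sup>2) \<partial>lebesgue) = ennreal (integral {-pi..pi} (\<lambda>\<theta>. (norm (f \<theta>))\<^sup>2))"
    using nn_integral_has_integral_lebesgue'[OF _ integrable_integral[OF i]] by (simp add: nn_integral_completion)
  then show ?thesis
    unfolding L2_norm_def by (simp add: sqrt_ennreal_ennreal integral_nonneg[OF i])
qed

lemma L2_norm_delta:
  assumes "continuous_on UNIV g"
  shows "L2_norm (delta \<beta> g) = ennreal (sqrt (qdiff g \<beta>))"
proof -
  have "continuous_on {-pi..pi} (\<lambda>\<theta>. g (\<theta> + \<beta>) - g \<theta>)"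
    by (intro continuous_intros continuous_on_compose2[OF assms]) auto
  then show ?thesis by (subst L2_norm_continuous) (simp_all add: delta_def[abs_def] qdiff_def)
qed

subsection \<open>Classical regularity of strong solutions\<close>

text \<open>The joint derivative is restricted to coordinate lines. In time it is relative to
  \<open>{0<..T}\<close>, hence one-sided at \<open>T\<close>.\<close>

lemma Ck_on_Suc_partials:
  fixes f :: "real \<times> real \<Rightarrow> 'b::real_normed_vector"
  assumes "Ck_on (Suc k) ({0<..T} \<times> UNIV) f"
  obtains ft fx where "Ck_on k ({0<..T} \<times> UNIV) ft" "Ck_on k ({0<..T} \<times> UNIV) fx"
    "\<And>t \<theta>. t \<in> {0<..T} \<Longrightarrow> ((\<lambda>\<theta>. f (t, \<theta>)) has_vector_derivative fx (t, \<theta>)) (at \<theta>)"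
    "\<And>t \<theta>. t \<in> {0<..T} \<Longrightarrow> ((\<lambda>t. f (t, \<theta>)) has_vector_derivative ft (t, \<theta>)) (at t within {0<..T})"
proof -
  let ?S = "{0<..T} \<times> (UNIV :: real set)"
  obtain g where g: "\<And>z. z \<in> ?S \<Longrightarrow> (f has_derivative (\<lambda>h. \<Sum>b\<in>Basis. (h \<bullet> b) *\<^sub>R g b z)) (at z within ?S)"
    and k: "\<And>b. b \<in> Basis \<Longrightarrow> Ck_on k ?S (g b)"
    using assms by auto
  have B: "(Basis :: (real \<times> real) set) = {(1, 0), (0, 1)}" by (auto simp: Basis_prod_def)
  have sum: "(\<Sum>b\<in>Basis. (h \<bullet> b) *\<^sub>R g b z) = fst h *\<^sub>R g (1, 0) z + snd h *\<^sub>R g (0, 1) z" for h z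
    by (cases h) (simp add: B)
  show thesis
  proof (rule that[of "g (1, 0)" "g (0, 1)"])
    show "Ck_on k ?S (g (1, 0))" "Ck_on k ?S (g (0, 1))" using k by (auto simp: B)
    fix t \<theta> :: real assume t: "t \<in> {0<..T}"
    have d: "(f has_derivative (\<lambda>h. fst h *\<^sub>R g (1, 0) (t, \<theta>) + snd h *\<^sub>R g (0, 1) (t, \<theta>))) (at (t, \<theta>) within ?S)"
      using g[of "(t, \<theta>)"] t unfolding sum by simp
    have 1: "((\<lambda>\<theta>. (t, \<theta>)) has_derivative (\<lambda>h. (0, h))) (at \<theta>)" by (auto intro!: derivative_eq_intros)
    have 2: "(f has_derivative (\<lambda>h. fst h *\<^sub>R g (1, 0) (t, \<theta>) + snd h *\<^sub>R g (0, 1) (t, \<theta>))) (at (t, \<theta>) within range (\<lambda>\<theta>. (t, \<theta>)))"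
      by (rule has_derivative_subset[OF d]) (use t in auto)
    show "((\<lambda>\<theta>. f (t, \<theta>)) has_vector_derivative g (0, 1) (t, \<theta>)) (at \<theta>)"
      using has_derivative_in_compose[OF 1 2] by (simp add: has_vector_derivative_def)
    have 3: "((\<lambda>t. (t, \<theta>)) has_derivative (\<lambda>h. (h, 0))) (at t within {0<..T})" by (auto intro!: derivative_eq_intros)
    have 4: "(f has_derivative (\<lambda>h. fst h *\<^sub>R g (1, 0) (t, \<theta>) + snd h *\<^sub>R g (0, 1) (t, \<theta>))) (at (t, \<theta>) within (\<lambda>t. (t, \<theta>)) ` {0<..T})"
      by (rule has_derivative_subset[OF d]) auto
    show "((\<lambda>t. f (t, \<theta>)) has_vector_derivative g (1, 0) (t, \<theta>)) (at t within {0<..T})"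
      using has_derivative_in_compose[OF 3 4] by (simp add: has_vector_derivative_def)
  qed
qed

text \<open>\<open>X2\<close> is the second angular derivative of \<open>X\<close> and
  \<open>Xt\<close> the time derivative of the angular one. Time 0 is left out, as a strong solution
  is known to be regular only afterwards.\<close>

definition regular_flow :: "real \<Rightarrow> (real \<Rightarrow> real \<Rightarrow> real^2) \<Rightarrow> (real \<Rightarrow> real \<Rightarrow> real^2) \<Rightarrow> (real \<Rightarrow> real \<Rightarrow> real^2) \<Rightarrow> bool" where
  "regular_flow T X X2 Xt \<longleftrightarrow>
     (\<forall>t\<in>{0<..T}. periodic (X t)) \<and>
     (\<forall>t\<in>{0<..T}. \<forall>\<theta>. (X t has_vector_derivative dtheta (X t) \<theta>) (at \<theta>)) \<and>
     (\<forall>t\<in>{0<..T}. \<forall>\<theta>. (dtheta (X t) has_vector_derivative X2 t \<theta>) (at \<theta>)) \<and>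
     (\<forall>t\<in>{0<..T}. \<forall>\<theta>. ((\<lambda>s. dtheta (X s) \<theta>) has_vector_derivative Xt t \<theta>) (at t within {0<..T})) \<and>
     continuous_on ({0<..T} \<times> UNIV) (\<lambda>(t, \<theta>). dtheta (X t) \<theta>) \<and>
     continuous_on ({0<..T} \<times> UNIV) (\<lambda>(t, \<theta>). X2 t \<theta>) \<and>
     continuous_on ({0<..T} \<times> UNIV) (\<lambda>(t, \<theta>). Xt t \<theta>)"

lemma strong_solution_regular:
  assumes "strong_solution \<T> T X0 X"
  obtains X2 Xt where "regular_flow T X X2 Xt"
proof -
  let ?S = "{0<..T} \<times> (UNIV :: real set)"
  have per: "\<forall>t\<in>{0..T}. periodic (X t)" and C2: "Ck_on (Suc (Suc 0)) ?S (\<lambda>(t, \<theta>). X t \<theta>)"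
    using assms by (simp_all add: strong_solution_def numeral_2_eq_2)
  obtain ft fx where fx: "Ck_on (Suc 0) ?S fx"
    and dx: "\<And>t \<theta>. t \<in> {0<..T} \<Longrightarrow> ((\<lambda>\<theta>. (\<lambda>(t, \<theta>). X t \<theta>) (t, \<theta>)) has_vector_derivative fx (t, \<theta>)) (at \<theta>)"
    using Ck_on_Suc_partials[OF C2] by metis
  have eq: "dtheta (X t) \<theta> = fx (t, \<theta>)" if "t \<in> {0<..T}" for t \<theta>
    unfolding dtheta_def using dx[OF that, of \<theta>] by (intro vector_derivative_at) simp
  obtain fxt fxx where c: "Ck_on 0 ?S fxt" "Ck_on 0 ?S fxx"
    and dxx: "\<And>t \<theta>. t \<in> {0<..T} \<Longrightarrow> ((\<lambda>\<theta>. fx (t, \<theta>)) has_vector_derivative fxx (t, \<theta>)) (at \<theta>)"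
    and dxt: "\<And>t \<theta>. t \<in> {0<..T} \<Longrightarrow> ((\<lambda>t. fx (t, \<theta>)) has_vector_derivative fxt (t, \<theta>)) (at t within {0<..T})"
    using Ck_on_Suc_partials[OF fx] by metis
  have fxc: "continuous_on ?S fx"
  proof -
    from fx obtain g where "\<forall>z\<in>?S. (fx has_derivative g z) (at z within ?S)" by auto
    then show ?thesis using has_derivative_continuous_on by metis
  qed
  show thesis
  proof (rule that[of "\<lambda>t \<theta>. fxx (t, \<theta>)" "\<lambda>t \<theta>. fxt (t, \<theta>)"], unfold regular_flow_def, intro conjI ballI allI)
    fix t \<theta> assume t: "t \<in> {0<..T}"
    show "periodic (X t)" using per t by auto
    show "(X t has_vector_derivative dtheta (X t) \<theta>) (at \<theta>)" using dx[OF t] by (simp add: eq[OF t])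
    show "(dtheta (X t) has_vector_derivative fxx (t, \<theta>)) (at \<theta>)"
    proof -
      have "dtheta (X t) = (\<lambda>\<theta>. fx (t, \<theta>))" using eq[OF t] by auto
      then show ?thesis using dxx[OF t] by simp
    qed
    show "((\<lambda>s. dtheta (X s) \<theta>) has_vector_derivative fxt (t, \<theta>)) (at t within {0<..T})"
      by (rule has_vector_derivative_transform[OF t _ dxt[OF t]]) (simp add: eq)
  next
    show "continuous_on ?S (\<lambda>(t, \<theta>). dtheta (X t) \<theta>)"
      by (rule continuous_on_eq[OF fxc]) (auto simp: eq)
  qed (use c in \<open>simp_all add: split_beta\<close>)
qed

lemma regular_flowD:
  assumes "regular_flow T X X2 Xt" and t: "t \<in> {0<..T}"
  shows "periodic (X t)" "\<And>\<theta>. (X t has_vector_derivative dtheta (X t) \<theta>) (at \<theta>)"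
    "\<And>\<theta>. (dtheta (X t) has_vector_derivative X2 t \<theta>) (at \<theta>)"
    "\<And>\<theta>. ((\<lambda>s. dtheta (X s) \<theta>) has_vector_derivative Xt t \<theta>) (at t within {0<..T})"
    "continuous_on UNIV (dtheta (X t))" "continuous_on UNIV (X2 t)" "continuous_on UNIV (Xt t)"
    "periodic (dtheta (X t))" "integral {-pi..pi} (dtheta (X t)) = 0"
proof -
  note r = assms(1)[unfolded regular_flow_def]
  show per: "periodic (X t)" and d: "\<And>\<theta>. (X t has_vector_derivative dtheta (X t) \<theta>) (at \<theta>)"
    "\<And>\<theta>. (dtheta (X t) has_vector_derivative X2 t \<theta>) (at \<theta>)"
    "\<And>\<theta>. ((\<lambda>s. dtheta (X s) \<theta>) has_vector_derivative Xt t \<theta>) (at t within {0<..T})"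
    using r t by blast+
  have slice: "continuous_on UNIV (F t)" if "continuous_on ({0<..T} \<times> UNIV) (\<lambda>(t, \<theta>). F t \<theta>)" for F :: "real \<Rightarrow> real \<Rightarrow> real^2"
  proof -
    have "continuous_on UNIV (\<lambda>\<theta>. (\<lambda>(t, \<theta>). F t \<theta>) (t, \<theta>))"
      by (rule continuous_on_compose2[OF that], rule continuous_on_Pair[OF continuous_on_const continuous_on_id]) (use t in auto)
    then show ?thesis by simp
  qed
  show "continuous_on UNIV (dtheta (X t))" "continuous_on UNIV (X2 t)" "continuous_on UNIV (Xt t)"
    using r by (auto intro: slice)
  show "periodic (dtheta (X t))"
    unfolding periodic_def
  proof
    fix \<theta>
    have "((\<lambda>x. x + 2 * pi) has_vector_derivative 1) (at \<theta>)" by (auto intro!: derivative_eq_intros)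
    from vector_diff_chain_at[OF this d(1)[of "\<theta> + 2 * pi"]]
    have "((\<lambda>x. X t (x + 2 * pi)) has_vector_derivative dtheta (X t) (\<theta> + 2 * pi)) (at \<theta>)" by (simp add: o_def)
    moreover have "(\<lambda>x. X t (x + 2 * pi)) = X t" using per by (auto simp: periodic_def)
    ultimately show "dtheta (X t) (\<theta> + 2 * pi) = dtheta (X t) \<theta>"
      using d(1)[of \<theta>] vector_derivative_unique_at by metis
  qed
  have "(dtheta (X t) has_integral (X t pi - X t (-pi))) {-pi..pi}"
    by (rule fundamental_theorem_of_calculus) (auto intro: has_vector_derivative_at_within[OF d(1)])
  moreover have "X t pi = X t (-pi)" using periodic_int[OF per, of "-pi" 1] by simp
  ultimately show "integral {-pi..pi} (dtheta (X t)) = 0" by (simp add: integral_unique)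
qed

text \<open>Points to the left are used because they remain in the interval even at
  \<open>t = T\<close>. They are rational in one application and outside an exceptional null set in
  the other.\<close>

lemma le_from_left_dense:
  fixes \<phi> :: "real \<Rightarrow> real"
  assumes c: "continuous_on {0<..T} \<phi>" and t: "t \<in> {0<..T}"
    and dense: "\<And>d. 0 < d \<Longrightarrow> d < t \<Longrightarrow> \<exists>s\<in>{t-d<..<t}. \<phi> s \<le> K"
  shows "\<phi> t \<le> K"
proof (rule ccontr)
  assume "\<not> \<phi> t \<le> K"
  then have "0 < \<phi> t - K" by simp
  then obtain d where d: "0 < d" "\<And>s. s \<in> {0<..T} \<Longrightarrow> dist s t < d \<Longrightarrow> dist (\<phi> s) (\<phi> t) < \<phi> t - K"
    using c t unfolding continuous_on_iff by metis
  let ?d = "min d (t / 2)"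
  have "0 < ?d" "?d < t" using d t by auto
  then obtain s where s: "t - ?d < s" "s < t" "\<phi> s \<le> K" using dense[of ?d] by auto
  then have "s \<in> {0<..T}" "dist s t < d" using t d by (auto simp: dist_real_def)
  from d(2)[OF this] s(3) show False by (simp add: dist_real_def)
qed

text \<open>
  \<open>LinfL2_norm\<close> of an increment need not be measurable in the increment; a countable supremum is.
\<close>

definition rat_sup :: "real \<Rightarrow> (real \<Rightarrow> real \<Rightarrow> real^2) \<Rightarrow> real \<Rightarrow> ennreal" where
  "rat_sup T U \<beta> = (SUP t\<in>\<rat> \<inter> {0<..T}. ennreal (sqrt (qdiff (U t) \<beta>)))"

lemma qdiff_time_continuous:
  assumes c: "continuous_on (A \<times> UNIV) (\<lambda>(t, \<theta>). U t \<theta>)"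
  shows "continuous_on A (\<lambda>t. qdiff (U t) \<beta>)"
proof -
  have sh: "continuous_on (A \<times> cbox (-pi) pi) (\<lambda>p. U (fst p) (snd p + b))" for b :: real
  proof -
    have "continuous_on (A \<times> cbox (-pi) pi) (\<lambda>p. (\<lambda>(t, \<theta>). U t \<theta>) (fst p, snd p + b))"
      by (rule continuous_on_compose2[OF c]) (auto intro!: continuous_intros)
    then show ?thesis by simp
  qed
  have "continuous_on (A \<times> cbox (-pi) pi) (\<lambda>(t, \<theta>). (norm (U t (\<theta> + \<beta>) - U t \<theta>))\<^sup>2)"
    using sh[of 0] unfolding split_beta' by (intro continuous_intros sh) simp
  from integral_continuous_on_param[OF this] show ?thesis
    by (simp only: qdiff_def cbox_interval)
qed

lemma flow_qdiff_continuous: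
  assumes r: "regular_flow T X X2 Xt"
  shows "continuous_on {0<..T} (\<lambda>t. qdiff (dtheta (X t)) \<beta>)"
  using r by (intro qdiff_time_continuous) (simp add: regular_flow_def)

lemma rat_sup_upper:
  assumes r: "regular_flow T X X2 Xt" and t: "t \<in> {0<..T}"
  shows "ennreal (sqrt (qdiff (dtheta (X t)) \<beta>)) \<le> rat_sup T (\<lambda>t. dtheta (X t)) \<beta>"
proof (cases "rat_sup T (\<lambda>t. dtheta (X t)) \<beta>")
  case (real K)
  have "sqrt (qdiff (dtheta (X t)) \<beta>) \<le> K"
  proof (rule le_from_left_dense[where \<phi>="\<lambda>t. sqrt (qdiff (dtheta (X t)) \<beta>)", OF _ t])
    show "continuous_on {0<..T} (\<lambda>t. sqrt (qdiff (dtheta (X t)) \<beta>))"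
      by (intro continuous_intros flow_qdiff_continuous[OF r])
    fix d assume d: "0 < d" "d < t"
    then obtain q where q: "q \<in> \<rat>" "t - d < q" "q < t" using Rats_dense_in_real[of "t - d" t] by auto
    then have "ennreal (sqrt (qdiff (dtheta (X q)) \<beta>)) \<le> rat_sup T (\<lambda>t. dtheta (X t)) \<beta>"
      unfolding rat_sup_def using d t by (intro SUP_upper) auto
    then show "\<exists>s\<in>{t-d<..<t}. sqrt (qdiff (dtheta (X s)) \<beta>) \<le> K" using q real by (intro bexI[of _ q]) auto
  qed
  then show ?thesis using real by (simp add: ennreal_leI)
qed simp

lemma rat_sup_measurable:
  assumes r: "regular_flow T X X2 Xt"
  shows "rat_sup T (\<lambda>t. dtheta (X t)) \<in> borel_measurable borel"
  unfolding rat_sup_def[abs_def]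
proof (rule borel_measurable_SUP)
  show "countable (\<rat> \<inter> {0<..T})" using countable_rat by blast
  fix t assume "t \<in> \<rat> \<inter> {0<..T}"
  then have t: "t \<in> {0<..T}" by simp
  have "(\<lambda>\<beta>. sqrt (qdiff (dtheta (X t)) \<beta>)) \<in> borel_measurable borel"
    by (intro borel_measurable_continuous_onI continuous_intros qdiff_continuous regular_flowD(5)[OF r t])
  then show "(\<lambda>\<beta>. ennreal (sqrt (qdiff (dtheta (X t)) \<beta>))) \<in> borel_measurable borel" by measurable
qed

text \<open>An essential bound holds at some time in every interval to the left, since an interval
  is not null; by continuity in time it then holds at every time in \<open>{0<..T}\<close>.\<close>

lemma rat_sup_le_LinfL2:
  assumes r: "regular_flow T X X2 Xt"
  shows "rat_sup T (\<lambda>t. dtheta (X t)) \<beta> \<le> LinfL2_norm T (\<lambda>t. delta \<beta> (dtheta (X t)))"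
  unfolding rat_sup_def
proof (rule SUP_least)
  fix t assume "t \<in> \<rat> \<inter> {0<..T}"
  then have t: "t \<in> {0<..T}" by simp
  let ?c = "LinfL2_norm T (\<lambda>t. delta \<beta> (dtheta (X t)))"
  have "AE s in restrict_space lebesgue {0..T}. L2_norm (delta \<beta> (dtheta (X s))) \<le> ?c"
    unfolding LinfL2_norm_def by (rule esssup_AE)
  then have "AE s in lebesgue. s \<in> {0..T} \<longrightarrow> L2_norm (delta \<beta> (dtheta (X s))) \<le> ?c"
    by (subst (asm) AE_restrict_space_iff) auto
  then have ae: "AE s in lebesgue. s \<in> {0<..T} \<longrightarrow> ennreal (sqrt (qdiff (dtheta (X s)) \<beta>)) \<le> ?c"
  proof eventually_elim
    case (elim s)
    show ?case
    proof
      assume s: "s \<in> {0<..T}"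
      then show "ennreal (sqrt (qdiff (dtheta (X s)) \<beta>)) \<le> ?c"
        using elim by (simp add: L2_norm_delta[OF regular_flowD(5)[OF r s]])
    qed
  qed
  show "ennreal (sqrt (qdiff (dtheta (X t)) \<beta>)) \<le> ?c"
  proof (cases ?c)
    case (real K)
    have "sqrt (qdiff (dtheta (X t)) \<beta>) \<le> K"
    proof (rule le_from_left_dense[where \<phi>="\<lambda>t. sqrt (qdiff (dtheta (X t)) \<beta>)", OF _ t])
      show "continuous_on {0<..T} (\<lambda>t. sqrt (qdiff (dtheta (X t)) \<beta>))"
        by (intro continuous_intros flow_qdiff_continuous[OF r])
      fix d assume d: "0 < d" "d < t"
      show "\<exists>s\<in>{t-d<..<t}. sqrt (qdiff (dtheta (X s)) \<beta>) \<le> K"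
      proof (rule ccontr)
        assume neg: "\<not> ?thesis"
        from ae have "AE s in lebesgue. s \<notin> {t-d<..<t}"
        proof eventually_elim
          case (elim s)
          show ?case
          proof
            assume s: "s \<in> {t-d<..<t}"
            then have "s \<in> {0<..T}" using d t by auto
            with elim have "ennreal (sqrt (qdiff (dtheta (X s)) \<beta>)) \<le> ennreal K" using real by simp
            then have "sqrt (qdiff (dtheta (X s)) \<beta>) \<le> K" using real by simp
            then show False using neg s by blast
          qed
        qed
        then have "{t-d<..<t} \<in> null_sets lebesgue" by (subst AE_iff_null_sets) auto
        then show False using open_not_negligible[of "{t-d<..<t}"] d by (simp add: negligible_iff_null_sets)
      qed
    qed
    then show ?thesis using real by (simp add: ennreal_leI)
  qed simp
qed

subsection \<open>Consequences of the energy bound\<close>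

text \<open>The nonnegative dissipation is dropped and the essential supremum replaced by the
  smaller \<open>rat_sup\<close>. The comparison is by monotonicity alone, as the original integrand
  may fail to be measurable in \<beta>.\<close>

lemma energy_sup_part:
  assumes r: "regular_flow T X X2 Xt" and e: "energy_bound \<mu> \<Lambda> c T X0 X" and d: "admissible_datum \<mu> M X0"
  shows "(\<integral>\<^sup>+\<beta>\<in>{-pi..pi}. ennreal (\<mu> (1 / \<bar>\<beta>\<bar>) / \<bar>\<beta>\<bar> powr (3/2)) * rat_sup T (\<lambda>t. dtheta (X t)) \<beta> \<partial>lborel) \<le> ennreal (4 * M)"
proof -
  have "(\<integral>\<^sup>+\<beta>\<in>{-pi..pi}. ennreal (\<mu> (1 / \<bar>\<beta>\<bar>) / \<bar>\<beta>\<bar> powr (3/2)) * rat_sup T (\<lambda>t. dtheta (X t)) \<beta> \<partial>lborel)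
    \<le> (\<integral>\<^sup>+\<beta>\<in>{-pi..pi}. ennreal (\<mu> (1 / \<bar>\<beta>\<bar>) / \<bar>\<beta>\<bar> powr (3/2)) *
        (LinfL2_norm T (\<lambda>t. delta \<beta> (dtheta (X t))) +
         ennreal (c * sqrt \<Lambda>) *
           L2L2_norm T (\<lambda>t. delta \<beta> (frac_laplacian (1/4) (dtheta (X t))))) \<partial>lborel)"
    by (intro nn_integral_mono mult_right_mono mult_left_mono order_trans[OF rat_sup_le_LinfL2[OF r]]) auto
  also have "\<dots> \<le> 4 * besov_norm \<mu> (dtheta X0)"
    using e by (simp add: energy_bound_def nn_integral_completion)
  also have "\<dots> \<le> 4 * ennreal M" using d by (intro mult_left_mono) (auto simp: admissible_datum_def)
  also have "\<dots> \<le> ennreal (4 * M)"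
    by (cases "0 \<le> M") (auto simp: ennreal_mult ennreal_neg)
  finally show ?thesis .
qed

lemma powr_weight: "0 < \<beta> \<Longrightarrow> \<beta> powr (-3/2) = 1 / \<beta> powr (3/2)" for \<beta> :: real
  using powr_minus_divide[of \<beta> "3/2"] by simp

lemma energy_sup_part_unweighted:
  assumes \<mu>: "\<And>r. 0 \<le> r \<Longrightarrow> 1 \<le> \<mu> r"
    and r: "regular_flow T X X2 Xt" and e: "energy_bound \<mu> \<Lambda> c T X0 X" and d: "admissible_datum \<mu> M X0"
  shows "(\<integral>\<^sup>+\<beta>. ennreal (\<beta> powr (-3/2)) * rat_sup T (\<lambda>t. dtheta (X t)) \<beta> * indicator {0<..pi} \<beta> \<partial>lborel) \<le> ennreal (4 * M)"
proof -
  have "(\<integral>\<^sup>+\<beta>. ennreal (\<beta> powr (-3/2)) * rat_sup T (\<lambda>t. dtheta (X t)) \<beta> * indicator {0<..pi} \<beta> \<partial>lborel)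
    \<le> (\<integral>\<^sup>+\<beta>\<in>{-pi..pi}. ennreal (\<mu> (1 / \<bar>\<beta>\<bar>) / \<bar>\<beta>\<bar> powr (3/2)) * rat_sup T (\<lambda>t. dtheta (X t)) \<beta> \<partial>lborel)"
  proof (rule nn_integral_mono)
    fix \<beta> :: real
    show "ennreal (\<beta> powr (-3/2)) * rat_sup T (\<lambda>t. dtheta (X t)) \<beta> * indicator {0<..pi} \<beta>
      \<le> ennreal (\<mu> (1 / \<bar>\<beta>\<bar>) / \<bar>\<beta>\<bar> powr (3/2)) * rat_sup T (\<lambda>t. dtheta (X t)) \<beta> * indicator {-pi..pi} \<beta>"
    proof (cases "\<beta> \<in> {0<..pi}")
      case True
      then have b: "0 < \<beta>" by simp
      have e: "\<beta> powr (-3/2) = 1 / \<bar>\<beta>\<bar> powr (3/2)" using powr_weight[OF b] b by (simp only: abs_of_pos)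
      have "\<beta> powr (-3/2) \<le> \<mu> (1 / \<bar>\<beta>\<bar>) / \<bar>\<beta>\<bar> powr (3/2)"
        unfolding e using \<mu>[of "1 / \<bar>\<beta>\<bar>"] by (intro divide_right_mono) auto
      then show ?thesis using True by (auto intro!: mult_right_mono ennreal_leI)
    qed simp
  qed
  also have "\<dots> \<le> ennreal (4 * M)" by (rule energy_sup_part[OF r e d])
  finally show ?thesis .
qed

text \<open>The embedding constant 4 times the energy bound 4M.\<close>

lemma flow_bounded:
  assumes \<mu>: "\<And>r. 0 \<le> r \<Longrightarrow> 1 \<le> \<mu> r" and M: "0 < M"
    and r: "regular_flow T X X2 Xt" and e: "energy_bound \<mu> \<Lambda> c T X0 X" and d: "admissible_datum \<mu> M X0"
    and t: "t \<in> {0<..T}"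
  shows "norm (dtheta (X t) \<theta>) \<le> 16 * M"
proof -
  have "ennreal (norm (dtheta (X t) \<theta>)) \<le> 4 * (\<integral>\<^sup>+\<beta>. ennreal (\<beta> powr (-3/2) * sqrt (qdiff (dtheta (X t)) \<beta>)) * indicator {0<..pi} \<beta> \<partial>lborel)"
    by (rule besov_embedding[OF regular_flowD(8,5,9)[OF r t]])
  also have "\<dots> \<le> 4 * (\<integral>\<^sup>+\<beta>. ennreal (\<beta> powr (-3/2)) * rat_sup T (\<lambda>t. dtheta (X t)) \<beta> * indicator {0<..pi} \<beta> \<partial>lborel)"
    by (intro mult_left_mono nn_integral_mono mult_right_mono)
      (auto simp: ennreal_mult qdiff_nonneg intro!: mult_left_mono rat_sup_upper[OF r t])
  also have "\<dots> \<le> 4 * ennreal (4 * M)"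
    by (intro mult_left_mono energy_sup_part_unweighted[OF \<mu> r e d]) auto
  also have "\<dots> = ennreal (16 * M)" using M by (subst ennreal_numeral[symmetric], subst ennreal_mult[symmetric]) auto
  finally show ?thesis using M by simp
qed

lemma scaleR_complex_conv: "r *\<^sub>R (z::complex) = of_real r * z"
  by (rule scaleR_conv_of_real)

text \<open>\<open>frac_laplacian\<close> is a choice by \<open>SOME\<close>, so the dissipation in
  the energy bound carries no information until a function with the right coefficients exists.
  Slices at positive times are smooth enough for \<open>half_laplacian_exists\<close>, applied to
  each component.\<close>

lemma frac_laplacian_flow:
  assumes r: "regular_flow T X X2 Xt" and t: "t \<in> {0<..T}"
  shows "is_frac_laplacian (1/4) (dtheta (X t)) (frac_laplacian (1/4) (dtheta (X t)))"
  unfolding frac_laplacian_def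
proof (rule someI_ex[of "is_frac_laplacian (1/4) (dtheta (X t))"])
  let ?f = "dtheta (X t)"
  note rf = regular_flowD[OF r t]
  have "\<exists>g B. periodic g \<and> g \<in> borel_measurable borel \<and> (\<forall>x. \<bar>g x\<bar> \<le> B) \<and>
    (\<forall>k. fc g k = of_real (of_int (k\<^sup>2) powr (1/4)) * fc (\<lambda>\<theta>. ?f \<theta> $ j) k)" for j
  proof -
    have "periodic (\<lambda>\<theta>. ?f \<theta> $ j)" using rf(8) by (simp add: periodic_def)
    moreover have "((\<lambda>\<theta>. ?f \<theta> $ j) has_real_derivative X2 t \<theta> $ j) (at \<theta>)" for \<theta>
      using bounded_linear.has_vector_derivative[OF bounded_linear_vec_nth rf(3)[of \<theta>], of j]
      by (simp add: has_real_derivative_iff_has_vector_derivative)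
    moreover have "continuous_on UNIV (\<lambda>\<theta>. X2 t \<theta> $ j)" using rf(6) by (intro continuous_intros)
    ultimately show ?thesis by (rule half_laplacian_exists) blast
  qed
  then obtain g B where g: "\<And>j. periodic (g j)" "\<And>j. g j \<in> borel_measurable borel" "\<And>j x. \<bar>g j x\<bar> \<le> B j"
    "\<And>j k. fc (g j) k = of_real (of_int (k\<^sup>2) powr (1/4)) * fc (\<lambda>\<theta>. ?f \<theta> $ j) k"
    by metis
  let ?G = "\<lambda>\<theta>. \<chi> j. g j \<theta>"
  have Gm: "?G \<in> borel_measurable borel"
  proof -
    have "?G = (\<lambda>\<theta>. g 1 \<theta> *\<^sub>R axis 1 1 + g 2 \<theta> *\<^sub>R axis 2 1)"
      by (auto simp: vec_eq_iff forall_2 axis_def)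
    moreover have "(\<lambda>\<theta>. g 1 \<theta> *\<^sub>R axis 1 1 + g 2 \<theta> *\<^sub>R axis 2 1 :: real^2) \<in> borel_measurable borel"
      using g(2)[of 1] g(2)[of 2] by measurable
    ultimately show ?thesis by simp
  qed
  have fcG: "fourier_coeff ?G k = (of_int (k\<^sup>2) powr (1/4)) *\<^sub>R fourier_coeff ?f k" for k
  proof -
    have "fourier_coeff ?G k $ j = ((of_int (k\<^sup>2) powr (1/4)) *\<^sub>R fourier_coeff ?f k) $ j" for j
      unfolding fourier_coeff_nth vector_scaleR_component scaleR_complex_conv using g(4)[of j k] by simp
    then show ?thesis by (simp only: vec_eq_iff) simp
  qed
  have "is_frac_laplacian (1/4) ?f ?G"
    unfolding is_frac_laplacian_def
  proof (intro conjI)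
    show "\<forall>k. fourier_coeff ?G k = (of_int (k\<^sup>2) powr (1/4)) *\<^sub>R fourier_coeff ?f k" using fcG by blast
    show "periodic ?G" using g(1) by (simp add: periodic_def)
    show "?G \<in> borel_measurable lebesgue" using Gm by (simp add: measurable_completion)
    show "L2_norm ?G < top"
    proof -
      have b: "(norm (?G \<theta>))\<^sup>2 \<le> (\<bar>B 1\<bar> + \<bar>B 2\<bar>)\<^sup>2" for \<theta>
      proof (rule power_mono)
        have "norm (?G \<theta>) \<le> \<bar>g 1 \<theta>\<bar> + \<bar>g 2 \<theta>\<bar>" using norm_le_l1_cart[of "?G \<theta>"] by (simp add: sum_2)
        then show "norm (?G \<theta>) \<le> \<bar>B 1\<bar> + \<bar>B 2\<bar>" using g(3)[of 1 \<theta>] g(3)[of 2 \<theta>] by linarith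
      qed simp
      have "(\<integral>\<^sup>+\<theta>\<in>{-pi..pi}. ennreal ((norm (?G \<theta>))\<^sup>2) \<partial>lebesgue) \<le> (\<integral>\<^sup>+\<theta>\<in>{-pi..pi}. ennreal ((\<bar>B 1\<bar> + \<bar>B 2\<bar>)\<^sup>2) \<partial>lebesgue)"
        by (intro nn_integral_mono mult_right_mono ennreal_leI b) auto
      also have "\<dots> < top" by (simp add: nn_integral_cmult_indicator ennreal_mult_less_top)
      finally show ?thesis by (auto simp: L2_norm_def sqrt_ennreal_def)
    qed
  qed
  then show "\<exists>g. is_frac_laplacian (1/4) ?f g" by blast
qed

lemma norm2_sq: "(norm (x::real^2))\<^sup>2 = (x $ 1)\<^sup>2 + (x $ 2)\<^sup>2"
  by (simp add: norm_vec_def L2_set_def sum_2 sum_nonneg)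

text \<open>Increments commute with Fourier multipliers, so \<open>half_derivative_energy\<close>
  applies to each component of \<open>delta \<beta> f\<close> with the corresponding component of
  \<open>delta \<beta> g\<close>.\<close>

lemma half_derivative_energy_delta:
  assumes per: "periodic f" and c: "continuous_on UNIV f" and g: "is_frac_laplacian (1/4) f g"
  shows "(\<integral>\<^sup>+\<alpha>. ennreal (qdiff (delta \<beta> f) \<alpha> / \<alpha>\<^sup>2) * indicator {0<..} \<alpha> \<partial>lborel) \<le> 5 * (L2_norm (delta \<beta> g))\<^sup>2"
proof (cases "L2_norm (delta \<beta> g) = top")
  case True
  then show ?thesis by (simp add: power2_eq_square ennreal_mult_top)
next
  case False
  let ?M = "lebesgue_on {-pi..pi}"
  note gd = g[unfolded is_frac_laplacian_def]
  have gm: "g \<in> borel_measurable lebesgue" and gper: "periodic g" using gd by auto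
  have gsm: "(\<lambda>\<theta>. g (\<theta> + \<beta>)) \<in> borel_measurable lebesgue"
    using borel_measurable_affine[OF gm, of 1 \<beta>] by (simp add: add.commute)
  have dm: "(\<lambda>\<theta>. delta \<beta> g \<theta>) \<in> borel_measurable lebesgue" unfolding delta_def using gm gsm by measurable
  have nth_m: "(\<lambda>\<theta>. G \<theta> $ j) \<in> borel_measurable ?M" if "G \<in> borel_measurable lebesgue" for G :: "real \<Rightarrow> real^2" and j
  proof -
    have "(\<lambda>\<theta>. G \<theta> $ j) \<in> borel_measurable lebesgue"
      using that by (intro borel_measurable_continuous_on[of "\<lambda>v. v $ j"] continuous_intros)
    then show ?thesis by (rule measurable_restrict_space1)
  qed
  have sq_int: "integrable ?M (\<lambda>\<theta>. (G \<theta> $ j)\<^sup>2)" "integrable ?M (\<lambda>\<theta>. G \<theta> $ j)" "integrable ?M (\<lambda>\<theta>. (norm (G \<theta>))\<^sup>2)"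
    if Gm: "G \<in> borel_measurable lebesgue" and fin: "L2_norm G \<noteq> top" for G :: "real \<Rightarrow> real^2" and j
  proof -
    have [measurable]: "(\<lambda>\<theta>. G \<theta> $ j) \<in> borel_measurable ?M" by (rule nth_m[OF Gm])
    have [measurable]: "G \<in> borel_measurable ?M" using Gm by (rule measurable_restrict_space1)
    have fin': "(\<integral>\<^sup>+\<theta>. ennreal ((norm (G \<theta>))\<^sup>2) \<partial>?M) \<noteq> top"
      using fin by (simp add: L2_norm_def sqrt_ennreal_def nn_integral_restrict_space split: if_splits)
    show n: "integrable ?M (\<lambda>\<theta>. (norm (G \<theta>))\<^sup>2)"
      by (rule integrableI_nonneg) (use fin' in \<open>auto simp: less_top\<close>)
    show s: "integrable ?M (\<lambda>\<theta>. (G \<theta> $ j)\<^sup>2)"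
    proof (rule Bochner_Integration.integrable_bound[OF n])
      show "AE \<theta> in ?M. norm ((G \<theta> $ j)\<^sup>2) \<le> norm ((norm (G \<theta>))\<^sup>2)"
        using component_le_norm_cart by (intro AE_I2) (auto simp: abs_le_square_iff[symmetric])
    qed measurable
    have one: "integrable ?M (\<lambda>_. 1::real)" using lebesgue_on_eq_integral(1)[of "-pi" pi "\<lambda>_. 1::real"] by simp
    show "integrable ?M (\<lambda>\<theta>. G \<theta> $ j)"
    proof (rule Bochner_Integration.integrable_bound[OF Bochner_Integration.integrable_add[OF one s]])
      show "AE \<theta> in ?M. norm (G \<theta> $ j) \<le> norm (1 + (G \<theta> $ j)\<^sup>2)"
      proof (rule AE_I2)
        fix \<theta>
        have "\<bar>x\<bar> \<le> 1 + x\<^sup>2" for x :: real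
          using zero_le_square[of "\<bar>x\<bar> - 1"] zero_le_square[of x] by (simp add: power2_eq_square algebra_simps abs_mult[symmetric])
        then show "norm (G \<theta> $ j) \<le> norm (1 + (G \<theta> $ j)\<^sup>2)" by simp
      qed
    qed measurable
  qed
  note gi = sq_int(2)[OF gm] and di = sq_int[OF dm False]
  have gfin: "L2_norm g \<noteq> top" using gd by auto
  have cS: "continuous_on S f" for S using c by (rule continuous_on_subset) auto
  have cd: "continuous_on S (delta \<beta> f)" for S
    unfolding delta_def[abs_def] by (intro continuous_intros cS continuous_on_compose2[OF c]) auto
  have comp: "(\<integral>\<^sup>+\<alpha>. ennreal (integral {-pi..pi} (\<lambda>\<theta>. (delta \<beta> f (\<theta> + \<alpha>) $ j - delta \<beta> f \<theta> $ j)\<^sup>2) / \<alpha>\<^sup>2) * indicator {0<..} \<alpha> \<partial>lborel)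
    \<le> ennreal (5 * (LINT \<theta>|?M. (delta \<beta> g \<theta> $ j)\<^sup>2))" for j
  proof (rule half_derivative_energy[of "\<lambda>\<theta>. delta \<beta> f \<theta> $ j" "\<lambda>\<theta>. delta \<beta> g \<theta> $ j"])
    show "periodic (\<lambda>\<theta>. delta \<beta> f \<theta> $ j)" using per periodic_shift[OF per, of \<beta>] by (simp add: periodic_def delta_def)
    show "continuous_on UNIV (\<lambda>\<theta>. delta \<beta> f \<theta> $ j)" by (intro continuous_intros cd)
    show "integrable ?M (\<lambda>\<theta>. delta \<beta> g \<theta> $ j)" "integrable ?M (\<lambda>\<theta>. (delta \<beta> g \<theta> $ j)\<^sup>2)" by (rule di)+
    fix k :: int
    have pj: "periodic (\<lambda>\<theta>. f \<theta> $ j)" "periodic (\<lambda>\<theta>. g \<theta> $ j)" using per gper by (simp_all add: periodic_def)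
    have fi: "integrable ?M (\<lambda>\<theta>. f \<theta> $ j)" by (intro lebesgue_on_eq_integral(1) continuous_intros cS)
    have "fc (\<lambda>\<theta>. delta \<beta> g \<theta> $ j) k = (cis (of_int k * \<beta>) - 1) * fc (\<lambda>\<theta>. g \<theta> $ j) k"
      using fc_delta[OF pj(2) gi[OF gfin], of \<beta> k] by (simp add: delta_def)
    also have "fc (\<lambda>\<theta>. g \<theta> $ j) k = of_real (of_int (k\<^sup>2) powr (1/4)) * fc (\<lambda>\<theta>. f \<theta> $ j) k"
    proof -
      have "fourier_coeff g k $ j = ((of_int (k\<^sup>2) powr (1/4)) *\<^sub>R fourier_coeff f k) $ j" using gd by simp
      then show ?thesis by (simp only: fourier_coeff_nth vector_scaleR_component scaleR_complex_conv)
    qed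
    also have "(cis (of_int k * \<beta>) - 1) * (of_real (of_int (k\<^sup>2) powr (1/4)) * fc (\<lambda>\<theta>. f \<theta> $ j) k)
      = of_real (of_int (k\<^sup>2) powr (1/4)) * fc (\<lambda>\<theta>. delta \<beta> f \<theta> $ j) k"
      using fc_delta[OF pj(1) fi, of \<beta> k] by (simp add: delta_def)
    finally show "fc (\<lambda>\<theta>. delta \<beta> g \<theta> $ j) k = of_real (of_int (k\<^sup>2) powr (1/4)) * fc (\<lambda>\<theta>. delta \<beta> f \<theta> $ j) k" .
  qed
  let ?q = "\<lambda>j \<alpha>. integral {-pi..pi} (\<lambda>\<theta>. (delta \<beta> f (\<theta> + \<alpha>) $ j - delta \<beta> f \<theta> $ j)\<^sup>2)"
  have ci: "continuous_on S (\<lambda>\<theta>. delta \<beta> f (\<theta> + \<alpha>) $ j - delta \<beta> f \<theta> $ j)" for S \<alpha> j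
    by (intro continuous_intros cd continuous_on_compose2[OF cd[of UNIV]]) auto
  have qn: "0 \<le> ?q j \<alpha>" for j \<alpha>
    by (intro integral_nonneg integrable_continuous_interval continuous_intros ci) auto
  have qsplit: "qdiff (delta \<beta> f) \<alpha> = ?q 1 \<alpha> + ?q 2 \<alpha>" for \<alpha>
    unfolding qdiff_def norm2_sq vector_minus_component
    by (intro integral_add integrable_continuous_interval continuous_intros ci)
  have qm: "(\<lambda>\<alpha>. ?q j \<alpha>) \<in> borel_measurable borel" for j
  proof (rule borel_measurable_continuous_onI)
    have *: "continuous_on (cbox a b) (?q j)" for a b
      unfolding interval_cbox
      by (rule integral_continuous_on_param) (auto intro!: continuous_intros continuous_on_compose2[OF cd[of UNIV]] simp: split_beta)
    have "isCont (?q j) x" for x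
      using *[of "x-1" "x+1"] by (intro continuous_on_interior[of "cbox (x-1) (x+1)"]) (auto simp: interval_cbox[symmetric])
    then show "continuous_on UNIV (?q j)" by (simp add: continuous_at_imp_continuous_on)
  qed
  note qm [measurable]
  have "(\<integral>\<^sup>+\<alpha>. ennreal (qdiff (delta \<beta> f) \<alpha> / \<alpha>\<^sup>2) * indicator {0<..} \<alpha> \<partial>lborel)
     = (\<integral>\<^sup>+\<alpha>. ennreal (?q 1 \<alpha> / \<alpha>\<^sup>2) * indicator {0<..} \<alpha> + ennreal (?q 2 \<alpha> / \<alpha>\<^sup>2) * indicator {0<..} \<alpha> \<partial>lborel)"
    by (intro nn_integral_cong) (auto simp: qsplit add_divide_distrib indicator_def qn)
  also have "\<dots> = (\<integral>\<^sup>+\<alpha>. ennreal (?q 1 \<alpha> / \<alpha>\<^sup>2) * indicator {0<..} \<alpha> \<partial>lborel) + (\<integral>\<^sup>+\<alpha>. ennreal (?q 2 \<alpha> / \<alpha>\<^sup>2) * indicator {0<..} \<alpha> \<partial>lborel)"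
    by (intro nn_integral_add) (measurable, measurable)
  also have "\<dots> \<le> ennreal (5 * (LINT \<theta>|?M. (delta \<beta> g \<theta> $ 1)\<^sup>2)) + ennreal (5 * (LINT \<theta>|?M. (delta \<beta> g \<theta> $ 2)\<^sup>2))"
    by (intro add_mono comp)
  also have "\<dots> = ennreal (5 * (LINT \<theta>|?M. (norm (delta \<beta> g \<theta>))\<^sup>2))"
    unfolding norm2_sq using di(1) by (subst ennreal_plus[symmetric]) (auto intro!: Bochner_Integration.integral_nonneg)
  also have "\<dots> = 5 * (L2_norm (delta \<beta> g))\<^sup>2"
  proof -
    have "(L2_norm (delta \<beta> g))\<^sup>2 = (\<integral>\<^sup>+\<theta>. ennreal ((norm (delta \<beta> g \<theta>))\<^sup>2) \<partial>?M)"
      unfolding L2_norm_def sqrt_ennreal_power2 by (simp add: nn_integral_restrict_space)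
    also have "\<dots> = ennreal (LINT \<theta>|?M. (norm (delta \<beta> g \<theta>))\<^sup>2)"
      by (rule nn_integral_eq_integral[OF di(3)]) auto
    finally show ?thesis by (simp add: ennreal_mult)
  qed
  finally show ?thesis .
qed

text \<open>Stated for possibly nonmeasurable integrands, such as the norms in the energy bound. The
  integral is a supremum over simple functions below the integrand, and dividing such a function by
  \<open>k\<close> yields a measurable minorant of \<open>f\<close>.\<close>

lemma nn_integral_cmult_le:
  assumes k: "0 < k"
  shows "(\<integral>\<^sup>+x. ennreal k * f x \<partial>M) \<le> ennreal k * (\<integral>\<^sup>+x. f x \<partial>M)"
  unfolding nn_integral_def[of M "\<lambda>x. ennreal k * f x"]
proof (rule SUP_least, clarify)
  fix g assume g: "simple_function M g" "g \<le> (\<lambda>x. ennreal k * f x)"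
  let ?h = "\<lambda>x. ennreal (1 / k) * g x"
  have k1: "ennreal (1 / k) * ennreal k = 1" "ennreal k * ennreal (1 / k) = 1"
    using k by (simp_all add: ennreal_mult[symmetric])
  have [measurable]: "g \<in> borel_measurable M" using g(1) by (rule borel_measurable_simple_function)
  have "integral\<^sup>S M g = (\<integral>\<^sup>+x. g x \<partial>M)" by (rule nn_integral_eq_simple_integral[OF g(1), symmetric])
  also have "\<dots> = (\<integral>\<^sup>+x. ennreal k * ?h x \<partial>M)" by (simp add: mult.assoc[symmetric] k1)
  also have "\<dots> = ennreal k * (\<integral>\<^sup>+x. ?h x \<partial>M)" by (rule nn_integral_cmult) measurable
  also have "(\<integral>\<^sup>+x. ?h x \<partial>M) \<le> (\<integral>\<^sup>+x. f x \<partial>M)"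
  proof (rule nn_integral_mono)
    fix x
    have "?h x \<le> ennreal (1 / k) * (ennreal k * f x)" using g(2) by (intro mult_left_mono) (auto simp: le_fun_def)
    then show "?h x \<le> f x" by (simp add: mult.assoc[symmetric] k1)
  qed
  finally show "integral\<^sup>S M g \<le> ennreal k * (\<integral>\<^sup>+x. f x \<partial>M)" by (simp add: mult_left_mono)
qed

text \<open>The unweighted B^{1/2}_{2,1} norm of the increment of \<open>g\<close>, over positive
  \<beta> only. By the embedding it bounds that increment uniformly in the angle.\<close>

definition besov_diff :: "(real \<Rightarrow> real^2) \<Rightarrow> real \<Rightarrow> ennreal" where
  "besov_diff g \<alpha> = (\<integral>\<^sup>+\<beta>. ennreal (\<beta> powr (-3/2) * sqrt (qdiff (delta \<alpha> g) \<beta>)) * indicator {0<..pi} \<beta> \<partial>lborel)"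

text \<open>An increment of a periodic function has mean zero, as the embedding requires.\<close>

lemma delta_le_besov_diff:
  assumes per: "periodic g" and c: "continuous_on UNIV g"
  shows "ennreal (norm (g (\<theta> + \<alpha>) - g \<theta>)) \<le> 4 * besov_diff g \<alpha>"
proof -
  have cd: "continuous_on UNIV (delta \<alpha> g)"
    unfolding delta_def[abs_def] by (intro continuous_intros continuous_on_compose2[OF c]) auto
  have perd: "periodic (delta \<alpha> g)"
    using per periodic_shift[OF per, of \<alpha>] by (simp add: periodic_def delta_def)
  have cS: "continuous_on {-pi..pi} g" using c by (rule continuous_on_subset) auto
  have "integral {-pi..pi} (delta \<alpha> g) = integral {-pi..pi} (\<lambda>\<theta>. g (\<theta> + \<alpha>)) - integral {-pi..pi} g"
    unfolding delta_def[abs_def]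
    by (intro integral_diff integrable_continuous_interval cS continuous_on_compose2[OF c] continuous_intros) auto
  also have "\<dots> = 0"
    using periodic_integral_shift[OF per integrable_continuous_interval[OF cS], of \<alpha>] by simp
  finally have "integral {-pi..pi} (delta \<alpha> g) = 0" .
  from besov_embedding[OF perd cd this, of \<theta>] show ?thesis
    by (simp add: besov_diff_def delta_def)
qed

text \<open>Lets the two increments exchange roles: \<beta> belongs to the Besov norm, \<alpha> to
  the half derivative energy.\<close>

lemma qdiff_delta_commute: "qdiff (delta \<alpha> g) \<beta> = qdiff (delta \<beta> g) \<alpha>"
proof -
  have "delta \<alpha> g (\<theta> + \<beta>) - delta \<alpha> g \<theta> = delta \<beta> g (\<theta> + \<alpha>) - delta \<beta> g \<theta>" for \<theta>
    by (simp add: delta_def algebra_simps)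
  then show ?thesis by (simp add: qdiff_def)
qed

lemma diff_energy_measurable:
  assumes c: "continuous_on ({0<..T} \<times> UNIV) (\<lambda>(t, \<theta>). U t \<theta>)"
  shows "(\<lambda>(t, \<alpha>, \<beta>). indicator ({0<..T} \<times> UNIV) (t, \<alpha>, \<beta>) * qdiff (delta \<alpha> (U t)) \<beta>) \<in> borel_measurable (borel :: (real \<times> real \<times> real) measure)"
proof -
  let ?S = "{0<..T} \<times> (UNIV :: (real \<times> real) set)"
  let ?f = "\<lambda>(p::real \<times> real \<times> real) \<theta>. (norm (U (fst p) (\<theta> + snd (snd p) + fst (snd p)) - U (fst p) (\<theta> + snd (snd p)) - (U (fst p) (\<theta> + fst (snd p)) - U (fst p) \<theta>)))\<^sup>2"
  have sh: "continuous_on (?S \<times> cbox (-pi) pi) (\<lambda>x. U (fst (fst x)) (snd x + h x))"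
    if "continuous_on (?S \<times> cbox (-pi) pi) h" for h :: "(real \<times> real \<times> real) \<times> real \<Rightarrow> real"
  proof -
    have "continuous_on (?S \<times> cbox (-pi) pi) (\<lambda>x. (\<lambda>(t, \<theta>). U t \<theta>) (fst (fst x), snd x + h x))"
    proof (rule continuous_on_compose2[OF c])
      show "continuous_on (?S \<times> cbox (-pi) pi) (\<lambda>x. (fst (fst x), snd x + h x))"
        by (intro continuous_intros that)
    qed auto
    then show ?thesis by simp
  qed
  have "continuous_on (?S \<times> cbox (-pi) pi) (\<lambda>(p, \<theta>). ?f p \<theta>)"
  proof -
    have h: "continuous_on (?S \<times> cbox (-pi) pi) (\<lambda>x. snd (snd (fst x)) + fst (snd (fst x)))"
      "continuous_on (?S \<times> cbox (-pi) pi) (\<lambda>x. snd (snd (fst x)))"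
      "continuous_on (?S \<times> cbox (-pi) pi) (\<lambda>x. fst (snd (fst x)))"
      "continuous_on (?S \<times> cbox (-pi) pi) (\<lambda>x. 0)"
      by (intro continuous_intros)+
    have "continuous_on (?S \<times> cbox (-pi) pi) (\<lambda>x. U (fst (fst x)) (snd x))" using sh[OF h(4)] by simp
    then have "continuous_on (?S \<times> cbox (-pi) pi) (\<lambda>x. (norm (U (fst (fst x)) (snd x + (snd (snd (fst x)) + fst (snd (fst x)))) - U (fst (fst x)) (snd x + snd (snd (fst x)))
         - (U (fst (fst x)) (snd x + fst (snd (fst x))) - U (fst (fst x)) (snd x))))\<^sup>2)"
      by (intro continuous_on_power continuous_on_norm continuous_on_diff sh[OF h(1)] sh[OF h(2)] sh[OF h(3)])
    then show ?thesis by (simp only: split_beta' add.assoc fst_conv snd_conv)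
  qed
  then have "continuous_on ?S (\<lambda>p. integral (cbox (-pi) pi) (?f p))"
    by (rule integral_continuous_on_param)
  then have "continuous_on ?S (\<lambda>p. qdiff (delta (fst (snd p)) (U (fst p))) (snd (snd p)))"
    by (simp only: qdiff_def delta_def cbox_interval)
  moreover have "?S \<in> sets borel"
    using borel_Times[of "{0<..T}" "UNIV :: (real \<times> real) set"] by simp
  ultimately have "(\<lambda>p. indicator ?S p *\<^sub>R qdiff (delta (fst (snd p)) (U (fst p))) (snd (snd p))) \<in> borel_measurable borel"
    by (intro borel_measurable_continuous_on_indicator)
  then show ?thesis by (simp only: split_beta' real_scaleR_def prod.collapse)
qed

text \<open>Minkowski's inequality moves the \<beta> integral outside the L^2 norm in t and
  \<alpha>. For fixed \<beta> the increments are exchanged, and the \<alpha> integral is the half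
  derivative energy of the \<beta> increment, at most 5 times the squared norm appearing in the
  dissipation. The constant is the square of sqrt 5 times 4M / (c sqrt \<Lambda>).\<close>

lemma energy_dissipation_part:
  assumes \<mu>: "\<And>r. 0 \<le> r \<Longrightarrow> 1 \<le> \<mu> r" and \<Lambda>: "0 < \<Lambda>" and c: "0 < c" and M: "0 < M"
    and r: "regular_flow T X X2 Xt" and e: "energy_bound \<mu> \<Lambda> c T X0 X" and d: "admissible_datum \<mu> M X0"
  shows "(\<lambda>(t, \<alpha>). indicator {0<..T} t * besov_diff (dtheta (X t)) \<alpha>) \<in> borel_measurable (lborel \<Otimes>\<^sub>M lborel)"
    "(\<integral>\<^sup>+t. (\<integral>\<^sup>+\<alpha>. ennreal (1 / \<alpha>\<^sup>2) * (besov_diff (dtheta (X t)) \<alpha>)\<^sup>2 * indicator {0<..pi} \<alpha> \<partial>lborel) * indicator {0<..T} t \<partial>lborel)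
       \<le> ennreal (80 * M\<^sup>2 / (c\<^sup>2 * \<Lambda>))"
proof -
  let ?U = "\<lambda>t. dtheta (X t)"
  have cU: "continuous_on ({0<..T} \<times> UNIV) (\<lambda>(t, \<theta>). ?U t \<theta>)" using r by (simp add: regular_flow_def)
  \<comment> \<open>Extended by 0 outside \<open>{0<..T}\<close> to be jointly measurable, as
    Fubini's theorem requires.\<close>
  define W where "W = (\<lambda>(t, \<alpha>, \<beta>). indicator ({0<..T} \<times> UNIV) (t, \<alpha>, \<beta>) * qdiff (delta \<alpha> (?U t)) \<beta>)"
  have [measurable]: "W \<in> borel_measurable (lborel \<Otimes>\<^sub>M (lborel \<Otimes>\<^sub>M lborel))"
  proof -
    have "sets (lborel \<Otimes>\<^sub>M (lborel \<Otimes>\<^sub>M lborel)) = sets (borel :: (real \<times> real \<times> real) measure)"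
      by (metis lborel_prod sets_lborel)
    then show ?thesis using diff_energy_measurable[OF cU] unfolding W_def by (simp cong: measurable_cong_sets)
  qed
  have Wnn: "0 \<le> W p" for p by (auto simp: W_def split_beta qdiff_nonneg)
  \<comment> \<open>The weight 1/\<alpha>^2 is brought under the square as 1/\<alpha>.\<close>
  define F where "F = (\<lambda>(x::real \<times> real) \<beta>::real. ennreal (\<beta> powr (-3/2) * (1 / snd x) * sqrt (W (fst x, snd x, \<beta>))) * (indicator {0<..pi} (snd x) * indicator {0<..pi} \<beta>))"
  have Fm [measurable]: "(\<lambda>(x, y). F x y) \<in> borel_measurable ((lborel \<Otimes>\<^sub>M lborel) \<Otimes>\<^sub>M lborel)"
    unfolding F_def by measurable
  define B where "B = (\<lambda>(t, \<alpha>). \<integral>\<^sup>+\<beta>. ennreal (\<beta> powr (-3/2) * sqrt (W (t, \<alpha>, \<beta>))) * indicator {0<..pi} \<beta> \<partial>lborel)"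
  have Bm: "B \<in> borel_measurable (lborel \<Otimes>\<^sub>M lborel)" unfolding B_def by measurable
  have B_eq: "B (t, \<alpha>) = indicator {0<..T} t * besov_diff (?U t) \<alpha>" for t \<alpha>
  proof (cases "t \<in> {0<..T}")
    case True
    then show ?thesis by (simp add: B_def besov_diff_def W_def)
  qed (simp add: B_def W_def)
  show "(\<lambda>(t, \<alpha>). indicator {0<..T} t * besov_diff (?U t) \<alpha>) \<in> borel_measurable (lborel \<Otimes>\<^sub>M lborel)"
    using Bm by (simp add: B_eq[symmetric] split_beta)
  define G where "G = (\<lambda>\<beta>. sqrt_ennreal (\<integral>\<^sup>+x. (F x \<beta>)\<^sup>2 \<partial>(lborel \<Otimes>\<^sub>M lborel)))"
  have sf: "sigma_finite_measure (lborel \<Otimes>\<^sub>M (lborel :: real measure) :: (real \<times> real) measure)"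
    by (simp add: lborel_prod sigma_finite_lborel)
  interpret P: pair_sigma_finite "lborel \<Otimes>\<^sub>M lborel :: (real \<times> real) measure" "lborel :: real measure"
    by (simp add: pair_sigma_finite_def sf sigma_finite_lborel)
  have Gm: "G \<in> borel_measurable lborel"
  proof -
    have "(\<lambda>\<beta>. \<integral>\<^sup>+x. (case (x, \<beta>) of (x, y) \<Rightarrow> (F x y)\<^sup>2) \<partial>(lborel \<Otimes>\<^sub>M lborel)) \<in> borel_measurable lborel"
      by (rule sigma_finite_measure.borel_measurable_nn_integral[OF sf]) (unfold F_def split_beta, measurable)
    then show ?thesis unfolding G_def by simp
  qed
  have "(\<integral>\<^sup>+x. (\<integral>\<^sup>+\<beta>. F x \<beta> \<partial>lborel)\<^sup>2 \<partial>(lborel \<Otimes>\<^sub>M lborel)) \<le> (\<integral>\<^sup>+\<beta>. G \<beta> \<partial>lborel)\<^sup>2"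
    by (rule minkowski_nn_integral[OF sf sigma_finite_lborel Fm Gm]) (simp add: G_def sqrt_ennreal_power2)
  moreover have "(\<integral>\<^sup>+x. (\<integral>\<^sup>+\<beta>. F x \<beta> \<partial>lborel)\<^sup>2 \<partial>(lborel \<Otimes>\<^sub>M lborel))
    = (\<integral>\<^sup>+t. (\<integral>\<^sup>+\<alpha>. ennreal (1 / \<alpha>\<^sup>2) * (besov_diff (?U t) \<alpha>)\<^sup>2 * indicator {0<..pi} \<alpha> \<partial>lborel) * indicator {0<..T} t \<partial>lborel)"
  proof -
    have Fi: "(\<integral>\<^sup>+\<beta>. F (t, \<alpha>) \<beta> \<partial>lborel)\<^sup>2 = (ennreal (1 / \<alpha>\<^sup>2) * (besov_diff (?U t) \<alpha>)\<^sup>2 * indicator {0<..pi} \<alpha>) * indicator {0<..T} t" for t \<alpha>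
    proof (cases "\<alpha> \<in> {0<..pi}")
      case True
      have "(\<integral>\<^sup>+\<beta>. F (t, \<alpha>) \<beta> \<partial>lborel) = (\<integral>\<^sup>+\<beta>. ennreal (1 / \<alpha>) * (ennreal (\<beta> powr (-3/2) * sqrt (W (t, \<alpha>, \<beta>))) * indicator {0<..pi} \<beta>) \<partial>lborel)"
      proof (rule nn_integral_cong)
        fix \<beta>
        have "ennreal (\<beta> powr (-3/2) * (1 / \<alpha>) * sqrt (W (t, \<alpha>, \<beta>))) = ennreal (1 / \<alpha>) * ennreal (\<beta> powr (-3/2) * sqrt (W (t, \<alpha>, \<beta>)))"
          using True Wnn[of "(t, \<alpha>, \<beta>)"] by (subst ennreal_mult[symmetric]) (auto simp: mult_ac)
        then show "F (t, \<alpha>) \<beta> = ennreal (1 / \<alpha>) * (ennreal (\<beta> powr (-3/2) * sqrt (W (t, \<alpha>, \<beta>))) * indicator {0<..pi} \<beta>)"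
          using True by (simp add: F_def mult.assoc)
      qed
      also have "\<dots> = ennreal (1 / \<alpha>) * B (t, \<alpha>)"
        unfolding B_def by (subst nn_integral_cmult) simp_all
      finally have eq: "(\<integral>\<^sup>+\<beta>. F (t, \<alpha>) \<beta> \<partial>lborel) = ennreal (1 / \<alpha>) * (indicator {0<..T} t * besov_diff (?U t) \<alpha>)" by (simp only: B_eq)
      have i2: "(indicator {0<..T} t :: ennreal)\<^sup>2 = indicator {0<..T} t" by (simp add: indicator_def)
      have "(ennreal (1 / \<alpha>))\<^sup>2 = ennreal (1 / \<alpha>\<^sup>2)" using True by (simp add: ennreal_power power_divide)
      then show ?thesis unfolding eq power_mult_distrib i2 using True by (simp add: mult_ac)
    qed (simp add: F_def)
    have [measurable]: "(\<lambda>x. (\<integral>\<^sup>+\<beta>. F x \<beta> \<partial>lborel)\<^sup>2) \<in> borel_measurable (lborel \<Otimes>\<^sub>M lborel)" by measurable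
    have "(\<integral>\<^sup>+x. (\<integral>\<^sup>+\<beta>. F x \<beta> \<partial>lborel)\<^sup>2 \<partial>(lborel \<Otimes>\<^sub>M lborel)) = (\<integral>\<^sup>+t. (\<integral>\<^sup>+\<alpha>. (\<integral>\<^sup>+\<beta>. F (t, \<alpha>) \<beta> \<partial>lborel)\<^sup>2 \<partial>lborel) \<partial>lborel)"
      by (rule lborel.nn_integral_fst[symmetric]) measurable
    also have "\<dots> = (\<integral>\<^sup>+t. (\<integral>\<^sup>+\<alpha>. ennreal (1 / \<alpha>\<^sup>2) * (besov_diff (?U t) \<alpha>)\<^sup>2 * indicator {0<..pi} \<alpha> \<partial>lborel) * indicator {0<..T} t \<partial>lborel)"
    proof (rule nn_integral_cong)
      fix t
      show "(\<integral>\<^sup>+\<alpha>. (\<integral>\<^sup>+\<beta>. F (t, \<alpha>) \<beta> \<partial>lborel)\<^sup>2 \<partial>lborel) = (\<integral>\<^sup>+\<alpha>. ennreal (1 / \<alpha>\<^sup>2) * (besov_diff (?U t) \<alpha>)\<^sup>2 * indicator {0<..pi} \<alpha> \<partial>lborel) * indicator {0<..T} t"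
        unfolding Fi by (cases "t \<in> {0<..T}") simp_all
    qed
    finally show ?thesis .
  qed
  moreover have "(\<integral>\<^sup>+\<beta>. G \<beta> \<partial>lborel) \<le> ennreal (sqrt 5 * (4 * M) / (c * sqrt \<Lambda>))"
  proof -
    let ?L = "\<lambda>\<beta>. L2L2_norm T (\<lambda>t. delta \<beta> (frac_laplacian (1/4) (?U t)))"
    let ?k = "c * sqrt \<Lambda>"
    have k: "0 < ?k" using c \<Lambda> by simp
    \<comment> \<open>To reach the integrand of the energy bound, the factor c sqrt \<Lambda> is
      divided out, the weight \<mu> \<ge> 1 is inserted and the supremum term is added.\<close>
    have Gle: "G \<beta> \<le> ennreal (sqrt 5 / ?k) * (ennreal (\<mu> (1 / \<bar>\<beta>\<bar>) / \<bar>\<beta>\<bar> powr (3/2)) * (LinfL2_norm T (\<lambda>t. delta \<beta> (?U t)) + ennreal ?k * ?L \<beta>) * indicator {-pi..pi} \<beta>)" for \<beta>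
    proof (cases "\<beta> \<in> {0<..pi}")
      case False
      then have "F x \<beta> = 0" for x by (simp add: F_def split_beta)
      then show ?thesis by (simp add: G_def sqrt_ennreal_def)
    next
      case True
      then have b: "0 < \<beta>" by simp
      let ?w = "\<beta> powr (-3/2)"
      have "(\<integral>\<^sup>+x. (F x \<beta>)\<^sup>2 \<partial>(lborel \<Otimes>\<^sub>M lborel)) = (\<integral>\<^sup>+t. (\<integral>\<^sup>+\<alpha>. (F (t, \<alpha>) \<beta>)\<^sup>2 \<partial>lborel) \<partial>lborel)"
        by (rule lborel.nn_integral_fst[symmetric]) measurable
      also have "\<dots> \<le> (\<integral>\<^sup>+t. ennreal (?w\<^sup>2 * 5) * ((L2_norm (delta \<beta> (frac_laplacian (1/4) (?U t))))\<^sup>2 * indicator {0..T} t) \<partial>lborel)"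
      proof (rule nn_integral_mono)
        fix t
        show "(\<integral>\<^sup>+\<alpha>. (F (t, \<alpha>) \<beta>)\<^sup>2 \<partial>lborel) \<le> ennreal (?w\<^sup>2 * 5) * ((L2_norm (delta \<beta> (frac_laplacian (1/4) (?U t))))\<^sup>2 * indicator {0..T} t)"
        proof (cases "t \<in> {0<..T}")
          case False
          then have "F (t, \<alpha>) \<beta> = 0" for \<alpha> by (simp add: F_def W_def)
          then show ?thesis by simp
        next
          case t: True
          have "(\<integral>\<^sup>+\<alpha>. (F (t, \<alpha>) \<beta>)\<^sup>2 \<partial>lborel) \<le> (\<integral>\<^sup>+\<alpha>. ennreal (?w\<^sup>2) * (ennreal (qdiff (delta \<beta> (?U t)) \<alpha> / \<alpha>\<^sup>2) * indicator {0<..} \<alpha>) \<partial>lborel)"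
          proof (rule nn_integral_mono)
            fix \<alpha>
            show "(F (t, \<alpha>) \<beta>)\<^sup>2 \<le> ennreal (?w\<^sup>2) * (ennreal (qdiff (delta \<beta> (?U t)) \<alpha> / \<alpha>\<^sup>2) * indicator {0<..} \<alpha>)"
            proof (cases "\<alpha> \<in> {0<..pi}")
              case a: True
              have "(F (t, \<alpha>) \<beta>)\<^sup>2 = ennreal ((?w * (1 / \<alpha>) * sqrt (qdiff (delta \<alpha> (?U t)) \<beta>))\<^sup>2)"
                using a t True by (simp add: F_def W_def ennreal_power qdiff_nonneg)
              also have "(?w * (1 / \<alpha>) * sqrt (qdiff (delta \<alpha> (?U t)) \<beta>))\<^sup>2 = ?w\<^sup>2 * (qdiff (delta \<beta> (?U t)) \<alpha> / \<alpha>\<^sup>2)"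
                by (simp add: power_mult_distrib power_divide qdiff_nonneg qdiff_delta_commute[of \<alpha>])
              also have "ennreal (?w\<^sup>2 * (qdiff (delta \<beta> (?U t)) \<alpha> / \<alpha>\<^sup>2)) = ennreal (?w\<^sup>2) * ennreal (qdiff (delta \<beta> (?U t)) \<alpha> / \<alpha>\<^sup>2)"
                by (rule ennreal_mult) (auto simp: qdiff_nonneg)
              finally show ?thesis using a by simp
            qed (simp add: F_def)
          qed
          also have "\<dots> = ennreal (?w\<^sup>2) * (\<integral>\<^sup>+\<alpha>. (ennreal (qdiff (delta \<beta> (?U t)) \<alpha> / \<alpha>\<^sup>2) * indicator {0<..} \<alpha>) \<partial>lborel)"
          proof (rule nn_integral_cmult)
            have "continuous_on UNIV (delta \<beta> (?U t))"
              unfolding delta_def[abs_def] using regular_flowD(5)[OF r t] by (intro continuous_intros continuous_on_compose2[OF regular_flowD(5)[OF r t]]) auto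
            then have "qdiff (delta \<beta> (?U t)) \<in> borel_measurable borel"
              by (intro borel_measurable_continuous_onI qdiff_continuous)
            then show "(\<lambda>\<alpha>. ennreal (qdiff (delta \<beta> (?U t)) \<alpha> / \<alpha>\<^sup>2) * indicator {0<..} \<alpha>) \<in> borel_measurable lborel" by measurable
          qed
          also have "\<dots> \<le> ennreal (?w\<^sup>2) * (5 * (L2_norm (delta \<beta> (frac_laplacian (1/4) (?U t))))\<^sup>2)"
            by (intro mult_left_mono half_derivative_energy_delta regular_flowD[OF r t] frac_laplacian_flow[OF r t]) auto
          finally show ?thesis using t by (simp add: ennreal_mult mult_ac)
        qed
      qed
      also have "\<dots> \<le> ennreal (?w\<^sup>2 * 5) * (?L \<beta>)\<^sup>2"
      proof -
        have "(\<integral>\<^sup>+t. ennreal (?w\<^sup>2 * 5) * ((L2_norm (delta \<beta> (frac_laplacian (1/4) (?U t))))\<^sup>2 * indicator {0..T} t) \<partial>lborel) 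
          \<le> ennreal (?w\<^sup>2 * 5) * (\<integral>\<^sup>+t. ((L2_norm (delta \<beta> (frac_laplacian (1/4) (?U t))))\<^sup>2 * indicator {0..T} t) \<partial>lborel)"
          by (rule nn_integral_cmult_le) (use b in auto)
        then show ?thesis by (simp add: L2L2_norm_def sqrt_ennreal_power2 nn_integral_completion)
      qed
      also have "\<dots> = (ennreal (?w * sqrt 5) * ?L \<beta>)\<^sup>2"
        by (simp add: power_mult_distrib ennreal_power)
      finally have "G \<beta> \<le> ennreal (?w * sqrt 5) * ?L \<beta>" unfolding G_def sqrt_ennreal_le_iff .
      also have "\<dots> = ennreal (sqrt 5 / ?k) * (ennreal ?w * (ennreal ?k * ?L \<beta>))"
      proof -
        have "ennreal (?w * sqrt 5) = ennreal (sqrt 5 / ?k) * (ennreal ?w * ennreal ?k)"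
        proof -
          have "w * s = s / k * (w * k)" if "0 < k" for w s k :: real using that by simp
          from this[OF k, of ?w "sqrt 5"] have "ennreal (?w * sqrt 5) = ennreal (sqrt 5 / ?k * (?w * ?k))" by (simp only:)
          also have "\<dots> = ennreal (sqrt 5 / ?k) * ennreal (?w * ?k)" by (rule ennreal_mult) (use k in auto)
          also have "ennreal (?w * ?k) = ennreal ?w * ennreal ?k" by (rule ennreal_mult) (use k in auto)
          finally show ?thesis .
        qed
        then show ?thesis by (simp add: mult.assoc)
      qed
      also have "\<dots> \<le> ennreal (sqrt 5 / ?k) * (ennreal (\<mu> (1 / \<bar>\<beta>\<bar>) / \<bar>\<beta>\<bar> powr (3/2)) * (LinfL2_norm T (\<lambda>t. delta \<beta> (?U t)) + ennreal ?k * ?L \<beta>))"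
      proof (intro mult_left_mono mult_mono)
        have e: "?w = 1 / \<bar>\<beta>\<bar> powr (3/2)" using powr_weight[OF b] b by (simp only: abs_of_pos)
        show "ennreal ?w \<le> ennreal (\<mu> (1 / \<bar>\<beta>\<bar>) / \<bar>\<beta>\<bar> powr (3/2))"
          unfolding e using \<mu>[of "1 / \<bar>\<beta>\<bar>"] by (intro ennreal_leI divide_right_mono) auto
      qed auto
      finally show ?thesis using True by simp
    qed
    have "(\<integral>\<^sup>+\<beta>. G \<beta> \<partial>lborel) \<le> (\<integral>\<^sup>+\<beta>. ennreal (sqrt 5 / ?k) * (ennreal (\<mu> (1 / \<bar>\<beta>\<bar>) / \<bar>\<beta>\<bar> powr (3/2)) * (LinfL2_norm T (\<lambda>t. delta \<beta> (?U t)) + ennreal ?k * ?L \<beta>) * indicator {-pi..pi} \<beta>) \<partial>lborel)"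
      by (intro nn_integral_mono Gle)
    also have "\<dots> \<le> ennreal (sqrt 5 / ?k) * (\<integral>\<^sup>+\<beta>. (ennreal (\<mu> (1 / \<bar>\<beta>\<bar>) / \<bar>\<beta>\<bar> powr (3/2)) * (LinfL2_norm T (\<lambda>t. delta \<beta> (?U t)) + ennreal ?k * ?L \<beta>) * indicator {-pi..pi} \<beta>) \<partial>lborel)"
      by (rule nn_integral_cmult_le) (use k in simp)
    also have "\<dots> \<le> ennreal (sqrt 5 / ?k) * ennreal (4 * M)"
    proof (rule mult_left_mono)
      have "(\<integral>\<^sup>+\<beta>. (ennreal (\<mu> (1 / \<bar>\<beta>\<bar>) / \<bar>\<beta>\<bar> powr (3/2)) * (LinfL2_norm T (\<lambda>t. delta \<beta> (?U t)) + ennreal ?k * ?L \<beta>) * indicator {-pi..pi} \<beta>) \<partial>lborel)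
         \<le> 4 * besov_norm \<mu> (dtheta X0)"
        using e by (simp add: energy_bound_def nn_integral_completion)
      also have "\<dots> \<le> 4 * ennreal M" using d by (intro mult_left_mono) (auto simp: admissible_datum_def)
      finally show "(\<integral>\<^sup>+\<beta>. (ennreal (\<mu> (1 / \<bar>\<beta>\<bar>) / \<bar>\<beta>\<bar> powr (3/2)) * (LinfL2_norm T (\<lambda>t. delta \<beta> (?U t)) + ennreal ?k * ?L \<beta>) * indicator {-pi..pi} \<beta>) \<partial>lborel) \<le> ennreal (4 * M)"
        using M by (simp add: ennreal_mult)
    qed simp
    also have "\<dots> = ennreal (sqrt 5 * (4 * M) / ?k)" using k M by (simp add: ennreal_mult[symmetric])
    finally show ?thesis .
  qed
  ultimately have "(\<integral>\<^sup>+t. (\<integral>\<^sup>+\<alpha>. ennreal (1 / \<alpha>\<^sup>2) * (besov_diff (?U t) \<alpha>)\<^sup>2 * indicator {0<..pi} \<alpha> \<partial>lborel) * indicator {0<..T} t \<partial>lborel)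
     \<le> (ennreal (sqrt 5 * (4 * M) / (c * sqrt \<Lambda>)))\<^sup>2"
    by (metis (no_types, lifting) order_trans power_mono zero_le)
  also have "\<dots> = ennreal (80 * M\<^sup>2 / (c\<^sup>2 * \<Lambda>))"
    using c \<Lambda> M by (simp add: ennreal_power power_mult_distrib power_divide)
  finally show "(\<integral>\<^sup>+t. (\<integral>\<^sup>+\<alpha>. ennreal (1 / \<alpha>\<^sup>2) * (besov_diff (?U t) \<alpha>)\<^sup>2 * indicator {0<..pi} \<alpha> \<partial>lborel) * indicator {0<..T} t \<partial>lborel)
       \<le> ennreal (80 * M\<^sup>2 / (c\<^sup>2 * \<Lambda>))" .
qed

subsection \<open>The principal value as a weak limit\<close>

text \<open>Cut at height \<open>K\<close>: the part below converges by dominated convergence, and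
  the excess of |h| over \<open>K\<close> is at most h^2/K, with integral at most B/K. The choice of
  \<open>K\<close> makes this at most \<epsilon>/2, the added 1 keeping \<open>K\<close>
  positive.\<close>

lemma integral_tendsto_0_of_L2_bounded:
  fixes h :: "nat \<Rightarrow> real \<Rightarrow> real"
  assumes c: "\<And>n. continuous_on {a..b} (h n)" and B: "\<And>n. integral {a..b} (\<lambda>x. (h n x)\<^sup>2) \<le> B"
    and lim: "\<And>x. x \<in> {a..b} \<Longrightarrow> (\<lambda>n. h n x) \<longlonglongrightarrow> 0"
  shows "(\<lambda>n. integral {a..b} (h n)) \<longlonglongrightarrow> 0"
proof (rule LIMSEQ_I)
  fix \<epsilon> :: real assume \<epsilon>: "0 < \<epsilon>"
  define K where "K = 2 * (\<bar>B\<bar> + 1) / \<epsilon>"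
  have K: "0 < K" using \<epsilon> by (simp add: K_def)
  have cm: "continuous_on {a..b} (\<lambda>x. min \<bar>h n x\<bar> K)" for n by (intro continuous_intros c)
  have "(\<lambda>n. integral {a..b} (\<lambda>x. min \<bar>h n x\<bar> K)) \<longlonglongrightarrow> integral {a..b} (\<lambda>_. 0::real)"
  proof (rule dominated_convergence(2)[where h="\<lambda>_. K"])
    show "(\<lambda>x. min \<bar>h n x\<bar> K) integrable_on {a..b}" for n by (intro integrable_continuous_interval cm)
    show "(\<lambda>_. K) integrable_on {a..b}" by (rule integrable_const_ivl)
    show "norm (min \<bar>h n x\<bar> K) \<le> K" for n x using K by simp
    show "(\<lambda>n. min \<bar>h n x\<bar> K) \<longlonglongrightarrow> 0" if "x \<in> {a..b}" for x
    proof -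
      have "(\<lambda>n. min \<bar>h n x\<bar> K) \<longlonglongrightarrow> min \<bar>0\<bar> K" by (intro tendsto_intros lim that)
      then show ?thesis using K by simp
    qed
  qed
  then have "\<forall>\<^sub>F n in sequentially. \<bar>integral {a..b} (\<lambda>x. min \<bar>h n x\<bar> K)\<bar> < \<epsilon> / 2"
    using \<epsilon> by (auto simp: tendsto_iff dist_real_def dest!: spec[of _ "\<epsilon> / 2"])
  then obtain N where N: "\<And>n. N \<le> n \<Longrightarrow> \<bar>integral {a..b} (\<lambda>x. min \<bar>h n x\<bar> K)\<bar> < \<epsilon> / 2"
    by (auto simp: eventually_sequentially)
  have "norm (integral {a..b} (h n) - 0) < \<epsilon>" if n: "N \<le> n" for n
  proof -
    have pw: "\<bar>h n x\<bar> \<le> min \<bar>h n x\<bar> K + (h n x)\<^sup>2 / K" for x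
    proof (cases "\<bar>h n x\<bar> \<le> K")
      case False
      then have "K * \<bar>h n x\<bar> \<le> \<bar>h n x\<bar> * \<bar>h n x\<bar>" by (intro mult_right_mono) auto
      then have "\<bar>h n x\<bar> \<le> (h n x)\<^sup>2 / K" using K by (simp add: pos_le_divide_eq power2_eq_square mult.commute)
      then show ?thesis using K by simp
    qed (use K in simp)
    have i: "(\<lambda>x. min \<bar>h n x\<bar> K) integrable_on {a..b}" "(\<lambda>x. (h n x)\<^sup>2 / K) integrable_on {a..b}" "(h n) integrable_on {a..b}"
      using K by (auto intro!: integrable_continuous_interval cm c continuous_intros)
    have "norm (integral {a..b} (h n)) \<le> integral {a..b} (\<lambda>x. min \<bar>h n x\<bar> K + (h n x)\<^sup>2 / K)"
      using pw by (intro integral_norm_bound_integral i integrable_add) auto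
    also have "\<dots> = integral {a..b} (\<lambda>x. min \<bar>h n x\<bar> K) + integral {a..b} (\<lambda>x. (h n x)\<^sup>2) / K"
      using i by (simp add: integral_add)
    also have "integral {a..b} (\<lambda>x. (h n x)\<^sup>2) / K \<le> \<epsilon> / 2"
    proof -
      have "integral {a..b} (\<lambda>x. (h n x)\<^sup>2) / K \<le> (\<bar>B\<bar> + 1) / K"
        using B[of n] K by (intro divide_right_mono) auto
      also have "\<dots> = \<epsilon> / 2"
      proof -
        have eq: "b / (2 * b / \<epsilon>) = \<epsilon> / 2" if "0 < b" for b :: real using that \<epsilon> by simp
        have "0 < \<bar>B\<bar> + 1" by simp
        from eq[OF this] show ?thesis by (simp only: K_def)
      qed
      finally show ?thesis .
    qed
    finally show ?thesis using N[OF n] by simp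
  qed
  then show "\<exists>no. \<forall>n\<ge>no. norm (integral {a..b} (h n) - 0) < \<epsilon>" by blast
qed

text \<open>A time slice of a strong solution: \<open>u\<close> is the derivative of the closed curve \<open>x\<close>.\<close>

locale profile =
  fixes x u u2 :: "real \<Rightarrow> real^2" and R m :: real and \<T> :: "real \<Rightarrow> real" and \<Lambda> :: real
  assumes per: "periodic x" and dx: "\<And>\<theta>. (x has_vector_derivative u \<theta>) (at \<theta>)"
    and du: "\<And>\<theta>. (u has_vector_derivative u2 \<theta>) (at \<theta>)" and cu2: "continuous_on UNIV u2"
    and bound: "\<And>\<theta>. norm (u \<theta>) \<le> R" and m: "0 < m"
    and chord: "\<And>\<theta> \<alpha>. \<alpha> \<in> {-pi..pi} - {0} \<Longrightarrow> m \<le> norm (Dquot \<alpha> x \<theta>)"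
    and adm: "admissible_tension \<T> \<Lambda>"
begin

abbreviation "T \<equiv> tension_map \<T>"

lemma dtheta_x: "dtheta x = u"
  by (rule ext) (simp add: dtheta_def vector_derivative_at[OF dx])

lemma cu: "continuous_on S u"
  using du by (intro continuous_at_imp_continuous_on) (auto intro: has_vector_derivative_continuous)

lemma cx: "continuous_on S x"
  using dx by (intro continuous_at_imp_continuous_on) (auto intro: has_vector_derivative_continuous)

lemma cu_shift: "continuous_on S f \<Longrightarrow> continuous_on S (\<lambda>z. u (f z))" for f :: "_ \<Rightarrow> real"
  by (rule continuous_on_compose2[OF cu[of UNIV]]) auto

lemma cx_shift: "continuous_on S f \<Longrightarrow> continuous_on S (\<lambda>z. x (f z))" for f :: "_ \<Rightarrow> real"
  by (rule continuous_on_compose2[OF cx[of UNIV]]) auto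

lemma per_u: "periodic u"
  unfolding periodic_def
proof
  fix \<theta>
  have "((\<lambda>y. y + 2 * pi) has_vector_derivative 1) (at \<theta>)" by (auto intro!: derivative_eq_intros)
  from vector_diff_chain_at[OF this dx[of "\<theta> + 2 * pi"]]
  have "((\<lambda>y. x (y + 2 * pi)) has_vector_derivative u (\<theta> + 2 * pi)) (at \<theta>)" by (simp add: o_def)
  moreover have "(\<lambda>y. x (y + 2 * pi)) = x" using per by (auto simp: periodic_def)
  ultimately show "u (\<theta> + 2 * pi) = u \<theta>" using dx[of \<theta>] vector_derivative_unique_at by metis
qed

text \<open>The constant depends on the slice, so it is admissible in the qualitative bound of the
  truncations but must not enter the final estimate.\<close>

lemma u_lipschitz:
  obtains L where "0 \<le> L" "\<And>a b. norm (u a - u b) \<le> L * \<bar>a - b\<bar>"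
proof -
  have "periodic u2"
    unfolding periodic_def
  proof
    fix \<theta>
    have "((\<lambda>y. y + 2 * pi) has_vector_derivative 1) (at \<theta>)" by (auto intro!: derivative_eq_intros)
    from vector_diff_chain_at[OF this du[of "\<theta> + 2 * pi"]]
    have "((\<lambda>y. u (y + 2 * pi)) has_vector_derivative u2 (\<theta> + 2 * pi)) (at \<theta>)" by (simp add: o_def)
    moreover have "(\<lambda>y. u (y + 2 * pi)) = u" using per_u by (auto simp: periodic_def)
    ultimately show "u2 (\<theta> + 2 * pi) = u2 \<theta>" using du[of \<theta>] vector_derivative_unique_at by metis
  qed
  then obtain L where L: "\<And>\<theta>. norm (u2 \<theta>) \<le> L" using periodic_bounded[OF _ cu2] by blast
  show thesis
  proof (rule that[of L])
    show "0 \<le> L" using L[of 0] norm_ge_zero order_trans by blast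
    fix a b
    have on: "onorm (\<lambda>h. h *\<^sub>R u2 \<theta>) \<le> L" for \<theta>
    proof (rule onorm_le)
      show "norm (h *\<^sub>R u2 \<theta>) \<le> L * norm h" for h
        using mult_right_mono[OF L[of \<theta>], of "\<bar>h\<bar>"] by (simp add: mult.commute)
    qed
    show "norm (u a - u b) \<le> L * \<bar>a - b\<bar>"
      using differentiable_bound[of UNIV u "\<lambda>\<theta> h. h *\<^sub>R u2 \<theta>" L a b] du on
      by (auto simp: has_vector_derivative_def norm_minus_commute abs_minus_commute)
  qed
qed

text \<open>Both forms average the derivative over the arc; the second runs backwards from \<theta>
  + \<alpha>, for comparison with the derivative at that end.\<close>

lemma Dquot_average:
  assumes "0 < \<alpha>"
  shows "Dquot \<alpha> x \<theta> = (1 / \<alpha>) *\<^sub>R integral {0..\<alpha>} (\<lambda>s. u (\<theta> + s))"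
    "Dquot \<alpha> x \<theta> = (1 / \<alpha>) *\<^sub>R integral {0..\<alpha>} (\<lambda>s. u (\<theta> + \<alpha> - s))"
proof -
  have "((\<lambda>s. u (\<theta> + s)) has_integral (x (\<theta> + \<alpha>) - x (\<theta> + 0))) {0..\<alpha>}"
  proof (rule fundamental_theorem_of_calculus)
    fix s
    have "((\<lambda>s. \<theta> + s) has_vector_derivative 1) (at s)" by (auto intro!: derivative_eq_intros)
    from vector_diff_chain_at[OF this dx]
    show "((\<lambda>s. x (\<theta> + s)) has_vector_derivative u (\<theta> + s)) (at s within {0..\<alpha>})"
      by (auto simp: o_def intro: has_vector_derivative_at_within)
  qed (use assms in simp)
  then show 1: "Dquot \<alpha> x \<theta> = (1 / \<alpha>) *\<^sub>R integral {0..\<alpha>} (\<lambda>s. u (\<theta> + s))"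
    using assms by (simp add: Dquot_def delta_def integral_unique divide_inverse)
  have "((\<lambda>s. u (\<theta> + s)) has_integral integral {0..\<alpha>} (\<lambda>s. u (\<theta> + s))) {0..\<alpha>}"
    by (intro integrable_integral integrable_continuous_interval cu_shift continuous_intros)
  from has_integral_shift_real_ivl[OF this, of \<alpha>]
  have "((\<lambda>s. u (\<theta> + (s + \<alpha>))) has_integral integral {0..\<alpha>} (\<lambda>s. u (\<theta> + s))) {-\<alpha>..0}" by simp
  from has_integral_reflect_lemma_real[OF this]
  have "((\<lambda>s. u (\<theta> + (- s + \<alpha>))) has_integral integral {0..\<alpha>} (\<lambda>s. u (\<theta> + s))) {0..\<alpha>}" by simp
  then have i: "integral {0..\<alpha>} (\<lambda>s. u (\<theta> + (- s + \<alpha>))) = integral {0..\<alpha>} (\<lambda>s. u (\<theta> + s))" by (rule integral_unique)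
  have e: "\<theta> + (- s + \<alpha>) = \<theta> + \<alpha> - s" for s by simp
  show "Dquot \<alpha> x \<theta> = (1 / \<alpha>) *\<^sub>R integral {0..\<alpha>} (\<lambda>s. u (\<theta> + \<alpha> - s))"
    unfolding 1 using i unfolding e by simp
qed

lemma Dquot_reflect: "Dquot (- \<alpha>) x (\<theta> + \<alpha>) = Dquot \<alpha> x \<theta>"
  by (simp add: Dquot_def delta_def algebra_simps)

lemma Dquot_near:
  assumes L: "\<And>a b. norm (u a - u b) \<le> L * \<bar>a - b\<bar>" and L0: "0 \<le> L" and \<alpha>: "\<alpha> \<noteq> 0"
  shows "norm (u \<theta> - Dquot \<alpha> x \<theta>) \<le> L * \<bar>\<alpha>\<bar>" "norm (u (\<theta> + \<alpha>) - Dquot \<alpha> x \<theta>) \<le> L * \<bar>\<alpha>\<bar>"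
proof -
  have key: "norm (u b - Dquot \<alpha> x \<theta>) \<le> L * \<alpha>" if \<alpha>: "0 < \<alpha>" and b: "\<theta> \<le> b" "b \<le> \<theta> + \<alpha>" for \<theta> \<alpha> b
  proof -
    have c: "continuous_on {0..\<alpha>} (\<lambda>s. u (\<theta> + s))" by (intro cu_shift continuous_intros)
    have "integral {0..\<alpha>} (\<lambda>s. u b - u (\<theta> + s)) = \<alpha> *\<^sub>R u b - integral {0..\<alpha>} (\<lambda>s. u (\<theta> + s))"
      using \<alpha> by (subst integral_diff) (auto intro!: integrable_continuous_interval c)
    then have e: "u b - Dquot \<alpha> x \<theta> = (1 / \<alpha>) *\<^sub>R integral {0..\<alpha>} (\<lambda>s. u b - u (\<theta> + s))"
      using \<alpha> by (simp add: Dquot_average(1) scaleR_diff_right)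
    have "norm (integral {0..\<alpha>} (\<lambda>s. u b - u (\<theta> + s))) \<le> integral {0..\<alpha>} (\<lambda>s. L * \<alpha>)"
    proof (intro integral_norm_bound_integral integrable_continuous_interval continuous_intros c)
      fix s assume "s \<in> {0..\<alpha>}"
      then have "L * \<bar>b - (\<theta> + s)\<bar> \<le> L * \<alpha>" using b L0 by (intro mult_left_mono) auto
      then show "norm (u b - u (\<theta> + s)) \<le> L * \<alpha>" using L[of b "\<theta> + s"] by linarith
    qed
    also have "\<dots> = \<alpha> * (L * \<alpha>)" using \<alpha> by simp
    finally show ?thesis unfolding e using \<alpha> by (simp add: field_simps)
  qed
  have "norm (u \<theta> - Dquot \<alpha> x \<theta>) \<le> L * \<bar>\<alpha>\<bar> \<and> norm (u (\<theta> + \<alpha>) - Dquot \<alpha> x \<theta>) \<le> L * \<bar>\<alpha>\<bar>"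
  proof (cases "0 < \<alpha>")
    case True
    then show ?thesis using key[OF True, of \<theta> \<theta>] key[OF True, of \<theta> "\<theta> + \<alpha>"] by simp
  next
    case False
    then have n: "0 < - \<alpha>" using \<alpha> by simp
    have "Dquot (- \<alpha>) x (\<theta> + \<alpha>) = Dquot \<alpha> x \<theta>" by (rule Dquot_reflect)
    then show ?thesis using key[OF n, of "\<theta> + \<alpha>" "\<theta> + \<alpha>"] key[OF n, of "\<theta> + \<alpha>" \<theta>] n by simp
  qed
  then show "norm (u \<theta> - Dquot \<alpha> x \<theta>) \<le> L * \<bar>\<alpha>\<bar>" "norm (u (\<theta> + \<alpha>) - Dquot \<alpha> x \<theta>) \<le> L * \<bar>\<alpha>\<bar>" by auto
qed

lemma Dquot_bound: assumes "\<alpha> \<noteq> 0" shows "norm (Dquot \<alpha> x \<theta>) \<le> R"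
proof -
  have key: "norm (Dquot \<alpha> x \<theta>) \<le> R" if "0 < \<alpha>" for \<theta> \<alpha>
  proof -
    have "norm (integral {0..\<alpha>} (\<lambda>s. u (\<theta> + s))) \<le> integral {0..\<alpha>} (\<lambda>s. R)"
      by (intro integral_norm_bound_integral integrable_continuous_interval cu_shift continuous_intros bound)
    then have "norm (integral {0..\<alpha>} (\<lambda>s. u (\<theta> + s))) \<le> \<alpha> * R" using that by simp
    then show ?thesis using that by (simp add: Dquot_average(1) field_simps)
  qed
  show ?thesis
  proof (cases "0 < \<alpha>")
    case False
    then show ?thesis using key[of "- \<alpha>" "\<theta> + \<alpha>"] assms by (simp add: Dquot_reflect)
  qed (rule key)
qed

lemma in_domain: "\<alpha> \<in> {-pi..pi} - {0} \<Longrightarrow> (u (\<theta> + \<alpha>), u \<theta>, Dquot \<alpha> x \<theta>) \<in> kern_domain R m"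
  using bound chord[of \<alpha> \<theta>] Dquot_bound[of \<alpha> \<theta>] by (auto simp: kern_domain_def)

definition J :: "real \<Rightarrow> real \<Rightarrow> real^2" where
  "J \<theta> \<alpha> = kern (u (\<theta> + \<alpha>)) (u \<theta>) (Dquot \<alpha> x \<theta>) *v (T (u (\<theta> + \<alpha>)) - T (u \<theta>))"

lemma J_eq: "peskin_kernel x \<theta> \<alpha> *v delta \<alpha> (\<lambda>\<theta>'. T (dtheta x \<theta>')) \<theta> = J \<theta> \<alpha>"
  by (simp add: J_def peskin_kernel_kern dtheta_x delta_def)

text \<open>Seen from its other end, a chord has the same slope and the same kernel, while the
  increment of the tension changes sign. This antisymmetry drives the symmetrisation in
  \<open>trunc_test\<close>.\<close>

lemma J_reflect: "J (\<theta> + \<alpha>) (- \<alpha>) = - J \<theta> \<alpha>"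
proof -
  have "kern (u \<theta>) (u (\<theta> + \<alpha>)) (Dquot \<alpha> x \<theta>) = kern (u (\<theta> + \<alpha>)) (u \<theta>) (Dquot \<alpha> x \<theta>)" by (rule kern_commute)
  then show ?thesis
    by (simp add: J_def Dquot_reflect matrix_vector_mult_diff_distrib)
qed

lemma J_periodic: "periodic (\<lambda>\<theta>. J \<theta> \<alpha>)"
proof -
  have "u (\<theta> + 2 * pi + \<alpha>) = u (\<theta> + \<alpha>)" "x (\<theta> + 2 * pi + \<alpha>) = x (\<theta> + \<alpha>)" for \<theta>
    using periodic_shift[OF per_u, of \<alpha>] periodic_shift[OF per, of \<alpha>] by (simp_all add: periodic_def)
  then show ?thesis using per per_u by (simp add: periodic_def J_def Dquot_def delta_def)
qed

lemma T_continuous: "continuous_on S T"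
  using adm by (intro continuous_at_imp_continuous_on)
    (auto simp: admissible_tension_def intro: differentiable_imp_continuous_within)

lemma J_continuous:
  fixes f g :: "'z::topological_space \<Rightarrow> real"
  assumes f: "continuous_on S f" and g: "continuous_on S g" and S: "\<And>z. z \<in> S \<Longrightarrow> g z \<in> {-pi..pi} - {0}"
  shows "continuous_on S (\<lambda>z. J (f z) (g z))"
  unfolding J_def
proof (rule continuous_on_kern[OF m, where R=R])
  show "continuous_on S (\<lambda>z. Dquot (g z) x (f z))"
    unfolding Dquot_def delta_def using S by (intro continuous_intros cx_shift f g) auto
  show "continuous_on S (\<lambda>z. T (u (f z + g z)) - T (u (f z)))"
    by (intro continuous_intros continuous_on_compose2[OF T_continuous[of UNIV]] cu_shift f g) auto
qed (use S f g in \<open>auto intro!: cu_shift continuous_intros in_domain\<close>)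

text \<open>The principal value cut off at \<eta>, with \<alpha> and -\<alpha> folded together, so
  that to leading order it is a second difference of the tension that is divided by
  \<alpha>^2.\<close>

definition trunc :: "real \<Rightarrow> real \<Rightarrow> real^2" where
  "trunc \<eta> \<theta> = integral {\<eta>..pi} (\<lambda>\<alpha>. (1 / \<alpha>\<^sup>2) *\<^sub>R (J \<theta> \<alpha> + J \<theta> (- \<alpha>)))"

lemma J_sq_continuous:
  assumes "0 < \<eta>"
  shows "continuous_on (A \<times> {\<eta>..pi}) (\<lambda>(\<theta>, \<alpha>). (1 / \<alpha>\<^sup>2) *\<^sub>R (J \<theta> \<alpha> + J \<theta> (- \<alpha>)))"
  using assms unfolding split_beta by (intro continuous_intros J_continuous) auto

lemma J_slice_continuous:
  assumes "0 < \<eta>"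
  shows "continuous_on {\<eta>..pi} (\<lambda>\<alpha>. J \<theta> \<alpha>)" "continuous_on {\<eta>..pi} (\<lambda>\<alpha>. J \<theta> (- \<alpha>))"
  using assms by (intro continuous_intros J_continuous; auto)+

lemma trunc_continuous: assumes "0 < \<eta>" shows "continuous_on {a..b} (trunc \<eta>)"
proof -
  have "continuous_on ({a..b} \<times> cbox \<eta> pi) (\<lambda>(\<theta>, \<alpha>). (1 / \<alpha>\<^sup>2) *\<^sub>R (J \<theta> \<alpha> + J \<theta> (- \<alpha>)))"
    using J_sq_continuous[OF assms, of "{a..b}"] by (simp only: cbox_interval)
  from integral_continuous_on_param[OF this] show ?thesis
    by (simp only: trunc_def[abs_def] cbox_interval)
qed

lemma truncated_integral_eq:
  assumes \<eta>: "0 < \<eta>" "\<eta> \<le> pi"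
  shows "(LINT \<alpha>:{\<alpha>. \<eta> \<le> \<bar>\<alpha>\<bar> \<and> \<bar>\<alpha>\<bar> \<le> pi}|lebesgue.
     (1 / \<alpha>\<^sup>2) *\<^sub>R (peskin_kernel x \<theta> \<alpha> *v delta \<alpha> (\<lambda>\<theta>'. T (dtheta x \<theta>')) \<theta>)) = trunc \<eta> \<theta>"
proof -
  let ?g = "\<lambda>\<alpha>. (1 / \<alpha>\<^sup>2) *\<^sub>R J \<theta> \<alpha>"
  have c1: "continuous_on {\<eta>..pi} ?g" using \<eta> by (intro continuous_intros J_slice_continuous) auto
  have c2: "continuous_on {-pi..-\<eta>} ?g" using \<eta> by (intro continuous_intros J_continuous) auto
  have c3: "continuous_on {\<eta>..pi} (\<lambda>\<alpha>. (1 / \<alpha>\<^sup>2) *\<^sub>R J \<theta> (- \<alpha>))" using \<eta> by (intro continuous_intros J_slice_continuous) auto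
  have a1: "?g absolutely_integrable_on {\<eta>..pi}" "?g absolutely_integrable_on {-pi..-\<eta>}"
    using absolutely_integrable_continuous_real c1 c2 by blast+
  have S: "{\<alpha>. \<eta> \<le> \<bar>\<alpha>\<bar> \<and> \<bar>\<alpha>\<bar> \<le> pi} = {-pi..-\<eta>} \<union> {\<eta>..pi}" using \<eta> by auto
  have "(LINT \<alpha>:{-pi..-\<eta>} \<union> {\<eta>..pi}|lebesgue. ?g \<alpha>) = (LINT \<alpha>:{-pi..-\<eta>}|lebesgue. ?g \<alpha>) + (LINT \<alpha>:{\<eta>..pi}|lebesgue. ?g \<alpha>)"
    using \<eta> a1 by (intro set_integral_Un) auto
  also have "\<dots> = integral {-pi..-\<eta>} ?g + integral {\<eta>..pi} ?g"
    using a1 by (simp add: set_lebesgue_integral_eq_integral(2))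
  also have "integral {-pi..-\<eta>} ?g = integral {\<eta>..pi} (\<lambda>\<alpha>. (1 / \<alpha>\<^sup>2) *\<^sub>R J \<theta> (- \<alpha>))"
    using has_integral_reflect_lemma_real[OF integrable_integral[OF integrable_continuous_interval[OF c2]]]
    by (simp add: integral_unique)
  also have "\<dots> + integral {\<eta>..pi} ?g = trunc \<eta> \<theta>"
    unfolding trunc_def
    by (subst integral_add[symmetric]) (auto intro!: integrable_continuous_interval c1 c3 simp: scaleR_add_right add.commute)
  finally show ?thesis unfolding J_eq S .
qed

text \<open>After Fubini's theorem the part with -\<alpha> is shifted by \<alpha> in the angle;
  \<open>J_reflect\<close> turns it into minus the pairing of
  \<open>\<phi> (\<theta> + \<alpha>)\<close> with \<open>J \<theta> \<alpha>\<close>, which leaves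
  an increment of the test function.\<close>

lemma trunc_test:
  assumes \<eta>: "0 < \<eta>" "\<eta> \<le> pi" and \<phi>: "periodic \<phi>" "continuous_on UNIV \<phi>"
  shows "integral {-pi..pi} (\<lambda>\<theta>. \<phi> \<theta> \<bullet> trunc \<eta> \<theta>)
    = integral {\<eta>..pi} (\<lambda>\<alpha>. (1 / \<alpha>\<^sup>2) * integral {-pi..pi} (\<lambda>\<theta>. - ((\<phi> (\<theta> + \<alpha>) - \<phi> \<theta>) \<bullet> J \<theta> \<alpha>)))"
proof -
  have c\<phi>: "continuous_on S (\<lambda>z. \<phi> (f z))" if "continuous_on S f" for S and f :: "'z::topological_space \<Rightarrow> real"
    by (rule continuous_on_compose2[OF \<phi>(2) that]) auto
  have "integral {-pi..pi} (\<lambda>\<theta>. \<phi> \<theta> \<bullet> trunc \<eta> \<theta>) = integral {-pi..pi} (\<lambda>\<theta>. integral {\<eta>..pi} (\<lambda>\<alpha>. (1 / \<alpha>\<^sup>2) * (\<phi> \<theta> \<bullet> J \<theta> \<alpha> + \<phi> \<theta> \<bullet> J \<theta> (- \<alpha>))))"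
  proof (intro integral_cong)
    fix \<theta>
    have "continuous_on {\<eta>..pi} (\<lambda>\<alpha>. (1 / \<alpha>\<^sup>2) *\<^sub>R (J \<theta> \<alpha> + J \<theta> (- \<alpha>)))"
      using \<eta> by (intro continuous_intros J_slice_continuous) auto
    from has_integral_linear[OF integrable_integral[OF integrable_continuous_interval[OF this]] bounded_linear_inner_right[of "\<phi> \<theta>"]]
    show "\<phi> \<theta> \<bullet> trunc \<eta> \<theta> = integral {\<eta>..pi} (\<lambda>\<alpha>. (1 / \<alpha>\<^sup>2) * (\<phi> \<theta> \<bullet> J \<theta> \<alpha> + \<phi> \<theta> \<bullet> J \<theta> (- \<alpha>)))"
      by (simp add: trunc_def o_def integral_unique inner_add_right)
  qed
  also have "\<dots> = integral {\<eta>..pi} (\<lambda>\<alpha>. integral {-pi..pi} (\<lambda>\<theta>. (1 / \<alpha>\<^sup>2) * (\<phi> \<theta> \<bullet> J \<theta> \<alpha> + \<phi> \<theta> \<bullet> J \<theta> (- \<alpha>))))"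
    unfolding interval_cbox
  proof (rule integral_swap_continuous)
    show "continuous_on (cbox (- pi, \<eta>) (pi, pi)) (\<lambda>(\<theta>, \<alpha>). (1 / \<alpha>\<^sup>2) * (\<phi> \<theta> \<bullet> J \<theta> \<alpha> + \<phi> \<theta> \<bullet> J \<theta> (- \<alpha>)))"
      using \<eta> unfolding split_beta cbox_Pair_eq interval_cbox[symmetric] by (intro continuous_intros c\<phi> J_continuous) auto
  qed
  also have "\<dots> = integral {\<eta>..pi} (\<lambda>\<alpha>. (1 / \<alpha>\<^sup>2) * integral {-pi..pi} (\<lambda>\<theta>. - ((\<phi> (\<theta> + \<alpha>) - \<phi> \<theta>) \<bullet> J \<theta> \<alpha>)))"
  proof (intro integral_cong)
    fix \<alpha> assume \<alpha>: "\<alpha> \<in> {\<eta>..pi}"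
    then have \<alpha>': "\<alpha> \<in> {-pi..pi} - {0}" "- \<alpha> \<in> {-pi..pi} - {0}" using \<eta> by auto
    have cJ: "continuous_on S (\<lambda>\<theta>. J (f \<theta>) \<alpha>)" "continuous_on S (\<lambda>\<theta>. J (f \<theta>) (- \<alpha>))" if "continuous_on S f" for S and f :: "real \<Rightarrow> real"
      using \<alpha>' that by (intro J_continuous continuous_intros; simp)+
    have i: "(\<lambda>\<theta>. \<phi> \<theta> \<bullet> J \<theta> \<alpha>) integrable_on {-pi..pi}" "(\<lambda>\<theta>. \<phi> \<theta> \<bullet> J \<theta> (- \<alpha>)) integrable_on {-pi..pi}"
      "(\<lambda>\<theta>. \<phi> (\<theta> + \<alpha>) \<bullet> J \<theta> \<alpha>) integrable_on {-pi..pi}"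
      by (intro integrable_continuous_interval continuous_intros c\<phi> cJ)+
    have p: "periodic (\<lambda>\<theta>. \<phi> \<theta> \<bullet> J \<theta> (- \<alpha>))"
      using \<phi>(1) J_periodic[of "- \<alpha>"] by (simp add: periodic_def)
    have "integral {-pi..pi} (\<lambda>\<theta>. \<phi> \<theta> \<bullet> J \<theta> (- \<alpha>)) = integral {-pi..pi} (\<lambda>\<theta>. \<phi> (\<theta> + \<alpha>) \<bullet> J (\<theta> + \<alpha>) (- \<alpha>))"
      using periodic_integral_shift[OF p i(2), of \<alpha>] by simp
    also have "\<dots> = - integral {-pi..pi} (\<lambda>\<theta>. \<phi> (\<theta> + \<alpha>) \<bullet> J \<theta> \<alpha>)"
      by (simp add: J_reflect)
    finally have "integral {-pi..pi} (\<lambda>\<theta>. \<phi> \<theta> \<bullet> J \<theta> \<alpha> + \<phi> \<theta> \<bullet> J \<theta> (- \<alpha>))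
      = integral {-pi..pi} (\<lambda>\<theta>. \<phi> \<theta> \<bullet> J \<theta> \<alpha>) - integral {-pi..pi} (\<lambda>\<theta>. \<phi> (\<theta> + \<alpha>) \<bullet> J \<theta> \<alpha>)"
      using i by (simp add: integral_add)
    also have "\<dots> = integral {-pi..pi} (\<lambda>\<theta>. \<phi> \<theta> \<bullet> J \<theta> \<alpha> - \<phi> (\<theta> + \<alpha>) \<bullet> J \<theta> \<alpha>)"
      using i by (simp add: integral_diff)
    also have "(\<lambda>\<theta>. \<phi> \<theta> \<bullet> J \<theta> \<alpha> - \<phi> (\<theta> + \<alpha>) \<bullet> J \<theta> \<alpha>) = (\<lambda>\<theta>. - ((\<phi> (\<theta> + \<alpha>) - \<phi> \<theta>) \<bullet> J \<theta> \<alpha>))"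
      by (auto simp: inner_diff_left)
    finally show "integral {-pi..pi} (\<lambda>\<theta>. (1 / \<alpha>\<^sup>2) * (\<phi> \<theta> \<bullet> J \<theta> \<alpha> + \<phi> \<theta> \<bullet> J \<theta> (- \<alpha>)))
      = (1 / \<alpha>\<^sup>2) * integral {-pi..pi} (\<lambda>\<theta>. - ((\<phi> (\<theta> + \<alpha>) - \<phi> \<theta>) \<bullet> J \<theta> \<alpha>))"
      by (simp only: integral_mult_right)
  qed
  finally show ?thesis .
qed

text \<open>Near \<alpha> = 0 the kernel differs from the identity over 4 pi by O(\<alpha>), and the
  increment of the tension is itself O(\<alpha>), so replacing the kernel costs a bounded error
  after division by \<alpha>^2. What remains is the truncated second difference of the tension along
  the curve, which \<open>truncated_second_difference_L2\<close> bounds.\<close>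

lemma trunc_L2_bounded:
  obtains B where "\<And>\<eta>. 0 < \<eta> \<Longrightarrow> \<eta> \<le> pi \<Longrightarrow> integral {-pi..pi} (\<lambda>\<theta>. (norm (trunc \<eta> \<theta>))\<^sup>2) \<le> B"
proof -
  obtain L where L0: "0 \<le> L" and L: "\<And>a b. norm (u a - u b) \<le> L * \<bar>a - b\<bar>" using u_lipschitz by metis
  obtain Jm LT B where dT: "\<And>z. (T has_derivative (\<lambda>h. Jm z *v h)) (at z)"
    and LT: "\<And>z w h. norm (Jm z *v h - Jm w *v h) \<le> LT * norm (z - w) * norm h"
    and B: "\<And>a b. norm (T a - T b) \<le> B * norm (a - b)" and B0: "0 \<le> B"
    using tension_regularity[OF adm] by metis
  obtain K where K0: "0 \<le> K" and K: "\<And>U V D U' V' D' h. (U, V, D) \<in> kern_domain R m \<Longrightarrow> (U', V', D') \<in> kern_domain R m \<Longrightarrow>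
     norm (kern U V D *v h - kern U' V' D' *v h) \<le> K * (norm (U - U') + norm (V - V') + norm (D - D')) * norm h"
    using kern_lipschitz[OF m, of R] by metis
  define g where "g = (\<lambda>\<theta>. T (u \<theta>))"
  define g2 where "g2 = (\<lambda>\<theta>. Jm (u \<theta>) *v u2 \<theta>)"
  have dg: "(g has_vector_derivative g2 \<theta>) (at \<theta>)" for \<theta>
    using has_derivative_compose[OF du[of \<theta>, unfolded has_vector_derivative_def] dT[of "u \<theta>"]]
    by (simp add: g_def g2_def has_vector_derivative_def matrix_vector_mult_scaleR)
  \<comment> \<open>The Lipschitz bound of \<open>Jm\<close> is phrased through its action on
    vectors, hence a comparison in two steps: first the matrix is moved, then the vector.\<close>
  have cg2: "continuous_on UNIV g2"
  proof (rule continuous_at_imp_continuous_on, rule ballI)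
    fix \<theta> :: real
    have "((\<lambda>s. Jm (u s) *v u2 s) \<longlongrightarrow> Jm (u \<theta>) *v u2 \<theta>) (at \<theta>)"
    proof (rule tendsto_dist_iff[THEN iffD2], rule tendsto_sandwich[where f="\<lambda>_. 0"])
      let ?H = "\<lambda>s. LT * norm (u s - u \<theta>) * norm (u2 s) + norm (Jm (u \<theta>) *v u2 s - Jm (u \<theta>) *v u2 \<theta>)"
      show "\<forall>\<^sub>F s in at \<theta>. dist (Jm (u s) *v u2 s) (Jm (u \<theta>) *v u2 \<theta>) \<le> ?H s"
      proof (intro always_eventually allI)
        fix s
        have "norm (Jm (u s) *v u2 s - Jm (u \<theta>) *v u2 \<theta>) \<le> norm (Jm (u s) *v u2 s - Jm (u \<theta>) *v u2 s) + norm (Jm (u \<theta>) *v u2 s - Jm (u \<theta>) *v u2 \<theta>)"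
          using norm_triangle_ineq[of "Jm (u s) *v u2 s - Jm (u \<theta>) *v u2 s" "Jm (u \<theta>) *v u2 s - Jm (u \<theta>) *v u2 \<theta>"] by simp
        then show "dist (Jm (u s) *v u2 s) (Jm (u \<theta>) *v u2 \<theta>) \<le> ?H s"
          using LT[of "u s" "u2 s" "u \<theta>"] by (simp add: dist_norm)
      qed
      have i2: "isCont u2 \<theta>" and i1: "isCont u \<theta>"
        using cu2 cu[of UNIV] by (auto simp: continuous_on_eq_continuous_at)
      have "isCont (\<lambda>s. Jm (u \<theta>) *v u2 s) \<theta>"
        by (rule isCont_o2[OF i2]) (rule linear_continuous_at[OF matrix_vector_mul_bounded_linear])
      then have "isCont ?H \<theta>" using i1 i2 by (intro continuous_intros)
      then show "(?H \<longlongrightarrow> 0) (at \<theta>)" by (simp add: isCont_def)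
    qed auto
    then show "isCont g2 \<theta>" by (simp add: isCont_def g2_def)
  qed
  have perg: "periodic g" using per_u by (simp add: periodic_def g_def)
  define A where "A = (\<lambda>\<eta> j \<theta>. integral {\<eta>..pi} (\<lambda>\<alpha>. (g (\<theta> + \<alpha>) $ j + g (\<theta> - \<alpha>) $ j - 2 * g \<theta> $ j) / \<alpha>\<^sup>2))"
  \<comment> \<open>Twice the product of the kernel deviation, with coefficient K times 2L, and the
    tension increment, with coefficient BL; the factor 2 counts \<alpha> and -\<alpha>.\<close>
  define c1 where "c1 = 4 * K * L * (B * L)"
  have cg: "continuous_on S (\<lambda>z. g (f z))" if "continuous_on S f" for S and f :: "'z::topological_space \<Rightarrow> real"
    unfolding g_def by (rule continuous_on_compose2[OF T_continuous[of UNIV] cu_shift[OF that]]) auto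
  have Abound: "integral {-pi..pi} (\<lambda>\<theta>. (A \<eta> j \<theta>)\<^sup>2) \<le> 25 * integral {-pi..pi} (\<lambda>\<theta>. (g2 \<theta> $ j)\<^sup>2)" and Acont: "continuous_on UNIV (A \<eta> j)"
    if "0 < \<eta>" "\<eta> \<le> pi" for \<eta> j
  proof -
    have p: "periodic (\<lambda>\<theta>. g \<theta> $ j)" using perg by (simp add: periodic_def)
    have d: "((\<lambda>\<theta>. g \<theta> $ j) has_real_derivative g2 \<theta> $ j) (at \<theta>)" for \<theta>
      using bounded_linear.has_vector_derivative[OF bounded_linear_vec_nth dg[of \<theta>], of j]
      by (simp add: has_real_derivative_iff_has_vector_derivative)
    have c: "continuous_on UNIV (\<lambda>\<theta>. g2 \<theta> $ j)" using cg2 by (intro continuous_intros)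
    show "integral {-pi..pi} (\<lambda>\<theta>. (A \<eta> j \<theta>)\<^sup>2) \<le> 25 * integral {-pi..pi} (\<lambda>\<theta>. (g2 \<theta> $ j)\<^sup>2)"
      unfolding A_def by (rule truncated_second_difference_L2(2)[OF p d c that])
    show "continuous_on UNIV (A \<eta> j)" unfolding A_def by (rule truncated_second_difference_L2(1)[OF p d c that])
  qed
  have rem: "norm (trunc \<eta> \<theta> - (1 / (4 * pi)) *\<^sub>R (\<chi> j. A \<eta> j \<theta>)) \<le> pi * c1" if \<eta>: "0 < \<eta>" "\<eta> \<le> pi" for \<eta> \<theta>
  proof -
    have c0: "0 \<le> c1" using K0 L0 B0 by (simp add: c1_def)
    let ?s = "\<lambda>\<alpha>. g (\<theta> + \<alpha>) + g (\<theta> - \<alpha>) - 2 *\<^sub>R g \<theta>"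
    have cs: "continuous_on {\<eta>..pi} (\<lambda>\<alpha>. (1 / \<alpha>\<^sup>2) *\<^sub>R ?s \<alpha>)"
      using \<eta> by (intro continuous_intros cg) auto
    have vec: "(\<chi> j. A \<eta> j \<theta>) = integral {\<eta>..pi} (\<lambda>\<alpha>. (1 / \<alpha>\<^sup>2) *\<^sub>R ?s \<alpha>)"
    proof -
      have "integral {\<eta>..pi} (\<lambda>\<alpha>. (1 / \<alpha>\<^sup>2) *\<^sub>R ?s \<alpha>) $ j = A \<eta> j \<theta>" for j
        using has_integral_linear[OF integrable_integral[OF integrable_continuous_interval[OF cs]] bounded_linear_vec_nth[of j]]
        by (simp add: A_def o_def integral_unique)
      then show ?thesis by (simp add: vec_eq_iff)
    qed
    have cJJ: "continuous_on {\<eta>..pi} (\<lambda>\<alpha>. (1 / \<alpha>\<^sup>2) *\<^sub>R (J \<theta> \<alpha> + J \<theta> (- \<alpha>)))"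
      using \<eta> by (intro continuous_intros J_slice_continuous) auto
    have near: "norm (J \<theta> \<alpha> - (1 / (4 * pi)) *\<^sub>R (g (\<theta> + \<alpha>) - g \<theta>)) \<le> (c1 / 2) * \<alpha>\<^sup>2" if \<alpha>: "\<alpha> \<in> {-pi..pi} - {0}" for \<alpha>
    proof -
      let ?D = "Dquot \<alpha> x \<theta>" and ?h = "T (u (\<theta> + \<alpha>)) - T (u \<theta>)"
      have D0: "?D \<noteq> 0" using chord[OF \<alpha>, of \<theta>] m by auto
      have Dm: "(?D, ?D, ?D) \<in> kern_domain R m" using in_domain[OF \<alpha>, of \<theta>] by (simp add: kern_domain_def)
      have "J \<theta> \<alpha> - (1 / (4 * pi)) *\<^sub>R (g (\<theta> + \<alpha>) - g \<theta>) = kern (u (\<theta> + \<alpha>)) (u \<theta>) ?D *v ?h - kern ?D ?D ?D *v ?h"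
        unfolding J_def g_def kern_diagonal[OF D0] by (simp add: scaleR_matrix_vector_assoc[symmetric])
      then have "norm (J \<theta> \<alpha> - (1 / (4 * pi)) *\<^sub>R (g (\<theta> + \<alpha>) - g \<theta>)) \<le> K * (norm (u (\<theta> + \<alpha>) - ?D) + norm (u \<theta> - ?D) + norm (?D - ?D)) * norm ?h"
        using K[OF in_domain[OF \<alpha>, of \<theta>] Dm, of ?h] by (simp only:)
      also have "\<dots> \<le> K * (2 * L * \<bar>\<alpha>\<bar>) * (B * L * \<bar>\<alpha>\<bar>)"
      proof (intro mult_mono mult_left_mono)
        have "\<alpha> \<noteq> 0" using \<alpha> by simp
        from Dquot_near[OF L L0 this, of \<theta>]
        show "norm (u (\<theta> + \<alpha>) - ?D) + norm (u \<theta> - ?D) + norm (?D - ?D) \<le> 2 * L * \<bar>\<alpha>\<bar>" by simp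
        have "norm ?h \<le> B * norm (u (\<theta> + \<alpha>) - u \<theta>)" by (rule B)
        also have "\<dots> \<le> B * (L * \<bar>\<alpha>\<bar>)" using L[of "\<theta> + \<alpha>" \<theta>] B0 by (intro mult_left_mono) auto
        finally show "norm ?h \<le> B * L * \<bar>\<alpha>\<bar>" by (simp add: mult.assoc)
      qed (use K0 L0 in auto)
      also have "\<dots> = (c1 / 2) * (\<bar>\<alpha>\<bar> * \<bar>\<alpha>\<bar>)" by (simp add: c1_def)
      finally show ?thesis by (simp add: power2_eq_square)
    qed
    have eq: "trunc \<eta> \<theta> - (1 / (4 * pi)) *\<^sub>R (\<chi> j. A \<eta> j \<theta>)
      = integral {\<eta>..pi} (\<lambda>\<alpha>. (1 / \<alpha>\<^sup>2) *\<^sub>R (J \<theta> \<alpha> + J \<theta> (- \<alpha>)) - (1 / (4 * pi)) *\<^sub>R ((1 / \<alpha>\<^sup>2) *\<^sub>R ?s \<alpha>))"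
      unfolding vec trunc_def
      using integral_diff[OF integrable_continuous_interval[OF cJJ] integrable_cmul[OF integrable_continuous_interval[OF cs], of "1 / (4 * pi)"]]
      by (simp only: integral_cmul)
    have "norm (trunc \<eta> \<theta> - (1 / (4 * pi)) *\<^sub>R (\<chi> j. A \<eta> j \<theta>)) \<le> integral {\<eta>..pi} (\<lambda>_. c1)"
      unfolding eq
    proof (intro integral_norm_bound_integral integrable_const_ivl integrable_continuous_interval)
      show "continuous_on {\<eta>..pi} (\<lambda>\<alpha>. (1 / \<alpha>\<^sup>2) *\<^sub>R (J \<theta> \<alpha> + J \<theta> (- \<alpha>)) - (1 / (4 * pi)) *\<^sub>R ((1 / \<alpha>\<^sup>2) *\<^sub>R ?s \<alpha>))"
        by (intro continuous_on_diff cJJ continuous_on_scaleR continuous_on_const cs)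
      fix \<alpha> assume "\<alpha> \<in> {\<eta>..pi}"
      then have a: "0 < \<alpha>" "\<alpha> \<in> {-pi..pi} - {0}" "- \<alpha> \<in> {-pi..pi} - {0}" using \<eta> by auto
      have eq2: "(1 / \<alpha>\<^sup>2) *\<^sub>R (J \<theta> \<alpha> + J \<theta> (- \<alpha>)) - (1 / (4 * pi)) *\<^sub>R ((1 / \<alpha>\<^sup>2) *\<^sub>R ?s \<alpha>)
         = (1 / \<alpha>\<^sup>2) *\<^sub>R ((J \<theta> \<alpha> - (1 / (4 * pi)) *\<^sub>R (g (\<theta> + \<alpha>) - g \<theta>)) + (J \<theta> (- \<alpha>) - (1 / (4 * pi)) *\<^sub>R (g (\<theta> + - \<alpha>) - g \<theta>)))"
        by (simp add: vec_eq_iff field_simps)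
      have "norm ((1 / \<alpha>\<^sup>2) *\<^sub>R ((J \<theta> \<alpha> - (1 / (4 * pi)) *\<^sub>R (g (\<theta> + \<alpha>) - g \<theta>)) + (J \<theta> (- \<alpha>) - (1 / (4 * pi)) *\<^sub>R (g (\<theta> + - \<alpha>) - g \<theta>)))) \<le> (1 / \<alpha>\<^sup>2) * ((c1 / 2) * \<alpha>\<^sup>2 + (c1 / 2) * \<alpha>\<^sup>2)"
      proof -
        have "norm ((1 / \<alpha>\<^sup>2) *\<^sub>R v) \<le> (1 / \<alpha>\<^sup>2) * K'" if "norm v \<le> K'" for v :: "real^2" and K'
          using mult_left_mono[OF that, of "1 / \<alpha>\<^sup>2"] by (simp only: norm_scaleR) simp
        from this[OF norm_triangle_le[OF add_mono[OF near[OF a(2)] near[OF a(3)]]]] show ?thesis by simp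
      qed
      also have "\<dots> = c1" using a(1) by (simp add: field_simps)
      finally show "norm ((1 / \<alpha>\<^sup>2) *\<^sub>R (J \<theta> \<alpha> + J \<theta> (- \<alpha>)) - (1 / (4 * pi)) *\<^sub>R ((1 / \<alpha>\<^sup>2) *\<^sub>R ?s \<alpha>)) \<le> c1" unfolding eq2 .
    qed
    also have "\<dots> \<le> pi * c1" using \<eta> c0 by (simp add: mult_right_mono)
    finally show ?thesis .
  qed
  show thesis
  proof (rule that)
    fix \<eta> :: real assume \<eta>: "0 < \<eta>" "\<eta> \<le> pi"
    have cA: "continuous_on {-pi..pi} (A \<eta> j)" for j using Acont[OF \<eta>] by (rule continuous_on_subset) auto
    have pw: "(norm (trunc \<eta> \<theta>))\<^sup>2 \<le> 2 * (pi * c1)\<^sup>2 + 2 * (A \<eta> 1 \<theta>)\<^sup>2 + 2 * (A \<eta> 2 \<theta>)\<^sup>2" for \<theta>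
    proof -
      let ?a = "(1 / (4 * pi)) *\<^sub>R (\<chi> j. A \<eta> j \<theta>)"
      have "norm (trunc \<eta> \<theta>) \<le> norm (trunc \<eta> \<theta> - ?a) + norm ?a" using norm_triangle_ineq[of "trunc \<eta> \<theta> - ?a" ?a] by simp
      also have "norm ?a \<le> norm (\<chi> j. A \<eta> j \<theta>)" 
        using mult_right_mono[of "1 / (4 * pi)" 1 "norm (\<chi> j. A \<eta> j \<theta>)"] pi_gt3 by simp
      finally have "norm (trunc \<eta> \<theta>) \<le> pi * c1 + norm (\<chi> j. A \<eta> j \<theta>)" using rem[OF \<eta>, of \<theta>] by linarith
      then have "(norm (trunc \<eta> \<theta>))\<^sup>2 \<le> (pi * c1 + norm (\<chi> j. A \<eta> j \<theta>))\<^sup>2" by (rule power_mono) simp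
      also have "\<dots> \<le> 2 * (pi * c1)\<^sup>2 + 2 * (norm (\<chi> j. A \<eta> j \<theta>))\<^sup>2"
        using zero_le_power2[of "pi * c1 - norm (\<chi> j. A \<eta> j \<theta>)"] by (simp add: power2_sum power2_diff)
      finally show ?thesis by (simp add: norm2_sq)
    qed
    have "integral {-pi..pi} (\<lambda>\<theta>. (norm (trunc \<eta> \<theta>))\<^sup>2) \<le> integral {-pi..pi} (\<lambda>\<theta>. 2 * (pi * c1)\<^sup>2 + 2 * (A \<eta> 1 \<theta>)\<^sup>2 + 2 * (A \<eta> 2 \<theta>)\<^sup>2)"
      by (intro integral_le pw integrable_continuous_interval continuous_intros trunc_continuous[OF \<eta>(1)] cA)
    also have "\<dots> = 2 * pi * (2 * (pi * c1)\<^sup>2) + 2 * integral {-pi..pi} (\<lambda>\<theta>. (A \<eta> 1 \<theta>)\<^sup>2) + 2 * integral {-pi..pi} (\<lambda>\<theta>. (A \<eta> 2 \<theta>)\<^sup>2)"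
    proof -
      have i: "(\<lambda>\<theta>. (A \<eta> j \<theta>)\<^sup>2) integrable_on {-pi..pi}" for j by (intro integrable_continuous_interval continuous_intros cA)
      have "((\<lambda>\<theta>. 2 * (pi * c1)\<^sup>2 + 2 * (A \<eta> 1 \<theta>)\<^sup>2 + 2 * (A \<eta> 2 \<theta>)\<^sup>2) has_integral
         ((pi - - pi) *\<^sub>R (2 * (pi * c1)\<^sup>2) + 2 * integral {-pi..pi} (\<lambda>\<theta>. (A \<eta> 1 \<theta>)\<^sup>2) + 2 * integral {-pi..pi} (\<lambda>\<theta>. (A \<eta> 2 \<theta>)\<^sup>2))) {-pi..pi}"
        using has_integral_add[OF has_integral_add[OF has_integral_const_real[of "2 * (pi * c1)\<^sup>2" "-pi" pi] has_integral_mult_right[OF integrable_integral[OF i[of 1]], of 2]] has_integral_mult_right[OF integrable_integral[OF i[of 2]], of 2]]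
        by simp
      then show ?thesis by (simp add: integral_unique)
    qed
    also have "\<dots> \<le> 2 * pi * (2 * (pi * c1)\<^sup>2) + 2 * (25 * integral {-pi..pi} (\<lambda>\<theta>. (g2 \<theta> $ 1)\<^sup>2)) + 2 * (25 * integral {-pi..pi} (\<lambda>\<theta>. (g2 \<theta> $ 2)\<^sup>2))"
      using Abound[OF \<eta>] by (intro add_mono mult_left_mono) auto
    finally show "integral {-pi..pi} (\<lambda>\<theta>. (norm (trunc \<eta> \<theta>))\<^sup>2) \<le> 2 * pi * (2 * (pi * c1)\<^sup>2) + 2 * (25 * integral {-pi..pi} (\<lambda>\<theta>. (g2 \<theta> $ 1)\<^sup>2)) + 2 * (25 * integral {-pi..pi} (\<lambda>\<theta>. (g2 \<theta> $ 2)\<^sup>2))" .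
  qed
qed

text \<open>The truncations converge pointwise by assumption and are bounded in \<open>L\<^sup>2\<close>, so they converge
  weakly.\<close>

lemma trunc_weak_limit:
  assumes rhs: "\<And>\<theta>. peskin_rhs \<T> x \<theta> (v \<theta>)" and v: "continuous_on UNIV v" and \<phi>: "continuous_on UNIV \<phi>"
  shows "(\<lambda>n. integral {-pi..pi} (\<lambda>\<theta>. \<phi> \<theta> \<bullet> trunc (1 / Suc n) \<theta>)) \<longlonglongrightarrow> integral {-pi..pi} (\<lambda>\<theta>. \<phi> \<theta> \<bullet> v \<theta>)"
proof -
  have \<eta>: "0 < 1 / real (Suc n)" "1 / real (Suc n) \<le> pi" for n
  proof -
    have "1 / real (Suc n) \<le> 1" by simp
    then show "1 / real (Suc n) \<le> pi" using pi_gt3 by linarith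
  qed simp
  have cS: "continuous_on {-pi..pi} v" "continuous_on {-pi..pi} \<phi>" using v \<phi> by (auto intro: continuous_on_subset)
  obtain B where B: "\<And>\<eta>. 0 < \<eta> \<Longrightarrow> \<eta> \<le> pi \<Longrightarrow> integral {-pi..pi} (\<lambda>\<theta>. (norm (trunc \<eta> \<theta>))\<^sup>2) \<le> B"
    using trunc_L2_bounded by metis
  obtain C where C: "\<And>\<theta>. \<theta> \<in> {-pi..pi} \<Longrightarrow> norm (\<phi> \<theta>) \<le> C" "0 \<le> C"
  proof -
    have "bounded (\<phi> ` {-pi..pi})" using compact_continuous_image[OF cS(2)] compact_imp_bounded by blast
    then show ?thesis using that unfolding bounded_pos by (metis imageI less_imp_le)
  qed
  have ptw: "(\<lambda>n. trunc (1 / Suc n) \<theta>) \<longlonglongrightarrow> v \<theta>" for \<theta>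
  proof -
    have "filterlim (\<lambda>n. 1 / real (Suc n)) (at_right 0) sequentially"
      unfolding filterlim_at
      using LIMSEQ_inverse_real_of_nat by (auto simp: inverse_eq_divide)
    from filterlim_compose[OF rhs[of \<theta>, unfolded peskin_rhs_def] this]
    show ?thesis by (simp only: truncated_integral_eq[OF \<eta>])
  qed
  let ?h = "\<lambda>n \<theta>. \<phi> \<theta> \<bullet> trunc (1 / Suc n) \<theta> - \<phi> \<theta> \<bullet> v \<theta>"
  have ch: "continuous_on {-pi..pi} (?h n)" for n
    by (intro continuous_intros cS trunc_continuous \<eta>)
  have "(\<lambda>n. integral {-pi..pi} (?h n)) \<longlonglongrightarrow> 0"
  proof (rule integral_tendsto_0_of_L2_bounded[OF ch])
    show "(\<lambda>n. ?h n \<theta>) \<longlonglongrightarrow> 0" for \<theta>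
      using tendsto_diff[OF tendsto_inner[OF tendsto_const ptw[of \<theta>]] tendsto_const[of "\<phi> \<theta> \<bullet> v \<theta>"], of "\<phi> \<theta>"] by simp
    fix n
    have "integral {-pi..pi} (\<lambda>\<theta>. (?h n \<theta>)\<^sup>2) \<le> integral {-pi..pi} (\<lambda>\<theta>. 2 * C\<^sup>2 * (norm (trunc (1 / Suc n) \<theta>))\<^sup>2 + 2 * C\<^sup>2 * (norm (v \<theta>))\<^sup>2)"
    proof (intro integral_le integrable_continuous_interval continuous_intros ch cS trunc_continuous \<eta>)
      fix \<theta> assume \<theta>: "\<theta> \<in> {-pi..pi}"
      let ?t = "trunc (1 / Suc n) \<theta>"
      have "\<bar>?h n \<theta>\<bar> \<le> C * (norm ?t + norm (v \<theta>))"
      proof -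
        have "\<bar>?h n \<theta>\<bar> \<le> \<bar>\<phi> \<theta> \<bullet> ?t\<bar> + \<bar>\<phi> \<theta> \<bullet> v \<theta>\<bar>" by linarith
        also have "\<dots> \<le> norm (\<phi> \<theta>) * norm ?t + norm (\<phi> \<theta>) * norm (v \<theta>)" by (intro add_mono Cauchy_Schwarz_ineq2)
        also have "\<dots> = norm (\<phi> \<theta>) * (norm ?t + norm (v \<theta>))" by (simp add: distrib_left)
        also have "\<dots> \<le> C * (norm ?t + norm (v \<theta>))" using C(1)[OF \<theta>] by (intro mult_right_mono) auto
        finally show ?thesis .
      qed
      then have "\<bar>?h n \<theta>\<bar>\<^sup>2 \<le> (C * (norm ?t + norm (v \<theta>)))\<^sup>2" by (rule power_mono) simp
      also have "\<dots> = C\<^sup>2 * (norm ?t + norm (v \<theta>))\<^sup>2" by (simp add: power_mult_distrib)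
      also have "\<dots> \<le> C\<^sup>2 * (2 * (norm ?t)\<^sup>2 + 2 * (norm (v \<theta>))\<^sup>2)"
        using zero_le_power2[of "norm ?t - norm (v \<theta>)"] by (intro mult_left_mono) (auto simp: power2_sum power2_diff)
      finally show "(?h n \<theta>)\<^sup>2 \<le> 2 * C\<^sup>2 * (norm ?t)\<^sup>2 + 2 * C\<^sup>2 * (norm (v \<theta>))\<^sup>2" by (simp add: distrib_left)
    qed
    also have "\<dots> = 2 * C\<^sup>2 * integral {-pi..pi} (\<lambda>\<theta>. (norm (trunc (1 / Suc n) \<theta>))\<^sup>2) + 2 * C\<^sup>2 * integral {-pi..pi} (\<lambda>\<theta>. (norm (v \<theta>))\<^sup>2)"
    proof -
      have i: "(\<lambda>\<theta>. (norm (trunc (1 / Suc n) \<theta>))\<^sup>2) integrable_on {-pi..pi}" "(\<lambda>\<theta>. (norm (v \<theta>))\<^sup>2) integrable_on {-pi..pi}"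
        by (intro integrable_continuous_interval continuous_intros cS trunc_continuous \<eta>)+
      show ?thesis
        by (rule integral_unique[OF has_integral_add[OF has_integral_mult_right[OF integrable_integral[OF i(1)]] has_integral_mult_right[OF integrable_integral[OF i(2)]]]])
    qed
    also have "\<dots> \<le> 2 * C\<^sup>2 * B + 2 * C\<^sup>2 * integral {-pi..pi} (\<lambda>\<theta>. (norm (v \<theta>))\<^sup>2)"
      using B[OF \<eta>[of n]] by (intro add_mono mult_left_mono) auto
    finally show "integral {-pi..pi} (\<lambda>\<theta>. (?h n \<theta>)\<^sup>2) \<le> 2 * C\<^sup>2 * B + 2 * C\<^sup>2 * integral {-pi..pi} (\<lambda>\<theta>. (norm (v \<theta>))\<^sup>2)" .
  qed
  moreover have "integral {-pi..pi} (?h n) = integral {-pi..pi} (\<lambda>\<theta>. \<phi> \<theta> \<bullet> trunc (1 / Suc n) \<theta>) - integral {-pi..pi} (\<lambda>\<theta>. \<phi> \<theta> \<bullet> v \<theta>)" for n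
    by (intro integral_diff integrable_continuous_interval continuous_intros cS trunc_continuous \<eta>)
  ultimately show ?thesis by (simp add: LIM_zero_cancel)
qed

end

subsection \<open>The energy inequality\<close>

text \<open>The negative part of \<open>f\<close> is lost on the right in passing to the extended
  reals, whence the inequality.\<close>

lemma ennreal_integral_le:
  fixes f :: "real \<Rightarrow> real"
  assumes c: "continuous_on {a..b} f"
  shows "ennreal (integral {a..b} f) \<le> (\<integral>\<^sup>+x. ennreal (f x) * indicator {a..b} x \<partial>lborel)"
proof -
  have i: "(\<lambda>x. max 0 (f x)) integrable_on {a..b}" by (intro integrable_continuous_interval continuous_intros c)
  have "integral {a..b} f \<le> integral {a..b} (\<lambda>x. max 0 (f x))"
    by (intro integral_le integrable_continuous_interval c i) auto
  then have "ennreal (integral {a..b} f) \<le> ennreal (integral {a..b} (\<lambda>x. max 0 (f x)))" by (rule ennreal_leI)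
  also have "\<dots> = (\<integral>\<^sup>+x. ennreal (max 0 (f x)) * indicator {a..b} x \<partial>lborel)"
    using nn_integral_has_integral_lebesgue'[OF _ integrable_integral[OF i]] by simp
  also have "\<dots> = (\<integral>\<^sup>+x. ennreal (f x) * indicator {a..b} x \<partial>lborel)"
    by (intro nn_integral_cong arg_cong2[where f="(*)"] refl) (simp add: max_def ennreal_neg)
  finally show ?thesis .
qed

text \<open>The mean over \<open>s\<close> in (0,\<alpha>] of the squared increment bounds; it
  arises because a chord slope is the mean of the derivative over the arc.\<close>

definition besov_avg :: "(real \<Rightarrow> real^2) \<Rightarrow> real \<Rightarrow> ennreal" where
  "besov_avg g \<alpha> = (\<integral>\<^sup>+s. ennreal (1 / \<alpha>) * (besov_diff g s)\<^sup>2 * indicator {0<..\<alpha>} s \<partial>lborel)"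

lemma norm_average_sq_le:
  fixes w :: "real \<Rightarrow> real^2"
  assumes \<alpha>: "0 < \<alpha>" and c: "continuous_on {0..\<alpha>} w"
  shows "(norm ((1 / \<alpha>) *\<^sub>R integral {0..\<alpha>} w))\<^sup>2 \<le> (1 / \<alpha>) * integral {0..\<alpha>} (\<lambda>s. (norm (w s))\<^sup>2)"
proof -
  have "norm (integral {0..\<alpha>} w) \<le> integral {0..\<alpha>} (\<lambda>s. norm (w s))"
    by (intro integral_norm_bound_integral integrable_continuous_interval c continuous_on_norm) auto
  then have "(norm (integral {0..\<alpha>} w))\<^sup>2 \<le> (integral {0..\<alpha>} (\<lambda>s. norm (w s)))\<^sup>2" by (rule power_mono) simp
  also have "\<dots> \<le> \<alpha> * integral {0..\<alpha>} (\<lambda>s. (norm (w s))\<^sup>2)"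
    using integral_square_le[of 0 \<alpha> "\<lambda>s. norm (w s)"] \<alpha> continuous_on_norm[OF c] by simp
  finally have "(1 / \<alpha>)\<^sup>2 * (norm (integral {0..\<alpha>} w))\<^sup>2 \<le> (1 / \<alpha>)\<^sup>2 * (\<alpha> * integral {0..\<alpha>} (\<lambda>s. (norm (w s))\<^sup>2))"
    by (rule mult_left_mono) simp
  moreover have "(1 / \<alpha>)\<^sup>2 * (\<alpha> * I) = (1 / \<alpha>) * I" for I using \<alpha> by (simp add: power2_eq_square)
  ultimately show ?thesis using \<alpha> by (simp add: power_mult_distrib power_divide)
qed

lemma ennreal_sq_le_16: "ennreal (norm z) \<le> 4 * P \<Longrightarrow> ennreal ((norm z)\<^sup>2) \<le> 16 * P\<^sup>2"
proof -
  assume "ennreal (norm z) \<le> 4 * P"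
  then have "(ennreal (norm z))\<^sup>2 \<le> (4 * P)\<^sup>2" by (rule power_mono) simp
  then show ?thesis by (simp add: power_mult_distrib ennreal_power)
qed

lemma average_le_besov_avg:
  fixes w :: "real \<Rightarrow> real^2"
  assumes \<alpha>: "0 < \<alpha>" and c: "continuous_on {0..\<alpha>} w"
    and w: "\<And>s. s \<in> {0<..\<alpha>} \<Longrightarrow> ennreal (norm (w s)) \<le> 4 * besov_diff g s"
  shows "ennreal ((norm ((1 / \<alpha>) *\<^sub>R integral {0..\<alpha>} w))\<^sup>2) \<le> 16 * besov_avg g \<alpha>"
proof -
  have c2: "continuous_on {0..\<alpha>} (\<lambda>s. (1 / \<alpha>) * (norm (w s))\<^sup>2)" by (intro continuous_intros c)
  have "ennreal ((norm ((1 / \<alpha>) *\<^sub>R integral {0..\<alpha>} w))\<^sup>2) \<le> ennreal (integral {0..\<alpha>} (\<lambda>s. (1 / \<alpha>) * (norm (w s))\<^sup>2))"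
    using norm_average_sq_le[OF \<alpha> c] by (simp add: ennreal_leI)
  also have "\<dots> \<le> (\<integral>\<^sup>+s. ennreal ((1 / \<alpha>) * (norm (w s))\<^sup>2) * indicator {0..\<alpha>} s \<partial>lborel)"
    by (rule ennreal_integral_le[OF c2])
  also have "\<dots> \<le> (\<integral>\<^sup>+s. ennreal 16 * (ennreal (1 / \<alpha>) * (besov_diff g s)\<^sup>2 * indicator {0<..\<alpha>} s) \<partial>lborel)"
  proof (rule nn_integral_mono_AE)
    have "AE s in lborel. s \<noteq> (0::real)" by (rule AE_lborel_singleton)
    then show "AE s in lborel. ennreal ((1 / \<alpha>) * (norm (w s))\<^sup>2) * indicator {0..\<alpha>} s \<le> ennreal 16 * (ennreal (1 / \<alpha>) * (besov_diff g s)\<^sup>2 * indicator {0<..\<alpha>} s)"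
    proof eventually_elim
      case (elim s)
      show ?case
      proof (cases "s \<in> {0<..\<alpha>}")
        case True
        have "ennreal ((1 / \<alpha>) * (norm (w s))\<^sup>2) = ennreal (1 / \<alpha>) * ennreal ((norm (w s))\<^sup>2)"
          by (rule ennreal_mult) (use \<alpha> in auto)
        also have "\<dots> \<le> ennreal (1 / \<alpha>) * (16 * (besov_diff g s)\<^sup>2)"
          by (intro mult_left_mono ennreal_sq_le_16 w True) simp
        finally show ?thesis using True by (simp add: mult_ac)
      qed (use elim in \<open>auto simp: indicator_def\<close>)
    qed
  qed
  also have "\<dots> \<le> ennreal 16 * besov_avg g \<alpha>"
    unfolding besov_avg_def by (rule nn_integral_cmult_le) simp
  finally show ?thesis by simp
qed

context profile begin

text \<open>Both differences are means of increments over the arc, so Jensen's inequality applies;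
  16 is the square of the embedding constant.\<close>

lemma near_besov:
  assumes \<alpha>: "0 < \<alpha>"
  shows "ennreal ((norm (u (\<theta> + \<alpha>) - Dquot \<alpha> x \<theta>))\<^sup>2) \<le> 16 * besov_avg u \<alpha>"
    "ennreal ((norm (u \<theta> - Dquot \<alpha> x \<theta>))\<^sup>2) \<le> 16 * besov_avg u \<alpha>"
proof -
  have cuU: "continuous_on UNIV u" by (rule cu)
  have int: "integral {0..\<alpha>} (\<lambda>s. b - w s) = \<alpha> *\<^sub>R b - integral {0..\<alpha>} w" if "continuous_on {0..\<alpha>} w" for b :: "real^2" and w
    using \<alpha> that by (subst integral_diff) (auto intro!: integrable_continuous_interval)
  have c1: "continuous_on {0..\<alpha>} (\<lambda>s. u (\<theta> + \<alpha> - s))" "continuous_on {0..\<alpha>} (\<lambda>s. u (\<theta> + s))"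
    by (intro cu_shift continuous_intros)+
  have 1: "u (\<theta> + \<alpha>) - Dquot \<alpha> x \<theta> = (1 / \<alpha>) *\<^sub>R integral {0..\<alpha>} (\<lambda>s. u (\<theta> + \<alpha>) - u (\<theta> + \<alpha> - s))"
    unfolding int[OF c1(1)] Dquot_average(2)[OF \<alpha>] using \<alpha> by (simp add: scaleR_diff_right)
  show "ennreal ((norm (u (\<theta> + \<alpha>) - Dquot \<alpha> x \<theta>))\<^sup>2) \<le> 16 * besov_avg u \<alpha>"
    unfolding 1
  proof (rule average_le_besov_avg[OF \<alpha>])
    show "continuous_on {0..\<alpha>} (\<lambda>s. u (\<theta> + \<alpha>) - u (\<theta> + \<alpha> - s))" by (intro continuous_intros c1)
    show "ennreal (norm (u (\<theta> + \<alpha>) - u (\<theta> + \<alpha> - s))) \<le> 4 * besov_diff u s" for s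
      using delta_le_besov_diff[OF per_u cuU, of "\<theta> + \<alpha> - s" s] by simp
  qed
  have 2: "u \<theta> - Dquot \<alpha> x \<theta> = (1 / \<alpha>) *\<^sub>R integral {0..\<alpha>} (\<lambda>s. u \<theta> - u (\<theta> + s))"
    unfolding int[OF c1(2)] Dquot_average(1)[OF \<alpha>] using \<alpha> by (simp add: scaleR_diff_right)
  show "ennreal ((norm (u \<theta> - Dquot \<alpha> x \<theta>))\<^sup>2) \<le> 16 * besov_avg u \<alpha>"
    unfolding 2
  proof (rule average_le_besov_avg[OF \<alpha>])
    show "continuous_on {0..\<alpha>} (\<lambda>s. u \<theta> - u (\<theta> + s))" by (intro continuous_intros c1)
    show "ennreal (norm (u \<theta> - u (\<theta> + s))) \<le> 4 * besov_diff u s" for s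
      using delta_le_besov_diff[OF per_u cuU, of \<theta> s] by (simp add: norm_minus_commute)
  qed
qed

lemma test_continuous:
  assumes \<eta>: "0 < \<eta>" and \<phi>: "continuous_on UNIV \<phi>"
  shows "continuous_on {\<eta>..pi} (\<lambda>\<alpha>. (1 / \<alpha>\<^sup>2) * integral {-pi..pi} (\<lambda>\<theta>. - ((\<phi> (\<theta> + \<alpha>) - \<phi> \<theta>) \<bullet> J \<theta> \<alpha>)))"
proof -
  have c\<phi>: "continuous_on S (\<lambda>z. \<phi> (f z))" if "continuous_on S f" for S and f :: "real \<times> real \<Rightarrow> real"
    by (rule continuous_on_compose2[OF \<phi> that]) auto
  have "continuous_on ({\<eta>..pi} \<times> cbox (-pi) pi) (\<lambda>(\<alpha>, \<theta>). - ((\<phi> (\<theta> + \<alpha>) - \<phi> \<theta>) \<bullet> J \<theta> \<alpha>))"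
    using \<eta> unfolding split_beta' by (intro continuous_intros c\<phi> J_continuous) auto
  from integral_continuous_on_param[OF this]
  have "continuous_on {\<eta>..pi} (\<lambda>\<alpha>. integral {-pi..pi} (\<lambda>\<theta>. - ((\<phi> (\<theta> + \<alpha>) - \<phi> \<theta>) \<bullet> J \<theta> \<alpha>)))"
    by (simp only: cbox_interval)
  then show ?thesis using \<eta> by (intro continuous_intros) auto
qed

end

text \<open>The bound of \<open>energy_density_bound\<close> as a predicate, so that one constant
  can be fixed before any solution is considered.\<close>

definition density_constant :: "real \<Rightarrow> real \<Rightarrow> (real \<Rightarrow> real) \<Rightarrow> real \<Rightarrow> bool" where
  "density_constant R m \<T> C \<longleftrightarrow> 0 \<le> C \<and> (\<forall>x0 x1 dx y0 y1 dy. (x1, x0, dx) \<in> kern_domain R m \<longrightarrow> (y1, y0, dy) \<in> kern_domain R m \<longrightarrow>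
     - (((x1 - y1) - (x0 - y0)) \<bullet> (kern x1 x0 dx *v (tension_map \<T> x1 - tension_map \<T> x0) - kern y1 y0 dy *v (tension_map \<T> y1 - tension_map \<T> y0)))
     \<le> C * ((norm (x0 - y0))\<^sup>2 + (norm (x1 - y1))\<^sup>2 + (norm (dx - dy))\<^sup>2) * ((norm (x1 - x0))\<^sup>2 + (norm (y1 - y0))\<^sup>2 + (norm (x1 - dx))\<^sup>2 + (norm (x0 - dx))\<^sup>2))"

locale profile_pair = X: profile x u u2 R m \<T> \<Lambda> + Y: profile y v v2 R m \<T> \<Lambda>
  for x u u2 y v v2 :: "real \<Rightarrow> real^2" and R m \<T> \<Lambda> +
  fixes C :: real
  assumes C: "density_constant R m \<T> C"
begin

definition Z where "Z \<theta> = u \<theta> - v \<theta>"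

definition N where "N = integral {-pi..pi} (\<lambda>\<theta>. (norm (Z \<theta>))\<^sup>2)"

lemma cZ: "continuous_on S f \<Longrightarrow> continuous_on S (\<lambda>z. Z (f z))" for f :: "_ \<Rightarrow> real"
  unfolding Z_def by (intro continuous_intros X.cu_shift Y.cu_shift)

lemma cZ0: "continuous_on S Z"
  using cZ[of S "\<lambda>z. z"] by (simp add: continuous_on_id)

lemma per_Z: "periodic Z"
  using X.per_u Y.per_u by (simp add: periodic_def Z_def)

lemma N_nonneg: "0 \<le> N"
  unfolding N_def by (intro integral_nonneg integrable_continuous_interval continuous_intros cZ0) auto

lemma Z_shift_integral: "integral {-pi..pi} (\<lambda>\<theta>. (norm (Z (\<theta> + s)))\<^sup>2) = N"
proof -
  have "periodic (\<lambda>\<theta>. (norm (Z \<theta>))\<^sup>2)" using per_Z by (simp add: periodic_def)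
  moreover have "(\<lambda>\<theta>. (norm (Z \<theta>))\<^sup>2) integrable_on {-pi..pi}"
    by (intro integrable_continuous_interval continuous_intros cZ0)
  ultimately show ?thesis unfolding N_def by (rule periodic_integral_shift)
qed

text \<open>Jensen's inequality for the mean over the arc, then Fubini's theorem and translation
  invariance.\<close>

lemma Dquot_diff_integral:
  assumes \<alpha>: "0 < \<alpha>"
  shows "integral {-pi..pi} (\<lambda>\<theta>. (norm (Dquot \<alpha> x \<theta> - Dquot \<alpha> y \<theta>))\<^sup>2) \<le> N"
proof -
  have D: "Dquot \<alpha> x \<theta> - Dquot \<alpha> y \<theta> = (1 / \<alpha>) *\<^sub>R integral {0..\<alpha>} (\<lambda>s. Z (\<theta> + s))" for \<theta>
    unfolding X.Dquot_average(1)[OF \<alpha>] Y.Dquot_average(1)[OF \<alpha>] Z_def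
    by (subst integral_diff) (auto intro!: integrable_continuous_interval X.cu_shift Y.cu_shift continuous_intros simp: scaleR_diff_right)
  have cD: "continuous_on S (\<lambda>\<theta>. Dquot \<alpha> x \<theta> - Dquot \<alpha> y \<theta>)" for S
    unfolding Dquot_def delta_def by (intro continuous_intros X.cx_shift Y.cx_shift)
  have c2: "continuous_on ({-pi..pi} \<times> cbox 0 \<alpha>) (\<lambda>(\<theta>, s). (norm (Z (\<theta> + s)))\<^sup>2)"
    unfolding split_beta' by (intro continuous_intros cZ)
  have c3: "continuous_on {-pi..pi} (\<lambda>\<theta>. integral {0..\<alpha>} (\<lambda>s. (norm (Z (\<theta> + s)))\<^sup>2))"
    using integral_continuous_on_param[OF c2] by (simp only: cbox_interval)
  have "integral {-pi..pi} (\<lambda>\<theta>. (norm (Dquot \<alpha> x \<theta> - Dquot \<alpha> y \<theta>))\<^sup>2) \<le> integral {-pi..pi} (\<lambda>\<theta>. (1 / \<alpha>) * integral {0..\<alpha>} (\<lambda>s. (norm (Z (\<theta> + s)))\<^sup>2))"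
  proof (intro integral_le integrable_continuous_interval)
    show "continuous_on {-pi..pi} (\<lambda>\<theta>. (norm (Dquot \<alpha> x \<theta> - Dquot \<alpha> y \<theta>))\<^sup>2)"
      by (intro continuous_on_power continuous_on_norm cD)
    show "continuous_on {-pi..pi} (\<lambda>\<theta>. (1 / \<alpha>) * integral {0..\<alpha>} (\<lambda>s. (norm (Z (\<theta> + s)))\<^sup>2))"
      by (intro continuous_on_mult continuous_on_const c3)
    fix \<theta>
    have "continuous_on {0..\<alpha>} (\<lambda>s. Z (\<theta> + s))" by (intro cZ continuous_intros)
    then show "(norm (Dquot \<alpha> x \<theta> - Dquot \<alpha> y \<theta>))\<^sup>2 \<le> (1 / \<alpha>) * integral {0..\<alpha>} (\<lambda>s. (norm (Z (\<theta> + s)))\<^sup>2)"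
      unfolding D by (rule norm_average_sq_le[OF \<alpha>])
  qed
  also have "\<dots> = (1 / \<alpha>) * integral {-pi..pi} (\<lambda>\<theta>. integral {0..\<alpha>} (\<lambda>s. (norm (Z (\<theta> + s)))\<^sup>2))"
    by (rule integral_mult_right)
  also have "integral {-pi..pi} (\<lambda>\<theta>. integral {0..\<alpha>} (\<lambda>s. (norm (Z (\<theta> + s)))\<^sup>2)) = integral {0..\<alpha>} (\<lambda>s. integral {-pi..pi} (\<lambda>\<theta>. (norm (Z (\<theta> + s)))\<^sup>2))"
  proof -
    have "continuous_on (cbox (-pi, 0) (pi, \<alpha>)) (\<lambda>(\<theta>, s). (norm (Z (\<theta> + s)))\<^sup>2)"
      unfolding split_beta' by (intro continuous_intros cZ)
    from integral_swap_continuous[OF this] show ?thesis by (simp only: cbox_interval)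
  qed
  also have "\<dots> = \<alpha> * N" using \<alpha> by (simp add: Z_shift_integral)
  finally show ?thesis using \<alpha> by simp
qed

text \<open>Bounds, uniformly in the angle, the second factor of the energy density: the increments
  of the two curves' derivatives, and two distances to the chord slope of \<open>x\<close> that
  share one bound.\<close>

definition gap where
  "gap \<alpha> = 16 * (besov_diff u \<alpha>)\<^sup>2 + 16 * (besov_diff v \<alpha>)\<^sup>2 + 32 * besov_avg u \<alpha>"

text \<open>As \<open>gap\<close> does not depend on the angle, it leaves the integral; each of the
  three squares in the other factor integrates to at most \<open>N\<close>, whence 3 C N.\<close>

lemma fixed_increment_energy:
  assumes \<alpha>: "0 < \<alpha>" "\<alpha> \<le> pi"
  shows "ennreal (integral {-pi..pi} (\<lambda>\<theta>. - ((Z (\<theta> + \<alpha>) - Z \<theta>) \<bullet> X.J \<theta> \<alpha>)) - integral {-pi..pi} (\<lambda>\<theta>. - ((Z (\<theta> + \<alpha>) - Z \<theta>) \<bullet> Y.J \<theta> \<alpha>)))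
    \<le> ennreal (3 * C * N) * gap \<alpha>"
proof -
  have \<alpha>': "\<alpha> \<in> {-pi..pi} - {0}" using \<alpha> by auto
  have C0: "0 \<le> C" using C by (simp add: density_constant_def)
  have cJ: "continuous_on S (\<lambda>\<theta>. X.J \<theta> \<alpha>)" "continuous_on S (\<lambda>\<theta>. Y.J \<theta> \<alpha>)" for S
    using \<alpha>' by (intro X.J_continuous Y.J_continuous continuous_intros; simp)+
  define f where "f = (\<lambda>\<theta>. - ((Z (\<theta> + \<alpha>) - Z \<theta>) \<bullet> (X.J \<theta> \<alpha> - Y.J \<theta> \<alpha>)))"
  have cf: "continuous_on {-pi..pi} f" unfolding f_def by (intro continuous_intros cZ cZ0 cJ)
  have eq: "integral {-pi..pi} (\<lambda>\<theta>. - ((Z (\<theta> + \<alpha>) - Z \<theta>) \<bullet> X.J \<theta> \<alpha>)) - integral {-pi..pi} (\<lambda>\<theta>. - ((Z (\<theta> + \<alpha>) - Z \<theta>) \<bullet> Y.J \<theta> \<alpha>)) = integral {-pi..pi} f"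
  proof -
    have "integral {-pi..pi} (\<lambda>\<theta>. - ((Z (\<theta> + \<alpha>) - Z \<theta>) \<bullet> X.J \<theta> \<alpha> ) - - ((Z (\<theta> + \<alpha>) - Z \<theta>) \<bullet> Y.J \<theta> \<alpha>))
       = integral {-pi..pi} (\<lambda>\<theta>. - ((Z (\<theta> + \<alpha>) - Z \<theta>) \<bullet> X.J \<theta> \<alpha>)) - integral {-pi..pi} (\<lambda>\<theta>. - ((Z (\<theta> + \<alpha>) - Z \<theta>) \<bullet> Y.J \<theta> \<alpha>))"
      by (intro integral_diff integrable_continuous_interval continuous_intros cZ cZ0 cJ)
    moreover have "f = (\<lambda>\<theta>. - ((Z (\<theta> + \<alpha>) - Z \<theta>) \<bullet> X.J \<theta> \<alpha> ) - - ((Z (\<theta> + \<alpha>) - Z \<theta>) \<bullet> Y.J \<theta> \<alpha>))"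
      by (rule ext) (simp add: f_def inner_diff_right)
    ultimately show ?thesis by simp
  qed
  define A where "A = (\<lambda>\<theta>. (norm (Z \<theta>))\<^sup>2 + (norm (Z (\<theta> + \<alpha>)))\<^sup>2 + (norm (Dquot \<alpha> x \<theta> - Dquot \<alpha> y \<theta>))\<^sup>2)"
  have cD: "continuous_on S (\<lambda>\<theta>. Dquot \<alpha> x \<theta> - Dquot \<alpha> y \<theta>)" for S
    unfolding Dquot_def delta_def by (intro continuous_intros X.cx_shift Y.cx_shift)
  have cA: "continuous_on S A" for S unfolding A_def by (intro continuous_intros cZ cZ0 cD)
  have A0: "0 \<le> A \<theta>" for \<theta> by (simp add: A_def)
  have Aint: "integral {-pi..pi} A \<le> 3 * N"
  proof -
    have i: "(\<lambda>\<theta>. (norm (Z \<theta>))\<^sup>2) integrable_on {-pi..pi}" "(\<lambda>\<theta>. (norm (Z (\<theta> + \<alpha>)))\<^sup>2) integrable_on {-pi..pi}"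
       "(\<lambda>\<theta>. (norm (Dquot \<alpha> x \<theta> - Dquot \<alpha> y \<theta>))\<^sup>2) integrable_on {-pi..pi}"
      by (intro integrable_continuous_interval continuous_intros cZ cZ0 cD)+
    have "integral {-pi..pi} A = N + N + integral {-pi..pi} (\<lambda>\<theta>. (norm (Dquot \<alpha> x \<theta> - Dquot \<alpha> y \<theta>))\<^sup>2)"
      unfolding A_def using integral_add[OF integrable_add[OF i(1,2)] i(3)] integral_add[OF i(1,2)]
      by (simp add: Z_shift_integral) (simp add: N_def)
    then show ?thesis using Dquot_diff_integral[OF \<alpha>(1)] by simp
  qed
  have pw: "ennreal (f \<theta>) \<le> ennreal (C * A \<theta>) * gap \<alpha>" for \<theta>
  proof -
    let ?G = "(norm (u (\<theta> + \<alpha>) - u \<theta>))\<^sup>2 + (norm (v (\<theta> + \<alpha>) - v \<theta>))\<^sup>2 + (norm (u (\<theta> + \<alpha>) - Dquot \<alpha> x \<theta>))\<^sup>2 + (norm (u \<theta> - Dquot \<alpha> x \<theta>))\<^sup>2"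
    have "f \<theta> \<le> C * A \<theta> * ?G"
      using C[unfolded density_constant_def] X.in_domain[OF \<alpha>', of \<theta>] Y.in_domain[OF \<alpha>', of \<theta>]
      unfolding f_def A_def Z_def X.J_def Y.J_def by blast
    then have "ennreal (f \<theta>) \<le> ennreal (C * A \<theta> * ?G)" by (rule ennreal_leI)
    also have "\<dots> = ennreal (C * A \<theta>) * ennreal ?G"
      by (rule ennreal_mult) (auto intro!: mult_nonneg_nonneg C0 A0)
    also have "ennreal ?G \<le> gap \<alpha>"
    proof -
      have "ennreal ?G = ennreal ((norm (u (\<theta> + \<alpha>) - u \<theta>))\<^sup>2) + ennreal ((norm (v (\<theta> + \<alpha>) - v \<theta>))\<^sup>2)
         + (ennreal ((norm (u (\<theta> + \<alpha>) - Dquot \<alpha> x \<theta>))\<^sup>2) + ennreal ((norm (u \<theta> - Dquot \<alpha> x \<theta>))\<^sup>2))"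
        by (simp add: add.assoc)
      also have "\<dots> \<le> 16 * (besov_diff u \<alpha>)\<^sup>2 + 16 * (besov_diff v \<alpha>)\<^sup>2 + (16 * besov_avg u \<alpha> + 16 * besov_avg u \<alpha>)"
        by (intro add_mono X.near_besov[OF \<alpha>(1)] ennreal_sq_le_16 delta_le_besov_diff X.per_u Y.per_u X.cu Y.cu)
      also have "16 * besov_avg u \<alpha> + 16 * besov_avg u \<alpha> = 32 * besov_avg u \<alpha>"
        by (subst distrib_right[symmetric]) simp
      finally show ?thesis by (simp add: gap_def)
    qed
    finally show ?thesis by (simp add: mult_left_mono)
  qed
  have Am: "(\<lambda>\<theta>. ennreal (C * A \<theta>) * indicator {-pi..pi} \<theta>) \<in> borel_measurable lborel"
    using borel_measurable_continuous_onI[OF cA] by measurable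
  have "ennreal (integral {-pi..pi} f) \<le> (\<integral>\<^sup>+\<theta>. ennreal (f \<theta>) * indicator {-pi..pi} \<theta> \<partial>lborel)"
    by (rule ennreal_integral_le[OF cf])
  also have "\<dots> \<le> (\<integral>\<^sup>+\<theta>. (ennreal (C * A \<theta>) * indicator {-pi..pi} \<theta>) * gap \<alpha> \<partial>lborel)"
  proof (rule nn_integral_mono)
    fix \<theta>
    show "ennreal (f \<theta>) * indicator {-pi..pi} \<theta> \<le> (ennreal (C * A \<theta>) * indicator {-pi..pi} \<theta>) * gap \<alpha>"
      using pw[of \<theta>] by (simp add: indicator_def)
  qed
  also have "\<dots> = (\<integral>\<^sup>+\<theta>. ennreal (C * A \<theta>) * indicator {-pi..pi} \<theta> \<partial>lborel) * gap \<alpha>"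
    by (rule nn_integral_multc[OF Am])
  also have "(\<integral>\<^sup>+\<theta>. ennreal (C * A \<theta>) * indicator {-pi..pi} \<theta> \<partial>lborel) = ennreal (integral {-pi..pi} (\<lambda>\<theta>. C * A \<theta>))"
    by (rule nn_integral_has_integral_lebesgue'[OF _ integrable_integral])
      (auto intro!: mult_nonneg_nonneg C0 A0 integrable_continuous_interval continuous_intros cA)
  also have "integral {-pi..pi} (\<lambda>\<theta>. C * A \<theta>) = C * integral {-pi..pi} A" by (rule integral_mult_right)
  also have "ennreal (C * integral {-pi..pi} A) \<le> ennreal (3 * C * N)"
    using mult_left_mono[OF Aint C0] by (intro ennreal_leI) simp
  finally show ?thesis unfolding eq by (simp add: mult_right_mono)
qed

end

lemma nn_integral_inverse_cube:
  assumes s: "0 < s"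
  shows "(\<integral>\<^sup>+\<alpha>. ennreal (1 / \<alpha> ^ 3) * indicator {s..} \<alpha> \<partial>lborel) = ennreal (1 / (2 * s\<^sup>2))"
proof -
  have "(\<integral>\<^sup>+\<alpha>. ennreal (1 / \<alpha> ^ 3) * indicator {s..} \<alpha> \<partial>lborel) = ennreal (0 - (- 1 / (2 * s\<^sup>2)))"
  proof (rule nn_integral_FTC_atLeast[where F="\<lambda>\<alpha>. - 1 / (2 * \<alpha>\<^sup>2)" and T=0])
    fix \<alpha> assume "s \<le> \<alpha>" then have a: "0 < \<alpha>" using s by simp
    show "((\<lambda>\<alpha>. - 1 / (2 * \<alpha>\<^sup>2)) has_real_derivative 1 / \<alpha> ^ 3) (at \<alpha>)"
      using a by (auto intro!: derivative_eq_intros simp: power2_eq_square power3_eq_cube field_simps)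
    show "0 \<le> 1 / \<alpha> ^ 3" using a by simp
  next
    show "((\<lambda>\<alpha>. - 1 / (2 * \<alpha>\<^sup>2)) \<longlongrightarrow> 0) (at_top::real filter)"
      by (intro tendsto_divide_0[OF tendsto_const] filterlim_at_top_imp_at_infinity filterlim_tendsto_pos_mult_at_top[OF tendsto_const]
        filterlim_pow_at_top filterlim_ident) auto
  qed auto
  then show ?thesis by simp
qed

lemma besov_avg_measurable:
  assumes [measurable]: "besov_diff g \<in> borel_measurable borel"
  shows "besov_avg g \<in> borel_measurable borel"
proof -
  have "(\<lambda>\<alpha>. \<integral>\<^sup>+s. ennreal (1 / \<alpha>) * (besov_diff g s)\<^sup>2 * (if 0 < s \<and> s \<le> \<alpha> then 1 else 0) \<partial>lborel) \<in> borel_measurable borel"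
    by measurable
  moreover have "besov_avg g = (\<lambda>\<alpha>. \<integral>\<^sup>+s. ennreal (1 / \<alpha>) * (besov_diff g s)\<^sup>2 * (if 0 < s \<and> s \<le> \<alpha> then 1 else 0) \<partial>lborel)"
    unfolding besov_avg_def[abs_def] by (intro ext nn_integral_cong) (simp add: indicator_def)
  ultimately show ?thesis by simp
qed

text \<open>The dissipation at one time, whose integral over time
  \<open>energy_dissipation_part\<close> bounds.\<close>

definition diss :: "(real \<Rightarrow> real^2) \<Rightarrow> ennreal" where
  "diss g = (\<integral>\<^sup>+\<alpha>. ennreal (1 / \<alpha>\<^sup>2) * (besov_diff g \<alpha>)\<^sup>2 * indicator {0<..pi} \<alpha> \<partial>lborel)"

text \<open>Hardy's inequality: in the exchanged order the integral of 1/\<alpha>^3 beyond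
  \<open>s\<close> is at most 1/(2 s^2), which returns the weight of \<open>diss\<close>.\<close>

lemma hardy_besov_avg:
  assumes [measurable]: "besov_diff g \<in> borel_measurable borel"
  shows "(\<integral>\<^sup>+\<alpha>. ennreal (1 / \<alpha>\<^sup>2) * besov_avg g \<alpha> * indicator {0<..pi} \<alpha> \<partial>lborel) \<le> ennreal (1/2) * diss g"
proof -
  let ?k = "\<lambda>\<alpha> s. ennreal (1 / \<alpha> ^ 3) * (besov_diff g s)\<^sup>2 * (if 0 < s \<and> s \<le> \<alpha> \<and> \<alpha> \<le> pi then 1 else 0)"
  have "(\<integral>\<^sup>+\<alpha>. ennreal (1 / \<alpha>\<^sup>2) * besov_avg g \<alpha> * indicator {0<..pi} \<alpha> \<partial>lborel) = (\<integral>\<^sup>+\<alpha>. (\<integral>\<^sup>+s. ?k \<alpha> s \<partial>lborel) \<partial>lborel)"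
  proof (rule nn_integral_cong)
    fix \<alpha> :: real
    show "ennreal (1 / \<alpha>\<^sup>2) * besov_avg g \<alpha> * indicator {0<..pi} \<alpha> = (\<integral>\<^sup>+s. ?k \<alpha> s \<partial>lborel)"
    proof (cases "\<alpha> \<in> {0<..pi}")
      case True
      have "ennreal (1 / \<alpha>\<^sup>2) * besov_avg g \<alpha> = (\<integral>\<^sup>+s. ennreal (1 / \<alpha>\<^sup>2) * (ennreal (1 / \<alpha>) * (besov_diff g s)\<^sup>2 * indicator {0<..\<alpha>} s) \<partial>lborel)"
        unfolding besov_avg_def by (rule nn_integral_cmult[symmetric]) measurable
      also have "\<dots> = (\<integral>\<^sup>+s. ?k \<alpha> s \<partial>lborel)"
      proof (rule nn_integral_cong)
        fix s :: real
        have "ennreal (1 / \<alpha> ^ 3) = ennreal (1 / \<alpha>\<^sup>2) * ennreal (1 / \<alpha>)"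
          using True by (subst ennreal_mult[symmetric]) (auto simp: power2_eq_square power3_eq_cube)
        then show "ennreal (1 / \<alpha>\<^sup>2) * (ennreal (1 / \<alpha>) * (besov_diff g s)\<^sup>2 * indicator {0<..\<alpha>} s) = ?k \<alpha> s"
          using True by (simp add: indicator_def mult.assoc)
      qed
      finally show ?thesis using True by simp
    next
      case False
      then have "?k \<alpha> = (\<lambda>s. 0)" by (intro ext) auto
      then show ?thesis using False by (simp only: nn_integral_const) simp
    qed
  qed
  also have "\<dots> = (\<integral>\<^sup>+s. (\<integral>\<^sup>+\<alpha>. ?k \<alpha> s \<partial>lborel) \<partial>lborel)"
    by (rule lborel_pair.Fubini'[symmetric]) measurable
  also have "\<dots> \<le> (\<integral>\<^sup>+s. ennreal (1/2) * (ennreal (1 / s\<^sup>2) * (besov_diff g s)\<^sup>2 * indicator {0<..pi} s) \<partial>lborel)"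
  proof (rule nn_integral_mono)
    fix s :: real
    show "(\<integral>\<^sup>+\<alpha>. ?k \<alpha> s \<partial>lborel) \<le> ennreal (1/2) * (ennreal (1 / s\<^sup>2) * (besov_diff g s)\<^sup>2 * indicator {0<..pi} s)"
    proof (cases "s \<in> {0<..pi}")
      case True
      have "(\<integral>\<^sup>+\<alpha>. ?k \<alpha> s \<partial>lborel) \<le> (\<integral>\<^sup>+\<alpha>. (ennreal (1 / \<alpha> ^ 3) * indicator {s..} \<alpha>) * (besov_diff g s)\<^sup>2 \<partial>lborel)"
        by (intro nn_integral_mono) (auto simp: indicator_def)
      also have "\<dots> = (\<integral>\<^sup>+\<alpha>. ennreal (1 / \<alpha> ^ 3) * indicator {s..} \<alpha> \<partial>lborel) * (besov_diff g s)\<^sup>2"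
        by (rule nn_integral_multc) measurable
      also have "(\<integral>\<^sup>+\<alpha>. ennreal (1 / \<alpha> ^ 3) * indicator {s..} \<alpha> \<partial>lborel) = ennreal (1 / (2 * s\<^sup>2))"
        using True by (intro nn_integral_inverse_cube) simp
      also have "ennreal (1 / (2 * s\<^sup>2)) = ennreal (1/2) * ennreal (1 / s\<^sup>2)"
        by (subst ennreal_mult[symmetric]) auto
      finally show ?thesis using True by (simp add: mult.assoc)
    next
      case False
      then have "(\<lambda>\<alpha>. ?k \<alpha> s) = (\<lambda>\<alpha>. 0)" by (intro ext) auto
      then show ?thesis by (simp only: nn_integral_const) simp
    qed
  qed
  also have "\<dots> \<le> ennreal (1/2) * diss g"
    unfolding diss_def by (rule nn_integral_cmult_le) simp
  finally show ?thesis .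
qed

context profile_pair begin

text \<open>The bound for the truncations does not involve \<eta>, so it survives the weak limit
  that removes the cut-off.\<close>

lemma energy_inequality:
  assumes mu: "besov_diff u \<in> borel_measurable borel" and mv: "besov_diff v \<in> borel_measurable borel"
    and rx: "\<And>\<theta>. peskin_rhs \<T> x \<theta> (a \<theta>)" and ry: "\<And>\<theta>. peskin_rhs \<T> y \<theta> (b \<theta>)"
    and ca: "continuous_on UNIV a" and cb: "continuous_on UNIV b"
  shows "ennreal (integral {-pi..pi} (\<lambda>\<theta>. Z \<theta> \<bullet> (a \<theta> - b \<theta>))) \<le> ennreal (3 * C * N) * (32 * (diss u + diss v))"
proof -
  note mu [measurable] mv [measurable] besov_avg_measurable[OF mu, measurable]
  have C0: "0 \<le> C" using C by (simp add: density_constant_def)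
  have gapm [measurable]: "gap \<in> borel_measurable borel" unfolding gap_def[abs_def] by measurable
  \<comment> \<open>The increments of the two derivatives give 16 each, and the chord terms of
    \<open>u\<close> another 16 after Hardy's inequality. The sum is rounded up to a symmetric
    32.\<close>
  have gapint: "(\<integral>\<^sup>+\<alpha>. ennreal (1 / \<alpha>\<^sup>2) * gap \<alpha> * indicator {0<..pi} \<alpha> \<partial>lborel) \<le> 32 * (diss u + diss v)"
  proof -
    have "(\<integral>\<^sup>+\<alpha>. ennreal (1 / \<alpha>\<^sup>2) * gap \<alpha> * indicator {0<..pi} \<alpha> \<partial>lborel)
      = (\<integral>\<^sup>+\<alpha>. 16 * (ennreal (1 / \<alpha>\<^sup>2) * (besov_diff u \<alpha>)\<^sup>2 * indicator {0<..pi} \<alpha>) + 16 * (ennreal (1 / \<alpha>\<^sup>2) * (besov_diff v \<alpha>)\<^sup>2 * indicator {0<..pi} \<alpha>)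
          + 32 * (ennreal (1 / \<alpha>\<^sup>2) * besov_avg u \<alpha> * indicator {0<..pi} \<alpha>) \<partial>lborel)"
      by (intro nn_integral_cong) (simp add: gap_def distrib_left distrib_right mult_ac)
    also have "\<dots> = 16 * diss u + 16 * diss v + 32 * (\<integral>\<^sup>+\<alpha>. ennreal (1 / \<alpha>\<^sup>2) * besov_avg u \<alpha> * indicator {0<..pi} \<alpha> \<partial>lborel)"
      by (simp add: nn_integral_add nn_integral_cmult diss_def)
    also have "\<dots> \<le> 16 * diss u + 16 * diss v + 32 * (ennreal (1/2) * diss u)"
      by (intro add_mono mult_left_mono hardy_besov_avg mu order_refl) auto
    also have "32 * (ennreal (1/2) * diss u) = 16 * diss u"
    proof -
      have "32 * ennreal (1/2) = ennreal (32 * (1/2))" by (subst ennreal_mult) auto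
      then show ?thesis by (simp add: mult.assoc[symmetric])
    qed
    also have "16 * diss u + 16 * diss v + 16 * diss u \<le> 32 * (diss u + diss v)"
    proof -
      have "16 * diss u + 16 * diss v + 16 * diss u = 32 * diss u + 16 * diss v"
        using distrib_right[of 16 16 "diss u"] by (simp add: add_ac)
      also have "\<dots> \<le> 32 * diss u + 32 * diss v" by (intro add_mono mult_right_mono) auto
      finally show ?thesis by (simp add: distrib_left)
    qed
    finally show ?thesis .
  qed
  have cZU: "continuous_on UNIV Z" by (rule cZ0)
  have trunc_le: "ennreal (integral {-pi..pi} (\<lambda>\<theta>. Z \<theta> \<bullet> X.trunc \<eta> \<theta>) - integral {-pi..pi} (\<lambda>\<theta>. Z \<theta> \<bullet> Y.trunc \<eta> \<theta>)) \<le> ennreal (3 * C * N) * (32 * (diss u + diss v))"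
    if \<eta>: "0 < \<eta>" "\<eta> \<le> pi" for \<eta>
  proof -
    let ?EX = "\<lambda>\<alpha>. integral {-pi..pi} (\<lambda>\<theta>. - ((Z (\<theta> + \<alpha>) - Z \<theta>) \<bullet> X.J \<theta> \<alpha>))"
    let ?EY = "\<lambda>\<alpha>. integral {-pi..pi} (\<lambda>\<theta>. - ((Z (\<theta> + \<alpha>) - Z \<theta>) \<bullet> Y.J \<theta> \<alpha>))"
    have cX: "continuous_on {\<eta>..pi} (\<lambda>\<alpha>. (1 / \<alpha>\<^sup>2) * ?EX \<alpha>)" by (rule X.test_continuous[OF \<eta>(1) cZU])
    have cY: "continuous_on {\<eta>..pi} (\<lambda>\<alpha>. (1 / \<alpha>\<^sup>2) * ?EY \<alpha>)" by (rule Y.test_continuous[OF \<eta>(1) cZU])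
    have "integral {-pi..pi} (\<lambda>\<theta>. Z \<theta> \<bullet> X.trunc \<eta> \<theta>) - integral {-pi..pi} (\<lambda>\<theta>. Z \<theta> \<bullet> Y.trunc \<eta> \<theta>)
       = integral {\<eta>..pi} (\<lambda>\<alpha>. (1 / \<alpha>\<^sup>2) * ?EX \<alpha>) - integral {\<eta>..pi} (\<lambda>\<alpha>. (1 / \<alpha>\<^sup>2) * ?EY \<alpha>)"
      by (simp only: X.trunc_test[OF \<eta> per_Z cZU] Y.trunc_test[OF \<eta> per_Z cZU])
    also have "\<dots> = integral {\<eta>..pi} (\<lambda>\<alpha>. (1 / \<alpha>\<^sup>2) * ?EX \<alpha> - (1 / \<alpha>\<^sup>2) * ?EY \<alpha>)"
      by (intro integral_diff[symmetric] integrable_continuous_interval cX cY)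
    finally have "ennreal (integral {-pi..pi} (\<lambda>\<theta>. Z \<theta> \<bullet> X.trunc \<eta> \<theta>) - integral {-pi..pi} (\<lambda>\<theta>. Z \<theta> \<bullet> Y.trunc \<eta> \<theta>))
       \<le> (\<integral>\<^sup>+\<alpha>. ennreal ((1 / \<alpha>\<^sup>2) * ?EX \<alpha> - (1 / \<alpha>\<^sup>2) * ?EY \<alpha>) * indicator {\<eta>..pi} \<alpha> \<partial>lborel)"
      using ennreal_integral_le[OF continuous_on_diff[OF cX cY]] by (simp only:)
    also have "\<dots> \<le> (\<integral>\<^sup>+\<alpha>. ennreal (3 * C * N) * (ennreal (1 / \<alpha>\<^sup>2) * gap \<alpha> * indicator {0<..pi} \<alpha>) \<partial>lborel)"
    proof (rule nn_integral_mono)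
      fix \<alpha>
      show "ennreal ((1 / \<alpha>\<^sup>2) * ?EX \<alpha> - (1 / \<alpha>\<^sup>2) * ?EY \<alpha>) * indicator {\<eta>..pi} \<alpha> \<le> ennreal (3 * C * N) * (ennreal (1 / \<alpha>\<^sup>2) * gap \<alpha> * indicator {0<..pi} \<alpha>)"
      proof (cases "\<alpha> \<in> {\<eta>..pi}")
        case True
        then have \<alpha>: "0 < \<alpha>" "\<alpha> \<le> pi" using \<eta> by auto
        have "ennreal ((1 / \<alpha>\<^sup>2) * ?EX \<alpha> - (1 / \<alpha>\<^sup>2) * ?EY \<alpha>) = ennreal (1 / \<alpha>\<^sup>2) * ennreal (?EX \<alpha> - ?EY \<alpha>)"
          by (subst ennreal_mult'[symmetric]) (auto simp: right_diff_distrib)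
        also have "\<dots> \<le> ennreal (1 / \<alpha>\<^sup>2) * (ennreal (3 * C * N) * gap \<alpha>)"
          by (intro mult_left_mono fixed_increment_energy \<alpha>) simp
        finally show ?thesis using True \<alpha> by (simp add: mult_ac)
      qed simp
    qed
    also have "\<dots> = ennreal (3 * C * N) * (\<integral>\<^sup>+\<alpha>. ennreal (1 / \<alpha>\<^sup>2) * gap \<alpha> * indicator {0<..pi} \<alpha> \<partial>lborel)"
      by (rule nn_integral_cmult) measurable
    also have "\<dots> \<le> ennreal (3 * C * N) * (32 * (diss u + diss v))"
      by (intro mult_left_mono gapint) simp
    finally show ?thesis .
  qed
  have \<eta>: "0 < 1 / real (Suc n)" "1 / real (Suc n) \<le> pi" for n
  proof -
    have "1 / real (Suc n) \<le> 1" by simp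
    then show "1 / real (Suc n) \<le> pi" using pi_gt3 by linarith
  qed simp
  have "(\<lambda>n. ennreal (integral {-pi..pi} (\<lambda>\<theta>. Z \<theta> \<bullet> X.trunc (1 / Suc n) \<theta>) - integral {-pi..pi} (\<lambda>\<theta>. Z \<theta> \<bullet> Y.trunc (1 / Suc n) \<theta>)))
    \<longlonglongrightarrow> ennreal (integral {-pi..pi} (\<lambda>\<theta>. Z \<theta> \<bullet> a \<theta>) - integral {-pi..pi} (\<lambda>\<theta>. Z \<theta> \<bullet> b \<theta>))"
    by (intro tendsto_ennrealI tendsto_diff X.trunc_weak_limit Y.trunc_weak_limit rx ry ca cb cZU)
  then have "ennreal (integral {-pi..pi} (\<lambda>\<theta>. Z \<theta> \<bullet> a \<theta>) - integral {-pi..pi} (\<lambda>\<theta>. Z \<theta> \<bullet> b \<theta>)) \<le> ennreal (3 * C * N) * (32 * (diss u + diss v))"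
    by (rule LIMSEQ_le_const2) (use trunc_le[OF \<eta>] in blast)
  moreover have "integral {-pi..pi} (\<lambda>\<theta>. Z \<theta> \<bullet> a \<theta>) - integral {-pi..pi} (\<lambda>\<theta>. Z \<theta> \<bullet> b \<theta>) = integral {-pi..pi} (\<lambda>\<theta>. Z \<theta> \<bullet> (a \<theta> - b \<theta>))"
  proof -
    have "continuous_on {-pi..pi} a" "continuous_on {-pi..pi} b" using ca cb by (auto intro: continuous_on_subset)
    then show ?thesis unfolding inner_diff_right
      by (intro integral_diff[symmetric] integrable_continuous_interval continuous_intros cZ0)
  qed
  ultimately show ?thesis by simp
qed

end

subsection \<open>Stability of the derivative in the square integral norm\<close>

text \<open>The logarithm is differentiated, with \<epsilon> added because N may vanish. The rate g
  is an extended real function with bounded integral, which suffices since only an upper bound for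
  the growth of the logarithm is sought. The starting time is positive because differentiability is
  given only there.\<close>

lemma log_gronwall:
  fixes N N' :: "real \<Rightarrow> real" and g :: "real \<Rightarrow> ennreal"
  assumes d: "\<And>t. t \<in> {0<..T} \<Longrightarrow> (N has_vector_derivative N' t) (at t within {0<..T})"
    and c: "continuous_on {0<..T} N'" and N0: "\<And>t. t \<in> {0<..T} \<Longrightarrow> 0 \<le> N t"
    and le: "\<And>t. t \<in> {0<..T} \<Longrightarrow> ennreal (N' t) \<le> ennreal (N t) * g t"
    and int: "(\<integral>\<^sup>+t. g t * indicator {0<..T} t \<partial>lborel) \<le> ennreal K"
    and K: "0 \<le> K" and s: "0 < s" "s \<le> t" "t \<le> T"
  shows "N t \<le> exp K * N s"
proof -
  have sub: "{s..t} \<subseteq> {0<..T}" using s by auto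
  have cN: "continuous_on {0<..T} N" 
    using has_vector_derivative_continuous[OF d] by (auto simp: continuous_on_eq_continuous_within)
  have step: "N t + \<epsilon> \<le> exp K * (N s + \<epsilon>)" if \<epsilon>: "0 < \<epsilon>" for \<epsilon>
  proof -
    have pos: "0 < N r + \<epsilon>" if "r \<in> {s..t}" for r using N0[of r] sub that \<epsilon> by force
    have "((\<lambda>r. ln (N r + \<epsilon>)) has_vector_derivative N' r / (N r + \<epsilon>)) (at r within {s..t})" if r: "r \<in> {s..t}" for r
    proof -
      have "r \<in> {0<..T}" using r sub by blast
      from has_vector_derivative_within_subset[OF d[OF this] sub]
      have "(N has_real_derivative N' r) (at r within {s..t})"
        by (simp add: has_real_derivative_iff_has_vector_derivative)
      then have "((\<lambda>r. ln (N r + \<epsilon>)) has_real_derivative N' r / (N r + \<epsilon>)) (at r within {s..t})"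
        using pos[OF r] by (auto intro!: derivative_eq_intros)
      then show ?thesis by (simp add: has_real_derivative_iff_has_vector_derivative)
    qed
    from fundamental_theorem_of_calculus[OF s(2) this]
    have "ln (N t + \<epsilon>) - ln (N s + \<epsilon>) = integral {s..t} (\<lambda>r. N' r / (N r + \<epsilon>))"
      by (rule integral_unique[symmetric])
    moreover have "continuous_on {s..t} (\<lambda>r. N' r / (N r + \<epsilon>))"
      using pos by (intro continuous_intros continuous_on_subset[OF c sub] continuous_on_subset[OF cN sub]) force
    ultimately have "ennreal (ln (N t + \<epsilon>) - ln (N s + \<epsilon>)) \<le> (\<integral>\<^sup>+r. ennreal (N' r / (N r + \<epsilon>)) * indicator {s..t} r \<partial>lborel)"
      using ennreal_integral_le by simp
    also have "\<dots> \<le> (\<integral>\<^sup>+r. g r * indicator {0<..T} r \<partial>lborel)"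
    proof (rule nn_integral_mono)
      fix r
      show "ennreal (N' r / (N r + \<epsilon>)) * indicator {s..t} r \<le> g r * indicator {0<..T} r"
      proof (cases "r \<in> {s..t}")
        case True
        then have r: "r \<in> {0<..T}" using sub by auto
        have "ennreal (N' r / (N r + \<epsilon>)) = ennreal (1 / (N r + \<epsilon>)) * ennreal (N' r)"
          using pos[OF True] by (subst ennreal_mult'[symmetric]) auto
        also have "\<dots> \<le> ennreal (1 / (N r + \<epsilon>)) * (ennreal (N r) * g r)"
          by (intro mult_left_mono le r) simp
        also have "\<dots> = ennreal (N r / (N r + \<epsilon>)) * g r"
          using pos[OF True] by (simp add: mult.assoc[symmetric] ennreal_mult'[symmetric])
        also have "\<dots> \<le> 1 * g r"
          using pos[OF True] \<epsilon> by (intro mult_right_mono) (auto simp: ennreal_le_1)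
        finally show ?thesis using True r by simp
      qed simp
    qed
    also have "\<dots> \<le> ennreal K" by (rule int)
    finally have "ln (N t + \<epsilon>) - ln (N s + \<epsilon>) \<le> K" using K by simp
    then have "ln (N t + \<epsilon>) \<le> ln (exp K * (N s + \<epsilon>))" using pos[of s] s by (simp add: ln_mult)
    then show ?thesis using pos[of s] pos[of t] s by simp
  qed
  show ?thesis
  proof (rule field_le_epsilon)
    fix e :: real assume e: "0 < e"
    \<comment> \<open>With \<epsilon> = e / exp K the error on the right is exactly e.\<close>
    have "N t + e / exp K \<le> exp K * (N s + e / exp K)" using e by (intro step) simp
    moreover have "exp K * (N s + e / exp K) = exp K * N s + e" by (simp add: distrib_left)
    moreover have "0 < e / exp K" using e by simp
    ultimately show "N t \<le> exp K * N s + e" by linarith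
  qed
qed

lemma shift_into_period:
  obtains k :: int where "\<theta> + 2 * pi * of_int k \<in> {-pi..pi}"
proof -
  let ?r = "(\<theta> + pi) / (2 * pi)"
  have "of_int \<lfloor>?r\<rfloor> * (2 * pi) \<le> \<theta> + pi" "\<theta> + pi < (of_int \<lfloor>?r\<rfloor> + 1) * (2 * pi)"
    by (intro floor_divide_lower floor_divide_upper; simp)+
  then show thesis by (intro that[of "- \<lfloor>?r\<rfloor>"]) (auto simp: algebra_simps)
qed

lemma arc_chord_nonneg: "0 \<le> arc_chord x"
proof -
  have "(0, pi) \<in> {-pi..pi} \<times> ({-pi..pi} - {0})" by simp
  then have "{-pi..pi} \<times> ({-pi..pi} - {0::real}) \<noteq> {}" by blast
  then show ?thesis unfolding arc_chord_def by (rule cINF_greatest) auto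
qed

text \<open>The infimum ranges over one period of angles; periodicity of the curve carries it to all
  of them.\<close>

lemma arc_chord_le:
  assumes per: "periodic x" and \<alpha>: "\<alpha> \<in> {-pi..pi} - {0}"
  shows "arc_chord x \<le> norm (Dquot \<alpha> x \<theta>)"
proof -
  obtain k :: int where k: "\<theta> + 2 * pi * of_int k \<in> {-pi..pi}" by (rule shift_into_period)
  have "arc_chord x \<le> (\<lambda>(\<theta>, \<alpha>). norm (Dquot \<alpha> x \<theta>)) (\<theta> + 2 * pi * of_int k, \<alpha>)"
    unfolding arc_chord_def using k \<alpha> by (intro cINF_lower bdd_belowI2[where m=0]) auto
  also have "\<dots> = norm (Dquot \<alpha> x \<theta>)"
    using periodic_int[OF per, of "\<theta>" k] periodic_int[OF per, of "\<theta> + \<alpha>" k] by (simp add: Dquot_def delta_def algebra_simps)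
  finally show ?thesis .
qed

lemma flow_profile:
  assumes \<mu>: "\<And>r. 0 \<le> r \<Longrightarrow> 1 \<le> \<mu> r" and M: "0 < M"
    and r: "regular_flow T X X2 Xt" and e: "energy_bound \<mu> \<Lambda> c T X0 X" and d: "admissible_datum \<mu> M X0"
    and m: "0 < m" "m \<le> (INF t\<in>{0..T}. arc_chord (X t))" and adm: "admissible_tension \<T> \<Lambda>"
    and t: "t \<in> {0<..T}"
  shows "profile (X t) (dtheta (X t)) (X2 t) (16 * M) m \<T> \<Lambda>"
proof
  have "m \<le> arc_chord (X t)"
  proof (rule order_trans[OF m(2)])
    show "(INF t\<in>{0..T}. arc_chord (X t)) \<le> arc_chord (X t)"
      using t by (intro cINF_lower bdd_belowI2[where m=0] arc_chord_nonneg) auto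
  qed
  then show "m \<le> norm (Dquot \<alpha> (X t) \<theta>)" if "\<alpha> \<in> {-pi..pi} - {0}" for \<alpha> \<theta>
    using arc_chord_le[OF regular_flowD(1)[OF r t] that, of \<theta>] by linarith
  show "norm (dtheta (X t) \<theta>) \<le> 16 * M" for \<theta> by (rule flow_bounded[OF \<mu> M r e d t])
qed (use regular_flowD[OF r t] m adm in auto)

text \<open>The equation provides some velocity for each angle; it equals \<open>Xt\<close> since
  derivatives within \<open>{0<..T}\<close> are unique at limit points, \<open>T\<close> included.
  This makes the principal value continuous in the angle, as the weak limit requires.\<close>

lemma flow_rhs:
  assumes s: "strong_solution \<T> T X0 X" and r: "regular_flow T X X2 Xt" and t: "t \<in> {0<..T}"
  shows "peskin_rhs \<T> (X t) \<theta> (Xt t \<theta>)"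
proof -
  obtain v where v: "peskin_rhs \<T> (X t) \<theta> v" "((\<lambda>s. dtheta (X s) \<theta>) has_vector_derivative v) (at t within {0<..T})"
    using s t unfolding strong_solution_def by blast
  have "t islimpt {0<..T}"
    by (rule islimpt_subset[OF islimpt_greaterThanLessThan2[of 0 t]]) (use t in auto)
  then have "at t within {0<..T} \<noteq> bot" by (simp add: trivial_limit_within)
  then have "v = Xt t \<theta>" using v(2) regular_flowD(4)[OF r t] by (rule vector_derivative_unique_within)
  then show ?thesis using v by simp
qed

locale solution_pair =
  fixes \<mu> \<T> :: "real \<Rightarrow> real" and M \<Lambda> c T m C :: real and X0 Y0 :: "real \<Rightarrow> real^2" and X Y X2 Y2 Xt Yt :: "real \<Rightarrow> real \<Rightarrow> real^2"
  assumes \<mu>: "admissible_weight \<mu>" and M: "0 < M" and \<Lambda>: "0 < \<Lambda>" and c: "0 < c" and adm: "admissible_tension \<T> \<Lambda>"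
    and C: "density_constant (16 * M) m \<T> C"
    and datum: "admissible_datum \<mu> M X0" "admissible_datum \<mu> M Y0"
    and sol: "corresponding_solution \<mu> \<T> \<Lambda> c T X0 X" "corresponding_solution \<mu> \<T> \<Lambda> c T Y0 Y"
    and m: "0 < m" "m \<le> (INF t\<in>{0..T}. arc_chord (X t))" "m \<le> (INF t\<in>{0..T}. arc_chord (Y t))"
    and r: "regular_flow T X X2 Xt" "regular_flow T Y Y2 Yt"
begin

definition Z where "Z t \<theta> = dtheta (X t) \<theta> - dtheta (Y t) \<theta>"

definition N where "N t = integral {-pi..pi} (\<lambda>\<theta>. (norm (Z t \<theta>))\<^sup>2)"

text \<open>Composed of the 2 from differentiating a square, the 3C and 32 of
  \<open>energy_inequality\<close>, and the time integral of the dissipation, once per solution. It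
  is built from parameters alone and not from the solutions, which makes the final \<delta>
  uniform.\<close>

definition K where "K = 2 * (3 * C) * (32 * (2 * (80 * M\<^sup>2 / (c\<^sup>2 * \<Lambda>))))"

lemma \<mu>1: "0 \<le> r \<Longrightarrow> 1 \<le> \<mu> r"
  using \<mu> by (simp add: admissible_weight_def)

lemma strong: "strong_solution \<T> T X0 X" "strong_solution \<T> T Y0 Y"
  and energy: "energy_bound \<mu> \<Lambda> c T X0 X" "energy_bound \<mu> \<Lambda> c T Y0 Y"
  using sol by (auto simp: corresponding_solution_def)

lemma C0: "0 \<le> C" using C by (simp add: density_constant_def)

lemma K0: "0 \<le> K"
  using C0 c \<Lambda> by (simp add: K_def)

lemma cZ: "continuous_on ({0<..T} \<times> UNIV) (\<lambda>(t, \<theta>). Z t \<theta>)"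
  using r unfolding Z_def regular_flow_def split_beta' by (intro continuous_intros) auto

lemma cZt: "t \<in> {0<..T} \<Longrightarrow> continuous_on UNIV (Z t)"
  unfolding Z_def[abs_def] by (intro continuous_intros regular_flowD(5)[OF r(1)] regular_flowD(5)[OF r(2)])

lemma perZ: "t \<in> {0<..T} \<Longrightarrow> periodic (Z t)"
  using regular_flowD(8)[OF r(1)] regular_flowD(8)[OF r(2)] by (simp add: periodic_def Z_def)

lemma N_nonneg: "t \<in> {0<..T} \<Longrightarrow> 0 \<le> N t"
  unfolding N_def
  by (intro Henstock_Kurzweil_Integration.integral_nonneg integrable_continuous_interval continuous_on_power continuous_on_norm continuous_on_subset[OF cZt]) auto

definition N' where "N' t = integral {-pi..pi} (\<lambda>\<theta>. 2 * (Z t \<theta> \<bullet> (Xt t \<theta> - Yt t \<theta>)))"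

lemma N_derivative:
  "t \<in> {0<..T} \<Longrightarrow> (N has_vector_derivative N' t) (at t within {0<..T})"
  "continuous_on {0<..T} N'"
proof -
  have cc: "continuous_on ({0<..T} \<times> cbox (-pi) pi) (\<lambda>(t, \<theta>). 2 * (Z t \<theta> \<bullet> (Xt t \<theta> - Yt t \<theta>)))"
  proof -
    have "continuous_on ({0<..T} \<times> UNIV) (\<lambda>(t, \<theta>). 2 * (Z t \<theta> \<bullet> (Xt t \<theta> - Yt t \<theta>)))"
      using r cZ unfolding regular_flow_def split_beta' by (intro continuous_intros) auto
    then show ?thesis by (rule continuous_on_subset) auto
  qed
  from integral_continuous_on_param[OF cc] show "continuous_on {0<..T} N'"
    unfolding N'_def[abs_def] by (simp only: cbox_interval)
  assume t: "t \<in> {0<..T}"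
  have "((\<lambda>t. integral (cbox (-pi) pi) (\<lambda>\<theta>. (norm (Z t \<theta>))\<^sup>2)) has_vector_derivative
     integral (cbox (-pi) pi) (\<lambda>\<theta>. 2 * (Z t \<theta> \<bullet> (Xt t \<theta> - Yt t \<theta>)))) (at t within {0<..T})"
  proof (rule leibniz_rule_vector_derivative[OF _ _ cc t])
    fix s \<theta> assume s: "s \<in> {0<..T}"
    have "((\<lambda>t. Z t \<theta>) has_vector_derivative (Xt s \<theta> - Yt s \<theta>)) (at s within {0<..T})"
      unfolding Z_def by (intro has_vector_derivative_diff regular_flowD(4)[OF r(1) s] regular_flowD(4)[OF r(2) s])
    from bounded_bilinear.has_vector_derivative[OF bounded_bilinear_inner this this]
    show "((\<lambda>t. (norm (Z t \<theta>))\<^sup>2) has_vector_derivative 2 * (Z s \<theta> \<bullet> (Xt s \<theta> - Yt s \<theta>))) (at s within {0<..T})"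
      by (simp add: dot_square_norm inner_commute[of "Xt s \<theta> - Yt s \<theta>"])
  next
    fix s assume s: "s \<in> {0<..T}"
    show "(\<lambda>\<theta>. (norm (Z s \<theta>))\<^sup>2) integrable_on cbox (-pi) pi"
      by (intro integrable_continuous continuous_on_power continuous_on_norm continuous_on_subset[OF cZt[OF s]]) auto
  qed auto
  then show "(N has_vector_derivative N' t) (at t within {0<..T})"
    unfolding N_def[abs_def] N'_def by (simp only: cbox_interval)
qed

lemma besov_diff_slice:
  assumes "(\<lambda>(t, \<alpha>). indicator {0<..T} t * besov_diff (U t) \<alpha>) \<in> borel_measurable (lborel \<Otimes>\<^sub>M lborel)" and t: "t \<in> {0<..T}"
  shows "besov_diff (U t) \<in> borel_measurable borel"
proof -
  have "(\<lambda>\<alpha>. (\<lambda>(t, \<alpha>). indicator {0<..T} t * besov_diff (U t) \<alpha>) (t, \<alpha>)) \<in> borel_measurable lborel"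
    by (rule measurable_Pair2[OF assms(1)]) simp
  then show ?thesis using t by simp
qed

lemma diss_measurable:
  assumes [measurable]: "(\<lambda>(t, \<alpha>). indicator {0<..T} t * besov_diff (U t) \<alpha>) \<in> borel_measurable (lborel \<Otimes>\<^sub>M lborel)"
  shows "(\<lambda>t. diss (U t) * indicator {0<..T} t) \<in> borel_measurable lborel"
proof -
  let ?B = "\<lambda>(t, \<alpha>). indicator {0<..T} t * besov_diff (U t) \<alpha>"
  have m: "(\<lambda>t. \<integral>\<^sup>+\<alpha>. ennreal (1 / \<alpha>\<^sup>2) * (?B (t, \<alpha>))\<^sup>2 * indicator {0<..pi} \<alpha> \<partial>lborel) \<in> borel_measurable lborel"
    by measurable
  have "diss (U t) * indicator {0<..T} t = (\<integral>\<^sup>+\<alpha>. ennreal (1 / \<alpha>\<^sup>2) * (?B (t, \<alpha>))\<^sup>2 * indicator {0<..pi} \<alpha> \<partial>lborel)" for t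
    by (cases "t \<in> {0<..T}") (simp_all add: diss_def)
  then show ?thesis using m by (simp only:)
qed

lemma N'_le:
  assumes t: "t \<in> {0<..T}"
  shows "ennreal (N' t) \<le> ennreal (N t) * (ennreal (2 * (3 * C)) * (32 * (diss (dtheta (X t)) + diss (dtheta (Y t)))))"
proof -
  note EX = energy_dissipation_part[OF \<mu>1 \<Lambda> c M r(1) energy(1) datum(1)]
  note EY = energy_dissipation_part[OF \<mu>1 \<Lambda> c M r(2) energy(2) datum(2)]
  interpret P: profile_pair "X t" "dtheta (X t)" "X2 t" "Y t" "dtheta (Y t)" "Y2 t" "16 * M" m \<T> \<Lambda> C
    using flow_profile[OF \<mu>1 M r(1) energy(1) datum(1) m(1,2) adm t] flow_profile[OF \<mu>1 M r(2) energy(2) datum(2) m(1,3) adm t] C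
    by (simp add: profile_pair_def profile_pair_axioms_def)
  have Z: "P.Z = Z t" by (rule ext) (simp add: P.Z_def Z_def)
  then have N: "P.N = N t" by (simp add: P.N_def N_def)
  have "ennreal (integral {-pi..pi} (\<lambda>\<theta>. Z t \<theta> \<bullet> (Xt t \<theta> - Yt t \<theta>))) \<le> ennreal (3 * C * N t) * (32 * (diss (dtheta (X t)) + diss (dtheta (Y t))))"
    using P.energy_inequality[OF besov_diff_slice[OF EX(1) t] besov_diff_slice[OF EY(1) t] flow_rhs[OF strong(1) r(1) t] flow_rhs[OF strong(2) r(2) t]
      regular_flowD(7)[OF r(1) t] regular_flowD(7)[OF r(2) t]] unfolding Z N .
  then have "2 * ennreal (integral {-pi..pi} (\<lambda>\<theta>. Z t \<theta> \<bullet> (Xt t \<theta> - Yt t \<theta>))) \<le> 2 * (ennreal (3 * C * N t) * (32 * (diss (dtheta (X t)) + diss (dtheta (Y t)))))"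
    by (rule mult_left_mono) simp
  moreover have "ennreal (N' t) = 2 * ennreal (integral {-pi..pi} (\<lambda>\<theta>. Z t \<theta> \<bullet> (Xt t \<theta> - Yt t \<theta>)))"
    by (simp add: N'_def ennreal_mult')
  moreover have "2 * ennreal (3 * C * N t) = ennreal (N t) * ennreal (2 * (3 * C))"
    using N_nonneg[OF t] C0 by (simp add: ennreal_mult'[symmetric] ennreal_numeral[symmetric] mult_ac del: ennreal_numeral)
  ultimately show ?thesis
    by (simp only: mult.assoc[symmetric])
qed

lemma N_gronwall:
  assumes s: "0 < s" "s \<le> t" "t \<le> T"
  shows "N t \<le> exp K * N s"
proof (rule log_gronwall[where N=N and N'=N' and T=T and g="\<lambda>t. ennreal (2 * (3 * C)) * (32 * (diss (dtheta (X t)) + diss (dtheta (Y t))))"])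
  note EX = energy_dissipation_part[OF \<mu>1 \<Lambda> c M r(1) energy(1) datum(1)]
  note EY = energy_dissipation_part[OF \<mu>1 \<Lambda> c M r(2) energy(2) datum(2)]
  note [measurable] = diss_measurable[OF EX(1)] diss_measurable[OF EY(1)]
  define D where "D = 80 * M\<^sup>2 / (c\<^sup>2 * \<Lambda>)"
  have "(\<integral>\<^sup>+t. ennreal (2 * (3 * C)) * (32 * (diss (dtheta (X t)) + diss (dtheta (Y t)))) * indicator {0<..T} t \<partial>lborel)
    = (\<integral>\<^sup>+t. ennreal (2 * (3 * C)) * (32 * (diss (dtheta (X t)) * indicator {0<..T} t + diss (dtheta (Y t)) * indicator {0<..T} t)) \<partial>lborel)"
    by (intro nn_integral_cong) (simp add: distrib_left distrib_right mult_ac)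
  also have "\<dots> = ennreal (2 * (3 * C)) * (32 * ((\<integral>\<^sup>+t. diss (dtheta (X t)) * indicator {0<..T} t \<partial>lborel) + (\<integral>\<^sup>+t. diss (dtheta (Y t)) * indicator {0<..T} t \<partial>lborel)))"
    by (simp add: nn_integral_cmult nn_integral_add)
  also have "\<dots> \<le> ennreal (2 * (3 * C)) * (32 * (ennreal D + ennreal D))"
    using EX(2) EY(2) by (intro mult_left_mono add_mono) (auto simp: diss_def D_def)
  also have "\<dots> = ennreal K"
  proof -
    have D: "0 \<le> D" using c \<Lambda> by (simp add: D_def)
    then have "ennreal D + ennreal D = ennreal (2 * D)" by (simp add: ennreal_plus[symmetric] del: ennreal_plus)
    moreover have "32 * ennreal (2 * D) = ennreal (32 * (2 * D))" using D by (simp add: ennreal_mult)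
    moreover have "ennreal (2 * (3 * C)) * ennreal (32 * (2 * D)) = ennreal K"
      unfolding K_def D_def[symmetric] using D C0 by (intro ennreal_mult[symmetric]) auto
    ultimately show ?thesis by simp
  qed
  finally show "(\<integral>\<^sup>+t. ennreal (2 * (3 * C)) * (32 * (diss (dtheta (X t)) + diss (dtheta (Y t)))) * indicator {0<..T} t \<partial>lborel) \<le> ennreal K" .
qed (use N_derivative N_nonneg N'_le K0 s in auto)

lemma L2_Z: "t \<in> {0<..T} \<Longrightarrow> (L2_norm (Z t))\<^sup>2 = ennreal (N t)"
  using N_nonneg[of t] by (subst L2_norm_continuous[OF continuous_on_subset[OF cZt]]) (auto simp: ennreal_power N_def)

text \<open>The data are attained only as a uniform limit at time 0, so the comparison is made at a
  small positive time. There |Z| is at most |h| + 2\<epsilon>, with h the difference of the data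
  derivatives; its square is at most 3|h|^2 + 6\<epsilon>^2, and the period has length 2 pi.\<close>

lemma initial_closeness:
  assumes \<epsilon>: "0 < \<epsilon>" and t: "0 < t"
  obtains s where "0 < s" "s < t" "(L2_norm (Z s))\<^sup>2 \<le> ennreal (12 * pi * \<epsilon>\<^sup>2) + 3 * (L2_norm (\<lambda>\<theta>. dtheta X0 \<theta> - dtheta Y0 \<theta>))\<^sup>2"
proof -
  let ?h = "\<lambda>\<theta>. dtheta X0 \<theta> - dtheta Y0 \<theta>"
  have "\<forall>\<^sub>F s in at_right 0. Linf_norm (\<lambda>\<theta>. dtheta (X s) \<theta> - dtheta X0 \<theta>) < ennreal \<epsilon>"
    "\<forall>\<^sub>F s in at_right 0. Linf_norm (\<lambda>\<theta>. dtheta (Y s) \<theta> - dtheta Y0 \<theta>) < ennreal \<epsilon>"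
    using strong \<epsilon> unfolding strong_solution_def by (auto intro!: order_tendstoD(2))
  moreover have "\<forall>\<^sub>F s in at_right (0::real). 0 < s \<and> s < t"
    using t eventually_at_right_field by blast
  ultimately have "\<forall>\<^sub>F s in at_right 0. Linf_norm (\<lambda>\<theta>. dtheta (X s) \<theta> - dtheta X0 \<theta>) < ennreal \<epsilon> \<and>
     Linf_norm (\<lambda>\<theta>. dtheta (Y s) \<theta> - dtheta Y0 \<theta>) < ennreal \<epsilon> \<and> 0 < s \<and> s < t"
    by eventually_elim simp
  from eventually_happens[OF this]
  obtain s where s: "Linf_norm (\<lambda>\<theta>. dtheta (X s) \<theta> - dtheta X0 \<theta>) < ennreal \<epsilon>"
     "Linf_norm (\<lambda>\<theta>. dtheta (Y s) \<theta> - dtheta Y0 \<theta>) < ennreal \<epsilon>" "0 < s" "s < t" by auto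
  have ae: "AE \<theta> in lebesgue. \<theta> \<in> {-pi..pi} \<longrightarrow> norm (f \<theta>) \<le> \<epsilon>" if "Linf_norm f < ennreal \<epsilon>" for f :: "real \<Rightarrow> real^2"
  proof -
    have "AE \<theta> in restrict_space lebesgue {-pi..pi}. ennreal (norm (f \<theta>)) \<le> Linf_norm f"
      unfolding Linf_norm_def by (rule esssup_AE)
    then have "AE \<theta> in lebesgue. \<theta> \<in> {-pi..pi} \<longrightarrow> ennreal (norm (f \<theta>)) \<le> Linf_norm f"
      by (subst (asm) AE_restrict_space_iff) auto
    then show ?thesis
    proof eventually_elim
      case (elim \<theta>)
      show ?case
      proof
        assume "\<theta> \<in> {-pi..pi}"
        then have "ennreal (norm (f \<theta>)) \<le> ennreal \<epsilon>" using elim that by simp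
        then show "norm (f \<theta>) \<le> \<epsilon>" using \<epsilon> by simp
      qed
    qed
  qed
  \<comment> \<open>The derivatives of the data are integrable on the period, hence measurable
    there; splitting the integral below relies on this.\<close>
  have hm: "(\<lambda>\<theta>. ennreal ((norm (?h \<theta>))\<^sup>2) * indicator {-pi..pi} \<theta>) \<in> borel_measurable lebesgue"
  proof -
    have le: "(- pi::real) \<le> pi" by simp
    have w: "(\<lambda>\<theta>. indicator {-pi..pi} \<theta> *\<^sub>R dtheta V \<theta>) \<in> borel_measurable lebesgue" if "W11_torus V" for V
    proof -
      have "set_integrable lebesgue {-pi..pi} (dtheta V)" using that le unfolding W11_torus_def by simp
      then show ?thesis unfolding set_integrable_def by (rule borel_measurable_integrable)
    qed
    have [measurable]: "(\<lambda>\<theta>. indicator {-pi..pi} \<theta> *\<^sub>R dtheta X0 \<theta>) \<in> borel_measurable lebesgue"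
      "(\<lambda>\<theta>. indicator {-pi..pi} \<theta> *\<^sub>R dtheta Y0 \<theta>) \<in> borel_measurable lebesgue"
      using datum by (auto intro!: w simp: admissible_datum_def)
    have "(\<lambda>\<theta>. ennreal ((norm (indicator {-pi..pi} \<theta> *\<^sub>R dtheta X0 \<theta> - indicator {-pi..pi} \<theta> *\<^sub>R dtheta Y0 \<theta>))\<^sup>2)) \<in> borel_measurable lebesgue"
      by measurable
    moreover have "(\<lambda>\<theta>. ennreal ((norm (indicator {-pi..pi} \<theta> *\<^sub>R dtheta X0 \<theta> - indicator {-pi..pi} \<theta> *\<^sub>R dtheta Y0 \<theta>))\<^sup>2))
       = (\<lambda>\<theta>. ennreal ((norm (?h \<theta>))\<^sup>2) * indicator {-pi..pi} \<theta>)" by (auto simp: indicator_def)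
    ultimately show ?thesis by simp
  qed
  have "(L2_norm (Z s))\<^sup>2 = (\<integral>\<^sup>+\<theta>\<in>{-pi..pi}. ennreal ((norm (Z s \<theta>))\<^sup>2) \<partial>lebesgue)"
    by (simp add: L2_norm_def sqrt_ennreal_power2)
  also have "\<dots> \<le> (\<integral>\<^sup>+\<theta>. ennreal (6 * \<epsilon>\<^sup>2) * indicator {-pi..pi} \<theta> + 3 * (ennreal ((norm (?h \<theta>))\<^sup>2) * indicator {-pi..pi} \<theta>) \<partial>lebesgue)"
  proof (rule nn_integral_mono_AE)
    show "AE \<theta> in lebesgue. ennreal ((norm (Z s \<theta>))\<^sup>2) * indicator {-pi..pi} \<theta> \<le> ennreal (6 * \<epsilon>\<^sup>2) * indicator {-pi..pi} \<theta> + 3 * (ennreal ((norm (?h \<theta>))\<^sup>2) * indicator {-pi..pi} \<theta>)"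
      using ae[OF s(1)] ae[OF s(2)]
    proof eventually_elim
      case (elim \<theta>)
      show ?case
      proof (cases "\<theta> \<in> {-pi..pi}")
        case True
        let ?a = "dtheta (X s) \<theta> - dtheta X0 \<theta>" and ?b = "dtheta (Y s) \<theta> - dtheta Y0 \<theta>"
        have ab: "norm ?a \<le> \<epsilon>" "norm ?b \<le> \<epsilon>" using elim True by auto
        have "Z s \<theta> = ?a + ?h \<theta> - ?b" by (simp add: Z_def)
        then have "norm (Z s \<theta>) = norm (?a + ?h \<theta> - ?b)" by (rule arg_cong)
        then have "norm (Z s \<theta>) \<le> norm (?h \<theta>) + 2 * \<epsilon>"
          using norm_triangle_ineq4[of "?a + ?h \<theta>" ?b] norm_triangle_ineq[of ?a "?h \<theta>"] ab by linarith
        then have "(norm (Z s \<theta>))\<^sup>2 \<le> (norm (?h \<theta>) + 2 * \<epsilon>)\<^sup>2" by (intro power_mono) auto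
        also have "\<dots> \<le> 6 * \<epsilon>\<^sup>2 + 3 * (norm (?h \<theta>))\<^sup>2"
        proof -
          have "0 \<le> 2 * (norm (?h \<theta>) - \<epsilon>)\<^sup>2" by simp
          then show ?thesis by (simp add: power2_eq_square algebra_simps)
        qed
        finally have "ennreal ((norm (Z s \<theta>))\<^sup>2) \<le> ennreal (6 * \<epsilon>\<^sup>2 + 3 * (norm (?h \<theta>))\<^sup>2)" by (rule ennreal_leI)
        also have "\<dots> = ennreal (6 * \<epsilon>\<^sup>2) + 3 * ennreal ((norm (?h \<theta>))\<^sup>2)" by (simp add: ennreal_mult)
        finally show ?thesis using True by simp
      qed simp
    qed
  qed
  also have "\<dots> = ennreal (6 * \<epsilon>\<^sup>2) * ennreal (2 * pi) + 3 * (\<integral>\<^sup>+\<theta>. ennreal ((norm (?h \<theta>))\<^sup>2) * indicator {-pi..pi} \<theta> \<partial>lebesgue)"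
    using hm by (subst nn_integral_add) (auto intro!: borel_measurable_times_ennreal borel_measurable_indicator simp: nn_integral_cmult nn_integral_cmult_indicator)
  also have "ennreal (6 * \<epsilon>\<^sup>2) * ennreal (2 * pi) = ennreal (12 * pi * \<epsilon>\<^sup>2)"
    by (subst ennreal_mult[symmetric]) (auto simp: mult_ac)
  also have "(\<integral>\<^sup>+\<theta>. ennreal ((norm (?h \<theta>))\<^sup>2) * indicator {-pi..pi} \<theta> \<partial>lebesgue) = (L2_norm ?h)\<^sup>2"
    by (simp add: L2_norm_def sqrt_ennreal_power2)
  finally show thesis using that s by blast
qed

text \<open>Gronwall's inequality from a positive time close to 0. The slack \<epsilon> is tuned so
  that exp K times its contribution equals e.\<close>

lemma L2_stability:
  assumes t: "t \<in> {0<..T}"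
  shows "ennreal (N t) \<le> ennreal (3 * exp K) * (L2_norm (\<lambda>\<theta>. dtheta X0 \<theta> - dtheta Y0 \<theta>))\<^sup>2"
proof (rule ennreal_le_epsilon)
  let ?L = "(L2_norm (\<lambda>\<theta>. dtheta X0 \<theta> - dtheta Y0 \<theta>))\<^sup>2"
  fix e :: real assume e: "0 < e"
  define \<epsilon> where "\<epsilon> = sqrt (e / (exp K * (12 * pi)))"
  have \<epsilon>: "0 < \<epsilon>" "exp K * (12 * pi * \<epsilon>\<^sup>2) = e" using e by (auto simp: \<epsilon>_def)
  obtain s where s: "0 < s" "s < t" "(L2_norm (Z s))\<^sup>2 \<le> ennreal (12 * pi * \<epsilon>\<^sup>2) + 3 * ?L"
    using initial_closeness[OF \<epsilon>(1), of t] t by auto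
  have "N t \<le> exp K * N s" using s t by (intro N_gronwall) auto
  then have "ennreal (N t) \<le> ennreal (exp K * N s)" by (rule ennreal_leI)
  also have "\<dots> = ennreal (exp K) * (L2_norm (Z s))\<^sup>2" using s t by (subst L2_Z) (auto simp: ennreal_mult')
  also have "\<dots> \<le> ennreal (exp K) * (ennreal (12 * pi * \<epsilon>\<^sup>2) + 3 * ?L)" by (intro mult_left_mono s(3)) simp
  also have "\<dots> = ennreal (3 * exp K) * ?L + ennreal e"
    unfolding \<epsilon>(2)[symmetric] by (simp add: distrib_left ennreal_mult' mult_ac)
  finally show "ennreal (N t) \<le> ennreal (3 * exp K) * ?L + ennreal e" .
qed

end

subsection \<open>Stability in the weighted Besov norm\<close>

context solution_pair begin

text \<open>The first bound serves increments away from 0, where closeness in L^2 is what counts;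
  the second serves small ones, where the energy bounds of the two solutions take over.\<close>

lemma qdiff_Z_le:
  assumes t: "t \<in> {0<..T}"
  shows "qdiff (Z t) \<beta> \<le> 4 * N t"
    "qdiff (Z t) \<beta> \<le> 2 * (qdiff (dtheta (X t)) \<beta> + qdiff (dtheta (Y t)) \<beta>)"
proof -
  have sq: "(norm (a - b))\<^sup>2 \<le> 2 * ((norm a)\<^sup>2 + (norm b)\<^sup>2)" for a b :: "real^2"
  proof -
    have "(norm (a - b))\<^sup>2 \<le> (norm a + norm b)\<^sup>2" by (intro power_mono norm_triangle_ineq4) simp
    moreover have "0 \<le> (norm a - norm b)\<^sup>2" by simp
    ultimately show ?thesis by (simp add: power2_eq_square algebra_simps)
  qed
  have sh: "continuous_on {-pi..pi} (\<lambda>\<theta>. f (\<theta> + b))" if "continuous_on UNIV f" for f :: "real \<Rightarrow> real^2" and b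
    by (rule continuous_on_compose2[OF that]) (auto intro!: continuous_intros)
  have nn: "continuous_on {-pi..pi} f \<Longrightarrow> (\<lambda>\<theta>. (norm (f \<theta>))\<^sup>2) integrable_on {-pi..pi}" for f :: "real \<Rightarrow> real^2"
    by (intro integrable_continuous_interval continuous_intros)
  have key: "integral {-pi..pi} (\<lambda>\<theta>. (norm (f \<theta> - g \<theta>))\<^sup>2) \<le> 2 * (integral {-pi..pi} (\<lambda>\<theta>. (norm (f \<theta>))\<^sup>2) + integral {-pi..pi} (\<lambda>\<theta>. (norm (g \<theta>))\<^sup>2))"
    if f: "continuous_on {-pi..pi} f" and g: "continuous_on {-pi..pi} g" for f g :: "real \<Rightarrow> real^2"
  proof -
    have "integral {-pi..pi} (\<lambda>\<theta>. (norm (f \<theta> - g \<theta>))\<^sup>2) \<le> integral {-pi..pi} (\<lambda>\<theta>. 2 * ((norm (f \<theta>))\<^sup>2 + (norm (g \<theta>))\<^sup>2))"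
      by (intro integral_le sq integrable_continuous_interval continuous_intros f g)
    also have "\<dots> = 2 * integral {-pi..pi} (\<lambda>\<theta>. (norm (f \<theta>))\<^sup>2 + (norm (g \<theta>))\<^sup>2)" by (rule integral_mult_right)
    finally show ?thesis using integral_add[OF nn[OF f] nn[OF g]] by simp
  qed
  have cz: "continuous_on {-pi..pi} (Z t)" using sh[OF cZt[OF t], of 0] by simp
  have "periodic (\<lambda>\<theta>. (norm (Z t \<theta>))\<^sup>2)" using perZ[OF t] by (simp add: periodic_def)
  then have "integral {-pi..pi} (\<lambda>\<theta>. (norm (Z t (\<theta> + \<beta>)))\<^sup>2) = N t"
    unfolding N_def using nn[OF cz] by (rule periodic_integral_shift)
  then show "qdiff (Z t) \<beta> \<le> 4 * N t"
    using key[OF sh[OF cZt[OF t], of \<beta>] cz] by (simp add: qdiff_def N_def)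
  let ?a = "\<lambda>\<theta>. dtheta (X t) (\<theta> + \<beta>) - dtheta (X t) \<theta>" and ?b = "\<lambda>\<theta>. dtheta (Y t) (\<theta> + \<beta>) - dtheta (Y t) \<theta>"
  note U = regular_flowD(5)[OF r(1) t] regular_flowD(5)[OF r(2) t]
  have "continuous_on {-pi..pi} ?a" "continuous_on {-pi..pi} ?b"
    using sh[OF U(1), of 0] sh[OF U(2), of 0] by (auto intro!: continuous_on_diff sh U)
  from key[OF this] show "qdiff (Z t) \<beta> \<le> 2 * (qdiff (dtheta (X t)) \<beta> + qdiff (dtheta (Y t)) \<beta>)"
    by (simp add: qdiff_def Z_def algebra_simps)
qed

text \<open>\<open>esssup_I\<close> asks for measurability on all of [0,T], but continuity in time
  is known only on \<open>{0<..T}\<close>. The auxiliary \<open>g\<close> agrees with the norm on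
  [0,T]: it keeps the value at the single point 0 and is given by a measurable formula
  elsewhere.\<close>

lemma LinfL2_le:
  assumes "\<And>t. t \<in> {0<..T} \<Longrightarrow> ennreal (sqrt (qdiff (Z t) \<beta>)) \<le> B"
  shows "LinfL2_norm T (\<lambda>t. delta \<beta> (Z t)) \<le> B"
proof -
  have L: "L2_norm (delta \<beta> (Z t)) = ennreal (sqrt (qdiff (Z t) \<beta>))" if "t \<in> {0<..T}" for t
    by (rule L2_norm_delta[OF cZt[OF that]])
  define g where "g t = (if t = 0 then L2_norm (delta \<beta> (Z 0)) else ennreal (sqrt (indicator {0<..T} t *\<^sub>R qdiff (Z t) \<beta>)))" for t
  have [measurable]: "(\<lambda>t. indicator {0<..T} t *\<^sub>R qdiff (Z t) \<beta>) \<in> borel_measurable borel"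
    by (intro borel_measurable_continuous_on_indicator qdiff_time_continuous cZ) simp
  have "g \<in> borel_measurable borel" unfolding g_def[abs_def] by measurable
  then have "g \<in> borel_measurable (restrict_space lebesgue {0..T})"
    by (intro measurable_restrict_space1 measurable_completion) simp
  moreover have eq: "g t = L2_norm (delta \<beta> (Z t))" if "t \<in> {0..T}" for t
    using that L[of t] by (auto simp: g_def)
  ultimately have m: "(\<lambda>t. L2_norm (delta \<beta> (Z t))) \<in> borel_measurable (restrict_space lebesgue {0..T})"
    by (subst measurable_cong[where g=g]) (auto simp: space_restrict_space)
  have "AE t in lebesgue. t \<noteq> 0"
    by (rule AE_completion) (rule AE_lborel_singleton)
  then have "AE t in lebesgue. t \<in> {0..T} \<longrightarrow> L2_norm (delta \<beta> (Z t)) \<le> B"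
  proof eventually_elim
    case (elim t)
    then show ?case using L[of t] assms[of t] by auto
  qed
  then have "AE t in restrict_space lebesgue {0..T}. L2_norm (delta \<beta> (Z t)) \<le> B"
    by (subst AE_restrict_space_iff) auto
  with m show ?thesis unfolding LinfL2_norm_def by (rule esssup_I)
qed

lemma LinfL2_increment:
  shows "LinfL2_norm T (\<lambda>t. delta \<beta> (Z t)) \<le> 2 * (rat_sup T (\<lambda>t. dtheta (X t)) \<beta> + rat_sup T (\<lambda>t. dtheta (Y t)) \<beta>)"
    and "\<lbrakk>0 \<le> S; \<And>t. t \<in> {0<..T} \<Longrightarrow> N t \<le> S\<^sup>2\<rbrakk> \<Longrightarrow> LinfL2_norm T (\<lambda>t. delta \<beta> (Z t)) \<le> ennreal (2 * S)"
proof -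
  show "LinfL2_norm T (\<lambda>t. delta \<beta> (Z t)) \<le> 2 * (rat_sup T (\<lambda>t. dtheta (X t)) \<beta> + rat_sup T (\<lambda>t. dtheta (Y t)) \<beta>)"
  proof (rule LinfL2_le)
    fix t assume t: "t \<in> {0<..T}"
    let ?a = "qdiff (dtheta (X t)) \<beta>" and ?b = "qdiff (dtheta (Y t)) \<beta>"
    have "qdiff (Z t) \<beta> \<le> 4 * (?a + ?b)"
      by (rule order_trans[OF qdiff_Z_le(2)[OF t]]) (intro mult_right_mono add_nonneg_nonneg qdiff_nonneg, simp)
    then have "sqrt (qdiff (Z t) \<beta>) \<le> sqrt (4 * (?a + ?b))" by (rule real_sqrt_le_mono)
    also have "\<dots> = 2 * sqrt (?a + ?b)" by (simp only: real_sqrt_mult real_sqrt_four)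
    also have "\<dots> \<le> 2 * (sqrt ?a + sqrt ?b)"
      by (intro mult_left_mono sqrt_add_le_add_sqrt qdiff_nonneg) simp
    finally have "ennreal (sqrt (qdiff (Z t) \<beta>)) \<le> ennreal (2 * (sqrt ?a + sqrt ?b))" by (rule ennreal_leI)
    also have "\<dots> = 2 * (ennreal (sqrt ?a) + ennreal (sqrt ?b))" by (simp add: ennreal_mult' qdiff_nonneg)
    also have "\<dots> \<le> 2 * (rat_sup T (\<lambda>t. dtheta (X t)) \<beta> + rat_sup T (\<lambda>t. dtheta (Y t)) \<beta>)"
      by (intro mult_left_mono add_mono rat_sup_upper[OF r(1) t] rat_sup_upper[OF r(2) t]) simp
    finally show "ennreal (sqrt (qdiff (Z t) \<beta>)) \<le> 2 * (rat_sup T (\<lambda>t. dtheta (X t)) \<beta> + rat_sup T (\<lambda>t. dtheta (Y t)) \<beta>)" .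
  qed
  assume S: "0 \<le> S" "\<And>t. t \<in> {0<..T} \<Longrightarrow> N t \<le> S\<^sup>2"
  show "LinfL2_norm T (\<lambda>t. delta \<beta> (Z t)) \<le> ennreal (2 * S)"
  proof (rule LinfL2_le, rule ennreal_leI)
    fix t assume t: "t \<in> {0<..T}"
    have "qdiff (Z t) \<beta> \<le> (2 * S)\<^sup>2" using qdiff_Z_le(1)[OF t, of \<beta>] S(2)[OF t] by (simp add: power_mult_distrib)
    then show "sqrt (qdiff (Z t) \<beta>) \<le> 2 * S" using S(1) by (intro real_le_lsqrt) auto
  qed
qed

text \<open>Monotonicity is given on the half line; composing with \<open>max 0\<close> makes the
  function monotone everywhere, hence measurable.\<close>

lemma weight_measurable: "(\<lambda>\<beta>. \<mu> (1 / \<bar>\<beta>\<bar>)) \<in> borel_measurable borel"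
proof -
  have "mono (\<lambda>r. \<mu> (max 0 r))" using \<mu> by (auto simp: admissible_weight_def mono_on_def intro!: monoI)
  then have [measurable]: "(\<lambda>r. \<mu> (max 0 r)) \<in> borel_measurable borel" by (rule borel_measurable_mono)
  have "(\<lambda>\<beta>. (\<lambda>r. \<mu> (max 0 r)) (1 / \<bar>\<beta>\<bar>)) \<in> borel_measurable borel" by measurable
  then show ?thesis by simp
qed

text \<open>
  Small increments are absorbed by the energy bound for \<open>\<mu>\<close>, which beats \<open>\<omega>\<close> there by the factor
  \<open>\<kappa>\<close>; for the others the weight is bounded and the stability in \<open>L\<^sup>2\<close> suffices.
\<close>

lemma B_norm_le:
  assumes \<omega>: "admissible_weight \<omega>" and \<eta>: "0 < \<eta>" and \<kappa>: "0 < \<kappa>"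
    and small: "\<And>\<rho>. 1 / \<eta> \<le> \<rho> \<Longrightarrow> \<omega> \<rho> \<le> \<kappa> * \<mu> \<rho>"
    and S: "0 \<le> S" "\<And>t. t \<in> {0<..T} \<Longrightarrow> N t \<le> S\<^sup>2"
  shows "B_norm \<omega> T Z \<le> ennreal (16 * \<kappa> * M + 4 * pi * (\<omega> (1 / \<eta>) / \<eta> powr (3/2)) * S)"
proof -
  let ?W = "\<omega> (1 / \<eta>) / \<eta> powr (3/2)"
  let ?w = "\<lambda>\<mu> \<beta>. ennreal (\<mu> (1 / \<bar>\<beta>\<bar>) / \<bar>\<beta>\<bar> powr (3/2))"
  let ?rX = "rat_sup T (\<lambda>t. dtheta (X t))" and ?rY = "rat_sup T (\<lambda>t. dtheta (Y t))"
  let ?I = "indicator {-pi..pi} :: real \<Rightarrow> ennreal"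
  note [measurable] = weight_measurable rat_sup_measurable[OF r(1)] rat_sup_measurable[OF r(2)]
  have \<omega>1: "1 \<le> \<omega> \<rho>" if "0 \<le> \<rho>" for \<rho> using \<omega> that by (simp add: admissible_weight_def)
  have W0: "0 \<le> ?W" using \<omega>1[of "1 / \<eta>"] \<eta> by (intro divide_nonneg_nonneg) auto
  \<comment> \<open>Both regimes in one inequality: for |\<beta>| < \<eta> the first term is used,
    otherwise the second. At \<beta> = 0 the weight is 0 by the convention for division.\<close>
  have pw: "?w \<omega> \<beta> * LinfL2_norm T (\<lambda>t. delta \<beta> (Z t)) * ?I \<beta>
     \<le> ennreal (2 * \<kappa>) * (?w \<mu> \<beta> * ?rX \<beta> * ?I \<beta> + ?w \<mu> \<beta> * ?rY \<beta> * ?I \<beta>) + ennreal (?W * (2 * S)) * ?I \<beta>" for \<beta>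
  proof (cases "\<beta> \<in> {-pi..pi} \<and> \<beta> \<noteq> 0")
    case True
    then have b: "0 < \<bar>\<beta>\<bar>" by simp
    show ?thesis
    proof (cases "\<bar>\<beta>\<bar> < \<eta>")
      case lt: True
      have "\<omega> (1 / \<bar>\<beta>\<bar>) \<le> \<kappa> * \<mu> (1 / \<bar>\<beta>\<bar>)" using lt b by (intro small) (simp add: frac_le)
      then have "\<omega> (1 / \<bar>\<beta>\<bar>) / \<bar>\<beta>\<bar> powr (3/2) \<le> \<kappa> * \<mu> (1 / \<bar>\<beta>\<bar>) / \<bar>\<beta>\<bar> powr (3/2)" by (intro divide_right_mono) auto
      then have "?w \<omega> \<beta> \<le> ennreal (\<kappa> * (\<mu> (1 / \<bar>\<beta>\<bar>) / \<bar>\<beta>\<bar> powr (3/2)))" by (intro ennreal_leI) simp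
      also have "\<dots> = ennreal \<kappa> * ?w \<mu> \<beta>" using \<kappa> by (intro ennreal_mult') simp
      finally have "?w \<omega> \<beta> * LinfL2_norm T (\<lambda>t. delta \<beta> (Z t)) \<le> (ennreal \<kappa> * ?w \<mu> \<beta>) * (2 * (?rX \<beta> + ?rY \<beta>))"
        by (intro mult_mono LinfL2_increment(1)) auto
      also have "\<dots> = ennreal (2 * \<kappa>) * (?w \<mu> \<beta> * ?rX \<beta> + ?w \<mu> \<beta> * ?rY \<beta>)"
        using \<kappa> by (simp add: ennreal_mult' distrib_left mult_ac)
      finally show ?thesis using True by (simp add: add_increasing2)
    next
      case False
      then have le: "1 / \<bar>\<beta>\<bar> \<le> 1 / \<eta>" using \<eta> by (intro frac_le) auto
      have "\<omega> (1 / \<bar>\<beta>\<bar>) \<le> \<omega> (1 / \<eta>)"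
        using \<omega> le \<eta> unfolding admissible_weight_def by (auto elim!: mono_onD)
      moreover have "\<eta> powr (3/2) \<le> \<bar>\<beta>\<bar> powr (3/2)" using False \<eta> by (intro powr_mono2) auto
      ultimately have "\<omega> (1 / \<bar>\<beta>\<bar>) / \<bar>\<beta>\<bar> powr (3/2) \<le> ?W"
        using \<omega>1[of "1 / \<eta>"] \<eta> by (intro frac_le) auto
      then have "?w \<omega> \<beta> * LinfL2_norm T (\<lambda>t. delta \<beta> (Z t)) \<le> ennreal ?W * ennreal (2 * S)"
        by (intro mult_mono LinfL2_increment(2) S ennreal_leI) auto
      also have "\<dots> = ennreal (?W * (2 * S))" using W0 by (rule ennreal_mult'[symmetric])
      finally show ?thesis using True by (simp add: add_increasing)
    qed
  qed auto
  have "B_norm \<omega> T Z = (\<integral>\<^sup>+\<beta>. ?w \<omega> \<beta> * LinfL2_norm T (\<lambda>t. delta \<beta> (Z t)) * ?I \<beta> \<partial>lborel)"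
    unfolding B_norm_def nn_integral_completion ..
  also have "\<dots> \<le> (\<integral>\<^sup>+\<beta>. ennreal (2 * \<kappa>) * (?w \<mu> \<beta> * ?rX \<beta> * ?I \<beta> + ?w \<mu> \<beta> * ?rY \<beta> * ?I \<beta>) + ennreal (?W * (2 * S)) * ?I \<beta> \<partial>lborel)"
    by (rule nn_integral_mono) (rule pw)
  also have "\<dots> = ennreal (2 * \<kappa>) * ((\<integral>\<^sup>+\<beta>. ?w \<mu> \<beta> * ?rX \<beta> * ?I \<beta> \<partial>lborel) + (\<integral>\<^sup>+\<beta>. ?w \<mu> \<beta> * ?rY \<beta> * ?I \<beta> \<partial>lborel)) + ennreal (?W * (2 * S)) * ennreal (2 * pi)"
    by (subst nn_integral_add, measurable, measurable, subst nn_integral_cmult, measurable, subst nn_integral_add, measurable, measurable,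
        subst nn_integral_cmult_indicator) auto
  also have "\<dots> \<le> ennreal (2 * \<kappa>) * (ennreal (4 * M) + ennreal (4 * M)) + ennreal (?W * (2 * S)) * ennreal (2 * pi)"
    using energy_sup_part[OF r(1) energy(1) datum(1)] energy_sup_part[OF r(2) energy(2) datum(2)]
    by (intro add_mono mult_left_mono) auto
  \<comment> \<open>The first term is 2\<kappa> times 4M for each solution; the second is the
    bounded weight times 2S over an interval of length 2 pi.\<close>
  also have "\<dots> = ennreal (16 * \<kappa> * M + 4 * pi * ?W * S)"
  proof -
    have "ennreal (4 * M) + ennreal (4 * M) = ennreal (8 * M)" using M by (simp add: ennreal_plus[symmetric] del: ennreal_plus)
    then have 1: "ennreal (2 * \<kappa>) * (ennreal (4 * M) + ennreal (4 * M)) = ennreal (16 * \<kappa> * M)"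
      using \<kappa> M by (simp add: ennreal_mult'[symmetric])
    have 2: "ennreal (?W * (2 * S)) * ennreal (2 * pi) = ennreal (4 * pi * ?W * S)"
      using mult_nonneg_nonneg[OF W0, of "2 * S"] S(1) by (subst ennreal_mult'[symmetric]) (simp_all add: mult_ac)
    have "0 \<le> 4 * pi * ?W * S" by (intro mult_nonneg_nonneg W0 S(1)) auto
    then show ?thesis unfolding 1 2 using \<kappa> M by (intro ennreal_plus[symmetric]) auto
  qed
  finally show ?thesis .
qed

lemma L2_stability_sq:
  assumes \<delta>: "0 \<le> \<delta>" and L: "L2_norm (\<lambda>\<theta>. dtheta X0 \<theta> - dtheta Y0 \<theta>) \<le> ennreal \<delta>" and t: "t \<in> {0<..T}"
  shows "N t \<le> (sqrt (3 * exp K) * \<delta>)\<^sup>2"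
proof -
  have "ennreal (N t) \<le> ennreal (3 * exp K) * (ennreal \<delta>)\<^sup>2"
    by (rule order_trans[OF L2_stability[OF t]]) (intro mult_left_mono power_mono L; simp)
  also have "\<dots> = ennreal ((sqrt (3 * exp K) * \<delta>)\<^sup>2)"
    using \<delta> by (simp add: power_mult_distrib ennreal_mult' ennreal_power)
  finally show ?thesis by simp
qed

lemma unique:
  assumes "L2_norm (\<lambda>\<theta>. dtheta X0 \<theta> - dtheta Y0 \<theta>) = 0" and t: "t \<in> {0<..T}"
  shows "dtheta (X t) \<theta> = dtheta (Y t) \<theta>"
proof -
  have "N t = 0" using L2_stability_sq[of 0 t] assms N_nonneg[OF t] by simp
  moreover have "continuous_on {-pi..pi} (\<lambda>\<theta>. (norm (Z t \<theta>))\<^sup>2)"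
    by (intro continuous_on_power continuous_on_norm continuous_on_subset[OF cZt[OF t]]) auto
  ultimately have z: "Z t \<theta> = 0" if "\<theta> \<in> {-pi..pi}" for \<theta>
    using integral_eq_0_iff[of "-pi" pi "\<lambda>\<theta>. (norm (Z t \<theta>))\<^sup>2"] that by (simp add: N_def)
  obtain k :: int where "\<theta> + 2 * pi * of_int k \<in> {-pi..pi}" by (rule shift_into_period)
  from z[OF this] have "Z t \<theta> = 0" using periodic_int[OF perZ[OF t]] by (simp add: mult_ac)
  then show ?thesis by (simp add: Z_def)
qed

end

text \<open>A quarter of \<epsilon> is spent on small increments, which fixes \<kappa> and then
  \<eta>; the weight at larger increments is then known, which fixes \<delta>0. All choices precede
  the solutions, about which only the bound \<open>m\<close> is used.\<close>

lemma continuous_dependence: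
  fixes \<mu> \<omega> \<T> :: "real \<Rightarrow> real" and M \<Lambda> c T :: real
  assumes \<mu>: "admissible_weight \<mu>" and M: "0 < M" and \<Lambda>: "0 < \<Lambda>" and adm: "admissible_tension \<T> \<Lambda>" and c: "0 < c"
    and \<omega>: "admissible_weight \<omega>" and lim: "((\<lambda>r. \<omega> r / \<mu> r) \<longlongrightarrow> 0) at_top"
    and \<epsilon>: "0 < \<epsilon>" and m: "0 < m"
  shows "\<exists>\<delta>0>0. \<forall>X0 Y0 X Y.
        admissible_datum \<mu> M X0 \<and> admissible_datum \<mu> M Y0 \<and>
        corresponding_solution \<mu> \<T> \<Lambda> c T X0 X \<and> corresponding_solution \<mu> \<T> \<Lambda> c T Y0 Y \<and>
        m \<le> (INF t\<in>{0..T}. arc_chord (X t)) \<and> m \<le> (INF t\<in>{0..T}. arc_chord (Y t)) \<longrightarrow>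
        (\<forall>\<delta>. 0 < \<delta> \<and> \<delta> \<le> \<delta>0 \<longrightarrow>
           L2_norm (\<lambda>\<theta>. dtheta X0 \<theta> - dtheta Y0 \<theta>) < ennreal \<delta> \<longrightarrow>
           B_norm \<omega> T (\<lambda>t \<theta>. dtheta (X t) \<theta> - dtheta (Y t) \<theta>) < ennreal \<epsilon>)"
proof -
  obtain C where C: "density_constant (16 * M) m \<T> C"
    using energy_density_bound[OF m adm \<Lambda>, where R="16 * M"] unfolding density_constant_def by metis
  define k where "k = 2 * (3 * C) * (32 * (2 * (80 * M\<^sup>2 / (c\<^sup>2 * \<Lambda>))))"
  define \<kappa> where "\<kappa> = \<epsilon> / (64 * M)"
  have \<kappa>: "0 < \<kappa>" "16 * \<kappa> * M = \<epsilon> / 4" using \<epsilon> M by (auto simp: \<kappa>_def)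
  have "\<forall>\<^sub>F \<rho> in at_top. \<omega> \<rho> / \<mu> \<rho> < \<kappa>" using order_tendstoD(2)[OF lim \<kappa>(1)] .
  then obtain \<rho>0 where \<rho>0: "\<And>\<rho>. \<rho>0 \<le> \<rho> \<Longrightarrow> \<omega> \<rho> / \<mu> \<rho> < \<kappa>" by (auto simp: eventually_at_top_linorder)
  \<comment> \<open>The maximum makes \<eta> positive while 1/\<eta> is at least the threshold
    \<rho>0.\<close>
  define \<eta> where "\<eta> = 1 / max 1 \<rho>0"
  have \<eta>: "0 < \<eta>" by (simp add: \<eta>_def)
  have small: "\<omega> \<rho> \<le> \<kappa> * \<mu> \<rho>" if "1 / \<eta> \<le> \<rho>" for \<rho>
  proof -
    have "\<rho>0 \<le> \<rho>" "0 \<le> \<rho>" using that by (auto simp: \<eta>_def)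
    then have "1 \<le> \<mu> \<rho>" "\<omega> \<rho> / \<mu> \<rho> < \<kappa>" using \<mu> \<rho>0 by (auto simp: admissible_weight_def)
    then show ?thesis by (simp add: divide_less_eq)
  qed
  define A where "A = 4 * pi * (\<omega> (1 / \<eta>) / \<eta> powr (3/2)) * sqrt (3 * exp k)"
  have A: "0 \<le> A"
  proof -
    have "1 \<le> \<omega> (1 / \<eta>)" using \<omega> \<eta> by (simp add: admissible_weight_def)
    then show ?thesis by (simp add: A_def)
  qed
  \<comment> \<open>The added 1 keeps the denominator positive, and A times \<delta>0 is still at
    most \<epsilon>/4.\<close>
  define \<delta>0 where "\<delta>0 = \<epsilon> / (4 * (A + 1))"
  have \<delta>0: "0 < \<delta>0" "A * \<delta>0 \<le> \<epsilon> / 4"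
  proof -
    show "0 < \<delta>0" using \<epsilon> A by (simp add: \<delta>0_def)
    have "A * \<delta>0 \<le> (A + 1) * \<delta>0" using \<open>0 < \<delta>0\<close> by (intro mult_right_mono) auto
    also have "\<dots> = \<epsilon> / 4"
    proof -
      have "b * (\<epsilon> / (4 * b)) = \<epsilon> / 4" if "0 < b" for b :: real using that by simp
      from this[of "A + 1"] show ?thesis using A by (simp only: \<delta>0_def)
    qed
    finally show "A * \<delta>0 \<le> \<epsilon> / 4" .
  qed
  show ?thesis
  proof (intro exI[of _ \<delta>0] conjI allI impI \<delta>0(1))
    fix X0 Y0 X Y \<delta>
    assume h: "admissible_datum \<mu> M X0 \<and> admissible_datum \<mu> M Y0 \<and>
        corresponding_solution \<mu> \<T> \<Lambda> c T X0 X \<and> corresponding_solution \<mu> \<T> \<Lambda> c T Y0 Y \<and>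
        m \<le> (INF t\<in>{0..T}. arc_chord (X t)) \<and> m \<le> (INF t\<in>{0..T}. arc_chord (Y t))"
      and \<delta>: "0 < \<delta> \<and> \<delta> \<le> \<delta>0" and L: "L2_norm (\<lambda>\<theta>. dtheta X0 \<theta> - dtheta Y0 \<theta>) < ennreal \<delta>"
    obtain X2 Xt Y2 Yt where r: "regular_flow T X X2 Xt" "regular_flow T Y Y2 Yt"
      using h strong_solution_regular unfolding corresponding_solution_def by metis
    interpret solution_pair \<mu> \<T> M \<Lambda> c T m C X0 Y0 X Y X2 Y2 Xt Yt
      using assms h C r by unfold_locales auto
    have K: "K = k" by (simp add: k_def K_def)
    have "B_norm \<omega> T Z \<le> ennreal (16 * \<kappa> * M + 4 * pi * (\<omega> (1 / \<eta>) / \<eta> powr (3/2)) * (sqrt (3 * exp k) * \<delta>))"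
      using \<delta> L2_stability_sq[of \<delta>] L K by (intro B_norm_le[OF \<omega> \<eta> \<kappa>(1) small]) auto
    also have "16 * \<kappa> * M + 4 * pi * (\<omega> (1 / \<eta>) / \<eta> powr (3/2)) * (sqrt (3 * exp k) * \<delta>) = \<epsilon> / 4 + A * \<delta>"
      unfolding \<kappa>(2) A_def by (simp only: mult.assoc)
    also have "ennreal (\<epsilon> / 4 + A * \<delta>) < ennreal \<epsilon>"
    proof (rule ennreal_lessI[OF \<epsilon>])
      have "A * \<delta> \<le> A * \<delta>0" using A \<delta> by (intro mult_left_mono) auto
      then show "\<epsilon> / 4 + A * \<delta> < \<epsilon>" using \<delta>0(2) \<epsilon> by linarith
    qed
    finally show "B_norm \<omega> T (\<lambda>t \<theta>. dtheta (X t) \<theta> - dtheta (Y t) \<theta>) < ennreal \<epsilon>"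
      by (simp add: Z_def[abs_def])
  qed
qed

text \<open>The parameter \<open>m\<close> makes explicit on which property of the two solutions the
  choice of \<delta> depends; for a given pair it exists because the infima in
  \<open>strong_solution\<close> are positive. Uniqueness is recorded both in the norm and, by
  continuity in the angle, pointwise at positive times.\<close>

theorem theorem1p8:
  fixes \<mu> \<omega> \<T> :: "real \<Rightarrow> real" and M \<Lambda> c T :: real
  assumes "admissible_weight \<mu>"
    and "0 < M"
    and "0 < \<Lambda>"
    and "admissible_tension \<T> \<Lambda>"
    and "0 < c"
    and "0 < T"
    and "admissible_weight \<omega>"
    and "\<exists>r0\<ge>1. antimono_on {r0..} (\<lambda>r. \<omega> r / \<mu> r)"
    and "((\<lambda>r. \<omega> r / \<mu> r) \<longlongrightarrow> 0) at_top"
  shows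
    "(\<forall>\<epsilon>>0. \<forall>m>0. \<exists>\<delta>0>0. \<forall>X0 Y0 X Y.
        admissible_datum \<mu> M X0 \<and> admissible_datum \<mu> M Y0 \<and>
        corresponding_solution \<mu> \<T> \<Lambda> c T X0 X \<and> corresponding_solution \<mu> \<T> \<Lambda> c T Y0 Y \<and>
        m \<le> (INF t\<in>{0..T}. arc_chord (X t)) \<and> m \<le> (INF t\<in>{0..T}. arc_chord (Y t)) \<longrightarrow>
        (\<forall>\<delta>. 0 < \<delta> \<and> \<delta> \<le> \<delta>0 \<longrightarrow>
           L2_norm (\<lambda>\<theta>. dtheta X0 \<theta> - dtheta Y0 \<theta>) < ennreal \<delta> \<longrightarrow>
           B_norm \<omega> T (\<lambda>t \<theta>. dtheta (X t) \<theta> - dtheta (Y t) \<theta>) < ennreal \<epsilon>)) \<and>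
     (\<forall>X0 Y0 X Y.
        admissible_datum \<mu> M X0 \<and> admissible_datum \<mu> M Y0 \<and>
        corresponding_solution \<mu> \<T> \<Lambda> c T X0 X \<and> corresponding_solution \<mu> \<T> \<Lambda> c T Y0 Y \<and>
        L2_norm (\<lambda>\<theta>. dtheta X0 \<theta> - dtheta Y0 \<theta>) = 0 \<longrightarrow>
        B_norm \<omega> T (\<lambda>t \<theta>. dtheta (X t) \<theta> - dtheta (Y t) \<theta>) = 0 \<and>
        (\<forall>t\<in>{0<..T}. \<forall>\<theta>. dtheta (X t) \<theta> = dtheta (Y t) \<theta>))"
proof (intro conjI allI impI ballI continuous_dependence[OF assms(1-5,7,9)])
  fix X0 Y0 X Y
  assume h: "admissible_datum \<mu> M X0 \<and> admissible_datum \<mu> M Y0 \<and>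
        corresponding_solution \<mu> \<T> \<Lambda> c T X0 X \<and> corresponding_solution \<mu> \<T> \<Lambda> c T Y0 Y \<and>
        L2_norm (\<lambda>\<theta>. dtheta X0 \<theta> - dtheta Y0 \<theta>) = 0"
  \<comment> \<open>A strong solution keeps its arc-chord number bounded away from 0, so the smaller
    of the two infima is a positive lower bound for both.\<close>
  define m where "m = min (INF t\<in>{0..T}. arc_chord (X t)) (INF t\<in>{0..T}. arc_chord (Y t))"
  have m: "0 < m" "m \<le> (INF t\<in>{0..T}. arc_chord (X t))" "m \<le> (INF t\<in>{0..T}. arc_chord (Y t))"
    using h by (auto simp: m_def corresponding_solution_def strong_solution_def)
  have "B_norm \<omega> T (\<lambda>t \<theta>. dtheta (X t) \<theta> - dtheta (Y t) \<theta>) \<le> 0"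
  proof (rule ennreal_le_epsilon)
    fix e :: real assume e: "0 < e"
    \<comment> \<open>The L^2 distance 0 lies below every positive \<delta>0, so the norm is below
      every e.\<close>
    from continuous_dependence[OF assms(1-5,7,9) e m(1)] h m obtain \<delta>0 where "0 < \<delta>0"
      "L2_norm (\<lambda>\<theta>. dtheta X0 \<theta> - dtheta Y0 \<theta>) < ennreal \<delta>0 \<longrightarrow> B_norm \<omega> T (\<lambda>t \<theta>. dtheta (X t) \<theta> - dtheta (Y t) \<theta>) < ennreal e"
      by blast
    then show "B_norm \<omega> T (\<lambda>t \<theta>. dtheta (X t) \<theta> - dtheta (Y t) \<theta>) \<le> 0 + ennreal e"
      using h by simp
  qed
  then show "B_norm \<omega> T (\<lambda>t \<theta>. dtheta (X t) \<theta> - dtheta (Y t) \<theta>) = 0" by simp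
  fix t \<theta> assume t: "t \<in> {0<..T}"
  obtain C where C: "density_constant (16 * M) m \<T> C"
    using energy_density_bound[OF m(1) assms(4,3), where R="16 * M"] unfolding density_constant_def by metis
  obtain X2 Xt Y2 Yt where r: "regular_flow T X X2 Xt" "regular_flow T Y Y2 Yt"
    using h strong_solution_regular unfolding corresponding_solution_def by metis
  interpret solution_pair \<mu> \<T> M \<Lambda> c T m C X0 Y0 X Y X2 Y2 Xt Yt
    using assms h C r m by unfold_locales auto
  show "dtheta (X t) \<theta> = dtheta (Y t) \<theta>" using h t by (intro unique) auto
qed

end
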